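(* Let $\omega$, $\Omega$, $R_c$, $R_0$, $s_\pm(r)$, $d_\pm(r)$, $\mathcal{F}_\pm(r)$ be as in the context, and let $r \in (R_c,R_0)$. Let $\eta \in C^{2,\gamma}(\mathbb{R})$ be positive, let $D=\{(x,y): x\in\mathbb{R},\ 0<y<\eta(x)\}$, and let $\psi \in C^{2,\gamma}(\overline{D})$ solve $$\Delta\psi+\omega(\psi)=0 \text{ in } D,\qquad \tfrac12|\nabla\psi|^2+y=r \text{ and } \psi=1 \text{ on } y=\eta(x),\qquad \psi=0 \text{ on } y=0,$$ with $\inf_D \psi_y>0$. Let $$\mathcal{F}=\int_0^{\eta(x)}\Big(\tfrac12(\psi_y^2-\psi_x^2)-y+\Omega(1)-\Omega(\psi)+r\Big)\,dy$$ (this quantity is independent of $x$). Then: (i) $\mathcal{F}_-(r)\le \mathcal{F}\le \mathcal{F}_+(r)$; (ii) $\mathcal{F}=\mathcal{F}_-(r)$ holds only if $(\psi,\eta)$ is the supercritical laminar flow ($\eta\equiv d_-(r)$, $\psi(x,y)=U(y;s_+(r))$) or a symmetric solitary wave of positive elevation supported by the supercritical stream, i.e. $\eta$ is symmetric about some vertical line, $\eta(x)>d_-(r)$ for all $x$, and $\eta(x)\to d_-(r)$ as $x\to\pm\infty$; (iii) $\mathcal{F}=\mathcal{F}_+(r)$ holds only if $(\psi,\eta)$ is the subcritical laminar flow ($\eta\equiv d_+(r)$, $\psi(x,y)=U(y;s_-(r))$).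
   Context: Fix $\gamma\in(0,1)$ and a continuous vorticity function $\omega:[0,1]\to\mathbb{R}$. Set $\Omega(p)=\int_0^p\omega(\tau)\,d\tau$ and $s_0=\sqrt{\max_{p\in[0,1]}2\Omega(p)}$. For $s>s_0$ define $$H(p;s)=\int_0^p\frac{d\tau}{\sqrt{s^2-2\Omega(\tau)}},\qquad d(s)=H(1;s),\qquad R(s)=\tfrac12 s^2-\Omega(1)+d(s).$$ Let $U(\cdot;s):[0,d(s)]\to[0,1]$ be the inverse function of $p\mapsto H(p;s)$. Then $U$ solves $U''+\omega(U)=0$, $U(0)=0$, $U(d(s))=1$, $U'(0)=s$, and $(\psi,\eta)=(U(y;s),d(s))$ is a laminar flow with Bernoulli constant $R(s)$. Let $s_c>s_0$ be defined by $\int_0^1 (s_c^2-2\Omega(p))^{-3/2}\,dp=1$. The function $R$ decreases on $(s_0,s_c)$ and increases to $+\infty$ on $(s_c,\infty)$. Put $R_c=R(s_c)$ and $R_0=\lim_{s\to s_0+}R(s)\in(R_c,+\infty]$. For $r\in(R_c,R_0)$ the equation $R(s)=r$ has exactly two solutions $s_-(r)<s_c<s_+(r)$. Set $d_-(r)=d(s_+(r))$ (supercritical depth) and $d_+(r)=d(s_-(r))$ (subcritical depth). For $s>s_0$ define $$\sigma(s;r)=\int_0^1\Big(\frac{1}{2H_p(p;s)^2}-H(p;s)-\Omega(p)+\Omega(1)+r\Big)H_p(p;s)\,dp.$$ The flow force constants of the conjugate laminar flows are $\mathcal{F}_+(r)=\sigma(s_-(r);r)$ (subcritical) and $\mathcal{F}_-(r)=\sigma(s_+(r);r)$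 (supercritical). *)

theory Defs
  imports "HOL-Analysis.Analysis"
begin

definition Omega :: "(real \<Rightarrow> real) \<Rightarrow> real \<Rightarrow> real" where
  "Omega \<omega> p = integral {0..p} \<omega>"

definition s0 :: "(real \<Rightarrow> real) \<Rightarrow> real" where
  "s0 \<omega> = sqrt (Sup ((\<lambda>p. 2 * Omega \<omega> p) ` {0..1}))"

definition Hp :: "(real \<Rightarrow> real) \<Rightarrow> real \<Rightarrow> real \<Rightarrow> real" where
  "Hp \<omega> s p = 1 / sqrt (s\<^sup>2 - 2 * Omega \<omega> p)"

definition H :: "(real \<Rightarrow> real) \<Rightarrow> real \<Rightarrow> real \<Rightarrow> real" where
  "H \<omega> s p = integral {0..p} (Hp \<omega> s)"

definition depth :: "(real \<Rightarrow> real) \<Rightarrow> real \<Rightarrow> real" where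
  "depth \<omega> s = H \<omega> s 1"

definition Rfun :: "(real \<Rightarrow> real) \<Rightarrow> real \<Rightarrow> real" where
  "Rfun \<omega> s = s\<^sup>2 / 2 - Omega \<omega> 1 + depth \<omega> s"

definition U :: "(real \<Rightarrow> real) \<Rightarrow> real \<Rightarrow> real \<Rightarrow> real" where
  "U \<omega> s y = (THE p. p \<in> {0..1} \<and> H \<omega> s p = y)"

definition s_crit :: "(real \<Rightarrow> real) \<Rightarrow> real" where
  "s_crit \<omega> = (THE s. s > s0 \<omega> \<and>
      integral {0..1} (\<lambda>p. (s\<^sup>2 - 2 * Omega \<omega> p) powr (-3/2)) = 1)"

definition R_crit :: "(real \<Rightarrow> real) \<Rightarrow> real" where
  "R_crit \<omega> = Rfun \<omega> (s_crit \<omega>)"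

definition R_zero :: "(real \<Rightarrow> real) \<Rightarrow> ereal" where
  "R_zero \<omega> = Lim (at_right (s0 \<omega>)) (\<lambda>s. ereal (Rfun \<omega> s))"

definition s_minus :: "(real \<Rightarrow> real) \<Rightarrow> real \<Rightarrow> real" where
  "s_minus \<omega> r = (THE s. s0 \<omega> < s \<and> s < s_crit \<omega> \<and> Rfun \<omega> s = r)"

definition s_plus :: "(real \<Rightarrow> real) \<Rightarrow> real \<Rightarrow> real" where
  "s_plus \<omega> r = (THE s. s_crit \<omega> < s \<and> Rfun \<omega> s = r)"

definition d_minus :: "(real \<Rightarrow> real) \<Rightarrow> real \<Rightarrow> real" where
  "d_minus \<omega> r = depth \<omega> (s_plus \<omega> r)"

definition d_plus :: "(real \<Rightarrow> real) \<Rightarrow> real \<Rightarrow> real" where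
  "d_plus \<omega> r = depth \<omega> (s_minus \<omega> r)"

definition sigma :: "(real \<Rightarrow> real) \<Rightarrow> real \<Rightarrow> real \<Rightarrow> real" where
  "sigma \<omega> s r = integral {0..1} (\<lambda>p.
     (1 / (2 * (Hp \<omega> s p)\<^sup>2) - H \<omega> s p - Omega \<omega> p + Omega \<omega> 1 + r) * Hp \<omega> s p)"

definition F_plus :: "(real \<Rightarrow> real) \<Rightarrow> real \<Rightarrow> real" where
  "F_plus \<omega> r = sigma \<omega> (s_minus \<omega> r) r"

definition F_minus :: "(real \<Rightarrow> real) \<Rightarrow> real \<Rightarrow> real" where
  "F_minus \<omega> r = sigma \<omega> (s_plus \<omega> r) r"

definition holder_on :: "real \<Rightarrow> 'a::metric_space set \<Rightarrow> ('a \<Rightarrow> real) \<Rightarrow> bool" where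
  "holder_on \<gamma> S f \<longleftrightarrow> (\<exists>C. \<forall>p\<in>S. \<forall>q\<in>S. \<bar>f p - f q\<bar> \<le> C * dist p q powr \<gamma>)"

definition C2g_line :: "real \<Rightarrow> (real \<Rightarrow> real) \<Rightarrow> bool" where
  "C2g_line \<gamma> f \<longleftrightarrow> (\<exists>f1 f2.
     (\<forall>x. (f has_real_derivative f1 x) (at x) \<and> (f1 has_real_derivative f2 x) (at x)) \<and>
     bounded (range f) \<and> bounded (range f1) \<and> bounded (range f2) \<and>
     holder_on \<gamma> UNIV f2)"

text \<open>C^{2,gamma}(closure D) for an open set D in the plane: psi is C^2 in D with the
  given partial derivatives (first and second order); psi and these partial derivatives
  extend continuously to closure D (the given functions are these extensions),
  are bounded, and the second derivatives are uniformly gamma-Hoelder in D.\<close>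
definition C2g_closure ::
  "real \<Rightarrow> (real \<times> real) set \<Rightarrow> (real \<times> real \<Rightarrow> real) \<Rightarrow> (real \<times> real \<Rightarrow> real) \<Rightarrow>
   (real \<times> real \<Rightarrow> real) \<Rightarrow> (real \<times> real \<Rightarrow> real) \<Rightarrow> (real \<times> real \<Rightarrow> real) \<Rightarrow>
   (real \<times> real \<Rightarrow> real) \<Rightarrow> bool" where
  "C2g_closure \<gamma> D u ux uy uxx uxy uyy \<longleftrightarrow>
     (\<forall>x y. (x, y) \<in> D \<longrightarrow>
        ((\<lambda>t. u (t, y)) has_real_derivative ux (x, y)) (at x) \<and>
        ((\<lambda>t. u (x, t)) has_real_derivative uy (x, y)) (at y) \<and>
        ((\<lambda>t. ux (t, y)) has_real_derivative uxx (x, y)) (at x) \<and>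
        ((\<lambda>t. ux (x, t)) has_real_derivative uxy (x, y)) (at y) \<and>
        ((\<lambda>t. uy (t, y)) has_real_derivative uxy (x, y)) (at x) \<and>
        ((\<lambda>t. uy (x, t)) has_real_derivative uyy (x, y)) (at y)) \<and>
     (\<forall>g \<in> {u, ux, uy, uxx, uxy, uyy}. continuous_on (closure D) g \<and> bounded (g ` D)) \<and>
     (\<forall>g \<in> {uxx, uxy, uyy}. holder_on \<gamma> D g)"

end

(*
Hodograph variables (q, p) = (x, psi) turn the free boundary problem into a quasilinear elliptic equation
for the height h (q, p) of the streamlines on the strip 0 < p < 1. For every laminar flow, with parameter e
= s^2 / 2, the flux function Phi obtained by integrating (1 / h_p - V)^2 - (h_q / h_p)^2 over vertical
columns satisfies a linear elliptic inequality without zeroth-order term, and its boundary values are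
determined by the flow force and the surface profile. Maximum principles and the Hopf lemma for Phi yield
the two bounds. Equality in the upper bound forces the flow to be laminar. Equality in the lower bound
implies that the surface either touches the supercritical level, in which case the flow is laminar, or lies
above it and approaches it at one end, because a critical point of the profile below the subcritical level
is impossible. The second case is a solitary wave, and the moving plane method gives its symmetry. Since
omega is merely continuous, the planes start with a barrier built from the linearization at the
supercritical flow (its Froude number exceeds 1), and at the final position one uses Serrin's corner lemma.
*)
theory Submission
  imports Defs
begin

section \<open>Maximum principles on planar domains\<close>

text \<open>Nothing on the unbounded strip need be attained, neither the infimum of the surface nor
  that of an auxiliary function. No limits of translated waves are extracted: first-derivative tests
  are run at almost minimal points, with a Lipschitz bound on the derivative and a quantitative
  barrier paying for the gap. Differences of heights \<open>w\<close>, flux functions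
  \<open>Phi\<close> and reflection defects \<open>u\<close> all satisfy one differential
  inequality, principal part bounded by \<open>K\<close> times the gradient, so one set of barriers
  serves them all and no derivative of \<open>\<omega>\<close> appears. What decides each step is
  the energy of the laminar flow used for comparison. The upper bound takes, column by column, the
  energy with the wave's own bottom speed, so that the Hopf lemma is contradicted at the bottom.
  Elsewhere the energy is \<open>\<Omega> 1 + r - y\<close>: on the surface \<open>Phi\<close> is
  then a constant plus the square of \<open>\<eta> - y\<close>, smallest where the surface is
  closest to the height \<open>y\<close>.\<close>

lemma second_derivative_nonneg_at_min:
  fixes \<phi> \<phi>' :: "real \<Rightarrow> real"
  assumes "0 < d"
    and der: "\<And>t. \<bar>t\<bar> < d \<Longrightarrow> (\<phi> has_real_derivative \<phi>' t) (at t)"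
    and der2: "(\<phi>' has_real_derivative k) (at 0)"
    and min: "\<And>t. \<bar>t\<bar> < d \<Longrightarrow> \<phi> 0 \<le> \<phi> t"
  shows "\<phi>' 0 = 0" "0 \<le> k"
proof -
  show z: "\<phi>' 0 = 0"
    using DERIV_local_min[OF der[of 0], of d] min assms(1) by auto
  show "0 \<le> k"
  proof (rule ccontr)
    assume "\<not> 0 \<le> k"
    then obtain d' where d': "d' > 0" "\<And>h. 0 < h \<Longrightarrow> h < d' \<Longrightarrow> \<phi>' (0 + h) < \<phi>' 0"
      using DERIV_neg_dec_right[OF der2] by (meson not_le)
    define t where "t = min d d' / 2"
    have t: "0 < t" "t < d" "t < d'" using assms(1) d'(1) by (auto simp: t_def)
    have "\<exists>\<xi>. 0 < \<xi> \<and> \<xi> < t \<and> \<phi> t - \<phi> 0 = (t - 0) * \<phi>' \<xi>"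
      using t by (intro MVT2) (auto intro: der)
    then obtain \<xi> where \<xi>: "0 < \<xi>" "\<xi> < t" "\<phi> t - \<phi> 0 = t * \<phi>' \<xi>" by auto
    have "\<phi>' \<xi> < 0" using d'(2)[of \<xi>] \<xi> t z by auto
    then have "t * \<phi>' \<xi> < 0" using t by (simp add: mult_pos_neg)
    with \<xi> min[of t] t show False by auto
  qed
qed

text \<open>Total derivatives of the function and of its gradient at each point; the shared
  \<open>fxy\<close> encodes the symmetry of the Hessian.\<close>

definition C2_data ::
  "(real \<times> real) set \<Rightarrow> (real \<times> real \<Rightarrow> real) \<Rightarrow> (real \<times> real \<Rightarrow> real) \<Rightarrow> (real \<times> real \<Rightarrow> real) \<Rightarrow>
   (real \<times> real \<Rightarrow> real) \<Rightarrow> (real \<times> real \<Rightarrow> real) \<Rightarrow> (real \<times> real \<Rightarrow> real) \<Rightarrow> bool" where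
  "C2_data S f fx fy fxx fxy fyy \<longleftrightarrow> (\<forall>z\<in>S.
     (f has_derivative (\<lambda>v. fx z * fst v + fy z * snd v)) (at z) \<and>
     (fx has_derivative (\<lambda>v. fxx z * fst v + fxy z * snd v)) (at z) \<and>
     (fy has_derivative (\<lambda>v. fxy z * fst v + fyy z * snd v)) (at z))"

lemma C2_dataD:
  assumes "C2_data S f fx fy fxx fxy fyy" "z \<in> S"
  shows "(f has_derivative (\<lambda>v. fx z * fst v + fy z * snd v)) (at z)"
    "(fx has_derivative (\<lambda>v. fxx z * fst v + fxy z * snd v)) (at z)"
    "(fy has_derivative (\<lambda>v. fxy z * fst v + fyy z * snd v)) (at z)"
  using assms by (auto simp: C2_data_def)

lemma C2_data_subset:
  "C2_data S f fx fy fxx fxy fyy \<Longrightarrow> T \<subseteq> S \<Longrightarrow> C2_data T f fx fy fxx fxy fyy"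
  by (auto simp: C2_data_def)

lemma C2_data_diff:
  assumes "C2_data S f fx fy fxx fxy fyy" "C2_data S g gx gy gxx gxy gyy"
  shows "C2_data S (\<lambda>z. f z - g z) (\<lambda>z. fx z - gx z) (\<lambda>z. fy z - gy z)
     (\<lambda>z. fxx z - gxx z) (\<lambda>z. fxy z - gxy z) (\<lambda>z. fyy z - gyy z)"
  unfolding C2_data_def
proof (intro ballI conjI)
  fix z assume z: "z \<in> S"
  note f = C2_dataD[OF assms(1) z] and g = C2_dataD[OF assms(2) z]
  show "((\<lambda>z. f z - g z) has_derivative (\<lambda>v. (fx z - gx z) * fst v + (fy z - gy z) * snd v)) (at z)"
    by (rule has_derivative_eq_rhs[OF has_derivative_diff[OF f(1) g(1)]]) (auto simp: algebra_simps)
  show "((\<lambda>z. fx z - gx z) has_derivative (\<lambda>v. (fxx z - gxx z) * fst v + (fxy z - gxy z) * snd v)) (at z)"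
    by (rule has_derivative_eq_rhs[OF has_derivative_diff[OF f(2) g(2)]]) (auto simp: algebra_simps)
  show "((\<lambda>z. fy z - gy z) has_derivative (\<lambda>v. (fxy z - gxy z) * fst v + (fyy z - gyy z) * snd v)) (at z)"
    by (rule has_derivative_eq_rhs[OF has_derivative_diff[OF f(3) g(3)]]) (auto simp: algebra_simps)
qed

lemma has_derivative_along_line:
  fixes f :: "real \<times> real \<Rightarrow> real"
  assumes "(f has_derivative (\<lambda>v. a * fst v + b * snd v)) (at (x + t * v1, y + t * v2))"
  shows "((\<lambda>t. f (x + t * v1, y + t * v2)) has_real_derivative (a * v1 + b * v2)) (at t)"
proof -
  have "((\<lambda>t. (x + t * v1, y + t * v2)) has_derivative (\<lambda>s. (s * v1, s * v2))) (at t)"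
    by (auto intro!: derivative_eq_intros)
  from has_derivative_compose[OF this assms]
  show ?thesis
    unfolding has_field_derivative_def
    by (rule has_derivative_eq_rhs) (auto simp: algebra_simps)
qed

text \<open>Restriction to lines through \<open>z\<close> reduces the claim to one variable. The
  second-order part is kept as a quadratic form in all directions, ready to be paired with a
  coefficient matrix.\<close>

lemma hessian_at_local_min:
  assumes C2: "C2_data S g gx gy gxx gxy gyy" and "open S" and z: "z \<in> S"
    and min: "eventually (\<lambda>w. g z \<le> g w) (nhds z)"
  shows "gx z = 0" "gy z = 0" "0 \<le> gxx z * v1\<^sup>2 + 2 * gxy z * v1 * v2 + gyy z * v2\<^sup>2"
proof -
  obtain x y where xy: "z = (x, y)" by (cases z)
  have "eventually (\<lambda>w. w \<in> S \<and> g z \<le> g w) (nhds z)"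
    using min eventually_nhds_in_open[OF \<open>open S\<close> z] by eventually_elim auto
  then obtain r where r: "r > 0" "\<And>w. dist w z < r \<Longrightarrow> w \<in> S \<and> g z \<le> g w"
    unfolding eventually_nhds_metric by blast
  have main: "gx z * v1 + gy z * v2 = 0 \<and> 0 \<le> gxx z * v1\<^sup>2 + 2 * gxy z * v1 * v2 + gyy z * v2\<^sup>2" for v1 v2
  proof -
    \<comment> \<open>For \<open>\<bar>t\<bar> < d\<close> the line in direction
      \<open>(v1, v2)\<close> stays in the ball; the summand 1 covers the zero direction.\<close>
    define d where "d = r / (1 + norm (v1, v2))"
    have d: "d > 0" using r(1) by (auto simp: d_def intro!: divide_pos_pos add_pos_nonneg)
    have inball: "dist (x + t * v1, y + t * v2) z < r" if "\<bar>t\<bar> < d" for t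
    proof -
      have "dist (x + t * v1, y + t * v2) z = \<bar>t\<bar> * norm (v1, v2)"
        using norm_scaleR[of t "(v1, v2)"] by (simp add: xy dist_norm)
      also have "\<dots> \<le> \<bar>t\<bar> * (1 + norm (v1, v2))" by (intro mult_left_mono) auto
      also have "\<dots> < d * (1 + norm (v1, v2))"
        using that by (intro mult_strict_right_mono) (auto intro: add_pos_nonneg)
      also have "\<dots> = r" by (simp add: d_def add_nonneg_eq_0_iff)
      finally show ?thesis .
    qed
    let ?\<phi> = "\<lambda>t. g (x + t * v1, y + t * v2)"
    let ?\<phi>' = "\<lambda>t. gx (x + t * v1, y + t * v2) * v1 + gy (x + t * v1, y + t * v2) * v2"
    have 1: "(?\<phi> has_real_derivative ?\<phi>' t) (at t)" if "\<bar>t\<bar> < d" for t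
      using inball[OF that] r(2) by (intro has_derivative_along_line C2_dataD(1)[OF C2]) auto
    have "((\<lambda>t. gx (x + t * v1, y + t * v2)) has_real_derivative (gxx z * v1 + gxy z * v2)) (at 0)"
      "((\<lambda>t. gy (x + t * v1, y + t * v2)) has_real_derivative (gxy z * v1 + gyy z * v2)) (at 0)"
      using C2_dataD(2,3)[OF C2 z] xy by (auto intro!: has_derivative_along_line)
    then have 2: "(?\<phi>' has_real_derivative ((gxx z * v1 + gxy z * v2) * v1 + (gxy z * v1 + gyy z * v2) * v2)) (at 0)"
      by (auto intro!: derivative_eq_intros)
    have 3: "?\<phi> 0 \<le> ?\<phi> t" if "\<bar>t\<bar> < d" for t
      using inball[OF that] r(2) xy by auto
    show ?thesis
      using second_derivative_nonneg_at_min[OF d 1 2 3] by (auto simp: xy power2_eq_square algebra_simps)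
  qed
  show "gx z = 0" using main[of 1 0] by simp
  show "gy z = 0" using main[of 0 1] by simp
  show "0 \<le> gxx z * v1\<^sup>2 + 2 * gxy z * v1 * v2 + gyy z * v2\<^sup>2" using main by blast
qed

text \<open>Uniform ellipticity with bounded, possibly rough coefficients. \<open>K\<close> serves
  twice: it bounds the coefficients here and the first-order terms in \<open>supersol\<close>, so
  barriers are tuned against one number.\<close>

locale elliptic_op =
  fixes S :: "(real \<times> real) set" and A B C :: "real \<times> real \<Rightarrow> real" and K c :: real
  assumes open_S: "open S" and c_pos: "0 < c" and K_nonneg: "0 \<le> K"
    and ellip: "z \<in> S \<Longrightarrow> c * (\<xi>\<^sup>2 + \<zeta>\<^sup>2) \<le> A z * \<xi>\<^sup>2 + 2 * B z * \<xi> * \<zeta> + C z * \<zeta>\<^sup>2"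
    and coeff_bound: "z \<in> S \<Longrightarrow> \<bar>A z\<bar> \<le> K" "z \<in> S \<Longrightarrow> \<bar>B z\<bar> \<le> K" "z \<in> S \<Longrightarrow> \<bar>C z\<bar> \<le> K"
begin

text \<open>A bounded drift is hidden in the gradient on the right, so every equation without
  zeroth-order term and with drift bounded by \<open>K\<close> fits. The absolute values make the
  class nonlinear; barriers therefore enter by contact and not by superposition.\<close>

definition supersol where
  "supersol f fx fy fxx fxy fyy \<longleftrightarrow> C2_data S f fx fy fxx fxy fyy \<and>
     (\<forall>z\<in>S. A z * fxx z + 2 * B z * fxy z + C z * fyy z \<le> K * (\<bar>fx z\<bar> + \<bar>fy z\<bar>))"

lemma supersolD:
  assumes "supersol f fx fy fxx fxy fyy"
  shows "C2_data S f fx fy fxx fxy fyy"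
    and "z \<in> S \<Longrightarrow> A z * fxx z + 2 * B z * fxy z + C z * fyy z \<le> K * (\<bar>fx z\<bar> + \<bar>fy z\<bar>)"
  using assms by (auto simp: supersol_def)

lemma coeff_ge: "z \<in> S \<Longrightarrow> c \<le> A z" "z \<in> S \<Longrightarrow> c \<le> C z"
  using ellip[of z 1 0] ellip[of z 0 1] by auto

text \<open>The trace of a product of two nonnegative matrices is nonnegative. Completing the square
  writes it as \<open>A z\<close> times the form at \<open>(1, B z / A z)\<close> plus the Schur
  complement \<open>C z - (B z)^2 / A z\<close> times \<open>Z\<close>.\<close>

lemma trace_psd_nonneg:
  assumes z: "z \<in> S" and psd: "\<And>v1 v2. 0 \<le> X * v1\<^sup>2 + 2 * Y * v1 * v2 + Z * v2\<^sup>2"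
  shows "0 \<le> A z * X + 2 * B z * Y + C z * Z"
proof -
  have A: "A z > 0" using coeff_ge[OF z] c_pos by linarith
  have Z: "0 \<le> Z" using psd[of 0 1] by simp
  have "0 \<le> A z * (B z / A z)\<^sup>2 - 2 * B z * (B z / A z) + C z"
  proof -
    have "0 \<le> c * ((- (B z / A z))\<^sup>2 + 1\<^sup>2)" using c_pos by (intro mult_nonneg_nonneg) auto
    also note ellip[OF z, of "- (B z / A z)" 1]
    finally show ?thesis by simp
  qed
  then have 1: "0 \<le> C z - (B z)\<^sup>2 / A z"
    using A by (simp add: power2_eq_square field_simps)
  have "A z * X + 2 * B z * Y + C z * Z
      = A z * (X * 1\<^sup>2 + 2 * Y * 1 * (B z / A z) + Z * (B z / A z)\<^sup>2) + (C z - (B z)\<^sup>2 / A z) * Z"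
    using A by (simp add: power2_eq_square field_simps)
  then show ?thesis using 1 Z A psd[of 1 "B z / A z"] by (simp add: mult_nonneg_nonneg)
qed

text \<open>At the contact point the gradients agree, so the first-order bound of the supersolution
  may be evaluated on the barrier alone.\<close>

lemma touching_from_below:
  assumes f: "supersol f fx fy fxx fxy fyy" and \<beta>: "C2_data S \<beta> \<beta>x \<beta>y \<beta>xx \<beta>xy \<beta>yy"
    and z: "z \<in> S" and min: "eventually (\<lambda>w. f z - \<beta> z \<le> f w - \<beta> w) (nhds z)"
  shows "A z * \<beta>xx z + 2 * B z * \<beta>xy z + C z * \<beta>yy z \<le> K * (\<bar>\<beta>x z\<bar> + \<bar>\<beta>y z\<bar>)"
proof -
  note C2 = C2_data_diff[OF supersolD(1)[OF f] \<beta>]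
  note hess = hessian_at_local_min[OF C2 open_S z min]
  have "0 \<le> A z * (fxx z - \<beta>xx z) + 2 * B z * (fxy z - \<beta>xy z) + C z * (fyy z - \<beta>yy z)"
    by (rule trace_psd_nonneg[OF z hess(3)])
  then have "A z * \<beta>xx z + 2 * B z * \<beta>xy z + C z * \<beta>yy z \<le> A z * fxx z + 2 * B z * fxy z + C z * fyy z"
    by (simp add: algebra_simps)
  also have "\<dots> \<le> K * (\<bar>fx z\<bar> + \<bar>fy z\<bar>)" by (rule supersolD(2)[OF f z])
  also have "\<dots> = K * (\<bar>\<beta>x z\<bar> + \<bar>\<beta>y z\<bar>)" using hess(1,2) by simp
  finally show ?thesis .
qed

text \<open>The hypothesis is a pointwise alternative, comparison already known or strict
  subsolution at an interior point, so the boundary of \<open>T\<close> never has to be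
  described.\<close>

lemma comparison:
  assumes f: "supersol f fx fy fxx fxy fyy" and \<beta>: "C2_data S \<beta> \<beta>x \<beta>y \<beta>xx \<beta>xy \<beta>yy"
    and T: "compact T" and cont: "continuous_on T f" "continuous_on T \<beta>"
    and alt: "\<And>z. z \<in> T \<Longrightarrow> \<beta> z \<le> f z \<or> (z \<in> S \<and> z \<in> interior T \<and>
       K * (\<bar>\<beta>x z\<bar> + \<bar>\<beta>y z\<bar>) < A z * \<beta>xx z + 2 * B z * \<beta>xy z + C z * \<beta>yy z)"
    and w: "w \<in> T"
  shows "\<beta> w \<le> f w"
proof (rule ccontr)
  assume neg: "\<not> \<beta> w \<le> f w"
  obtain z where z: "z \<in> T" "\<And>v. v \<in> T \<Longrightarrow> f z - \<beta> z \<le> f v - \<beta> v"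
    using continuous_attains_inf[OF T, of "\<lambda>z. f z - \<beta> z"] w continuous_on_diff[OF cont]
    by blast
  have "f z - \<beta> z < 0" using z(2)[OF w] neg by simp
  with alt[OF z(1)] have *: "z \<in> S" "z \<in> interior T"
    "K * (\<bar>\<beta>x z\<bar> + \<bar>\<beta>y z\<bar>) < A z * \<beta>xx z + 2 * B z * \<beta>xy z + C z * \<beta>yy z" by auto
  have "eventually (\<lambda>v. f z - \<beta> z \<le> f v - \<beta> v) (nhds z)"
    using eventually_nhds_in_open[OF open_interior *(2)]
    by eventually_elim (use z(2) interior_subset in blast)
  from touching_from_below[OF f \<beta> *(1) this] *(3) show False by simp
qed

text \<open>On the lateral sides of the rectangle only the poor bound \<open>m - M\<close> is
  available. A parabola in \<open>x\<close> lowers the barrier by \<open>M\<close> there; its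
  derivatives cost at most order \<open>1 / l\<close> in the inequality, and an exponential profile
  in \<open>y\<close> pays for them. The resulting error vanishes as \<open>l\<close> grows.\<close>

lemma local_min_principle:
  assumes f: "supersol f fx fy fxx fxy fyy"
    and P: "0 < P" and strip: "\<And>x y. \<bar>x - x1\<bar> < l \<Longrightarrow> 0 < y \<Longrightarrow> y < P \<Longrightarrow> (x, y) \<in> S"
    and cont: "continuous_on ({x1 - l..x1 + l} \<times> {0..P}) f"
    and bd: "\<And>x y. \<bar>x - x1\<bar> \<le> l \<Longrightarrow> 0 \<le> y \<Longrightarrow> y \<le> P \<Longrightarrow> m - M \<le> f (x, y)"
    and bot: "\<And>x. \<bar>x - x1\<bar> \<le> l \<Longrightarrow> m \<le> f (x, 0)"
    and top: "\<And>x. \<bar>x - x1\<bar> \<le> l \<Longrightarrow> m \<le> f (x, P)"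
    and M: "0 \<le> M" and l: "1 \<le> l" and y: "0 \<le> y" "y \<le> P"
  shows "m - 4 * M * K * exp (((K + 1) / c) * P) / l \<le> f (x1, y)"
proof -
  define k where "k = (K + 1) / c"
  have k: "k > 0" "c * k = K + 1" using c_pos K_nonneg by (auto simp: k_def)
  \<comment> \<open>\<open>2 * M * K / l\<close> comes from the slope of the parabola and as much
    again from its second derivative, where \<open>l \<ge> 1\<close> turns \<open>1 / l^2\<close>
    into \<open>1 / l\<close>.\<close>
  define N where "N = 4 * M * K / l + 0"
  have N: "N \<ge> 0" using M K_nonneg l by (auto simp: N_def)
  \<comment> \<open>The parameter \<open>d\<close> makes the comparison strict and tends to zero at
    the end.\<close>
  define g where "g d = (\<lambda>z :: real \<times> real. m - M / l\<^sup>2 * (fst z - x1)\<^sup>2 - (N / k + d) * (exp (k * P) - exp (k * snd z)))" for d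
  have ineq: "m - (N / k + d) * (exp (k * P) - exp (k * y)) \<le> f (x1, y)" if d: "d > 0" for d
  proof -
    define n where "n = N / k + d"
    have n: "n > 0" using N k d by (auto simp: n_def intro!: add_nonneg_pos)
    have nk: "n * k > N" using k d by (auto simp: n_def field_simps)
    let ?T = "{x1 - l..x1 + l} \<times> {0..P}"
    have intT: "interior ?T = {x1 - l<..<x1 + l} \<times> {0<..<P}"
      by (simp add: interior_Times)
    have "g d (x1, y) \<le> f (x1, y)"
    proof (rule comparison[OF f])
      show "C2_data S (g d) (\<lambda>z. - (2 * M / l\<^sup>2) * (fst z - x1)) (\<lambda>z. n * k * exp (k * snd z))
         (\<lambda>z. - (2 * M / l\<^sup>2)) (\<lambda>z. 0) (\<lambda>z. n * k\<^sup>2 * exp (k * snd z))"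
      proof -
        define Q where "Q = M / l\<^sup>2"
        have Q: "2 * M / l\<^sup>2 = 2 * Q" by (simp add: Q_def)
        show ?thesis
          unfolding C2_data_def g_def n_def[symmetric] Q Q_def[symmetric]
          by (intro ballI conjI)
            (auto intro!: derivative_eq_intros simp: fun_eq_iff algebra_simps power2_eq_square)
      qed
      show "compact ?T" by (intro compact_Times) auto
      show "continuous_on ?T f" by fact
      show "continuous_on ?T (g d)" unfolding g_def by (intro continuous_intros)
      show "(x1, y) \<in> ?T" using y l by auto
      fix z assume z: "z \<in> ?T"
      obtain x p where xp: "z = (x, p)" by (cases z)
      have xp': "\<bar>x - x1\<bar> \<le> l" "0 \<le> p" "p \<le> P" using z xp by auto
      have e: "exp (k * p) \<le> exp (k * P)" using xp' k by auto
      have gle: "g d z \<le> m - M / l\<^sup>2 * (x - x1)\<^sup>2"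
        using n e unfolding g_def n_def[symmetric] xp by (simp add: mult_nonneg_nonneg)
      have gle2: "g d z \<le> m" using gle M l
        by (smt (verit) divide_nonneg_nonneg mult_nonneg_nonneg zero_le_power2)
      consider "p = 0" | "p = P" | "\<bar>x - x1\<bar> = l" | "0 < p" "p < P" "\<bar>x - x1\<bar> < l"
        using xp' by linarith
      then show "g d z \<le> f z \<or> (z \<in> S \<and> z \<in> interior ?T \<and>
         K * (\<bar>- (2 * M / l\<^sup>2) * (fst z - x1)\<bar> + \<bar>n * k * exp (k * snd z)\<bar>)
         < A z * - (2 * M / l\<^sup>2) + 2 * B z * 0 + C z * (n * k\<^sup>2 * exp (k * snd z)))"
      proof cases
        case 1 then show ?thesis using gle2 bot[OF xp'(1)] xp by force
      next
        case 2 then show ?thesis using gle2 top[OF xp'(1)] xp by force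
      next
        case 3
        then have "(x - x1)\<^sup>2 = l\<^sup>2" by (metis power2_abs)
        then have "g d z \<le> m - M" using gle l by simp
        then show ?thesis using bd[OF xp'] xp by force
      next
        case 4
        have zS: "z \<in> S" using strip 4 xp by auto
        have a: "\<bar>- (2 * M / l\<^sup>2) * (x - x1)\<bar> \<le> 2 * M / l"
        proof -
          have "\<bar>- (2 * M / l\<^sup>2) * (x - x1)\<bar> = 2 * M / l\<^sup>2 * \<bar>x - x1\<bar>" using M by (simp add: abs_mult)
          also have "\<dots> \<le> 2 * M / l\<^sup>2 * l" using M 4 by (intro mult_left_mono) auto
          also have "\<dots> = 2 * M / l" using l by (simp add: power2_eq_square)
          finally show ?thesis .
        qed
        have b: "A z * (2 * M / l\<^sup>2) \<le> K * (2 * M / l)"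
        proof -
          have "A z * (2 * M / l\<^sup>2) \<le> K * (2 * M / l\<^sup>2)"
            using coeff_bound(1)[OF zS] M by (intro mult_right_mono) auto
          also have "\<dots> \<le> K * (2 * M / l)"
          proof (intro mult_left_mono divide_left_mono)
            show "l \<le> l\<^sup>2" using l by (simp add: power2_eq_square)
          qed (use M K_nonneg l in auto)
          finally show ?thesis .
        qed
        have ep: "exp (k * p) \<ge> 1" using k 4 by simp
        have "K * (\<bar>- (2 * M / l\<^sup>2) * (x - x1)\<bar> + \<bar>n * k * exp (k * p)\<bar>) + A z * (2 * M / l\<^sup>2)
           \<le> K * (2 * M / l + n * k * exp (k * p)) + K * (2 * M / l)"
          using a b n k K_nonneg by (intro add_mono mult_left_mono) auto
        also have "\<dots> = N + K * (n * k * exp (k * p))" by (simp add: N_def algebra_simps)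
        also have "\<dots> < n * k * exp (k * p) + K * (n * k * exp (k * p))"
        proof -
          have "N < n * k * 1" using nk by simp
          also have "\<dots> \<le> n * k * exp (k * p)" using n k ep by (intro mult_left_mono) auto
          finally show ?thesis by simp
        qed
        also have "\<dots> = c * (n * k\<^sup>2 * exp (k * p))"
        proof -
          have "c * (n * k\<^sup>2 * exp (k * p)) = (c * k) * (n * k * exp (k * p))"
            by (simp add: power2_eq_square)
          also have "\<dots> = (K + 1) * (n * k * exp (k * p))" by (simp only: k(2))
          finally show ?thesis by (simp add: algebra_simps)
        qed
        also have "\<dots> \<le> C z * (n * k\<^sup>2 * exp (k * p))"
          using coeff_ge(2)[OF zS] n by (intro mult_right_mono) auto
        finally show ?thesis using zS 4 xp unfolding intT by (auto simp: abs_less_iff)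
      qed
    qed
    then show ?thesis by (simp add: g_def)
  qed
  have "m - (N / k) * (exp (k * P) - exp (k * y)) \<le> f (x1, y)"
  proof (rule tendsto_upperbound[where F = "at_right 0"])
    have "((\<lambda>d. m - (N / k + d) * (exp (k * P) - exp (k * y))) \<longlongrightarrow> m - (N / k + 0) * (exp (k * P) - exp (k * y))) (at_right 0)"
      by (intro tendsto_intros)
    then show "((\<lambda>d. m - (N / k + d) * (exp (k * P) - exp (k * y))) \<longlongrightarrow> m - (N / k) * (exp (k * P) - exp (k * y))) (at_right 0)"
      by simp
    show "\<forall>\<^sub>F d in at_right 0. m - (N / k + d) * (exp (k * P) - exp (k * y)) \<le> f (x1, y)"
      using eventually_at_right_less[of 0] by eventually_elim (rule ineq)
  qed simp
  moreover have "(N / k) * (exp (k * P) - exp (k * y)) \<le> 4 * M * K * exp (k * P) / l"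
  proof -
    have zS: "(x1, P / 2) \<in> S" using P l by (intro strip) auto
    have "c \<le> K" using coeff_ge(1)[OF zS] coeff_bound(1)[OF zS] by linarith
    then have "k \<ge> 1" using c_pos K_nonneg by (simp add: k_def)
    then have "N / k \<le> N" using N by (simp add: divide_le_eq mult_left_mono[of 1 k N, simplified])
    then have "(N / k) * (exp (k * P) - exp (k * y)) \<le> N * exp (k * P)"
      using N k y by (intro mult_mono) auto
    then show ?thesis by (simp add: N_def)
  qed
  ultimately show ?thesis unfolding k_def by linarith
qed

text \<open>Rectangles of growing length exhaust the strip and the error of
  \<open>local_min_principle\<close> disappears; boundedness below replaces any information at
  infinity.\<close>

lemma min_principle:
  assumes f: "supersol f fx fy fxx fxy fyy"
    and P: "0 < P" and strip: "\<And>x y. 0 < y \<Longrightarrow> y < P \<Longrightarrow> (x, y) \<in> S"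
    and cont: "continuous_on (UNIV \<times> {0..P}) f"
    and bd: "\<And>x y. 0 \<le> y \<Longrightarrow> y \<le> P \<Longrightarrow> - M \<le> f (x, y)"
    and bot: "\<And>x. m \<le> f (x, 0)"
    and top: "\<And>x. m \<le> f (x, P)"
    and y: "0 \<le> y" "y \<le> P"
  shows "m \<le> f (x1, y)"
proof -
  define M' where "M' = \<bar>m\<bar> + \<bar>M\<bar>"
  have "m - 4 * M' * K * exp (((K + 1) / c) * P) / l \<le> f (x1, y)" if "l \<ge> 1" for l
  proof (rule local_min_principle[OF f P _ _ _ _ _ _ that y])
    fix x y assume "0 \<le> y" "y \<le> P"
    from bd[OF this, of x] show "m - M' \<le> f (x, y)" by (simp add: M'_def)
  qed (use strip bot top in \<open>auto simp: M'_def intro: continuous_on_subset[OF cont]\<close>)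
  then have "\<forall>\<^sub>F l in at_top. m - 4 * M' * K * exp (((K + 1) / c) * P) / l \<le> f (x1, y)"
    using eventually_ge_at_top[of 1] by (rule eventually_mono[rotated])
  moreover have "((\<lambda>l. m - 4 * M' * K * exp (((K + 1) / c) * P) / l) \<longlongrightarrow> m - 0) at_top"
    by (intro tendsto_intros tendsto_divide_0[OF tendsto_const] filterlim_at_top_imp_at_infinity filterlim_ident)
  ultimately have "m - 0 \<le> f (x1, y)" by (intro tendsto_upperbound) auto
  then show ?thesis by simp
qed

end

section \<open>Hopf lemma, strong minimum principle and corner lemma on parabolic caps\<close>

definition cap_fun :: "real \<times> real \<Rightarrow> real \<Rightarrow> real \<Rightarrow> real \<Rightarrow> real \<times> real \<Rightarrow> real" where
  "cap_fun z0 e1 e2 a z = e1 * (fst z - fst z0) + e2 * (snd z - snd z0)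
     - a * (e1 * (snd z - snd z0) - e2 * (fst z - fst z0))\<^sup>2"

text \<open>With aperture \<open>4 * T / m^2\<close> a parabolic cap of height \<open>T\<close>
  stays within transverse distance \<open>m / 2\<close> of its axis. This is how caps are fitted
  into a domain.\<close>

lemma abs_le_half_if_scaled_square_le:
  fixes T m s :: real
  assumes "0 < T" "0 < m" "4 * T / m\<^sup>2 * s\<^sup>2 \<le> T"
  shows "\<bar>s\<bar> \<le> m / 2"
proof -
  have "T * (4 * s\<^sup>2) \<le> T * m\<^sup>2" using assms by (simp add: field_simps)
  then have "(2 * s)\<^sup>2 \<le> m\<^sup>2" using assms by (simp add: power2_eq_square)
  then have "\<bar>2 * s\<bar> \<le> \<bar>m\<bar>" by (simp only: abs_le_square_iff)
  then show ?thesis using assms by simp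
qed

context elliptic_op
begin

text \<open>The barrier \<open>exp (k g) - 1\<close> lives on a parabolic cap whose vertex is the boundary zero, so no
  interior ball condition is needed and the sides of the cap contribute nothing.\<close>
lemma hopf_cap:
  assumes f: "supersol f fx fy fxx fxy fyy"
    and e: "e1\<^sup>2 + e2\<^sup>2 = 1" and t1: "0 < t1" and a0: "0 \<le> a0"
    and cont: "continuous_on T0 f" and T0: "closed T0"
    and cap: "\<And>z. 0 \<le> cap_fun z0 e1 e2 a0 z \<Longrightarrow>
       e1 * (fst z - fst z0) + e2 * (snd z - snd z0) \<le> t1 \<Longrightarrow> z \<in> T0 \<and> 0 \<le> f z"
    and cap_int: "\<And>z. 0 < cap_fun z0 e1 e2 a0 z \<Longrightarrow>
       e1 * (fst z - fst z0) + e2 * (snd z - snd z0) < t1 \<Longrightarrow> z \<in> S"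
    and pos: "0 < f (fst z0 + t1 * e1, snd z0 + t1 * e2)"
  shows "\<exists>\<epsilon>>0. \<forall>t\<in>{0..t1}. \<epsilon> * t \<le> f (fst z0 + t * e1, snd z0 + t * e2)"
proof -
  obtain x0 y0 where z0: "z0 = (x0, y0)" by (cases z0)
  \<comment> \<open>\<open>?t\<close> and \<open>?s\<close> are the coordinates along and across the
    axis, so the cap is the region where \<open>?t\<close> is at least \<open>a\<close> times the
    square of \<open>?s\<close>.\<close>
  let ?t = "\<lambda>z :: real \<times> real. e1 * (fst z - x0) + e2 * (snd z - y0)"
  let ?s = "\<lambda>z :: real \<times> real. e1 * (snd z - y0) - e2 * (fst z - x0)"
  let ?z1 = "(x0 + t1 * e1, y0 + t1 * e2)"
  have rot: "(?t z - t1)\<^sup>2 + (?s z)\<^sup>2 = (fst z - fst ?z1)\<^sup>2 + (snd z - snd ?z1)\<^sup>2" for z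
  proof -
    have "(?t z - t1)\<^sup>2 + (?s z)\<^sup>2
      = (e1\<^sup>2 + e2\<^sup>2) * ((fst z - x0)\<^sup>2 + (snd z - y0)\<^sup>2) - 2 * t1 * ?t z + t1\<^sup>2"
      by (simp add: power2_eq_square algebra_simps)
    moreover have "(fst z - fst ?z1)\<^sup>2 + (snd z - snd ?z1)\<^sup>2
      = (fst z - x0)\<^sup>2 + (snd z - y0)\<^sup>2 - 2 * t1 * ?t z + (e1\<^sup>2 + e2\<^sup>2) * t1\<^sup>2"
      by (simp add: power2_eq_square algebra_simps)
    ultimately show ?thesis by (simp add: e)
  qed
  have distz1: "dist z ?z1 = sqrt ((?t z - t1)\<^sup>2 + (?s z)\<^sup>2)" for z
    unfolding rot by (cases z) (simp add: dist_Pair_Pair dist_real_def)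
  have tz: "?t (x0 + t * e1, y0 + t * e2) = t" "?s (x0 + t * e1, y0 + t * e2) = 0" for t
  proof -
    have "?t (x0 + t * e1, y0 + t * e2) = t * (e1\<^sup>2 + e2\<^sup>2)" by (simp add: power2_eq_square algebra_simps)
    then show "?t (x0 + t * e1, y0 + t * e2) = t" by (simp add: e)
    show "?s (x0 + t * e1, y0 + t * e2) = 0" by simp
  qed
  define \<mu> where "\<mu> = f ?z1 / 2"
  have \<mu>: "\<mu> > 0" "\<mu> < f ?z1" using pos by (auto simp: \<mu>_def z0)
  have z1T: "?z1 \<in> T0"
    using cap[of ?z1] tz[of t1] t1 by (auto simp: cap_fun_def z0)
  obtain \<delta> where \<delta>: "\<delta> > 0" "\<And>z. z \<in> T0 \<Longrightarrow> dist z ?z1 < \<delta> \<Longrightarrow> \<mu> < f z"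
  proof -
    have "(f \<longlongrightarrow> f ?z1) (at ?z1 within T0)" using cont z1T by (auto simp: continuous_on_def)
    from order_tendstoD(1)[OF this \<mu>(2)]
    obtain d where "d > 0" "\<And>z. z \<in> T0 \<Longrightarrow> z \<noteq> ?z1 \<Longrightarrow> dist z ?z1 < d \<Longrightarrow> \<mu> < f z"
      unfolding eventually_at by blast
    then show ?thesis using \<mu>(2) that[of d] by metis
  qed
  \<comment> \<open>Narrows the cap until its flat end, where \<open>?t z = t1\<close>, lies in the
    disc of radius \<open>\<delta>\<close> around \<open>?z1\<close> on which \<open>f\<close>
    exceeds \<open>\<mu>\<close>.\<close>
  define a where "a = a0 + 4 * t1 / \<delta>\<^sup>2"
  have a: "a > 0" "a \<ge> a0" using a0 t1 \<delta> by (auto simp: a_def intro!: add_nonneg_pos)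
  let ?g = "cap_fun z0 e1 e2 a"
  have g_def: "?g z = ?t z - a * (?s z)\<^sup>2" for z by (simp add: cap_fun_def z0)
  have g_le: "?g z \<le> cap_fun z0 e1 e2 a0 z" for z
    using a by (simp add: cap_fun_def mult_right_mono)
  define T where "T = {z. 0 \<le> ?g z \<and> ?t z \<le> t1}"
  have TT0: "z \<in> T0" "0 \<le> f z" if "z \<in> T" for z
    using cap[of z] g_le[of z] that by (auto simp: T_def z0)
  have cont_g: "continuous_on X ?g" for X unfolding cap_fun_def by (intro continuous_intros)
  have cont_t: "continuous_on X ?t" for X by (intro continuous_intros)
  have closedT: "closed T"
    unfolding T_def by (intro closed_Collect_conj closed_Collect_le cont_g cont_t continuous_intros)
  have bT: "bounded T"
  proof (rule boundedI)
    fix z assume z: "z \<in> T"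
    have "a * (?s z)\<^sup>2 \<ge> 0" using a by simp
    then have t0: "0 \<le> ?t z" and tt: "?t z \<le> t1" and s: "a * (?s z)\<^sup>2 \<le> t1" using z by (auto simp: T_def g_def)
    have "(?t z - t1)\<^sup>2 \<le> t1\<^sup>2" using t0 tt by (intro power2_le_iff_abs_le[THEN iffD2]) auto
    moreover have "(?s z)\<^sup>2 \<le> t1 / a" using s a by (simp add: field_simps)
    ultimately have "dist z ?z1 \<le> sqrt (t1\<^sup>2 + t1 / a)" unfolding distz1 by (intro real_sqrt_le_mono) auto
    moreover have "norm z \<le> norm ?z1 + dist z ?z1"
      by (metis dist_0_norm dist_commute dist_triangle)
    ultimately show "norm z \<le> norm ?z1 + sqrt (t1\<^sup>2 + t1 / a)" by linarith
  qed
  have compT: "compact T" using closedT bT by (simp add: compact_eq_bounded_closed)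
  \<comment> \<open>\<open>k * c\<close> must beat \<open>4 * a * K\<close>, from the curvature of
    the parabola, and \<open>K * (1 + N)\<close>, from the gradient term, where
    \<open>N \<ge> 1\<close> is the squared gradient of \<open>?g\<close>.\<close>
  define k where "k = (4 * a * K + 2 * K + 1) / c"
  have kc: "k * c = 4 * a * K + 2 * K + 1" using c_pos by (simp add: k_def)
  have k: "k > 0" using c_pos K_nonneg a by (auto simp: k_def intro!: divide_pos_pos add_nonneg_pos)
  \<comment> \<open>Keeps the barrier at most \<open>\<mu>\<close> on the flat end, where
    \<open>?g\<close> is at most \<open>t1\<close>.\<close>
  define \<epsilon> where "\<epsilon> = \<mu> / exp (k * t1)"
  have \<epsilon>: "\<epsilon> > 0" using \<mu> by (simp add: \<epsilon>_def)
  let ?\<beta> = "\<lambda>z. \<epsilon> * (exp (k * ?g z) - 1)"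
  let ?gx = "\<lambda>z. e1 + 2 * a * ?s z * e2" and ?gy = "\<lambda>z. e2 - 2 * a * ?s z * e1"
  let ?E = "\<lambda>z. \<epsilon> * k * exp (k * ?g z)"
  have "?\<beta> z \<le> f z" if "z \<in> T" for z
  proof (rule comparison[OF f _ compT _ _ _ that])
    show "C2_data S ?\<beta> (\<lambda>z. ?E z * ?gx z) (\<lambda>z. ?E z * ?gy z)
       (\<lambda>z. ?E z * (k * (?gx z)\<^sup>2 - 2 * a * e2\<^sup>2)) (\<lambda>z. ?E z * (k * (?gx z * ?gy z) + 2 * a * e1 * e2))
       (\<lambda>z. ?E z * (k * (?gy z)\<^sup>2 - 2 * a * e1\<^sup>2))"
      unfolding C2_data_def
    proof (intro ballI conjI)
      fix z
      have dg: "(?g has_derivative (\<lambda>v. ?gx z * fst v + ?gy z * snd v)) (at z)"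
        unfolding cap_fun_def z0 fst_conv snd_conv
        by (auto intro!: derivative_eq_intros simp: fun_eq_iff algebra_simps)
      have dE: "(?E has_derivative (\<lambda>v. ?E z * (k * (?gx z * fst v + ?gy z * snd v)))) (at z)"
        by (auto intro!: derivative_eq_intros dg simp: fun_eq_iff algebra_simps)
      show "(?\<beta> has_derivative (\<lambda>v. ?E z * ?gx z * fst v + ?E z * ?gy z * snd v)) (at z)"
        by (auto intro!: derivative_eq_intros dg simp: fun_eq_iff algebra_simps)
      show "((\<lambda>z. ?E z * ?gx z) has_derivative (\<lambda>v. ?E z * (k * (?gx z)\<^sup>2 - 2 * a * e2\<^sup>2) * fst v
           + ?E z * (k * (?gx z * ?gy z) + 2 * a * e1 * e2) * snd v)) (at z)"
        by (rule has_derivative_eq_rhs, rule has_derivative_mult[OF dE],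
            (rule derivative_intros)+)
          (simp add: fun_eq_iff, simp add: algebra_simps power2_eq_square)
      show "((\<lambda>z. ?E z * ?gy z) has_derivative (\<lambda>v. ?E z * (k * (?gx z * ?gy z) + 2 * a * e1 * e2) * fst v
           + ?E z * (k * (?gy z)\<^sup>2 - 2 * a * e1\<^sup>2) * snd v)) (at z)"
        by (rule has_derivative_eq_rhs, rule has_derivative_mult[OF dE],
            (rule derivative_intros)+)
          (simp add: fun_eq_iff, simp add: algebra_simps power2_eq_square)
    qed
    show "continuous_on T f" using TT0(1) by (intro continuous_on_subset[OF cont]) auto
    show "continuous_on T ?\<beta>" by (intro continuous_intros cont_g)
    fix z assume z: "z \<in> T"
    consider "?g z = 0" | "?t z = t1" | "0 < ?g z" "?t z < t1" using z by (force simp: T_def)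
    then show "?\<beta> z \<le> f z \<or> (z \<in> S \<and> z \<in> interior T \<and>
      K * (\<bar>?E z * ?gx z\<bar> + \<bar>?E z * ?gy z\<bar>)
      < A z * (?E z * (k * (?gx z)\<^sup>2 - 2 * a * e2\<^sup>2)) + 2 * B z * (?E z * (k * (?gx z * ?gy z) + 2 * a * e1 * e2))
        + C z * (?E z * (k * (?gy z)\<^sup>2 - 2 * a * e1\<^sup>2)))"
    proof cases
      case 1 then show ?thesis using TT0(2)[OF z] by simp
    next
      case 2
      have s: "a * (?s z)\<^sup>2 \<le> t1" using z 2 by (auto simp: T_def g_def)
      have "4 * t1 / \<delta>\<^sup>2 * (?s z)\<^sup>2 \<le> t1"
      proof -
        have "0 \<le> a0 * (?s z)\<^sup>2" using a0 by simp
        with s show ?thesis by (simp add: a_def algebra_simps)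
      qed
      then have "\<bar>?s z\<bar> \<le> \<delta> / 2" by (rule abs_le_half_if_scaled_square_le[OF t1 \<delta>(1)])
      then have "dist z ?z1 \<le> \<delta> / 2" unfolding distz1 2 by simp
      then have "\<mu> < f z" using \<delta>(2)[OF TT0(1)[OF z]] \<delta>(1) by auto
      moreover have "?g z \<le> t1" using 2 a by (simp add: g_def)
      then have "exp (k * ?g z) \<le> exp (k * t1)" using k by auto
      then have "?\<beta> z \<le> \<epsilon> * exp (k * t1)" using \<epsilon> by (simp add: algebra_simps add_increasing)
      then have "?\<beta> z \<le> \<mu>" by (simp add: \<epsilon>_def)
      ultimately show ?thesis by simp
    next
      case 3
      have zS: "z \<in> S" using cap_int[of z] 3 g_le[of z] by (auto simp: z0)
      have "open {z. 0 < ?g z \<and> ?t z < t1}"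
        by (intro open_Collect_conj open_Collect_less cont_g cont_t continuous_intros)
      then have int: "z \<in> interior T" using 3 by (intro interiorI[of "{z. 0 < ?g z \<and> ?t z < t1}"]) (auto simp: T_def)
      define gx gy where "gx = ?gx z" and "gy = ?gy z"
      define N where "N = gx\<^sup>2 + gy\<^sup>2"
      have "N = (e1\<^sup>2 + e2\<^sup>2) * (1 + 4 * a\<^sup>2 * (?s z)\<^sup>2)"
        by (simp add: N_def gx_def gy_def power2_eq_square algebra_simps)
      then have N: "N \<ge> 1" by (simp add: e)
      have l1: "\<bar>gx\<bar> + \<bar>gy\<bar> \<le> 1 + N"
      proof -
        have "0 \<le> (\<bar>gx\<bar> - 1)\<^sup>2" "0 \<le> (\<bar>gy\<bar> - 1)\<^sup>2" by auto
        then have "2 * \<bar>gx\<bar> \<le> 1 + gx\<^sup>2" "2 * \<bar>gy\<bar> \<le> 1 + gy\<^sup>2"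
          by (auto simp: power2_diff)
        then show ?thesis using N unfolding N_def by linarith
      qed
      have l2: "A z * gx\<^sup>2 + 2 * B z * gx * gy + C z * gy\<^sup>2 \<ge> c * N"
        using ellip[OF zS, of gx gy] by (simp add: N_def)
      have l3: "A z * e2\<^sup>2 - 2 * B z * e1 * e2 + C z * e1\<^sup>2 \<le> 2 * K"
      proof -
        have "\<bar>2 * e1 * e2\<bar> \<le> 1"
        proof -
          have "0 \<le> (e1 - e2)\<^sup>2" "0 \<le> (e1 + e2)\<^sup>2" by auto
          then show ?thesis using e by (simp add: power2_eq_square algebra_simps abs_le_iff)
        qed
        then have "\<bar>B z * (2 * e1 * e2)\<bar> \<le> K * 1"
          unfolding abs_mult[of "B z"] using coeff_bound(2)[OF zS] K_nonneg by (intro mult_mono) auto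
        moreover have "A z * e2\<^sup>2 \<le> K * e2\<^sup>2" "C z * e1\<^sup>2 \<le> K * e1\<^sup>2"
          using coeff_bound(1,3)[OF zS] by (auto intro!: mult_right_mono)
        moreover have "K * e2\<^sup>2 + K * e1\<^sup>2 = K" using e by (simp add: distrib_left[symmetric] add.commute)
        ultimately show ?thesis by (simp add: algebra_simps abs_le_iff)
      qed
      have "K * (\<bar>gx\<bar> + \<bar>gy\<bar>) \<le> K * (1 + N)" using l1 K_nonneg by (rule mult_left_mono)
      also have "\<dots> < (k * c) * N - 4 * a * K"
      proof -
        have "(k * c) * N - 4 * a * K - K * (1 + N) = (4 * a * K + K) * (N - 1) + N"
          unfolding kc by (simp add: algebra_simps)
        also have "\<dots> > 0" using N a K_nonneg by (intro add_nonneg_pos) auto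
        finally show ?thesis by simp
      qed
      also have "(k * c) * N \<le> k * (A z * gx\<^sup>2 + 2 * B z * gx * gy + C z * gy\<^sup>2)"
        using mult_left_mono[OF l2, of k] k by (simp add: mult.assoc)
      also have "k * (A z * gx\<^sup>2 + 2 * B z * gx * gy + C z * gy\<^sup>2) - 4 * a * K
        \<le> k * (A z * gx\<^sup>2 + 2 * B z * gx * gy + C z * gy\<^sup>2) - 2 * a * (A z * e2\<^sup>2 - 2 * B z * e1 * e2 + C z * e1\<^sup>2)"
        using mult_left_mono[OF l3, of "2 * a"] a by simp
      finally have main: "K * (\<bar>gx\<bar> + \<bar>gy\<bar>) < k * (A z * gx\<^sup>2 + 2 * B z * gx * gy + C z * gy\<^sup>2)
         - 2 * a * (A z * e2\<^sup>2 - 2 * B z * e1 * e2 + C z * e1\<^sup>2)" by simp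
      have Ep: "?E z > 0" using \<epsilon> k by simp
      define E where "E = ?E z"
      have E: "E > 0" using Ep by (simp add: E_def)
      have "K * (\<bar>E * gx\<bar> + \<bar>E * gy\<bar>) = E * (K * (\<bar>gx\<bar> + \<bar>gy\<bar>))"
        using E by (simp add: abs_mult algebra_simps)
      also have "\<dots> < E * (k * (A z * gx\<^sup>2 + 2 * B z * gx * gy + C z * gy\<^sup>2)
         - 2 * a * (A z * e2\<^sup>2 - 2 * B z * e1 * e2 + C z * e1\<^sup>2))"
        using main E by (rule mult_strict_left_mono)
      also have "\<dots> = A z * (E * (k * gx\<^sup>2 - 2 * a * e2\<^sup>2)) + 2 * B z * (E * (k * (gx * gy) + 2 * a * e1 * e2))
        + C z * (E * (k * gy\<^sup>2 - 2 * a * e1\<^sup>2))" by (simp add: algebra_simps)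
      finally show ?thesis using zS int unfolding E_def gx_def gy_def by blast
    qed
  qed
  note cmp = this
  show ?thesis
  proof (intro exI conjI ballI)
    show "0 < \<epsilon> * k" using \<epsilon> k by simp
    fix t assume t: "t \<in> {0..t1}"
    have gz: "?g (x0 + t * e1, y0 + t * e2) = t" unfolding g_def tz by simp
    have "(x0 + t * e1, y0 + t * e2) \<in> T" using t gz tz(1)[of t] by (simp add: T_def)
    from cmp[OF this] have "\<epsilon> * (exp (k * t) - 1) \<le> f (x0 + t * e1, y0 + t * e2)" unfolding gz .
    moreover have "\<epsilon> * (k * t) \<le> \<epsilon> * (exp (k * t) - 1)"
    proof (rule mult_left_mono)
      show "k * t \<le> exp (k * t) - 1" using exp_ge_add_one_self[of "k * t"] by linarith
    qed (use \<epsilon> in simp)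
    ultimately show "\<epsilon> * k * t \<le> f (fst z0 + t * e1, snd z0 + t * e2)" by (simp add: z0 mult.assoc)
  qed
qed

text \<open>At an interior zero of a nonnegative supersolution the gradient vanishes, so \<open>hopf_cap\<close> excludes a positive
  value at the far end of a cap based there.\<close>
lemma interior_zero_spreads:
  assumes f: "supersol f fx fy fxx fxy fyy"
    and e: "e1\<^sup>2 + e2\<^sup>2 = 1" and t1: "0 < t1" and a0: "0 \<le> a0"
    and cont: "continuous_on T0 f" and T0: "closed T0"
    and cap: "\<And>z. 0 \<le> cap_fun z0 e1 e2 a0 z \<Longrightarrow>
       e1 * (fst z - fst z0) + e2 * (snd z - snd z0) \<le> t1 \<Longrightarrow> z \<in> T0 \<and> 0 \<le> f z"
    and cap_int: "\<And>z. 0 < cap_fun z0 e1 e2 a0 z \<Longrightarrow>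
       e1 * (fst z - fst z0) + e2 * (snd z - snd z0) < t1 \<Longrightarrow> z \<in> S"
    and z0: "z0 \<in> S" "f z0 = 0" and nonneg: "\<And>z. z \<in> S \<Longrightarrow> 0 \<le> f z"
  shows "f (fst z0 + t1 * e1, snd z0 + t1 * e2) = 0"
proof (rule ccontr)
  let ?z1 = "(fst z0 + t1 * e1, snd z0 + t1 * e2)"
  assume "f ?z1 \<noteq> 0"
  moreover have "f ?z1 \<ge> 0"
  proof -
    have "e1 * (t1 * e1) + e2 * (t1 * e2) = t1 * (e1\<^sup>2 + e2\<^sup>2)" by (simp add: power2_eq_square algebra_simps)
    then have "e1 * (fst ?z1 - fst z0) + e2 * (snd ?z1 - snd z0) = t1" by (simp add: e)
    moreover have "cap_fun z0 e1 e2 a0 ?z1 = t1 - a0 * 0\<^sup>2"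
      using \<open>e1 * (t1 * e1) + e2 * (t1 * e2) = _\<close> by (simp add: cap_fun_def e algebra_simps)
    ultimately show ?thesis using cap[of ?z1] t1 by auto
  qed
  ultimately have "0 < f ?z1" by linarith
  from hopf_cap[OF f e t1 a0 cont T0 cap cap_int this]
  obtain \<epsilon> where \<epsilon>: "\<epsilon> > 0" "\<And>t. t \<in> {0..t1} \<Longrightarrow> \<epsilon> * t \<le> f (fst z0 + t * e1, snd z0 + t * e2)" by blast
  have ev: "eventually (\<lambda>w. f z0 \<le> f w) (nhds z0)"
    using eventually_nhds_in_open[OF open_S z0(1)] by eventually_elim (use nonneg z0 in auto)
  note C2 = supersolD(1)[OF f]
  note grad = hessian_at_local_min[OF C2 open_S z0(1) ev]
  have "(f has_derivative (\<lambda>v. fx z0 * fst v + fy z0 * snd v)) (at (fst z0 + 0 * e1, snd z0 + 0 * e2))"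
    using C2_dataD(1)[OF C2 z0(1)] by simp
  from has_derivative_along_line[OF this]
  have D: "((\<lambda>t. f (fst z0 + t * e1, snd z0 + t * e2)) has_real_derivative 0) (at 0)"
    using grad(1,2) by simp
  have D': "((\<lambda>t. f (fst z0 + t * e1, snd z0 + t * e2) - \<epsilon> / 2 * t) has_real_derivative (0 - \<epsilon> / 2)) (at 0)"
    by (auto intro!: derivative_eq_intros D)
  obtain d where d: "d > 0" "\<And>h. 0 < h \<Longrightarrow> h < d \<Longrightarrow>
     f (fst z0 + (0 + h) * e1, snd z0 + (0 + h) * e2) - \<epsilon> / 2 * (0 + h) < f (fst z0 + 0 * e1, snd z0 + 0 * e2) - \<epsilon> / 2 * 0"
    using DERIV_neg_dec_right[OF D'] \<epsilon>(1) by auto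
  define h where "h = min d t1 / 2"
  have h: "0 < h" "h < d" "h \<le> t1" using d(1) t1 by (auto simp: h_def)
  have "\<epsilon> * h < \<epsilon> / 2 * h" using d(2)[OF h(1,2)] \<epsilon>(2)[of h] h z0(2) by simp
  then show False using h \<epsilon>(1) by simp
qed

text \<open>A cap based at a zero carries it along its axis in one stroke: horizontally to every
  abscissa, then vertically from the level \<open>y0\<close>. No chain of discs is needed in a
  half-strip.\<close>

lemma strong_min_principle:
  assumes f: "supersol f fx fy fxx fxy fyy"
    and S: "S = {z. l < fst z \<and> 0 < snd z \<and> snd z < 1}"
    and cont: "continuous_on ({l..} \<times> {0..1}) f"
    and nonneg: "\<And>x y. l < x \<Longrightarrow> 0 < y \<Longrightarrow> y < 1 \<Longrightarrow> 0 \<le> f (x, y)"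
    and z0: "l < x0" "0 < y0" "y0 < 1" "f (x0, y0) = 0"
    and z: "l \<le> x" "0 \<le> y" "y \<le> 1"
  shows "f (x, y) = 0"
proof -
  have nonneg': "0 \<le> f z" if "z \<in> S" for z using that nonneg[of "fst z" "snd z"] by (auto simp: S)
  have hor: "f (x, y0) = 0" if x: "l < x" for x
  proof -
    consider "x = x0" | "x > x0" | "x < x0" by linarith
    then show ?thesis
    proof cases
      case 1 then show ?thesis using z0 by simp
    next
      case 2
      let ?m = "min y0 (1 - y0)"
      \<comment> \<open>This aperture keeps the whole cap within half the distance of
        \<open>y0\<close> from the edges of the strip.\<close>
      let ?a = "4 * (x - x0) / ?m\<^sup>2"
      have m: "?m > 0" using z0 by auto
      have cap: "\<bar>snd z - y0\<bar> \<le> ?m / 2" if "0 \<le> cap_fun (x0, y0) 1 0 ?a z" "fst z - x0 \<le> x - x0" for z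
      proof -
        have "?a * (snd z - y0)\<^sup>2 \<le> x - x0" using that by (simp add: cap_fun_def)
        then show ?thesis using 2 m by (intro abs_le_half_if_scaled_square_le[of "x - x0"]) auto
      qed
      have cap2: "x0 \<le> fst z" if "0 \<le> cap_fun (x0, y0) 1 0 ?a z" for z
      proof -
        have "0 \<le> ?a * (snd z - y0)\<^sup>2" using 2 m by (intro mult_nonneg_nonneg divide_nonneg_nonneg) auto
        then show ?thesis using that by (simp add: cap_fun_def)
      qed
      have inS: "z \<in> S" if "0 \<le> cap_fun (x0, y0) 1 0 ?a z" "fst z - x0 \<le> x - x0" for z
      proof -
        have *: "\<bar>s\<bar> \<le> y0 / 2 \<and> \<bar>s\<bar> \<le> (1 - y0) / 2" if "\<bar>s\<bar> \<le> m / 2" "m \<le> y0" "m \<le> 1 - y0" for s m :: real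
          using that by auto
        have "\<bar>snd z - y0\<bar> \<le> y0 / 2" "\<bar>snd z - y0\<bar> \<le> (1 - y0) / 2"
          using *[OF cap[OF that] min.cobounded1 min.cobounded2] by auto
        from abs_le_D2[OF this(1)] abs_le_D1[OF this(2)]
        have "0 < snd z" "snd z < 1" using z0(2,3) by argo+
        moreover have "l < fst z" using cap2[OF that(1)] z0 by linarith
        ultimately show ?thesis by (simp add: S)
      qed
      have "f (fst (x0, y0) + (x - x0) * 1, snd (x0, y0) + (x - x0) * 0) = 0"
      proof (rule interior_zero_spreads[OF f, where ?e1.0=1 and ?e2.0=0 and ?a0.0="?a" and ?T0.0="{l..} \<times> {0..1}"])
        show "closed ({l..} \<times> {0..1::real})" by (intro closed_Times) auto
        show "z \<in> {l..} \<times> {0..1} \<and> 0 \<le> f z" if "0 \<le> cap_fun (x0, y0) 1 0 ?a z"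
          "1 * (fst z - fst (x0, y0)) + 0 * (snd z - snd (x0, y0)) \<le> x - x0" for z
          using inS[of z] that nonneg'[of z] by (cases z) (auto simp: S)
        show "z \<in> S" if "0 < cap_fun (x0, y0) 1 0 ?a z"
          "1 * (fst z - fst (x0, y0)) + 0 * (snd z - snd (x0, y0)) < x - x0" for z
          using inS[of z] that by auto
      qed (use 2 cont z0 m nonneg' in \<open>auto simp: S intro!: divide_nonneg_nonneg\<close>)
      then show ?thesis by simp
    next
      case 3
      let ?m = "min y0 (1 - y0)"
      let ?a = "4 * (x0 - x) / ?m\<^sup>2"
      have m: "?m > 0" using z0 by auto
      have cap: "\<bar>snd z - y0\<bar> \<le> ?m / 2" if "0 \<le> cap_fun (x0, y0) (-1) 0 ?a z" "- (fst z - x0) \<le> x0 - x" for z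
      proof -
        have "?a * (snd z - y0)\<^sup>2 \<le> x0 - x" using that by (simp add: cap_fun_def power2_commute)
        then show ?thesis using 3 m by (intro abs_le_half_if_scaled_square_le[of "x0 - x"]) auto
      qed
      have inS: "z \<in> S" if "0 \<le> cap_fun (x0, y0) (-1) 0 ?a z" "- (fst z - x0) \<le> x0 - x" for z
      proof -
        have *: "\<bar>s\<bar> \<le> y0 / 2 \<and> \<bar>s\<bar> \<le> (1 - y0) / 2" if "\<bar>s\<bar> \<le> m / 2" "m \<le> y0" "m \<le> 1 - y0" for s m :: real
          using that by auto
        have "\<bar>snd z - y0\<bar> \<le> y0 / 2" "\<bar>snd z - y0\<bar> \<le> (1 - y0) / 2"
          using *[OF cap[OF that] min.cobounded1 min.cobounded2] by auto
        from abs_le_D2[OF this(1)] abs_le_D1[OF this(2)]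
        have "0 < snd z" "snd z < 1" using z0(2,3) by argo+
        moreover have "l < fst z" using that(2) x z0 by linarith
        ultimately show ?thesis by (simp add: S)
      qed
      have "f (fst (x0, y0) + (x0 - x) * (-1), snd (x0, y0) + (x0 - x) * 0) = 0"
      proof (rule interior_zero_spreads[OF f, where ?e1.0="-1" and ?e2.0=0 and ?a0.0="?a" and ?T0.0="{l..} \<times> {0..1}"])
        show "closed ({l..} \<times> {0..1::real})" by (intro closed_Times) auto
        show "z \<in> {l..} \<times> {0..1} \<and> 0 \<le> f z" if "0 \<le> cap_fun (x0, y0) (-1) 0 ?a z"
          "(-1) * (fst z - fst (x0, y0)) + 0 * (snd z - snd (x0, y0)) \<le> x0 - x" for z
          using inS[of z] that nonneg'[of z] by (cases z) (auto simp: S)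
        show "z \<in> S" if "0 < cap_fun (x0, y0) (-1) 0 ?a z"
          "(-1) * (fst z - fst (x0, y0)) + 0 * (snd z - snd (x0, y0)) < x0 - x" for z
          using inS[of z] that by auto
      qed (use 3 cont z0 m nonneg' in \<open>auto simp: S intro!: divide_nonneg_nonneg\<close>)
      then show ?thesis by simp
    qed
  qed
  have int: "f (x, y) = 0" if x: "l < x" and y: "0 < y" "y < 1" for x y
  proof -
    consider "y = y0" | "y \<noteq> y0" by linarith
    then show ?thesis
    proof cases
      case 1 then show ?thesis using hor[OF x] by simp
    next
      case 2
      define e t where "e = sgn (y - y0)" and "t = \<bar>y - y0\<bar>"
      have e: "e = 1 \<or> e = -1" "e * e = 1" and t: "t > 0" "y0 + t * e = y" using 2
        by (auto simp: e_def t_def sgn_if abs_if)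
      let ?m = "x - l"
      \<comment> \<open>Now the constraint is the vertical side at \<open>l\<close>, at distance
        \<open>?m\<close> from the axis.\<close>
      let ?a = "4 * t / ?m\<^sup>2"
      have m: "?m > 0" using x by auto
      have inS: "z \<in> S" if "0 \<le> cap_fun (x, y0) 0 e ?a z" "e * (snd z - y0) \<le> t" for z
      proof -
        have "(e * (fst z - x))\<^sup>2 = (fst z - x)\<^sup>2" using e by (auto simp: power2_commute)
        then have 1: "?a * (fst z - x)\<^sup>2 \<le> e * (snd z - y0)"
          using that(1) by (simp add: cap_fun_def)
        then have "?a * (fst z - x)\<^sup>2 \<le> t" using that(2) by linarith
        then have "\<bar>fst z - x\<bar> \<le> ?m / 2" using t m by (intro abs_le_half_if_scaled_square_le[of t]) auto
        from abs_le_D2[OF this] have "l < fst z" using x by argo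
        moreover have "0 \<le> e * (snd z - y0)"
        proof -
          have "0 \<le> ?a * (fst z - x)\<^sup>2" using t by (intro mult_nonneg_nonneg divide_nonneg_nonneg) auto
          then show ?thesis using 1 by linarith
        qed
        ultimately show ?thesis using e(1) that(2) t y z0 by (auto simp: S)
      qed
      have "f (fst (x, y0) + t * 0, snd (x, y0) + t * e) = 0"
      proof (rule interior_zero_spreads[OF f, where ?e1.0=0 and ?e2.0=e and ?a0.0="?a" and ?T0.0="{l..} \<times> {0..1}"])
        show "closed ({l..} \<times> {0..1::real})" by (intro closed_Times) auto
        show "z \<in> {l..} \<times> {0..1} \<and> 0 \<le> f z" if "0 \<le> cap_fun (x, y0) 0 e ?a z"
          "0 * (fst z - fst (x, y0)) + e * (snd z - snd (x, y0)) \<le> t" for z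
          using inS[of z] that nonneg'[of z] by (cases z) (auto simp: S)
        show "z \<in> S" if "0 < cap_fun (x, y0) 0 e ?a z"
          "0 * (fst z - fst (x, y0)) + e * (snd z - snd (x, y0)) < t" for z
          using inS[of z] that by auto
        show "f (x, y0) = 0" by (rule hor[OF x])
      qed (use e t cont z0 m nonneg' x in \<open>auto simp: S power2_eq_square\<close>)
      then show ?thesis using t by simp
    qed
  qed
  have "f w = 0" if "w \<in> closure ({l<..} \<times> {0<..<1})" for w
  proof (rule continuous_constant_on_closure[OF _ _ that])
    show "continuous_on (closure ({l<..} \<times> {0<..<1})) f" by (simp add: closure_Times cont)
    show "\<And>v. v \<in> {l<..} \<times> {0<..<1} \<Longrightarrow> f v = 0" using int by auto
  qed
  then show ?thesis using z by (auto simp: closure_Times)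
qed

text \<open>At a right-angled corner the Hopf lemma degenerates to quadratic growth along the diagonal
  (Serrin's corner lemma). This needs the mixed coefficient to vanish at the corner; the convexity of
  \<open>x + b x\<^sup>2\<close> absorbs the first-order terms.\<close>
lemma serrin_corner:
  assumes f: "supersol f fx fy fxx fxy fyy"
    and S: "S = {z. l < fst z \<and> 0 < snd z \<and> snd z < 1}"
    and cont: "continuous_on ({l..} \<times> {0..1}) f"
    and nonneg: "\<And>x y. l \<le> x \<Longrightarrow> 0 \<le> y \<Longrightarrow> y \<le> 1 \<Longrightarrow> 0 \<le> f (x, y)"
    and pos: "\<And>x y. l < x \<Longrightarrow> 0 < y \<Longrightarrow> y < 1 \<Longrightarrow> 0 < f (x, y)"
    and B: "\<And>x y. (x, y) \<in> S \<Longrightarrow> \<bar>B (x, y)\<bar> \<le> L * ((x - l) + (1 - y))"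
    and L: "0 \<le> L"
  shows "\<exists>\<epsilon>>0. \<exists>d>0. \<forall>t\<in>{0..d}. \<epsilon> * t\<^sup>2 \<le> f (l + t, 1 - t)"
proof -
  \<comment> \<open>The barrier terms are multiples of \<open>G = E - 1\<close> or of
    \<open>k * x * E\<close>. The first collect \<open>3 * K\<close> from the gradient and
    \<open>42 * L\<close> from the mixed term, against \<open>2 * b * c\<close>; the second collect
    \<open>6 * K\<close> from the gradient, \<open>16 * K\<close> from the second derivative in
    \<open>x\<close> and \<open>28 * L\<close> from the mixed term, against
    \<open>k * c\<close>.\<close>
  define b where "b = (42 * L + 3 * K + 1) / (2 * c) + 1"
  define k where "k = (22 * K + 28 * L + 1) / c"
  have b: "b \<ge> 1" "2 * b * c \<ge> 42 * L + 3 * K"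
    using L K_nonneg c_pos by (auto simp: b_def field_simps)
  have k: "k > 0" "k * c > 22 * K + 28 * L"
    using L K_nonneg c_pos by (auto simp: k_def intro!: divide_pos_pos)
  \<comment> \<open>The bounds by \<open>1 / k\<close> and \<open>1 / b^2\<close> give
    \<open>E \<le> 3\<close> and \<open>b * x1 \<le> 1\<close>; the bound by \<open>1 / 2\<close>
    keeps the region in the strip.\<close>
  define z1 where "z1 = min (1 / 2) (min (1 / k) (1 / b\<^sup>2))"
  have z1: "0 < z1" "z1 \<le> 1/2" "z1 \<le> 1 / k" "z1 \<le> 1 / b\<^sup>2" using k b by (auto simp: z1_def)
  have kz1: "k * z1 \<le> 1" using z1(3) k by (simp add: field_simps)
  define x1 where "x1 = sqrt z1"
  have x1: "x1 > 0" "x1\<^sup>2 = z1" "x1 \<le> 1" using z1 by (auto simp: x1_def real_le_lsqrt)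
  have bx1: "b * x1 \<le> 1"
  proof -
    have "(b * x1)\<^sup>2 \<le> 1\<^sup>2" using z1(4) b x1 by (simp add: power_mult_distrib field_simps)
    then show ?thesis by (rule power2_le_imp_le) simp
  qed
  \<comment> \<open>The Hopf lemma at the vertical side, at depth \<open>z1\<close> below the
    corner, supplies the linear growth needed on the lower edge of the comparison region.\<close>
  obtain \<epsilon>0 where \<epsilon>0: "\<epsilon>0 > 0" "\<And>t. t \<in> {0..x1} \<Longrightarrow> \<epsilon>0 * t \<le> f (l + t, 1 - z1)"
  proof -
    let ?a = "4 * x1 / z1\<^sup>2"
    have inS: "z \<in> {l..} \<times> {0<..<1}" if "0 \<le> cap_fun (l, 1 - z1) 1 0 ?a z" "fst z - l \<le> x1" for z
    proof -
      have "0 \<le> ?a * (snd z - (1 - z1))\<^sup>2" using x1 by (intro mult_nonneg_nonneg divide_nonneg_nonneg) auto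
      moreover have *: "?a * (snd z - (1 - z1))\<^sup>2 \<le> fst z - l" using that by (simp add: cap_fun_def)
      ultimately have "l \<le> fst z" by linarith
      moreover have "\<bar>snd z - (1 - z1)\<bar> \<le> z1 / 2"
        using * that(2) x1 z1 by (intro abs_le_half_if_scaled_square_le[of x1]) auto
      from abs_le_D1[OF this] abs_le_D2[OF this] have "0 < snd z" "snd z < 1" using z1 by argo+
      ultimately show ?thesis by (cases z) auto
    qed
    have "\<exists>\<epsilon>>0. \<forall>t\<in>{0..x1}. \<epsilon> * t \<le> f (fst (l, 1 - z1) + t * 1, snd (l, 1 - z1) + t * 0)"
    proof (rule hopf_cap[OF f, where ?a0.0 = ?a and ?T0.0 = "{l..} \<times> {0..1}"])
      show "closed ({l..} \<times> {0..1::real})" by (intro closed_Times) auto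
      show "z \<in> {l..} \<times> {0..1} \<and> 0 \<le> f z" if "0 \<le> cap_fun (l, 1 - z1) 1 0 ?a z"
          "1 * (fst z - fst (l, 1 - z1)) + 0 * (snd z - snd (l, 1 - z1)) \<le> x1" for z
        using inS[of z] that nonneg[of "fst z" "snd z"] by (cases z) auto
      show "z \<in> S" if z: "0 < cap_fun (l, 1 - z1) 1 0 ?a z"
          "1 * (fst z - fst (l, 1 - z1)) + 0 * (snd z - snd (l, 1 - z1)) < x1" for z
      proof -
        have "0 \<le> ?a * (snd z - (1 - z1))\<^sup>2" using x1 by (intro mult_nonneg_nonneg divide_nonneg_nonneg) auto
        then have "l < fst z" using z(1) by (simp add: cap_fun_def)
        then show ?thesis using inS[of z] z by (cases z) (auto simp: S)
      qed
    qed (use x1 z1 cont pos[of "l + x1" "1 - z1"] in auto)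
    then show ?thesis using that by auto
  qed
  let ?X = "\<lambda>z :: real \<times> real. fst z - l" and ?Z = "\<lambda>z :: real \<times> real. 1 - snd z"
  let ?g = "\<lambda>z. ?Z z - (?X z)\<^sup>2"
  let ?\<phi> = "\<lambda>z. ?X z + b * (?X z)\<^sup>2"
  let ?\<phi>' = "\<lambda>z. 1 + 2 * b * ?X z"
  let ?E = "\<lambda>z. exp (k * ?g z)"
  define \<epsilon> where "\<epsilon> = \<epsilon>0 / 6"
  have \<epsilon>: "\<epsilon> > 0" using \<epsilon>0 by (simp add: \<epsilon>_def)
  \<comment> \<open>Vanishes on the side \<open>?X = 0\<close> and on the parabola
    \<open>?g = 0\<close>. The diagonal from the corner runs between the two, and along it the
    product of the two linear factors is quadratic.\<close>
  let ?v = "\<lambda>z. \<epsilon> * (?\<phi> z * (?E z - 1))"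
  let ?vx = "\<lambda>z. \<epsilon> * (?\<phi>' z * (?E z - 1) - 2 * k * ?X z * ?\<phi> z * ?E z)"
  let ?vy = "\<lambda>z. \<epsilon> * (- k * ?\<phi> z * ?E z)"
  let ?vxx = "\<lambda>z. \<epsilon> * (2 * b * (?E z - 1) - 4 * k * ?X z * ?\<phi>' z * ?E z + ?\<phi> z * (4 * k\<^sup>2 * (?X z)\<^sup>2 - 2 * k) * ?E z)"
  let ?vxy = "\<lambda>z. \<epsilon> * (- k * ?\<phi>' z * ?E z + 2 * k\<^sup>2 * ?X z * ?\<phi> z * ?E z)"
  let ?vyy = "\<lambda>z. \<epsilon> * (k\<^sup>2 * ?\<phi> z * ?E z)"
  define T where "T = {z. 0 \<le> ?X z \<and> 0 \<le> ?g z \<and> ?Z z \<le> z1}"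
  have T: "0 \<le> ?X z" "(?X z)\<^sup>2 \<le> ?Z z" "?Z z \<le> z1" "?X z \<le> x1" "0 \<le> ?Z z" if "z \<in> T" for z
  proof -
    show "0 \<le> ?X z" and 1: "(?X z)\<^sup>2 \<le> ?Z z" and 2: "?Z z \<le> z1" using that by (auto simp: T_def)
    then have "(?X z)\<^sup>2 \<le> x1\<^sup>2" using x1 by simp
    then show "?X z \<le> x1" using power2_le_imp_le[of _ x1] x1(1) by simp
    have "0 \<le> (?X z)\<^sup>2" by simp
    with 1 show "0 \<le> ?Z z" by linarith
  qed
  have compT: "compact T"
  proof -
    have "closed T" unfolding T_def
      by (intro closed_Collect_conj closed_Collect_le continuous_intros)
    moreover have "T \<subseteq> {l..l + x1} \<times> {1 - z1..1}" 
    proof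
      fix z assume "z \<in> T"
      from T[OF this] show "z \<in> {l..l + x1} \<times> {1 - z1..1}" by (cases z) auto
    qed
    ultimately show ?thesis
      using bounded_subset[OF compact_imp_bounded[OF compact_Times[OF compact_Icc compact_Icc]]]
      unfolding compact_eq_bounded_closed by blast
  qed
  have cmp: "?v z \<le> f z" if "z \<in> T" for z
  proof (rule comparison[OF f _ compT _ _ _ that])
    show "C2_data S ?v ?vx ?vy ?vxx ?vxy ?vyy"
      unfolding C2_data_def
    proof (intro ballI conjI)
      fix z
      have dX: "(?X has_derivative fst) (at z)" "(?Z has_derivative (\<lambda>v. - snd v)) (at z)"
        by (auto intro!: derivative_eq_intros)
      have dE: "(?E has_derivative (\<lambda>v. ?E z * (k * (- snd v - 2 * ?X z * fst v)))) (at z)"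
        by (auto intro!: derivative_eq_intros simp: fun_eq_iff algebra_simps)
      have d\<phi>: "(?\<phi> has_derivative (\<lambda>v. ?\<phi>' z * fst v)) (at z)" "(?\<phi>' has_derivative (\<lambda>v. 2 * b * fst v)) (at z)"
        by (auto intro!: derivative_eq_intros simp: fun_eq_iff algebra_simps)
      define X E \<phi> \<phi>' where fold: "X = ?X" "E = ?E" "\<phi> = ?\<phi>" "\<phi>' = ?\<phi>'"
      note d = dX(1)[folded fold] dE[folded fold] d\<phi>[folded fold]
      show "(?v has_derivative (\<lambda>v. ?vx z * fst v + ?vy z * snd v)) (at z)"
        unfolding fold[symmetric, THEN fun_cong]
        by (rule has_derivative_eq_rhs, (rule derivative_intros d)+) (simp add: fun_eq_iff algebra_simps)
      show "(?vx has_derivative (\<lambda>v. ?vxx z * fst v + ?vxy z * snd v)) (at z)"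
        unfolding fold[symmetric, THEN fun_cong]
        by (rule has_derivative_eq_rhs, (rule derivative_intros d)+) (simp add: fun_eq_iff algebra_simps power2_eq_square)
      show "(?vy has_derivative (\<lambda>v. ?vxy z * fst v + ?vyy z * snd v)) (at z)"
        unfolding fold[symmetric, THEN fun_cong]
        by (rule has_derivative_eq_rhs, (rule derivative_intros d)+) (simp add: fun_eq_iff algebra_simps power2_eq_square)
    qed
    show "continuous_on T f"
      using T z1 by (intro continuous_on_subset[OF cont]) (force simp: mem_Times_iff)
    show "continuous_on T ?v" by (intro continuous_intros)
    fix z assume z: "z \<in> T"
    note Tz = T[OF z]
    have gle: "?g z \<le> z1" using Tz(3) zero_le_power2[of "?X z"] by linarith
    have "k * ?g z \<le> 1" using mult_left_mono[OF gle, of k] k(1) kz1 by linarith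
    then have E3: "?E z \<le> 3" using exp_le by (meson exp_le_cancel_iff order_trans)
    have \<phi>2: "?\<phi> z \<le> 2 * ?X z" and \<phi>1: "?X z \<le> ?\<phi> z"
    proof -
      have "b * ?X z \<le> 1" using bx1 mult_left_mono[OF Tz(4), of b] b by linarith
      from mult_right_mono[OF this Tz(1)] show "?\<phi> z \<le> 2 * ?X z" by (simp add: power2_eq_square)
      show "?X z \<le> ?\<phi> z" using b by simp
    qed
    have f0: "0 \<le> f z" using nonneg[of "fst z" "snd z"] Tz z1 by simp
    consider "?X z = 0" | "?g z = 0" | "?Z z = z1" | "0 < ?X z" "0 < ?g z" "?Z z < z1"
      using z by (force simp: T_def)
    then show "?v z \<le> f z \<or> (z \<in> S \<and> z \<in> interior T \<and>
      K * (\<bar>?vx z\<bar> + \<bar>?vy z\<bar>) < A z * ?vxx z + 2 * B z * ?vxy z + C z * ?vyy z)"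
    proof cases
      case 1 then show ?thesis using f0 by simp
    next
      case 2 then show ?thesis using f0 by simp
    next
      case 3
      have "?v z \<le> \<epsilon> * (2 * ?X z * 3)"
      proof (intro mult_left_mono mult_mono)
        show "0 \<le> ?E z - 1" using Tz k by simp
      qed (use \<phi>2 E3 \<epsilon> Tz in auto)
      also have "\<dots> = \<epsilon>0 * ?X z" by (simp add: \<epsilon>_def)
      also have "\<dots> \<le> f (l + ?X z, 1 - z1)" using \<epsilon>0(2)[of "?X z"] Tz by simp
      also have "(l + ?X z, 1 - z1) = z" using 3 by (cases z) auto
      finally show ?thesis by simp
    next
      case 4
      define x Zz E G \<phi> \<phi>' where "x = ?X z" and "Zz = ?Z z" and "E = ?E z" and "G = ?E z - 1" and "\<phi> = ?\<phi> z" and "\<phi>' = ?\<phi>' z"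
      have zS: "z \<in> S" 
      proof -
        have "0 < ?Z z" using 4(2) zero_le_power2[of "?X z"] by linarith
        moreover have "snd z > 0" using 4(3) z1(2) by linarith
        ultimately show ?thesis using 4(1) by (simp add: S)
      qed
      have int: "z \<in> interior T"
      proof (rule interiorI)
        show "open {z. 0 < ?X z \<and> 0 < ?g z \<and> ?Z z < z1}"
          by (intro open_Collect_conj open_Collect_less continuous_intros)
      qed (use 4 in \<open>auto simp: T_def\<close>)
      have x: "0 < x" "x \<le> 1" "x\<^sup>2 \<le> x" "k * x\<^sup>2 \<le> 1"
      proof -
        show 1: "0 < x" "x \<le> 1" using 4 Tz x1 by (auto simp: x_def)
        then show "x\<^sup>2 \<le> x" by (simp add: power2_eq_square mult_le_cancel_left1)
        have "x\<^sup>2 \<le> z1" using Tz by (simp add: x_def)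
        then show "k * x\<^sup>2 \<le> 1" using kz1 k by (meson mult_left_mono order_trans less_imp_le)
      qed
      have EG: "E = G + 1" "0 < E" "E \<le> 3" using E3 by (auto simp: E_def G_def)
      have kg: "k * (Zz - x\<^sup>2) \<le> G" using exp_ge_add_one_self[of "k * ?g z"] unfolding G_def Zz_def x_def by linarith
      have kg0: "0 \<le> k * (Zz - x\<^sup>2)" using 4 k by (simp add: Zz_def x_def)
      have G: "0 \<le> G" using kg kg0 by linarith
      have \<phi>: "x \<le> \<phi>" "\<phi> \<le> 2 * x" "0 \<le> \<phi>" using \<phi>1 \<phi>2 4 by (auto simp: x_def \<phi>_def)
      have \<phi>': "0 \<le> \<phi>'" "\<phi>' \<le> 3"
      proof -
        have "b * x \<le> 1" using bx1 mult_left_mono[OF Tz(4), of b] b unfolding x_def by linarith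
        then show "\<phi>' \<le> 3" by (simp add: \<phi>'_def x_def)
        show "0 \<le> \<phi>'" using b 4 by (simp add: \<phi>'_def)
      qed
      have kxE: "0 \<le> k * x * E" using k x EG by simp
      have t1: "K * (\<bar>\<phi>' * G - 2 * k * x * \<phi> * E\<bar> + \<bar>- k * \<phi> * E\<bar>) \<le> 3 * K * G + 6 * K * (k * x * E)"
      proof -
        have "\<phi>' * G \<le> 3 * G" using \<phi>' G by (intro mult_right_mono) auto
        moreover have "0 \<le> \<phi>' * G" using \<phi>' G by simp
        moreover have "k * x * E * \<phi> \<le> k * x * E * 2" using kxE \<phi> x by (intro mult_left_mono) auto
        moreover have "0 \<le> k * x * E * \<phi>" using kxE \<phi> by simp
        moreover have "k * E * \<phi> \<le> k * E * (2 * x)" using k EG \<phi> by (intro mult_left_mono) auto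
        moreover have "0 \<le> k * E * \<phi>" using k EG \<phi> by simp
        ultimately have "\<bar>\<phi>' * G - 2 * k * x * \<phi> * E\<bar> + \<bar>- k * \<phi> * E\<bar> \<le> 3 * G + 6 * (k * x * E)"
          by (simp add: algebra_simps abs_le_iff abs_if)
        from mult_left_mono[OF this K_nonneg] show ?thesis by (simp add: algebra_simps)
      qed
      have t2: "c * (2 * b * G) - 16 * K * (k * x * E)
         \<le> A z * (2 * b * G - 4 * k * x * \<phi>' * E + \<phi> * (4 * k\<^sup>2 * x\<^sup>2 - 2 * k) * E)"
      proof -
        have Az: "c \<le> A z" "A z \<le> K" "0 \<le> A z" using coeff_ge(1)[OF zS] coeff_bound(1)[OF zS] c_pos by auto
        have "c * (2 * b * G) \<le> A z * (2 * b * G)" using Az G b by (intro mult_right_mono) auto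
        moreover have "A z * (k * x * E * \<phi>') \<le> K * (k * x * E * 3)"
          using Az k x EG \<phi>' K_nonneg by (intro mult_mono) auto
        moreover have "A z * (k * E * \<phi>) \<le> K * (k * E * (2 * x))"
          using Az k EG \<phi> K_nonneg by (intro mult_mono) auto
        moreover have "0 \<le> A z * (\<phi> * (4 * k\<^sup>2 * x\<^sup>2) * E)" using Az \<phi> EG by simp
        ultimately show ?thesis by (simp add: algebra_simps)
      qed
      have t3: "- (28 * L * (k * x * E) + 42 * L * G) \<le> 2 * B z * (- k * \<phi>' * E + 2 * k\<^sup>2 * x * \<phi> * E)"
      proof -
        define Q where "Q = - k * \<phi>' * E + 2 * k\<^sup>2 * x * \<phi> * E"
        have Bz: "\<bar>B z\<bar> \<le> L * (x + Zz)" using B[of "fst z" "snd z"] zS by (simp add: x_def Zz_def)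
        have "\<bar>- k * \<phi>' * E + 2 * k\<^sup>2 * x * \<phi> * E\<bar> \<le> 7 * k * E"
        proof -
          have "k * E * \<phi>' \<le> k * E * 3" using k EG \<phi>' by (intro mult_left_mono) auto
          moreover have "0 \<le> k * E * \<phi>'" using k EG \<phi>' by simp
          moreover have "k * E * (2 * k * x * \<phi>) \<le> k * E * 4"
          proof (intro mult_left_mono)
            have "k * x * \<phi> \<le> k * x * (2 * x)" using k x \<phi> by (intro mult_left_mono) auto
            also have "\<dots> = 2 * (k * x\<^sup>2)" by (simp add: power2_eq_square)
            also have "\<dots> \<le> 2" using x(4) by simp
            finally show "2 * k * x * \<phi> \<le> 4" by (simp add: algebra_simps)
          qed (use k EG in auto)
          moreover have "0 \<le> k * E * (2 * k * x * \<phi>)" using k EG \<phi> x by simp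
          ultimately show ?thesis by (simp add: algebra_simps power2_eq_square abs_le_iff)
        qed
        then have Q: "\<bar>Q\<bar> \<le> 7 * k * E" by (simp only: Q_def)
        then have "\<bar>B z * Q\<bar> \<le> (L * (x + Zz)) * (7 * k * E)"
          using Bz unfolding abs_mult by (intro mult_mono) auto
        also have "\<dots> = 7 * L * (k * x * E) + 7 * L * (k * Zz * E)" by (simp add: algebra_simps)
        \<comment> \<open>Writing \<open>Zz\<close> as \<open>(Zz - x^2) + x^2\<close> trades the
          vertical part of the bound on \<open>B z\<close> for \<open>G\<close>, which the convex
          term with \<open>b\<close> controls.\<close>
        also have "k * Zz * E \<le> k * x * E + 3 * G"
        proof -
          have "k * Zz * E = k * (Zz - x\<^sup>2) * E + k * x\<^sup>2 * E" by (simp add: algebra_simps)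
          also have "k * (Zz - x\<^sup>2) * E \<le> G * 3" using kg kg0 EG G by (intro mult_mono) auto
          also have "k * x\<^sup>2 * E \<le> k * x * E" using x k EG by (intro mult_right_mono mult_left_mono) auto
          finally show ?thesis by simp
        qed
        then have "7 * L * (k * x * E) + 7 * L * (k * Zz * E) \<le> 7 * L * (k * x * E) + 7 * L * (k * x * E + 3 * G)"
          using L by (intro add_left_mono mult_left_mono) auto
        finally have "\<bar>B z * Q\<bar> \<le> 14 * L * (k * x * E) + 21 * L * G"
          by (simp add: algebra_simps)
        from abs_le_D2[OF this] show ?thesis unfolding Q_def[symmetric] by (simp add: mult.assoc)
      qed
      have t4: "c * k * (k * x * E) \<le> C z * (k\<^sup>2 * \<phi> * E)"
      proof -
        have "c * (k\<^sup>2 * E * x) \<le> C z * (k\<^sup>2 * E * \<phi>)"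
          using coeff_ge(2)[OF zS] c_pos \<phi> x EG by (intro mult_mono mult_nonneg_nonneg) auto
        then show ?thesis by (simp add: power2_eq_square algebra_simps)
      qed
      have t5: "0 < (k * c - (22 * K + 28 * L)) * (k * x * E)" using k x EG by simp
      have t6: "0 \<le> (2 * b * c - (42 * L + 3 * K)) * G" using b G by simp
      have "K * (\<bar>\<phi>' * G - 2 * k * x * \<phi> * E\<bar> + \<bar>- k * \<phi> * E\<bar>)
        < A z * (2 * b * G - 4 * k * x * \<phi>' * E + \<phi> * (4 * k\<^sup>2 * x\<^sup>2 - 2 * k) * E)
        + 2 * B z * (- k * \<phi>' * E + 2 * k\<^sup>2 * x * \<phi> * E) + C z * (k\<^sup>2 * \<phi> * E)"
        using t1 t2 t3 t4 t5 t6 by (simp add: algebra_simps)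
      from mult_strict_left_mono[OF this \<epsilon>]
      have "K * (\<bar>?vx z\<bar> + \<bar>?vy z\<bar>) < A z * ?vxx z + 2 * B z * ?vxy z + C z * ?vyy z"
      proof -
        define R1 R2 where "R1 = \<phi>' * G - 2 * k * x * \<phi> * E" and "R2 = - k * \<phi> * E"
        have vals: "?vx z = \<epsilon> * R1" "?vy z = \<epsilon> * R2"
          by (simp_all only: R1_def R2_def x_def \<phi>_def \<phi>'_def E_def G_def)
        have "K * (\<bar>\<epsilon> * R1\<bar> + \<bar>\<epsilon> * R2\<bar>) = \<epsilon> * (K * (\<bar>R1\<bar> + \<bar>R2\<bar>))"
          using \<epsilon> by (simp add: abs_mult algebra_simps)
        also note \<open>\<epsilon> * (K * (\<bar>\<phi>' * G - 2 * k * x * \<phi> * E\<bar> + \<bar>- k * \<phi> * E\<bar>)) < _\<close>[folded R1_def R2_def]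
        also have "\<epsilon> * (A z * (2 * b * G - 4 * k * x * \<phi>' * E + \<phi> * (4 * k\<^sup>2 * x\<^sup>2 - 2 * k) * E)
            + 2 * B z * (- k * \<phi>' * E + 2 * k\<^sup>2 * x * \<phi> * E) + C z * (k\<^sup>2 * \<phi> * E))
          = A z * ?vxx z + 2 * B z * ?vxy z + C z * ?vyy z"
          unfolding x_def \<phi>_def \<phi>'_def E_def G_def by (simp only: distrib_left mult.left_commute[of \<epsilon>] mult.assoc)
        finally show ?thesis unfolding vals .
      qed
      then show ?thesis using zS int by blast
    qed
  qed
  show ?thesis
  proof (intro exI conjI ballI)
    show "0 < \<epsilon> * k / 2" using \<epsilon> k by simp
    show "0 < z1" by (rule z1)
    fix t assume t: "t \<in> {0..z1}"
    then have t': "0 \<le> t" "t \<le> 1/2" "t \<le> z1" using z1 by auto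
    have tt: "t\<^sup>2 \<le> t / 2" using mult_left_mono[OF t'(2) t'(1)] by (simp add: power2_eq_square)
    then have inT: "(l + t, 1 - t) \<in> T" using t' by (auto simp: T_def)
    have "\<epsilon> * k / 2 * t\<^sup>2 = \<epsilon> * (t * (k * (t / 2)))" by (simp add: power2_eq_square)
    also have "\<dots> \<le> \<epsilon> * ((t + b * t\<^sup>2) * (exp (k * (t - t\<^sup>2)) - 1))"
    proof (intro mult_left_mono mult_mono)
      have "k * (t / 2) \<le> k * (t - t\<^sup>2)" using tt k by (intro mult_left_mono) auto
      then show "k * (t / 2) \<le> exp (k * (t - t\<^sup>2)) - 1" using exp_ge_add_one_self[of "k * (t - t\<^sup>2)"] by linarith
    qed (use t' b k \<epsilon> in auto)
    also have "\<dots> \<le> f (l + t, 1 - t)" using cmp[OF inT] by simp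
    finally show "\<epsilon> * k / 2 * t\<^sup>2 \<le> f (l + t, 1 - t)" .
  qed
qed

end

section \<open>Laminar flows\<close>

text \<open>Laminar flows are parametrized by \<open>e = s\<^sup>2 / 2\<close>, the energy at the bottom; \<open>flowS\<close> is the flow force
  for which the flux function \<open>Phi\<close> below vanishes at a surface point of height \<open>y\<close>.\<close>
definition flowV :: "(real \<Rightarrow> real) \<Rightarrow> real \<Rightarrow> real \<Rightarrow> real" where
  "flowV \<omega> e p = sqrt (2 * e - 2 * Omega \<omega> p)"

definition e_min :: "(real \<Rightarrow> real) \<Rightarrow> real" where
  "e_min \<omega> = Sup (Omega \<omega> ` {0..1})"

definition flowD :: "(real \<Rightarrow> real) \<Rightarrow> real \<Rightarrow> real" where
  "flowD \<omega> e = integral {0..1} (\<lambda>p. 1 / flowV \<omega> e p)"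

text \<open>A primitive of \<open>flowD\<close> in \<open>e\<close>. It carries the part of the flow
  force that is not an explicit function of the depth.\<close>

definition flowW :: "(real \<Rightarrow> real) \<Rightarrow> real \<Rightarrow> real" where
  "flowW \<omega> e = integral {0..1} (flowV \<omega> e)"

text \<open>Minus the \<open>e\<close>-derivative of \<open>flowD\<close>, so \<open>flowR\<close>
  has derivative \<open>1 - flowI\<close>. The critical energy is where it equals 1, and values
  below 1 mean supercritical flow.\<close>

definition flowI :: "(real \<Rightarrow> real) \<Rightarrow> real \<Rightarrow> real" where
  "flowI \<omega> e = integral {0..1} (\<lambda>p. 1 / flowV \<omega> e p ^ 3)"

definition flowR :: "(real \<Rightarrow> real) \<Rightarrow> real \<Rightarrow> real" where
  "flowR \<omega> e = e - Omega \<omega> 1 + flowD \<omega> e"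

definition flowS :: "(real \<Rightarrow> real) \<Rightarrow> real \<Rightarrow> real \<Rightarrow> real \<Rightarrow> real" where
  "flowS \<omega> r e y = flowW \<omega> e - e * y + (Omega \<omega> 1 + r) * y - y\<^sup>2 / 2"

lemma Omega_derivative:
  assumes "continuous_on {0..1} \<omega>" "p \<in> {0..1}"
  shows "(Omega \<omega> has_real_derivative \<omega> p) (at p within {0..1})"
proof -
  have "((\<lambda>u. integral {0..u} \<omega>) has_real_derivative \<omega> p) (at p within {0..1})"
    by (rule integral_has_real_derivative[OF assms])
  then show ?thesis by (simp add: Omega_def[abs_def])
qed

lemma has_real_derivative_interior:
  fixes f :: "real \<Rightarrow> real"
  assumes "(f has_real_derivative D) (at p within {0..1})" "0 < p" "p < 1"
  shows "(f has_real_derivative D) (at p)"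
  using assms by (metis at_within_interior box_real(1) greaterThanLessThan_iff interior_atLeastAtMost_real)

locale vorticity =
  fixes \<omega> :: "real \<Rightarrow> real"
  assumes omega_cont: "continuous_on {0..1} \<omega>"
begin

abbreviation "\<Omega> \<equiv> Omega \<omega>"
abbreviation "V \<equiv> flowV \<omega>"
abbreviation "D \<equiv> flowD \<omega>"
abbreviation "W \<equiv> flowW \<omega>"
abbreviation "I \<equiv> flowI \<omega>"
abbreviation "R \<equiv> flowR \<omega>"
abbreviation "e0 \<equiv> e_min \<omega>"

lemma Omega_cont: "continuous_on {0..1} \<Omega>"
  using Omega_derivative[OF omega_cont] by (meson DERIV_continuous_on)

lemma Omega_0: "\<Omega> 0 = 0" by (simp add: Omega_def)

lemma Omega_argmax: obtains p0 where "p0 \<in> {0..1}" "\<Omega> p0 = e0" "\<And>p. p \<in> {0..1} \<Longrightarrow> \<Omega> p \<le> e0"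
proof -
  obtain p0 where p0: "p0 \<in> {0..1}" "\<And>p. p \<in> {0..1} \<Longrightarrow> \<Omega> p \<le> \<Omega> p0"
    using continuous_attains_sup[OF compact_Icc _ Omega_cont] by auto
  have "e0 = \<Omega> p0" unfolding e_min_def
    by (rule cSup_eq_maximum) (use p0 in auto)
  then show ?thesis using that p0 by auto
qed

lemma Omega_le: "p \<in> {0..1} \<Longrightarrow> \<Omega> p \<le> e0"
  using Omega_argmax by blast

lemma e0_nonneg: "0 \<le> e0" using Omega_le[of 0] by (simp add: Omega_0)

lemma arg_pos: "e0 < e \<Longrightarrow> p \<in> {0..1} \<Longrightarrow> 0 < e - \<Omega> p"
  using Omega_le[of p] by simp

lemma V_pos: "e0 < e \<Longrightarrow> p \<in> {0..1} \<Longrightarrow> 0 < V e p"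
  using Omega_le[of p] by (simp add: flowV_def)

lemma V_sq: "e0 < e \<Longrightarrow> p \<in> {0..1} \<Longrightarrow> (V e p)\<^sup>2 = 2 * e - 2 * \<Omega> p"
  using Omega_le[of p] by (simp add: flowV_def)

lemma V_ge: "e0 < e \<Longrightarrow> p \<in> {0..1} \<Longrightarrow> sqrt (2 * (e - e0)) \<le> V e p"
  using Omega_le[of p] by (simp add: flowV_def)

lemma V_cont: "continuous_on ({e0<..} \<times> {0..1}) (\<lambda>(e, p). V e p)"
  unfolding flowV_def case_prod_beta
  by (intro continuous_intros continuous_on_compose2[OF Omega_cont]) auto

lemma V_nonzero: "z \<in> {e0<..} \<times> {0..1} \<Longrightarrow> V (fst z) (snd z) \<noteq> 0"
  using V_pos[of "fst z" "snd z"] by (cases z) simp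

lemma inv_V_cont: "continuous_on ({e0<..} \<times> {0..1}) (\<lambda>(e, p). 1 / V e p)"
  unfolding case_prod_beta
  by (intro continuous_on_divide continuous_on_const V_cont[unfolded case_prod_beta] ballI V_nonzero)

lemma inv_V_cont3: "continuous_on ({e0<..} \<times> {0..1}) (\<lambda>(e, p). 1 / V e p ^ 3)"
  unfolding case_prod_beta
  by (intro continuous_on_divide continuous_on_const continuous_on_power V_cont[unfolded case_prod_beta] ballI
      power_not_zero V_nonzero)

lemma V_cont1 [continuous_intros]: "continuous_on {0..1} (V e)"
  unfolding flowV_def by (intro continuous_intros Omega_cont)

lemma V_strict_mono: "e0 < e \<Longrightarrow> e < e' \<Longrightarrow> p \<in> {0..1} \<Longrightarrow> V e p < V e' p"
  by (simp add: flowV_def)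

lemma V_deriv_e:
  assumes "e0 < e" "p \<in> {0..1}"
  shows "((\<lambda>e. V e p) has_real_derivative 1 / V e p) (at e)"
  unfolding flowV_def using arg_pos[OF assms]
  by (auto intro!: derivative_eq_intros simp: field_simps)

lemma V_deriv_p:
  assumes "e0 < e" "p \<in> {0..1}"
  shows "(V e has_real_derivative - \<omega> p / V e p) (at p within {0..1})"
  unfolding flowV_def[abs_def] using arg_pos[OF assms]
  by (auto intro!: derivative_eq_intros Omega_derivative omega_cont assms simp: field_simps)

lemma int_cont_pos:
  fixes f :: "real \<Rightarrow> real"
  assumes "continuous_on {0..1} f" "\<And>p. p \<in> {0..1} \<Longrightarrow> 0 < f p"
  shows "0 < integral {0..1} f"
proof -
  obtain p0 where p0: "p0 \<in> {0..1}" "\<And>p. p \<in> {0..1} \<Longrightarrow> f p0 \<le> f p"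
    using continuous_attains_inf[OF compact_Icc _ assms(1)] by auto
  have "integral {0..1} (\<lambda>_::real. f p0) \<le> integral {0..1} f"
    using p0 assms(1) by (intro integral_le integrable_continuous_real) auto
  then show ?thesis using assms(2)[OF p0(1)] by simp
qed

lemma cont_inv: "e0 < e \<Longrightarrow> continuous_on {0..1} (\<lambda>p. 1 / V e p)"
  using V_pos[of e] by (intro continuous_intros) force
lemma cont_inv3: "e0 < e \<Longrightarrow> continuous_on {0..1} (\<lambda>p. 1 / V e p ^ 3)"
  using V_pos[of e] by (intro continuous_intros) force

lemma W_deriv: assumes "e0 < e" shows "(W has_real_derivative D e) (at e)"
proof -
  have "((\<lambda>e. integral (cbox 0 1) (V e)) has_real_derivative integral (cbox 0 1) (\<lambda>p. 1 / V e p)) (at e within {e0<..})"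
  proof (rule leibniz_rule_field_derivative)
    show "((\<lambda>x. V x t) has_real_derivative 1 / V x t) (at x within {e0<..})"
      if "x \<in> {e0<..}" "t \<in> cbox 0 1" for x t
      using V_deriv_e[of x t] that by (auto intro: has_field_derivative_at_within)
    show "continuous_on ({e0<..} \<times> cbox 0 1) (\<lambda>(x, t). 1 / V x t)"
      using inv_V_cont by simp
    show "V x integrable_on cbox 0 1" for x
      using integrable_continuous_real[OF V_cont1] by simp
  qed (use assms in auto)
  then show ?thesis using assms
    by (simp add: flowW_def[abs_def] flowD_def at_within_open[of e "{e0<..}"])
qed

lemma D_deriv: assumes "e0 < e" shows "(D has_real_derivative - I e) (at e)"
proof -
  have "((\<lambda>e. integral (cbox 0 1) (\<lambda>p. 1 / V e p)) has_real_derivative integral (cbox 0 1) (\<lambda>p. - (1 / V e p ^ 3))) (at e within {e0<..})"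
  proof (rule leibniz_rule_field_derivative)
    show "((\<lambda>x. 1 / V x t) has_real_derivative - (1 / V x t ^ 3)) (at x within {e0<..})"
      if "x \<in> {e0<..}" "t \<in> cbox 0 1" for x t
    proof -
      have x: "e0 < x" "t \<in> {0..1}" using that by auto
      have "((\<lambda>x. inverse (V x t)) has_real_derivative - (1 / V x t * inverse (V x t ^ Suc (Suc 0)))) (at x within {e0<..})"
        by (rule DERIV_inverse_fun[OF has_field_derivative_at_within[OF V_deriv_e[OF x]]])
          (use V_pos[OF x] in simp)
      then show ?thesis by (simp add: divide_inverse power3_eq_cube mult.assoc)
    qed
    show "continuous_on ({e0<..} \<times> cbox 0 1) (\<lambda>(x, t). - (1 / V x t ^ 3))"
      using continuous_on_minus[OF inv_V_cont3] by (simp add: case_prod_beta)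
    show "(\<lambda>p. 1 / V x p) integrable_on cbox 0 1" if "x \<in> {e0<..}" for x
      using integrable_continuous_real[OF cont_inv] that by simp
  qed (use assms in auto)
  then show ?thesis using assms
    by (simp add: flowI_def flowD_def[abs_def] at_within_open[of e "{e0<..}"])
qed

lemma R_deriv: "e0 < e \<Longrightarrow> (R has_real_derivative 1 - I e) (at e)"
  unfolding flowR_def[abs_def] by (auto intro!: derivative_eq_intros D_deriv)

lemma D_pos: "e0 < e \<Longrightarrow> 0 < D e"
  unfolding flowD_def using V_pos[of e] by (intro int_cont_pos cont_inv) auto
lemma I_pos: "e0 < e \<Longrightarrow> 0 < I e"
  unfolding flowI_def using V_pos[of e] by (intro int_cont_pos cont_inv3) auto

lemma I_strict_antimono: assumes "e0 < e" "e < e'" shows "I e' < I e"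
proof -
  have e': "e0 < e'" using assms by simp
  have "0 < integral {0..1} (\<lambda>p. 1 / V e p ^ 3 - 1 / V e' p ^ 3)"
  proof (rule int_cont_pos)
    fix p :: real assume p: "p \<in> {0..1}"
    have "V e p ^ 3 < V e' p ^ 3"
      using V_strict_mono[OF assms p] V_pos[OF assms(1) p] by (intro power_strict_mono) auto
    then show "0 < 1 / V e p ^ 3 - 1 / V e' p ^ 3"
      using V_pos[OF assms(1) p] V_pos[OF e' p] by (simp add: frac_less2)
  qed (intro continuous_intros cont_inv3 assms e')
  also have "\<dots> = I e - I e'"
    unfolding flowI_def by (intro Henstock_Kurzweil_Integration.integral_diff integrable_continuous_real cont_inv3 assms e')
  finally show ?thesis by simp
qed

lemma D_strict_antimono: assumes "e0 < e" "e < e'" shows "D e' < D e"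
proof (rule DERIV_neg_imp_decreasing[OF assms(2)])
  fix x assume "e \<le> x" "x \<le> e'"
  then show "\<exists>y. (D has_real_derivative y) (at x) \<and> y < 0"
    using D_deriv[of x] I_pos[of x] assms by (intro exI[of _ "- I x"]) auto
qed

lemma D_le: assumes "e0 < e" shows "D e \<le> 1 / sqrt (2 * (e - e0))"
proof -
  have "D e \<le> integral {0..1} (\<lambda>_::real. 1 / sqrt (2 * (e - e0)))"
    unfolding flowD_def
  proof (intro integral_le integrable_continuous_real cont_inv assms)
    fix p :: real assume "p \<in> {0..1}"
    then show "1 / V e p \<le> 1 / sqrt (2 * (e - e0))"
      using V_ge[OF assms, of p] assms by (intro divide_left_mono mult_pos_pos V_pos) auto
  qed auto
  then show ?thesis by simp
qed

lemma I_cont: "continuous_on {e0<..} I"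
proof -
  have "continuous_on {e0<..} (\<lambda>e. integral (cbox 0 1) (\<lambda>p. 1 / V e p ^ 3))"
  proof (rule integral_continuous_on_param)
    show "continuous_on ({e0<..} \<times> cbox 0 1) (\<lambda>(x, t). 1 / V x t ^ 3)"
      using inv_V_cont3 by simp
  qed
  then show ?thesis by (simp add: flowI_def[abs_def])
qed

lemma D_cont: "continuous_on {e0<..} D"
  by (rule DERIV_continuous_on, rule has_field_derivative_at_within, rule D_deriv) simp

lemma R_cont: "continuous_on {e0<..} R"
  by (rule DERIV_continuous_on, rule has_field_derivative_at_within, rule R_deriv) simp

text \<open>Since \<open>\<omega>\<close> is bounded, \<open>\<Omega>\<close> falls at most linearly
  from its maximum. At energy \<open>e0 + d\<close> the speed is thus of order \<open>sqrt d\<close>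
  on an interval of length \<open>d\<close> near the maximizer, and the integral of its inverse cube
  is at least of order \<open>1 / sqrt d\<close>.\<close>

lemma I_large: "\<exists>e>e0. 1 < I e"
proof -
  obtain p0 where p0: "p0 \<in> {0..1}" "\<Omega> p0 = e0" by (rule Omega_argmax)
  obtain M where "\<forall>p\<in>{0..1}. \<bar>\<omega> p\<bar> \<le> M"
    using compact_imp_bounded[OF compact_continuous_image[OF omega_cont compact_Icc]]
    unfolding bounded_iff by auto
  then have M: "\<And>p. p \<in> {0..1} \<Longrightarrow> \<bar>\<omega> p\<bar> \<le> M" by blast
  have M0: "M \<ge> 0" using M[of 0] by auto
  define c where "c = 2 * (1 + M)"
  have c: "c \<ge> 2" using M0 by (simp add: c_def)
  \<comment> \<open>Then \<open>c * d = (1 / (2 * c))^2\<close>, so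
    \<open>V \<le> 1 / (2 * c)\<close> on the interval and the integral is at least
    \<open>d * (8 * c ^ 3) = 2\<close>.\<close>
  define d where "d = 1 / (4 * c ^ 3)"
  have c3: "c ^ 3 \<ge> 1" using c by (intro one_le_power) auto
  have d: "0 < d" "d \<le> 1 / 2"
  proof -
    show "0 < d" using c by (simp add: d_def)
    have "2 \<le> 4 * c ^ 3" using c3 by linarith
    then show "d \<le> 1 / 2" using c unfolding d_def by (intro divide_left_mono) auto
  qed
  have lip: "e0 - \<Omega> p \<le> M * \<bar>p - p0\<bar>" if "p \<in> {0..1}" for p
  proof -
    have "norm (\<Omega> p0 - \<Omega> p) \<le> M * norm (p0 - p)"
      using that p0 M by (intro field_differentiable_bound[of "{0..1}" \<Omega> \<omega>])
        (auto intro: Omega_derivative omega_cont)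
    then show ?thesis by (simp add: p0 abs_minus_commute)
  qed
  \<comment> \<open>An interval of length \<open>d\<close> with the maximizer as an endpoint, on the
    side where there is room.\<close>
  define a where "a = (if p0 \<le> 1/2 then p0 else p0 - d)"
  have a: "0 \<le> a" "a + d \<le> 1" "\<And>p. p \<in> {a..a+d} \<Longrightarrow> \<bar>p - p0\<bar> \<le> d"
    using p0 d by (auto simp: a_def abs_le_iff split: if_splits)
  define e where "e = e0 + d"
  have e: "e0 < e" using d by (simp add: e_def)
  have V: "1 / V e p ^ 3 \<ge> 8 * c ^ 3" if p: "p \<in> {a..a+d}" for p
  proof -
    have p01: "p \<in> {0..1}" using p a by auto
    have "2 * e - 2 * \<Omega> p \<le> 2 * d + 2 * (M * d)"
      using lip[OF p01] mult_left_mono[OF a(3)[OF p] M0] by (simp add: e_def)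
    also have "\<dots> = c * d" by (simp add: c_def algebra_simps)
    also have "\<dots> = (1 / (2 * c))\<^sup>2" using c by (simp add: d_def power2_eq_square power3_eq_cube)
    finally have "V e p \<le> 1 / (2 * c)"
      unfolding flowV_def using c by (intro real_le_lsqrt) auto
    then have "V e p ^ 3 \<le> (1 / (2 * c)) ^ 3" using V_pos[OF e p01] by (intro power_mono) auto
    then have "1 / (1 / (2 * c)) ^ 3 \<le> 1 / V e p ^ 3"
      using V_pos[OF e p01] c by (intro divide_left_mono) auto
    then show ?thesis using c by (simp add: power_divide power_mult_distrib)
  qed
  have "1 < d * (8 * c ^ 3)" using c by (simp add: d_def)
  also have "\<dots> = integral {a..a+d} (\<lambda>_. 8 * c ^ 3)" using d by simp
  also have "\<dots> \<le> integral {a..a+d} (\<lambda>p. 1 / V e p ^ 3)"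
    using V a by (intro integral_le integrable_continuous_real continuous_on_subset[OF cont_inv3[OF e]]) auto
  also have "\<dots> \<le> integral {0..1} (\<lambda>p. 1 / V e p ^ 3)"
    using a V_pos[OF e] by (intro integral_subset_le integrable_continuous_real continuous_on_subset[OF cont_inv3[OF e]])
      (auto intro!: divide_nonneg_nonneg zero_le_power less_imp_le)
  finally show ?thesis using e by (auto simp: flowI_def)
qed

lemma I_small: "I (e0 + 2) < 1"
proof -
  have "I (e0 + 2) \<le> integral {0..1} (\<lambda>_::real. 1 / 8)"
    unfolding flowI_def
  proof (intro integral_le integrable_continuous_real cont_inv3)
    fix p :: real assume p: "p \<in> {0..1}"
    have "2 \<le> V (e0 + 2) p" using V_ge[of "e0 + 2" p] p by simp
    then have "2 ^ 3 \<le> V (e0 + 2) p ^ 3" by (intro power_mono) auto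
    then show "1 / V (e0 + 2) p ^ 3 \<le> 1 / 8" using frac_le[of 1 1 8 "V (e0 + 2) p ^ 3"] by simp
  qed auto
  then show ?thesis by simp
qed

lemma ex1_crit: "\<exists>!e. e0 < e \<and> I e = 1"
proof -
  obtain e1 where e1: "e1 > e0" "1 < I e1" using I_large by auto
  have "e1 < e0 + 2"
  proof (rule ccontr)
    assume "\<not> e1 < e0 + 2"
    then have "I e1 \<le> I (e0 + 2)" using I_strict_antimono[of "e0 + 2" e1] by (cases "e1 = e0 + 2") auto
    then show False using I_small e1 by simp
  qed
  then have "\<exists>e\<ge>e1. e \<le> e0 + 2 \<and> I e = 1"
    using I_small e1 by (intro IVT2' continuous_on_subset[OF I_cont]) auto
  then obtain e where "e1 \<le> e" "I e = 1" by blast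
  then have e: "e0 < e" "I e = 1" using e1(1) by (auto intro: order.strict_trans2)
  show ?thesis
  proof (rule ex1I[of _ e])
    show "e0 < e \<and> I e = 1" using e by (rule conjI)
    fix e' assume "e0 < e' \<and> I e' = 1"
    then show "e' = e"
      using I_strict_antimono[of e e'] I_strict_antimono[of e' e] e
      by (cases e e' rule: linorder_cases) auto
  qed
qed

definition "ec = (THE e. e0 < e \<and> I e = 1)"

lemma ec: "e0 < ec" "I ec = 1"
  unfolding ec_def using conjunct1[OF theI'[OF ex1_crit]] conjunct2[OF theI'[OF ex1_crit]] .

lemma I_gt_1: "e0 < e \<Longrightarrow> e < ec \<Longrightarrow> 1 < I e"
  using I_strict_antimono[of e ec] ec by simp
lemma I_lt_1: "ec < e \<Longrightarrow> I e < 1"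
  using I_strict_antimono[of ec e] ec by simp

lemma R_decreasing: assumes "e0 < e" "e < e'" "e' \<le> ec" shows "R e' < R e"
proof (rule DERIV_neg_imp_decreasing_open[OF assms(2)])
  fix x assume x: "e < x" "x < e'"
  have x': "e0 < x" "x < ec" using less_trans[OF assms(1) x(1)] less_le_trans[OF x(2) assms(3)] by auto
  show "\<exists>y. (R has_real_derivative y) (at x) \<and> y < 0"
    by (intro exI conjI, rule R_deriv[OF x'(1)]) (simp add: I_gt_1[OF x'])
next
  have "{e..e'} \<subseteq> {e0<..}" using assms(1) by auto
  then show "continuous_on {e..e'} R"
    by (rule continuous_on_subset[OF R_cont])
qed

lemma R_increasing: assumes "ec \<le> e" "e < e'" shows "R e < R e'"
proof (rule DERIV_pos_imp_increasing_open[OF assms(2)])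
  fix x assume x: "e < x" "x < e'"
  have x': "ec < x" using le_less_trans[OF assms(1) x(1)] .
  show "\<exists>y. (R has_real_derivative y) (at x) \<and> y > 0"
    by (intro exI conjI, rule R_deriv[OF less_trans[OF ec(1) x']]) (simp add: I_lt_1[OF x'])
next
  have "{e..e'} \<subseteq> {e0<..}" using less_le_trans[OF ec(1) assms(1)] by auto
  then show "continuous_on {e..e'} R"
    by (rule continuous_on_subset[OF R_cont])
qed

section \<open>Critical and conjugate flows in terms of the energy\<close>

lemma Hp_eq: "Hp \<omega> s p = 1 / V (s\<^sup>2 / 2) p"
  by (simp add: Hp_def flowV_def)

lemma s0_eq: "s0 \<omega> = sqrt (2 * e0)"
proof -
  obtain p0 where p0: "p0 \<in> {0..1}" "\<Omega> p0 = e0" by (rule Omega_argmax)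
  have "Sup ((\<lambda>p. 2 * \<Omega> p) ` {0..1}) = 2 * e0"
  proof (rule cSup_eq_maximum)
    show "2 * e0 \<in> (\<lambda>p. 2 * \<Omega> p) ` {0..1}" using p0(1) unfolding p0(2)[symmetric] by (rule imageI)
    show "x \<le> 2 * e0" if "x \<in> (\<lambda>p. 2 * \<Omega> p) ` {0..1}" for x
      using that Omega_le by fastforce
  qed
  then show ?thesis by (simp add: s0_def)
qed

lemma s0_less_iff: assumes "0 \<le> s" shows "s0 \<omega> < s \<longleftrightarrow> e0 < s\<^sup>2 / 2"
proof -
  have "s0 \<omega> < s \<longleftrightarrow> sqrt (2 * e0) < sqrt (s\<^sup>2)" using assms by (simp add: s0_eq)
  then show ?thesis by (simp add: mult.commute del: real_sqrt_abs real_sqrt_pow2_iff)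
qed

lemma s0_nonneg: "0 \<le> s0 \<omega>" by (simp add: s0_eq e0_nonneg)

lemma depth_eq: "depth \<omega> s = D (s\<^sup>2 / 2)"
  by (simp add: depth_def H_def flowD_def Hp_eq[abs_def])

lemma Rfun_eq: "Rfun \<omega> s = R (s\<^sup>2 / 2)"
  by (simp add: Rfun_def flowR_def depth_eq)

lemma s_crit_eq: "s_crit \<omega> = sqrt (2 * ec)"
  unfolding s_crit_def
proof (rule the_equality)
  have I_powr: "integral {0..1} (\<lambda>p. (s\<^sup>2 - 2 * \<Omega> p) powr (-3/2)) = I (s\<^sup>2 / 2)" if "s0 \<omega> < s" for s
    unfolding flowI_def
  proof (rule integral_cong)
    fix p :: real assume p: "p \<in> {0..1}"
    have "e0 < s\<^sup>2 / 2" using that s0_nonneg s0_less_iff[of s] by simp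
    from arg_pos[OF this p] have pos: "0 < s\<^sup>2 - 2 * \<Omega> p" by simp
    have "V (s\<^sup>2 / 2) p ^ 3 = ((s\<^sup>2 - 2 * \<Omega> p) powr (1/2)) powr 3"
      using pos by (simp add: flowV_def powr_half_sqrt powr_numeral)
    also have "\<dots> = (s\<^sup>2 - 2 * \<Omega> p) powr (3/2)" by (simp add: powr_powr)
    finally show "(s\<^sup>2 - 2 * \<Omega> p) powr (-3/2) = 1 / V (s\<^sup>2 / 2) p ^ 3"
      using powr_minus_divide[of "s\<^sup>2 - 2 * \<Omega> p" "3/2"] by simp
  qed
  have "s0 \<omega> < sqrt (2 * ec)" using ec by (simp add: s0_eq)
  moreover have "(sqrt (2 * ec))\<^sup>2 / 2 = ec" using ec e0_nonneg by simp
  ultimately show "s0 \<omega> < sqrt (2 * ec) \<and> integral {0..1} (\<lambda>p. ((sqrt (2 * ec))\<^sup>2 - 2 * \<Omega> p) powr (-3/2)) = 1"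
    using I_powr[of "sqrt (2 * ec)"] ec by simp
  fix s assume s: "s0 \<omega> < s \<and> integral {0..1} (\<lambda>p. (s\<^sup>2 - 2 * \<Omega> p) powr (-3/2)) = 1"
  then have s0: "0 \<le> s" using s0_nonneg by linarith
  then have "e0 < s\<^sup>2 / 2" "I (s\<^sup>2 / 2) = 1" using s I_powr[of s] s0_less_iff[OF s0] by auto
  then have "s\<^sup>2 / 2 = ec" using ex1_crit ec by blast
  then have "2 * ec = s\<^sup>2" by simp
  then show "s = sqrt (2 * ec)" using s0 by simp
qed

text \<open>\<open>R\<close> decreases up to the critical energy, so its limit at the left end is
  its supremum there. The upper bound on \<open>r\<close> then yields an explicit energy with a
  larger value of \<open>R\<close>.\<close>

lemma R_zero_SUP: "R_zero \<omega> = (SUP e\<in>{e0<..<ec}. ereal (R e))"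
proof -
  let ?L = "SUP e\<in>{e0<..<ec}. ereal (R e)"
  have "((\<lambda>s. ereal (Rfun \<omega> s)) \<longlongrightarrow> ?L) (at_right (s0 \<omega>))"
  proof (rule order_tendstoI)
    fix a assume "a < ?L"
    then obtain e1 where e1: "e1 \<in> {e0<..<ec}" "a < ereal (R e1)" by (auto simp: less_SUP_iff)
    have "s0 \<omega> < sqrt (2 * e1)" using e1 by (simp add: s0_eq)
    moreover have "a < ereal (Rfun \<omega> s)" if s: "s0 \<omega> < s" "s < sqrt (2 * e1)" for s
    proof -
      have s0: "0 \<le> s" using s s0_nonneg by linarith
      have "s\<^sup>2 < (sqrt (2 * e1))\<^sup>2" using s s0 by (intro power_strict_mono) auto
      then have "s\<^sup>2 / 2 < e1" using e1 e0_nonneg by simp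
      then have "R e1 < R (s\<^sup>2 / 2)" using e1 s0_less_iff[OF s0] s by (intro R_decreasing) auto
      then show ?thesis using e1(2) by (simp add: Rfun_eq less_trans)
    qed
    ultimately show "\<forall>\<^sub>F s in at_right (s0 \<omega>). a < ereal (Rfun \<omega> s)"
      unfolding eventually_at_right_field by blast
  next
    fix a assume a: "?L < a"
    have "s0 \<omega> < sqrt (2 * ec)" using ec by (simp add: s0_eq)
    moreover have "ereal (Rfun \<omega> s) < a" if s: "s0 \<omega> < s" "s < sqrt (2 * ec)" for s
    proof -
      have s0: "0 \<le> s" using s s0_nonneg by linarith
      have "s\<^sup>2 < (sqrt (2 * ec))\<^sup>2" using s s0 by (intro power_strict_mono) auto
      then have "s\<^sup>2 / 2 \<in> {e0<..<ec}" using ec e0_nonneg s0_less_iff[OF s0] s by simp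
      then have "ereal (R (s\<^sup>2 / 2)) \<le> ?L" by (rule SUP_upper)
      then show ?thesis using a by (simp add: Rfun_eq)
    qed
    ultimately show "\<forall>\<^sub>F s in at_right (s0 \<omega>). ereal (Rfun \<omega> s) < a"
      unfolding eventually_at_right_field by blast
  qed
  then show ?thesis unfolding R_zero_def by (intro tendsto_Lim) auto
qed

lemma conjugate_flows:
  assumes r: "R_crit \<omega> < r" "ereal r < R_zero \<omega>"
  obtains em ep where "e0 < em" "em < ec" "ec < ep" "R em = r" "R ep = r"
    "s_minus \<omega> r = sqrt (2 * em)" "s_plus \<omega> r = sqrt (2 * ep)"
proof -
  have Rc: "R ec < r" using r(1) ec e0_nonneg by (simp add: R_crit_def s_crit_eq Rfun_eq)
  obtain e1 where e1: "e0 < e1" "e1 < ec" "r < R e1"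
    using r(2) unfolding R_zero_SUP less_SUP_iff by auto
  have "\<exists>e\<ge>e1. e \<le> ec \<and> R e = r"
    using Rc e1 by (intro IVT2' continuous_on_subset[OF R_cont]) auto
  then obtain em where "e1 \<le> em" "em \<le> ec" "R em = r" by blast
  then have em: "e0 < em" "em < ec" "R em = r" using e1 Rc by (auto simp: less_le)
  \<comment> \<open>Here \<open>R e2 \<ge> r\<close> merely because depths are positive.\<close>
  define e2 where "e2 = max ec (r + \<Omega> 1)"
  have "R e2 \<ge> r" 
  proof -
    have "e0 < e2" using ec(1) by (simp add: e2_def)
    from D_pos[OF this] have "0 < D e2" .
    moreover have "r + \<Omega> 1 \<le> e2" by (simp add: e2_def)
    ultimately show ?thesis by (simp add: flowR_def)
  qed
  then have "\<exists>e\<ge>ec. e \<le> e2 \<and> R e = r"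
    using Rc ec by (intro IVT' continuous_on_subset[OF R_cont]) (auto simp: e2_def)
  then obtain ep where "ec \<le> ep" "R ep = r" by blast
  then have ep: "ec < ep" "R ep = r" using Rc by (auto simp: less_le)
  have sq: "(sqrt (2 * em))\<^sup>2 / 2 = em" "(sqrt (2 * ep))\<^sup>2 / 2 = ep" using em ep ec e0_nonneg by auto
  have sm: "s_minus \<omega> r = sqrt (2 * em)"
    unfolding s_minus_def
  proof (rule the_equality)
    show "s0 \<omega> < sqrt (2 * em) \<and> sqrt (2 * em) < s_crit \<omega> \<and> Rfun \<omega> (sqrt (2 * em)) = r"
      using em sq by (simp add: s_crit_eq s0_eq Rfun_eq)
    fix s assume s: "s0 \<omega> < s \<and> s < s_crit \<omega> \<and> Rfun \<omega> s = r"
    then have s0: "0 \<le> s" using s0_nonneg by linarith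
    have "s\<^sup>2 < (sqrt (2 * ec))\<^sup>2" using s s0 by (intro power_strict_mono) (auto simp: s_crit_eq)
    then have s2: "s\<^sup>2 / 2 < ec" "e0 < s\<^sup>2 / 2" "R (s\<^sup>2 / 2) = r"
      using ec e0_nonneg s0_less_iff[OF s0] s by (auto simp: Rfun_eq)
    have "s\<^sup>2 / 2 = em"
      using R_decreasing[of "s\<^sup>2 / 2" em] R_decreasing[of em "s\<^sup>2 / 2"] s2 em
      by (cases "s\<^sup>2 / 2" em rule: linorder_cases) auto
    then have "2 * em = s\<^sup>2" by simp
    then show "s = sqrt (2 * em)" using s0 by simp
  qed
  have sp: "s_plus \<omega> r = sqrt (2 * ep)"
    unfolding s_plus_def
  proof (rule the_equality)
    show "s_crit \<omega> < sqrt (2 * ep) \<and> Rfun \<omega> (sqrt (2 * ep)) = r"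
      using ep sq by (simp add: s_crit_eq Rfun_eq)
    fix s assume s: "s_crit \<omega> < s \<and> Rfun \<omega> s = r"
    have sc: "0 \<le> s_crit \<omega>" using ec e0_nonneg by (simp add: s_crit_eq)
    then have s0: "0 \<le> s" using s by linarith
    have "(sqrt (2 * ec))\<^sup>2 < s\<^sup>2" using s sc by (intro power_strict_mono) (auto simp: s_crit_eq)
    then have s2: "ec < s\<^sup>2 / 2" "R (s\<^sup>2 / 2) = r"
      using ec e0_nonneg s by (auto simp: Rfun_eq)
    have "s\<^sup>2 / 2 = ep"
      using R_increasing[of "s\<^sup>2 / 2" ep] R_increasing[of ep "s\<^sup>2 / 2"] s2 ep
      by (cases "s\<^sup>2 / 2" ep rule: linorder_cases) auto
    then have "2 * ep = s\<^sup>2" by simp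
    then show "s = sqrt (2 * ep)" using s0 by simp
  qed
  show ?thesis using that em ep sm sp by blast
qed

end

section \<open>Laminar profiles and their flow force\<close>

definition flowH :: "(real \<Rightarrow> real) \<Rightarrow> real \<Rightarrow> real \<Rightarrow> real" where
  "flowH \<omega> e p = integral {0..p} (\<lambda>p. 1 / flowV \<omega> e p)"

text \<open>The maximum of \<open>flowS \<omega> r e\<close> over surface heights, attained at
  \<open>Omega \<omega> 1 + r - e\<close>.\<close>

definition flowG :: "(real \<Rightarrow> real) \<Rightarrow> real \<Rightarrow> real \<Rightarrow> real" where
  "flowG \<omega> r e = flowW \<omega> e + (Omega \<omega> 1 + r - e)\<^sup>2 / 2"

context vorticity
begin

abbreviation "Hf \<equiv> flowH \<omega>"
abbreviation "S \<equiv> flowS \<omega>"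
abbreviation "G \<equiv> flowG \<omega>"

lemma H_deriv: assumes "e0 < e" "p \<in> {0..1}"
  shows "(Hf e has_real_derivative 1 / V e p) (at p within {0..1})"
  using integral_has_real_derivative[OF cont_inv[OF assms(1)] assms(2)]
  by (simp add: flowH_def[abs_def])

lemma H_0 [simp]: "Hf e 0 = 0" by (simp add: flowH_def)
lemma H_1: "Hf e 1 = D e" by (simp add: flowH_def flowD_def)

lemma H_cont: "e0 < e \<Longrightarrow> continuous_on {0..1} (Hf e)"
  by (rule DERIV_continuous_on, rule H_deriv)

lemma H_strict_mono: assumes "e0 < e" "0 \<le> p" "p < q" "q \<le> 1" shows "Hf e p < Hf e q"
proof (rule DERIV_pos_imp_increasing_open[OF assms(3)])
  fix x assume x: "p < x" "x < q"
  then have "0 < x" "x < 1" using assms by linarith+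
  then show "\<exists>y. (Hf e has_real_derivative y) (at x) \<and> y > 0"
    by (intro exI[of _ "1 / V e x"] conjI has_real_derivative_interior H_deriv[OF assms(1)])
      (use V_pos[OF assms(1), of x] in auto)
next
  have "{p..q} \<subseteq> {0..1}" using assms by auto
  then show "continuous_on {p..q} (Hf e)" by (rule continuous_on_subset[OF H_cont[OF assms(1)]])
qed

lemma H_eq: "H \<omega> s p = Hf (s\<^sup>2 / 2) p"
  by (simp add: H_def flowH_def Hp_eq[abs_def])

lemma U_eq:
  assumes "e0 < s\<^sup>2 / 2" "p \<in> {0..1}"
  shows "U \<omega> s (Hf (s\<^sup>2 / 2) p) = p"
  unfolding U_def H_eq
proof (rule the_equality)
  fix q assume "q \<in> {0..1} \<and> Hf (s\<^sup>2 / 2) q = Hf (s\<^sup>2 / 2) p"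
  then show "q = p"
    using H_strict_mono[OF assms(1), of p q] H_strict_mono[OF assms(1), of q p] assms(2)
    by (cases p q rule: linorder_cases) auto
qed (use assms in simp)

lemma flowS_eq_G: "S r e y = G r e - (y - (\<Omega> 1 + r - e))\<^sup>2 / 2"
  by (simp add: flowS_def flowG_def power2_eq_square field_simps)

text \<open>As \<open>V^2 / 2 = e - \<Omega>\<close>, the integrand splits into \<open>V\<close>, a
  constant multiple of \<open>1 / V\<close>, and a product of \<open>Hf\<close> with its own
  derivative.\<close>

lemma sigma_eq:
  assumes "e0 < s\<^sup>2 / 2"
  shows "sigma \<omega> s r = S r (s\<^sup>2 / 2) (D (s\<^sup>2 / 2))"
proof -
  define e where "e = s\<^sup>2 / 2"
  have e: "e0 < e" using assms by (simp add: e_def)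
  have "((\<lambda>p. Hf e p * (1 / V e p)) has_integral ((Hf e 1)\<^sup>2 / 2 - (Hf e 0)\<^sup>2 / 2)) {0..1}"
  proof (rule fundamental_theorem_of_calculus)
    fix p :: real assume "p \<in> {0..1}"
    then have "((\<lambda>p. (Hf e p)\<^sup>2 / 2) has_real_derivative Hf e p * (1 / V e p)) (at p within {0..1})"
      by (auto intro!: derivative_eq_intros H_deriv[OF e])
    then show "((\<lambda>p. (Hf e p)\<^sup>2 / 2) has_vector_derivative Hf e p * (1 / V e p)) (at p within {0..1})"
      by (simp add: has_real_derivative_iff_has_vector_derivative)
  qed simp
  then have 1: "((\<lambda>p. Hf e p * (1 / V e p)) has_integral ((D e)\<^sup>2 / 2)) {0..1}" by (simp add: H_1)
  have 2: "(V e has_integral W e) {0..1}" "((\<lambda>p. 1 / V e p) has_integral D e) {0..1}"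
    unfolding flowW_def flowD_def
    by (intro integrable_integral integrable_continuous_real V_cont1 cont_inv[OF e])+
  have "((\<lambda>p. V e p + (\<Omega> 1 + r - e) * (1 / V e p) - Hf e p * (1 / V e p)) has_integral
     (W e + (\<Omega> 1 + r - e) * D e - (D e)\<^sup>2 / 2)) {0..1}"
    by (intro has_integral_add has_integral_diff has_integral_mult_right 1 2)
  then have "((\<lambda>p. (1 / (2 * (Hp \<omega> s p)\<^sup>2) - H \<omega> s p - \<Omega> p + \<Omega> 1 + r) * Hp \<omega> s p) has_integral
     (W e + (\<Omega> 1 + r - e) * D e - (D e)\<^sup>2 / 2)) {0..1}"
  proof (rule has_integral_eq[rotated])
    fix p :: real assume p: "p \<in> {0..1}"
    have Hs: "Hp \<omega> s p = 1 / V e p" "H \<omega> s p = Hf e p"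
      by (simp_all only: Hp_eq H_eq e_def)
    have "\<Omega> p = e - (V e p)\<^sup>2 / 2" using V_sq[OF e p] by argo
    then show "V e p + (\<Omega> 1 + r - e) * (1 / V e p) - Hf e p * (1 / V e p)
      = (1 / (2 * (Hp \<omega> s p)\<^sup>2) - H \<omega> s p - \<Omega> p + \<Omega> 1 + r) * Hp \<omega> s p"
      using V_pos[OF e p] unfolding Hs \<open>\<Omega> p = _\<close> by (simp add: power2_eq_square field_simps)
  qed
  then show ?thesis unfolding sigma_def e_def[symmetric]
    by (simp add: integral_unique flowS_def algebra_simps)
qed

text \<open>The sign of \<open>R e - r\<close> makes \<open>G\<close> strictly decreasing between
  the conjugate energies, which orders the flow forces later.\<close>

lemma G_deriv: assumes "e0 < e" shows "(G r has_real_derivative R e - r) (at e)"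
  unfolding flowG_def[abs_def]
  by (auto intro!: derivative_eq_intros W_deriv[OF assms] simp: flowR_def)

end

text \<open>Depth decreases with energy, so \<open>em\<close>, which comes from
  \<open>s_minus\<close>, is the deep subcritical flow and \<open>ep\<close> the shallow
  supercritical one; the indices of \<open>d_plus\<close> and \<open>F_plus\<close> run the other
  way.\<close>

locale conjugate_pair = vorticity +
  fixes r em ep :: real
  assumes em: "e0 < em" "em < ec" "R em = r" and ep: "ec < ep" "R ep = r"
begin

section \<open>Ordering of laminar flow forces\<close>

lemma em_less_ep: "em < ep" using em ep by linarith
lemma e0_ep: "e0 < ep" using em ep by linarith

lemma R_gt: assumes "e0 < e" "e < em \<or> ep < e" shows "r < R e"
  using R_decreasing[OF assms(1), of em] R_increasing[of ep e] assms(2) em ep by auto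

lemma R_lt: assumes "em < e" "e < ep" shows "R e < r"
proof (cases "e \<le> ec")
  case True then show ?thesis using R_decreasing[OF em(1) assms(1) True] em by simp
next
  case False then show ?thesis using R_increasing[of e ep] assms ep by simp
qed

lemma R_le: assumes "em \<le> e" "e \<le> ep" shows "R e \<le> r"
  using R_lt[of e] assms em(3) ep(2) by (cases "e = em"; cases "e = ep") auto

lemma R_le_imp: assumes "e0 < e" "R e \<le> r" shows "em \<le> e" "e \<le> ep"
  using R_gt[OF assms(1)] assms(2) by (auto simp: not_less[symmetric])

lemma R_eq_imp: assumes "e0 < e" "R e = r" shows "e = em \<or> e = ep"
  using R_le_imp[OF assms(1)] R_lt[of e] assms(2) by force

lemma D_ep_less: "D ep < D em" by (rule D_strict_antimono[OF em(1) em_less_ep])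

lemma depth_from_R: "R e = r \<Longrightarrow> \<Omega> 1 + r - e = D e"
  by (simp add: flowR_def)

lemma S_eq_G: "R e = r \<Longrightarrow> S r e (D e) = G r e"
  by (simp add: flowS_eq_G depth_from_R)

lemma G_strict: assumes "em \<le> e" "e < e'" "e' \<le> ep" shows "G r e' < G r e"
proof (rule DERIV_neg_imp_decreasing_open[OF assms(2)])
  fix x assume x: "e < x" "x < e'"
  have x': "em < x" "x < ep" using le_less_trans[OF assms(1) x(1)] less_le_trans[OF x(2) assms(3)] by auto
  show "\<exists>y. (G r has_real_derivative y) (at x) \<and> y < 0"
    by (intro exI conjI, rule G_deriv[OF less_trans[OF em(1) x'(1)]]) (simp add: R_lt[OF x'])
next
  have "isCont (G r) x" if "x \<in> {e..e'}" for x
  proof -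
    have "em \<le> x" using that assms(1) by auto
    then have "e0 < x" using em(1) by (rule order.strict_trans2[rotated])
    then show ?thesis by (rule DERIV_isCont[OF G_deriv])
  qed
  then show "continuous_on {e..e'} (G r)" by (simp add: continuous_at_imp_continuous_on)
qed

lemma F_minus_less_F_plus: "S r ep (D ep) < S r em (D em)"
  using G_strict[of em ep] em_less_ep by (simp add: S_eq_G em ep)

lemma flow_S_deriv: assumes "e0 < e" shows "((\<lambda>e. S r e (D e)) has_real_derivative I e * (R e - r)) (at e)"
  unfolding flowS_def
  by (auto intro!: derivative_eq_intros W_deriv[OF assms] D_deriv[OF assms] simp: flowR_def algebra_simps)

text \<open>Along the curve of laminar flows the derivative is \<open>I e * (R e - r)\<close>: the
  flow force rises up to \<open>em\<close> and falls from there to \<open>ep\<close>.\<close>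

lemma flow_S_le: assumes "e0 < e" "e \<le> ep" shows "S r e (D e) \<le> S r em (D em)"
proof (cases "e \<le> em")
  case True
  show ?thesis
  proof (rule DERIV_nonneg_imp_nondecreasing[OF True])
    fix x assume x: "e \<le> x" "x \<le> em"
    have x0: "e0 < x" using assms(1) x(1) by (rule less_le_trans)
    have "r \<le> R x" using R_gt[OF x0] x em by (cases "x = em") auto
    then have "0 \<le> I x * (R x - r)" using I_pos[OF x0] by simp
    then show "\<exists>y. ((\<lambda>e. S r e (D e)) has_real_derivative y) (at x) \<and> 0 \<le> y"
      using flow_S_deriv[OF x0] by blast
  qed
next
  case False
  then have le: "em \<le> e" by simp
  show ?thesis
  proof (rule DERIV_nonpos_imp_nonincreasing[OF le])
    fix x assume x: "em \<le> x" "x \<le> e"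
    have x0: "e0 < x" using em(1) x(1) by (rule less_le_trans)
    have "R x \<le> r" using R_le[of x] x assms(2) by auto
    then have "I x * (R x - r) \<le> 0" using I_pos[OF x0] by (simp add: mult_nonneg_nonpos)
    then show "\<exists>y. ((\<lambda>e. S r e (D e)) has_real_derivative y) (at x) \<and> y \<le> 0"
      using flow_S_deriv[OF x0] by blast
  qed
qed

lemma S_deriv_e: assumes "e0 < e" shows "((\<lambda>e. S r e y) has_real_derivative D e - y) (at e)"
  unfolding flowS_def
  by (auto intro!: derivative_eq_intros W_deriv[OF assms])

text \<open>At fixed height \<open>y\<close> the derivative in \<open>e\<close> is
  \<open>D e - y\<close>, so \<open>S r e y\<close> rises until the laminar depth has dropped to
  \<open>y\<close> and falls afterwards.\<close>

lemma S_mono_e: assumes "e0 < e" "e \<le> e'" "y \<le> D e'" shows "S r e y \<le> S r e' y"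
proof (rule DERIV_nonneg_imp_nondecreasing[OF assms(2)])
  fix x assume x: "e \<le> x" "x \<le> e'"
  have x0: "e0 < x" using assms(1) x(1) by (rule less_le_trans)
  have "D e' \<le> D x" using D_strict_antimono[OF x0, of e'] x(2) by (cases "x = e'") auto
  then show "\<exists>y'. ((\<lambda>e. S r e y) has_real_derivative y') (at x) \<and> 0 \<le> y'"
    using S_deriv_e[OF x0, of y] assms(3) by (intro exI conjI) auto
qed

lemma S_antimono_e: assumes "e0 < e" "e \<le> e'" "D e \<le> y" shows "S r e' y \<le> S r e y"
proof (rule DERIV_nonpos_imp_nonincreasing[OF assms(2)])
  fix x assume x: "e \<le> x" "x \<le> e'"
  have x0: "e0 < x" using assms(1) x(1) by (rule less_le_trans)
  have "D x \<le> D e" using D_strict_antimono[OF assms(1), of x] x(1) by (cases "x = e") auto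
  then show "\<exists>y'. ((\<lambda>e. S r e y) has_real_derivative y') (at x) \<and> y' \<le> 0"
    using S_deriv_e[OF x0, of y] assms(3) by (intro exI conjI) auto
qed

text \<open>For fixed \<open>y\<close> the worst \<open>e\<close> is the laminar flow of depth
  \<open>y\<close>, and \<open>D ep \<le> y\<close> places it at or before \<open>ep\<close>, where
  \<open>flow_S_le\<close> applies. If depths stay bounded as \<open>e\<close> tends to
  \<open>e0\<close>, a high \<open>y\<close> may be no depth at all; it is then lowered to one by
  means of the parabola in \<open>y\<close>.\<close>

lemma S_le_F_plus: assumes e: "e0 < e" and y: "D ep \<le> y" shows "S r e y \<le> S r em (D em)"
proof (cases "\<exists>e1>e0. y \<le> D e1")
  case True
  then obtain e1 where e1: "e0 < e1" "y \<le> D e1" by blast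
  have "\<exists>e'>e0. D e' = y \<and> e' \<le> ep"
  proof (cases "e1 \<le> ep")
    case True
    have "{e1..ep} \<subseteq> {e0<..}" using e1(1) by auto
    then have "continuous_on {e1..ep} D" by (rule continuous_on_subset[OF D_cont])
    then have "\<exists>x\<ge>e1. x \<le> ep \<and> D x = y" using e1 y True by (intro IVT2') auto
    then show ?thesis using e1(1) by (auto intro: less_le_trans)
  next
    case False
    then have "D e1 < D ep" by (intro D_strict_antimono e0_ep) auto
    then show ?thesis using e1(2) y by linarith
  qed
  then obtain e' where e': "e0 < e'" "D e' = y" "e' \<le> ep" by blast
  have "S r e y \<le> S r e' y"
  proof (cases "e \<le> e'")
    case True then show ?thesis using S_mono_e[OF e True] e'(2) by simp
  next
    case False then show ?thesis using S_antimono_e[OF e'(1), of e] e'(2) by simp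
  qed
  also have "\<dots> \<le> S r em (D em)" using flow_S_le[OF e'(1,3)] e'(2) by simp
  finally show ?thesis .
next
  case False
  \<comment> \<open>Being at most \<open>em\<close>, it satisfies \<open>R e2 \<ge> r\<close>, which
    puts the vertex of the parabola in \<open>y\<close> at or below the depth
    \<open>D e2\<close>.\<close>
  define e2 where "e2 = min e em"
  have e2: "e0 < e2" "e2 \<le> e" "e2 \<le> em" using e em by (auto simp: e2_def)
  have yD: "D e2 \<le> y" using False e2(1) by (meson linear)
  have "S r e y \<le> S r e2 y" by (rule S_antimono_e[OF e2(1,2) yD])
  also have "\<dots> \<le> S r e2 (D e2)"
  proof -
    have "r \<le> R e2" using R_gt[OF e2(1)] e2(3) em by (cases "e2 = em") auto
    then have "\<Omega> 1 + r - e2 \<le> D e2" by (simp add: flowR_def)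
    then have "(y - D e2) * (\<Omega> 1 + r - e2 - (y + D e2) / 2) \<le> 0" using yD by (intro mult_nonneg_nonpos) auto
    then show ?thesis by (simp add: flowS_def power2_eq_square field_simps)
  qed
  also have "\<dots> \<le> S r em (D em)" using flow_S_le[OF e2(1)] e2(3) em_less_ep by simp
  finally show ?thesis .
qed

end

section \<open>Waves in hodograph variables\<close>

lemma has_derivative_of_partials:
  fixes f fx fy :: "real \<times> real \<Rightarrow> real"
  assumes S: "open S" "z \<in> S"
    and fx: "\<And>x y. (x, y) \<in> S \<Longrightarrow> ((\<lambda>t. f (t, y)) has_real_derivative fx (x, y)) (at x)"
    and fy: "\<And>x y. (x, y) \<in> S \<Longrightarrow> ((\<lambda>t. f (x, t)) has_real_derivative fy (x, y)) (at y)"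
    and cont: "continuous_on S fy"
  shows "(f has_derivative (\<lambda>v. fx z * fst v + fy z * snd v)) (at z)"
proof -
  obtain x y where z: "z = (x, y)" by (cases z)
  obtain A B where AB: "open A" "open B" "z \<in> A \<times> B" "A \<times> B \<subseteq> S"
    using open_prod_elim[OF S] by blast
  then obtain e where e: "e > 0" "ball y e \<subseteq> B" using openE[OF AB(2), of y] z by auto
  let ?X = A and ?Y = "ball y e"
  have sub: "?X \<times> ?Y \<subseteq> S" using AB e by blast
  have op: "open (?X \<times> ?Y)" using AB by (intro open_Times) auto
  have zXY: "x \<in> ?X" "y \<in> ?Y" using AB z e by auto
  have xy: "(x, y) \<in> S" using S z by simp
  have "((\<lambda>(x, y). f (x, y)) has_derivative (\<lambda>(tx, ty). fx z * tx + blinfun_apply (blinfun_mult_right (fy (x, y))) ty)) (at (x, y) within ?X \<times> ?Y)"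
  proof (rule has_derivative_partialsI)
    show "((\<lambda>x. f (x, y)) has_derivative (*) (fx z)) (at x within ?X)"
      using fx[OF xy] z by (auto simp: has_field_derivative_def intro: has_derivative_at_withinI)
    show "((\<lambda>b. f (a, b)) has_derivative blinfun_apply (blinfun_mult_right (fy (a, b)))) (at b within ?Y)"
      if "a \<in> ?X" "b \<in> ?Y" for a b
    proof -
      have "(a, b) \<in> S" using sub that by blast
      from fy[OF this] show ?thesis
        by (auto simp: has_field_derivative_def intro: has_derivative_at_withinI)
    qed
    have c: "continuous_on (?X \<times> ?Y) (\<lambda>(a, b). blinfun_mult_right (fy (a, b)))"
      unfolding case_prod_beta prod.collapse
      by (intro bounded_linear.continuous_on[OF bounded_linear_blinfun_mult_right] continuous_on_subset[OF cont] sub)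
    show "continuous (at (x, y) within ?X \<times> ?Y) (\<lambda>(a, b). blinfun_mult_right (fy (a, b)))"
      using c zXY unfolding continuous_on_eq_continuous_within by blast
    show "y \<in> ?Y" "convex ?Y" using e by auto
  qed
  then show ?thesis
    using op zXY by (simp add: z at_within_open[of _ "?X \<times> ?Y"] case_prod_beta')
qed

lemma has_derivative_partials:
  fixes f :: "real \<times> real \<Rightarrow> real"
  assumes "(f has_derivative (\<lambda>v. a * fst v + b * snd v)) (at (x, y))"
  shows "((\<lambda>t. f (t, y)) has_real_derivative a) (at x)" "((\<lambda>t. f (x, t)) has_real_derivative b) (at y)"
proof -
  have "((\<lambda>t. (t, y)) has_derivative (\<lambda>s. (s, 0))) (at x)" "((\<lambda>t. (x, t)) has_derivative (\<lambda>s. (0, s))) (at y)"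
    by (auto intro!: derivative_eq_intros)
  note d = has_derivative_compose[OF this(1) assms] has_derivative_compose[OF this(2) assms]
  show "((\<lambda>t. f (t, y)) has_real_derivative a) (at x)"
    unfolding has_field_derivative_def by (rule has_derivative_eq_rhs[OF d(1)]) auto
  show "((\<lambda>t. f (x, t)) has_real_derivative b) (at y)"
    unfolding has_field_derivative_def by (rule has_derivative_eq_rhs[OF d(2)]) auto
qed

text \<open>The fundamental theorem writes \<open>f\<close> as an integral of \<open>g\<close> up to
  the ends, where the integral of a continuous function has one-sided derivatives.\<close>

lemma derivative_within_of_interior:
  fixes f g :: "real \<Rightarrow> real"
  assumes ab: "a < b"
    and der: "\<And>t. a < t \<Longrightarrow> t < b \<Longrightarrow> (f has_real_derivative g t) (at t)"
    and cont: "continuous_on {a..b} f" "continuous_on {a..b} g"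
    and x: "x \<in> {a..b}"
  shows "(f has_real_derivative g x) (at x within {a..b})"
proof -
  have eq: "f u = f a + integral {a..u} g" if u: "u \<in> {a..b}" for u
  proof -
    have "(g has_integral (f u - f a)) {a..u}"
      using u der by (intro fundamental_theorem_of_calculus_interior continuous_on_subset[OF cont(1)])
        (auto simp: has_real_derivative_iff_has_vector_derivative[symmetric])
    then show ?thesis by (simp add: integral_unique)
  qed
  have "((\<lambda>u. f a + integral {a..u} g) has_real_derivative g x) (at x within {a..b})"
    by (rule DERIV_cong[OF DERIV_add[OF DERIV_const integral_has_real_derivative[OF cont(2) x]]]) simp
  then show ?thesis
    by (rule has_field_derivative_transform_within[OF _ zero_less_one x]) (rule eq[symmetric])
qed

text \<open>On the boundary lines no derivative is given. The integrated identity holds for interior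
  \<open>p\<close>, passes to \<open>p = 0\<close> and \<open>p = 1\<close> by continuity, and is
  then differentiated back.\<close>

lemma strip_deriv_q:
  fixes f g :: "real \<times> real \<Rightarrow> real"
  assumes der: "\<And>q p. 0 < p \<Longrightarrow> p < 1 \<Longrightarrow> ((\<lambda>q. f (q, p)) has_real_derivative g (q, p)) (at q)"
    and cont: "continuous_on (UNIV \<times> {0..1}) f" "continuous_on (UNIV \<times> {0..1}) g"
    and p: "p \<in> {0..1}"
  shows "((\<lambda>q. f (q, p)) has_real_derivative g (q, p)) (at q)"
proof -
  have sec: "continuous_on X (\<lambda>t. k (t, p))" if "continuous_on (UNIV \<times> {0..1}) k" "p \<in> {0..1}" for X and k :: "real \<times> real \<Rightarrow> real" and p
    by (rule continuous_on_compose2[OF that(1)]) (use that(2) in \<open>auto intro!: continuous_intros\<close>)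
  have eq: "f (u, p) = f (q - 1, p) + integral {q - 1..u} (\<lambda>t. g (t, p))" if u: "u \<in> {q - 1..q + 1}" for u
  proof -
    let ?F = "\<lambda>p. f (u, p) - (f (q - 1, p) + integral (cbox (q - 1) u) (\<lambda>t. g (t, p)))"
    have c: "continuous_on {0..1} ?F"
    proof (intro continuous_intros)
      show "continuous_on {0..1} (\<lambda>p. f (u, p))" "continuous_on {0..1} (\<lambda>p. f (q - 1, p))"
        by (auto intro!: continuous_on_compose2[OF cont(1)] continuous_intros)
      show "continuous_on {0..1} (\<lambda>p. integral (cbox (q - 1) u) (\<lambda>t. g (t, p)))"
        by (rule integral_continuous_on_param)
          (auto simp: case_prod_beta intro!: continuous_on_compose2[OF cont(2)] continuous_intros)
    qed
    have z: "?F p = 0" if p: "p \<in> {0<..<1}" for p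
    proof -
      have "((\<lambda>t. g (t, p)) has_integral (f (u, p) - f (q - 1, p))) {q - 1..u}"
        using u der p by (intro fundamental_theorem_of_calculus)
          (auto simp: has_real_derivative_iff_has_vector_derivative[symmetric] intro: has_field_derivative_at_within)
      then show ?thesis by (simp add: integral_unique)
    qed
    have "?F p = 0"
      by (rule continuous_constant_on_closure[of "{0<..<1}" ?F 0]) (use c z p in auto)
    then show ?thesis by simp
  qed
  have "((\<lambda>u. f (q - 1, p) + integral {q - 1..u} (\<lambda>t. g (t, p))) has_real_derivative g (q, p)) (at q within {q - 1..q + 1})"
    by (rule DERIV_cong[OF DERIV_add[OF DERIV_const integral_has_real_derivative[OF sec[OF cont(2) p]]]]) auto
  then have "((\<lambda>u. f (u, p)) has_real_derivative g (q, p)) (at q within {q - 1..q + 1})"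
    by (rule has_field_derivative_transform_within[OF _ zero_less_one]) (simp, rule eq[symmetric])
  then show ?thesis
    using at_within_interior[of q "{q - 1..q + 1}"] by simp
qed

text \<open>A Landau inequality: the bound \<open>f (x + t) \<le> f x + t * f' x + C * t^2\<close>
  is used at its minimizer \<open>t = - f' x / (2 * C)\<close>. It makes the slope small at almost
  minimal points.\<close>

lemma deriv_sq_le:
  fixes f f' :: "real \<Rightarrow> real"
  assumes der: "\<And>x. (f has_real_derivative f' x) (at x)"
    and lip: "\<And>x y. \<bar>f' x - f' y\<bar> \<le> C * \<bar>x - y\<bar>" and C: "0 < C"
    and m: "\<And>x. m \<le> f x"
  shows "(f' x)\<^sup>2 \<le> 4 * C * (f x - m)"
proof (cases "f' x = 0")
  case True then show ?thesis using m[of x] C by simp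
next
  case False
  define t where "t = - f' x / (2 * C)"
  have t: "t \<noteq> 0" using False C by (simp add: t_def)
  obtain \<xi> where \<xi>: "f (x + t) - f x = t * f' \<xi>" "\<bar>\<xi> - x\<bar> \<le> \<bar>t\<bar>"
  proof (cases "t > 0")
    case True
    have "\<exists>\<xi>. x < \<xi> \<and> \<xi> < x + t \<and> f (x + t) - f x = (x + t - x) * f' \<xi>"
      using True der by (intro MVT2) auto
    then show ?thesis using that True by force
  next
    case False
    then have t: "t < 0" using t by simp
    have "\<exists>\<xi>. x + t < \<xi> \<and> \<xi> < x \<and> f x - f (x + t) = (x - (x + t)) * f' \<xi>"
      using t der by (intro MVT2) auto
    then obtain \<xi> where "x + t < \<xi>" "\<xi> < x" "f x - f (x + t) = - t * f' \<xi>" by auto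
    then show ?thesis using that[of \<xi>] t by (auto simp: algebra_simps)
  qed
  have "\<bar>f' \<xi> - f' x\<bar> \<le> C * \<bar>t\<bar>" using lip[of \<xi> x] mult_left_mono[OF \<xi>(2), of C] C by linarith
  then have "\<bar>t * (f' \<xi> - f' x)\<bar> \<le> \<bar>t\<bar> * (C * \<bar>t\<bar>)" unfolding abs_mult by (intro mult_left_mono) auto
  then have "t * f' \<xi> - t * f' x \<le> C * t\<^sup>2"
    by (simp add: abs_le_iff algebra_simps power2_eq_square abs_mult_self_eq)
  then have "m - f x \<le> t * f' x + C * t\<^sup>2" using \<xi>(1) m[of "x + t"] by linarith
  also have "\<dots> = - ((f' x)\<^sup>2 / (4 * C))" using C by (simp add: t_def power2_eq_square field_simps)
  finally show ?thesis using C by (simp add: field_simps)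
qed

text \<open>A difference quotient of length \<open>t\<close> takes the place of the sign of the
  derivative at a true minimum; \<open>t\<close> is to be balanced against the gap
  \<open>d\<close>.\<close>

lemma endpoint_deriv_le:
  fixes f f' :: "real \<Rightarrow> real"
  assumes P: "P \<le> 1" and t: "0 < t" "t \<le> P"
    and der: "\<And>x. x \<in> {0..1} \<Longrightarrow> (f has_real_derivative f' x) (at x within {0..1})"
    and lip: "\<And>x y. x \<in> {0..1} \<Longrightarrow> y \<in> {0..1} \<Longrightarrow> \<bar>f' x - f' y\<bar> \<le> C * \<bar>x - y\<bar>" and C: "0 \<le> C"
    and m: "m \<le> f (P - t)" "f P \<le> m + d"
  shows "f' P \<le> d / t + C * t"
proof -
  have "\<exists>\<xi>\<in>{P - t<..<P}. f P - f (P - t) = (P - (P - t)) * f' \<xi>"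
  proof (rule mvt_simple[where f' = "\<lambda>x h. h * f' x", simplified])
    show "P - t < P" using t by simp
    show "(f has_derivative (\<lambda>h. h * f' x)) (at x within {P - t..P})" if "P - t \<le> x" "x \<le> P" for x
    proof -
      have "x \<in> {0..1}" using that P t by auto
      from der[OF this] have "(f has_derivative (\<lambda>h. h * f' x)) (at x within {0..1})"
        by (simp add: has_field_derivative_def mult.commute[of _ "f' x"])
      then show ?thesis by (rule has_derivative_subset) (use P t in auto)
    qed
  qed
  then obtain \<xi> where \<xi>: "P - t < \<xi>" "\<xi> < P" "f P - f (P - t) = t * f' \<xi>" by auto
  have "\<bar>f' P - f' \<xi>\<bar> \<le> C * \<bar>P - \<xi>\<bar>" using \<xi> P t by (intro lip) auto
  also have "\<dots> \<le> C * t" using \<xi> C by (intro mult_left_mono) auto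
  finally have "f' P \<le> f' \<xi> + C * t" by linarith
  moreover have "t * f' \<xi> \<le> d" using \<xi> m by linarith
  then have "f' \<xi> \<le> d / t" using t by (simp add: field_simps)
  ultimately show ?thesis by linarith
qed

lemma lipschitz_of_bounded_deriv:
  fixes f f' :: "real \<Rightarrow> real"
  assumes "\<And>x. x \<in> X \<Longrightarrow> (f has_real_derivative f' x) (at x within X)" "convex X"
    "\<And>x. x \<in> X \<Longrightarrow> \<bar>f' x\<bar> \<le> C" "x \<in> X" "y \<in> X"
  shows "\<bar>f x - f y\<bar> \<le> C * \<bar>x - y\<bar>"
  using field_differentiable_bound[of X f f' C x y] assms by auto

text \<open>Barbalat's lemma, uniformly in a parameter.\<close>
lemma uniform_deriv_tendsto_zero:
  fixes f f' :: "real \<Rightarrow> 'a \<Rightarrow> real"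
  assumes lim: "uniform_limit A f L at_top"
    and der: "\<And>x p. p \<in> A \<Longrightarrow> ((\<lambda>x. f x p) has_real_derivative f' x p) (at x)"
    and unif: "\<And>\<epsilon>. \<epsilon> > 0 \<Longrightarrow> \<exists>d>0. \<forall>p\<in>A. \<forall>x y. \<bar>x - y\<bar> \<le> d \<longrightarrow> \<bar>f' x p - f' y p\<bar> < \<epsilon>"
  shows "uniform_limit A f' (\<lambda>_. 0) at_top"
proof (rule uniform_limitI)
  fix \<epsilon> :: real assume \<epsilon>: "\<epsilon> > 0"
  obtain d where d: "d > 0" "\<And>p x y. p \<in> A \<Longrightarrow> \<bar>x - y\<bar> \<le> d \<Longrightarrow> \<bar>f' x p - f' y p\<bar> < \<epsilon> / 2"
    using unif[of "\<epsilon> / 2"] \<epsilon> by auto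
  have "\<forall>\<^sub>F x in at_top. \<forall>p\<in>A. dist (f x p) (L p) < \<epsilon> * d / 8"
    using uniform_limitD[OF lim, of "\<epsilon> * d / 8"] \<epsilon> d by simp
  then obtain X where X: "\<And>x p. X \<le> x \<Longrightarrow> p \<in> A \<Longrightarrow> \<bar>f x p - L p\<bar> < \<epsilon> * d / 8"
    unfolding eventually_at_top_linorder dist_real_def by blast
  have "\<bar>f' x p\<bar> < \<epsilon>" if x: "X \<le> x" and p: "p \<in> A" for x p
  proof -
    have "\<exists>\<xi>. x < \<xi> \<and> \<xi> < x + d \<and> f (x + d) p - f x p = (x + d - x) * f' \<xi> p"
      using d der[OF p] by (intro MVT2) auto
    then obtain \<xi> where \<xi>: "x < \<xi>" "\<xi> < x + d" "f (x + d) p - f x p = d * f' \<xi> p" by auto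
    have "\<bar>f (x + d) p - f x p\<bar> < \<epsilon> * d / 4" 
      using X[OF x p] X[of "x + d" p] x p d abs_triangle_ineq4[of "f (x + d) p - L p" "f x p - L p"] by simp
    then have "d * \<bar>f' \<xi> p\<bar> < d * (\<epsilon> / 4)" using \<xi>(3) d by (simp add: abs_mult mult.commute)
    then have "\<bar>f' \<xi> p\<bar> < \<epsilon> / 4" using d by simp
    moreover have "\<bar>f' x p - f' \<xi> p\<bar> < \<epsilon> / 2" using d(2)[OF p, of x \<xi>] \<xi> by auto
    ultimately show ?thesis by linarith
  qed
  then show "\<forall>\<^sub>F x in at_top. \<forall>p\<in>A. dist (f' x p) 0 < \<epsilon>"
    unfolding eventually_at_top_linorder dist_real_def by auto
qed

text \<open>Interpolation: small values together with a Lipschitz derivative make the derivative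
  small, once \<open>t\<close> is balanced against \<open>d\<close>.\<close>

lemma unit_interval_deriv_le:
  fixes f f' :: "real \<Rightarrow> real"
  assumes der: "\<And>x. x \<in> {0..1} \<Longrightarrow> (f has_real_derivative f' x) (at x within {0..1})"
    and lip: "\<And>x y. x \<in> {0..1} \<Longrightarrow> y \<in> {0..1} \<Longrightarrow> \<bar>f' x - f' y\<bar> \<le> C * \<bar>x - y\<bar>" and C: "0 \<le> C"
    and d: "\<And>x. x \<in> {0..1} \<Longrightarrow> \<bar>f x\<bar> \<le> d" and t: "0 < t" "t \<le> 1/2" and x: "x \<in> {0..1}"
  shows "\<bar>f' x\<bar> \<le> 2 * d / t + C * t"
proof -
  \<comment> \<open>Left end of an interval of length \<open>t\<close> that contains
    \<open>x\<close> and stays in the unit interval.\<close>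
  define a where "a = (if x \<le> 1/2 then x else x - t)"
  have a: "0 \<le> a" "a + t \<le> 1" "a \<le> x" "x \<le> a + t" using x t by (auto simp: a_def)
  have "\<exists>\<xi>\<in>{a<..<a + t}. f (a + t) - f a = (a + t - a) * f' \<xi>"
  proof (rule mvt_simple[where f' = "\<lambda>x h. h * f' x", simplified])
    show "(f has_derivative (\<lambda>h. h * f' x)) (at x within {a..a + t})" if "a \<le> x" "x \<le> a + t" for x
    proof -
      have "x \<in> {0..1}" using that a by auto
      from der[OF this] have "(f has_derivative (\<lambda>h. h * f' x)) (at x within {0..1})"
        by (simp add: has_field_derivative_def mult.commute[of _ "f' x"])
      then show ?thesis by (rule has_derivative_subset) (use a in auto)
    qed
  qed (use t in simp)
  then obtain \<xi> where \<xi>: "a < \<xi>" "\<xi> < a + t" "f (a + t) - f a = t * f' \<xi>" by auto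
  have "t * \<bar>f' \<xi>\<bar> \<le> 2 * d" 
  proof -
    have "t * \<bar>f' \<xi>\<bar> = \<bar>f (a + t) - f a\<bar>" using t by (simp add: \<xi>(3) abs_mult)
    also have "\<dots> \<le> \<bar>f (a + t)\<bar> + \<bar>f a\<bar>" by (rule abs_triangle_ineq4)
    also have "\<dots> \<le> d + d" using a t by (intro add_mono d) auto
    finally show ?thesis by simp
  qed
  then have "\<bar>f' \<xi>\<bar> \<le> 2 * d / t" using t by (simp add: field_simps)
  moreover have "\<bar>f' x - f' \<xi>\<bar> \<le> C * \<bar>x - \<xi>\<bar>" using \<xi> a x by (intro lip) auto
  moreover have "C * \<bar>x - \<xi>\<bar> \<le> C * t" using \<xi> a C by (intro mult_left_mono) auto
  ultimately show ?thesis by linarith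
qed

context elliptic_op
begin

definition ell_sol where
  "ell_sol f fx fy fxx fxy fyy \<longleftrightarrow> C2_data S f fx fy fxx fxy fyy \<and>
     (\<forall>z\<in>S. \<bar>A z * fxx z + 2 * B z * fxy z + C z * fyy z\<bar> \<le> K * (\<bar>fx z\<bar> + \<bar>fy z\<bar>))"

lemma ell_sol_supersol: "ell_sol f fx fy fxx fxy fyy \<Longrightarrow> supersol f fx fy fxx fxy fyy"
  by (auto simp: ell_sol_def supersol_def abs_le_iff)

lemma ell_sol_uminus:
  assumes "ell_sol f fx fy fxx fxy fyy"
  shows "ell_sol (\<lambda>z. - f z) (\<lambda>z. - fx z) (\<lambda>z. - fy z) (\<lambda>z. - fxx z) (\<lambda>z. - fxy z) (\<lambda>z. - fyy z)"
  unfolding ell_sol_def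
proof (intro conjI ballI)
  have "C2_data S (\<lambda>z. 0) (\<lambda>z. 0) (\<lambda>z. 0) (\<lambda>z. 0) (\<lambda>z. 0) (\<lambda>z. 0)"
    by (simp add: C2_data_def)
  from C2_data_diff[OF this] assms
  show "C2_data S (\<lambda>z. - f z) (\<lambda>z. - fx z) (\<lambda>z. - fy z) (\<lambda>z. - fxx z) (\<lambda>z. - fxy z) (\<lambda>z. - fyy z)"
    by (auto simp: ell_sol_def)
  fix z assume z: "z \<in> S"
  have "A z * - fxx z + 2 * B z * - fxy z + C z * - fyy z = - (A z * fxx z + 2 * B z * fxy z + C z * fyy z)" by simp
  then show "\<bar>A z * - fxx z + 2 * B z * - fxy z + C z * - fyy z\<bar> \<le> K * (\<bar>- fx z\<bar> + \<bar>- fy z\<bar>)"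
    using assms z by (simp only: abs_minus_cancel) (auto simp: ell_sol_def)
qed

end

text \<open>Equality of the mixed derivatives of \<open>Phi\<close>, cleared of calculus:
  \<open>x\<close>, \<open>y\<close> stand for \<open>hp\<close>, \<open>hq\<close>, the letters
  \<open>A\<close>, \<open>B\<close>, \<open>C\<close> for \<open>hqq\<close>, \<open>hqp\<close>,
  \<open>hpp\<close>, \<open>k\<close> for \<open>1 / hp\<close>, and \<open>v\<close>,
  \<open>vd\<close> for the laminar speed and its derivative. Solving the equation for
  \<open>A\<close> leaves a polynomial identity.\<close>

lemma flux_compatibility:
  fixes x :: real
  assumes i: "k * x = 1" and v: "v * vd = - o'"
    and pde: "x^2 * A - 2 * x * y * B + (1 + y^2) * C = o' * x^3"
    and a: "a = - y * k" and b: "b = k - v"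
    and aq: "aq = - A * k + y * k^2 * B" and ap: "ap = - B * k + y * k^2 * C"
    and bq: "bq = - (k^2) * B" and bp: "bp = - (k^2) * C - vd"
  shows "(2 * b * bq - 2 * a * aq) * x + (b^2 - a^2) * B
    = 2 * ap * b + 2 * a * bp + B * (b^2 - a^2) + y * (2 * b * bp - 2 * a * ap)"
proof -
  have A: "A = (o' * x^3 + 2 * x * y * B - (1 + y^2) * C) * k^2" using pde i by algebra
  show ?thesis unfolding a b aq ap bq bp using A i v by algebra
qed

text \<open>In the same letters, the principal part of the wave equation applied to
  \<open>Phi\<close>. All second derivatives of \<open>h\<close> cancel, and the remainder is
  quadratic in \<open>a\<close>, \<open>b\<close>.\<close>

lemma flux_equation:
  fixes x :: real
  assumes i: "k * x = 1" and v: "v * vd = - o'"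
    and pde: "x^2 * A - 2 * x * y * B + (1 + y^2) * C = o' * x^3"
    and a: "a = - y * k" and b: "b = k - v"
    and aq: "aq = - A * k + y * k^2 * B" and ap: "ap = - B * k + y * k^2 * C"
    and bq: "bq = - (k^2) * B" and bp: "bp = - (k^2) * C - vd"
    and Pqq: "Pqq = 2 * aq * b + 2 * a * bq + A * (b^2 - a^2) + y * (2 * b * bq - 2 * a * aq)"
    and Pqp: "Pqp = 2 * ap * b + 2 * a * bp + B * (b^2 - a^2) + y * (2 * b * bp - 2 * a * ap)"
    and Ppp: "Ppp = (2 * b * bp - 2 * a * ap) * x + (b^2 - a^2) * C"
  shows "x^2 * Pqq + 2 * (- x * y) * Pqp + (1 + y^2) * Ppp
    = x^2 * (- 2 * vd * (a^2 + b^2)) + o' * x^2 * ((b^2 - a^2) * x)"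
proof -
  have A: "A = (o' * x^3 + 2 * x * y * B - (1 + y^2) * C) * k^2" using pde i by algebra
  have "x^2 * Pqq + 2 * (- x * y) * Pqp + (1 + y^2) * Ppp
      - (x^2 * (- 2 * vd * (a^2 + b^2)) + o' * x^2 * ((b^2 - a^2) * x)) = 0"
    unfolding Pqq Pqp Ppp a b aq ap bq bp using A i v by algebra
  then show ?thesis by simp
qed

text \<open>\<open>2 * a * b\<close> and \<open>b^2 - a^2\<close> are the imaginary and real part of
  the square of the complex number \<open>b + i a\<close>, whose modulus is
  \<open>a^2 + b^2\<close>.\<close>

lemma sum_sq_le_double_products: "(a::real)\<^sup>2 + b\<^sup>2 \<le> \<bar>2 * a * b\<bar> + \<bar>b\<^sup>2 - a\<^sup>2\<bar>"
proof (rule power2_le_imp_le)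
  have "(a\<^sup>2 + b\<^sup>2)\<^sup>2 = \<bar>2 * a * b\<bar>\<^sup>2 + \<bar>b\<^sup>2 - a\<^sup>2\<bar>\<^sup>2"
    by (simp add: power2_eq_square algebra_simps)
  also have "\<dots> \<le> (\<bar>2 * a * b\<bar> + \<bar>b\<^sup>2 - a\<^sup>2\<bar>)\<^sup>2"
    unfolding power2_sum by simp
  finally show "(a\<^sup>2 + b\<^sup>2)\<^sup>2 \<le> (\<bar>2 * a * b\<bar> + \<bar>b\<^sup>2 - a\<^sup>2\<bar>)\<^sup>2" .
qed simp

abbreviation strip :: "(real \<times> real) set" where "strip \<equiv> UNIV \<times> {0<..<1}"
abbreviation cstrip :: "(real \<times> real) set" where "cstrip \<equiv> UNIV \<times> {0..1}"

lemma open_strip: "open strip" by (intro open_Times) auto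

text \<open>The wave in partial hodograph variables: \<open>h (q, p)\<close> is the height of the streamline \<open>\<psi> = p\<close>
  above \<open>x = q\<close>.\<close>
locale wave = conjugate_pair +
  fixes h hq hp hqq hqp hpp :: "real \<times> real \<Rightarrow> real" and M c0 :: real
  assumes C2: "C2_data strip h hq hp hqq hqp hpp"
    and cont: "g \<in> {h, hq, hp, hqq, hqp, hpp} \<Longrightarrow> continuous_on cstrip g"
    and bound: "g \<in> {h, hq, hp, hqq, hqp, hpp} \<Longrightarrow> z \<in> cstrip \<Longrightarrow> \<bar>g z\<bar> \<le> M"
    and c0: "0 < c0" and hp_ge: "z \<in> cstrip \<Longrightarrow> c0 \<le> hp z"
    and hqq_unif: "0 < \<epsilon> \<Longrightarrow> \<exists>d>0. \<forall>p\<in>{0..1}. \<forall>x y. \<bar>x - y\<bar> \<le> d \<longrightarrow> \<bar>hqq (x, p) - hqq (y, p)\<bar> < \<epsilon>"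
    and pde: "z \<in> strip \<Longrightarrow>
      (hp z)\<^sup>2 * hqq z - 2 * hp z * hq z * hqp z + (1 + (hq z)\<^sup>2) * hpp z = \<omega> (snd z) * hp z ^ 3"
    and bernoulli: "(1 + (hq (q, 1))\<^sup>2) / (2 * (hp (q, 1))\<^sup>2) + h (q, 1) = r"
    and bottom: "h (q, 0) = 0"
begin

lemma conts: "continuous_on cstrip h" "continuous_on cstrip hq" "continuous_on cstrip hp"
  "continuous_on cstrip hqq" "continuous_on cstrip hqp" "continuous_on cstrip hpp"
  by (rule cont; simp)+

lemma bounds: assumes "z \<in> cstrip"
  shows "\<bar>h z\<bar> \<le> M" "\<bar>hq z\<bar> \<le> M" "\<bar>hp z\<bar> \<le> M" "\<bar>hqq z\<bar> \<le> M" "\<bar>hqp z\<bar> \<le> M" "\<bar>hpp z\<bar> \<le> M"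
  by (rule bound[OF _ assms]; simp)+

lemma M_pos: "0 < M"
proof -
  have "c0 \<le> hp (0, 0)" "\<bar>hp (0, 0)\<bar> \<le> M" using hp_ge[of "(0,0)"] bounds(3)[of "(0,0)"] by auto
  then show ?thesis using c0 by linarith
qed

lemma hp_pos: "z \<in> cstrip \<Longrightarrow> 0 < hp z" using hp_ge[of z] c0 by linarith

lemma strip_cstrip: "z \<in> strip \<Longrightarrow> z \<in> cstrip" by auto

lemma interior_partials:
  assumes "0 < p" "p < 1"
  shows "((\<lambda>q. h (q, p)) has_real_derivative hq (q, p)) (at q)"
    "((\<lambda>q. hq (q, p)) has_real_derivative hqq (q, p)) (at q)"
    "((\<lambda>q. hp (q, p)) has_real_derivative hqp (q, p)) (at q)"
    "((\<lambda>p. h (q, p)) has_real_derivative hp (q, p)) (at p)"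
    "((\<lambda>p. hq (q, p)) has_real_derivative hqp (q, p)) (at p)"
    "((\<lambda>p. hp (q, p)) has_real_derivative hpp (q, p)) (at p)"
proof -
  have "(q, p) \<in> strip" using assms by simp
  note d = C2_dataD[OF C2 this]
  show "((\<lambda>q. h (q, p)) has_real_derivative hq (q, p)) (at q)"
    "((\<lambda>q. hq (q, p)) has_real_derivative hqq (q, p)) (at q)"
    "((\<lambda>q. hp (q, p)) has_real_derivative hqp (q, p)) (at q)"
    "((\<lambda>p. h (q, p)) has_real_derivative hp (q, p)) (at p)"
    "((\<lambda>p. hq (q, p)) has_real_derivative hqp (q, p)) (at p)"
    "((\<lambda>p. hp (q, p)) has_real_derivative hpp (q, p)) (at p)"
    by (rule has_derivative_partials[OF d(1)] has_derivative_partials[OF d(2)] has_derivative_partials[OF d(3)])+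
qed

lemma deriv_q:
  assumes "p \<in> {0..1}"
  shows "((\<lambda>q. h (q, p)) has_real_derivative hq (q, p)) (at q)"
    "((\<lambda>q. hq (q, p)) has_real_derivative hqq (q, p)) (at q)"
    "((\<lambda>q. hp (q, p)) has_real_derivative hqp (q, p)) (at q)"
  by (rule strip_deriv_q[OF interior_partials(1) conts(1,2) assms]
      strip_deriv_q[OF interior_partials(2) conts(2,4) assms]
      strip_deriv_q[OF interior_partials(3) conts(3,5) assms]; assumption)+

lemma sect_cont: "continuous_on cstrip g \<Longrightarrow> continuous_on {0..1} (\<lambda>p. g (q, p))" for g :: "real \<times> real \<Rightarrow> real"
  by (rule continuous_on_compose2[of _ g]) (auto intro!: continuous_intros)

lemma sect_cont_q: "continuous_on cstrip g \<Longrightarrow> p \<in> {0..1} \<Longrightarrow> continuous_on X (\<lambda>q. g (q, p))" for g :: "real \<times> real \<Rightarrow> real"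
  by (rule continuous_on_compose2[of _ g]) (auto intro!: continuous_intros)

lemma deriv_p:
  assumes "p \<in> {0..1}"
  shows "((\<lambda>p. h (q, p)) has_real_derivative hp (q, p)) (at p within {0..1})"
    "((\<lambda>p. hq (q, p)) has_real_derivative hqp (q, p)) (at p within {0..1})"
    "((\<lambda>p. hp (q, p)) has_real_derivative hpp (q, p)) (at p within {0..1})"
  by (rule derivative_within_of_interior[OF zero_less_one interior_partials(4) sect_cont[OF conts(1)] sect_cont[OF conts(3)] assms]
      derivative_within_of_interior[OF zero_less_one interior_partials(5) sect_cont[OF conts(2)] sect_cont[OF conts(5)] assms]
      derivative_within_of_interior[OF zero_less_one interior_partials(6) sect_cont[OF conts(3)] sect_cont[OF conts(6)] assms]; assumption)+

lemma hq_bottom: "hq (q, 0) = 0"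
  using deriv_q(1)[of 0 q] DERIV_unique[of "\<lambda>q. h (q, 0)"] by (simp add: bottom)

definition ec_const where "ec_const = 1 / (2 / c0\<^sup>2 + 2 * M\<^sup>2 / c0\<^sup>2 + 1)"

lemma ec_const_pos: "0 < ec_const"
  unfolding ec_const_def by (intro divide_pos_pos add_nonneg_pos) auto

text \<open>The form equals \<open>(x * \<xi> - y * \<zeta>)^2 + \<zeta>^2\<close>, and the lower
  bound on \<open>x\<close> recovers \<open>\<xi>\<close> from it.\<close>

lemma quadratic_form_ge:
  assumes "c0 \<le> x" "\<bar>y\<bar> \<le> M"
  shows "ec_const * (\<xi>\<^sup>2 + \<zeta>\<^sup>2) \<le> x\<^sup>2 * \<xi>\<^sup>2 + 2 * (- x * y) * \<xi> * \<zeta> + (1 + y\<^sup>2) * \<zeta>\<^sup>2"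
proof -
  define N where "N = 2 / c0\<^sup>2 + 2 * M\<^sup>2 / c0\<^sup>2 + 1"
  have N: "N > 0" unfolding N_def by (intro add_nonneg_pos) auto
  define T where "T = (x * \<xi> - y * \<zeta>)\<^sup>2"
  have T: "T \<ge> 0" by (simp add: T_def)
  have "(x * \<xi>)\<^sup>2 \<le> 2 * T + 2 * (y * \<zeta>)\<^sup>2"
  proof -
    have "0 \<le> (x * \<xi> - 2 * (y * \<zeta>))\<^sup>2" by simp
    then show ?thesis by (simp add: T_def power2_eq_square algebra_simps)
  qed
  moreover have "c0\<^sup>2 * \<xi>\<^sup>2 \<le> (x * \<xi>)\<^sup>2"
    unfolding power_mult_distrib using assms(1) c0 by (intro mult_right_mono power_mono) auto
  moreover have "(y * \<zeta>)\<^sup>2 \<le> M\<^sup>2 * \<zeta>\<^sup>2"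
    unfolding power_mult_distrib using abs_le_square_iff[of y M] assms(2) M_pos by (intro mult_right_mono) auto
  ultimately have "c0\<^sup>2 * \<xi>\<^sup>2 \<le> 2 * T + 2 * (M\<^sup>2 * \<zeta>\<^sup>2)" by linarith
  then have "\<xi>\<^sup>2 \<le> (2 * T + 2 * (M\<^sup>2 * \<zeta>\<^sup>2)) / c0\<^sup>2" using c0 by (simp add: field_simps)
  then have "\<xi>\<^sup>2 + \<zeta>\<^sup>2 \<le> 2 / c0\<^sup>2 * T + (2 * M\<^sup>2 / c0\<^sup>2 + 1) * \<zeta>\<^sup>2"
    by (simp add: add_divide_distrib algebra_simps)
  also have "\<dots> \<le> N * T + N * \<zeta>\<^sup>2"
    using T unfolding N_def by (intro add_mono mult_right_mono) auto
  finally have "\<xi>\<^sup>2 + \<zeta>\<^sup>2 \<le> N * (T + \<zeta>\<^sup>2)" by (simp add: algebra_simps)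
  then have "(\<xi>\<^sup>2 + \<zeta>\<^sup>2) / N \<le> T + \<zeta>\<^sup>2" using N by (simp add: field_simps)
  moreover have "x\<^sup>2 * \<xi>\<^sup>2 + 2 * (- x * y) * \<xi> * \<zeta> + (1 + y\<^sup>2) * \<zeta>\<^sup>2 = T + \<zeta>\<^sup>2"
    by (simp add: T_def power2_eq_square algebra_simps)
  ultimately show ?thesis unfolding ec_const_def N_def[symmetric] by simp
qed

lemma elliptic:
  assumes "open X" "X \<subseteq> strip" "1 + M\<^sup>2 \<le> K"
  shows "elliptic_op X (\<lambda>z. (hp z)\<^sup>2) (\<lambda>z. - hp z * hq z) (\<lambda>z. 1 + (hq z)\<^sup>2) K ec_const"
proof
  show "0 \<le> K" using assms(3) zero_le_power2[of M] by linarith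
  fix z assume "z \<in> X"
  then have z: "z \<in> cstrip" using assms(2) by auto
  note b = bounds[OF z] hp_ge[OF z]
  have sq: "(hp z)\<^sup>2 \<le> M\<^sup>2" "(hq z)\<^sup>2 \<le> M\<^sup>2"
    using abs_le_square_iff[of "hp z" M] abs_le_square_iff[of "hq z" M] b M_pos by auto
  have "\<bar>hp z * hq z\<bar> \<le> M * M" unfolding abs_mult using b M_pos by (intro mult_mono) auto
  then show "\<bar>- hp z * hq z\<bar> \<le> K" using assms(3) by (simp add: power2_eq_square)
  show "\<bar>(hp z)\<^sup>2\<bar> \<le> K" "\<bar>1 + (hq z)\<^sup>2\<bar> \<le> K" using sq assms(3) by (auto simp: abs_of_nonneg add_nonneg_nonneg)
  show "ec_const * (\<xi>\<^sup>2 + \<zeta>\<^sup>2) \<le> (hp z)\<^sup>2 * \<xi>\<^sup>2 + 2 * (- hp z * hq z) * \<xi> * \<zeta> + (1 + (hq z)\<^sup>2) * \<zeta>\<^sup>2" for \<xi> \<zeta>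
    using quadratic_form_ge b by simp
qed (use assms ec_const_pos in auto)

lemma omega_bound: "\<exists>N>0. \<forall>p\<in>{0..1}. \<bar>\<omega> p\<bar> \<le> N"
proof -
  obtain N where "\<forall>p\<in>{0..1}. \<bar>\<omega> p\<bar> \<le> N"
    using compact_imp_bounded[OF compact_continuous_image[OF omega_cont compact_Icc]]
    unfolding bounded_iff by auto
  then show ?thesis by (intro exI[of _ "max N 1"]) (auto simp: le_max_iff_disj)
qed

definition w :: "real \<Rightarrow> real \<times> real \<Rightarrow> real" where "w e z = h z - Hf e (snd z)"

lemma w_cont: "e0 < e \<Longrightarrow> continuous_on cstrip (w e)"
  unfolding w_def by (intro continuous_intros conts continuous_on_compose2[OF H_cont]) auto

lemma inv_V_deriv:
  assumes "e0 < e" "p \<in> {0..1}"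
  shows "((\<lambda>p. 1 / V e p) has_real_derivative \<omega> p / V e p ^ 3) (at p within {0..1})"
proof -
  have "((\<lambda>p. inverse (V e p)) has_real_derivative - ((- \<omega> p / V e p) * inverse (V e p ^ Suc (Suc 0)))) (at p within {0..1})"
    by (rule DERIV_inverse_fun[OF V_deriv_p[OF assms]]) (use V_pos[OF assms] in simp)
  then show ?thesis by (simp add: divide_inverse power3_eq_cube mult.assoc)
qed

lemma deriv_snd:
  fixes g :: "real \<Rightarrow> real"
  assumes "(g has_real_derivative d) (at (snd z) within {0..1})" "z \<in> strip"
  shows "((\<lambda>z. g (snd z)) has_derivative (\<lambda>v. d * snd v)) (at z)"
proof -
  have "(g has_real_derivative d) (at (snd z))"
    using assms by (intro has_real_derivative_interior) auto
  then have "(g has_derivative (\<lambda>x. x * d)) (at (snd z))" by (simp add: has_field_derivative_def mult_commute_abs)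
  from has_derivative_compose[OF has_derivative_snd[OF has_derivative_ident] this]
  show ?thesis by (simp add: mult.commute)
qed

lemma w_C2: assumes e: "e0 < e"
  shows "C2_data strip (w e) hq (\<lambda>z. hp z - 1 / V e (snd z)) hqq hqp (\<lambda>z. hpp z - \<omega> (snd z) / V e (snd z) ^ 3)"
  unfolding C2_data_def
proof (intro ballI conjI)
  fix z :: "real \<times> real" assume z: "z \<in> strip"
  note d = C2_dataD[OF C2 z]
  have p: "snd z \<in> {0..1}" using z by auto
  show "(w e has_derivative (\<lambda>v. hq z * fst v + (hp z - 1 / V e (snd z)) * snd v)) (at z)"
    unfolding w_def[abs_def]
    by (rule has_derivative_eq_rhs[OF has_derivative_diff[OF d(1) deriv_snd[OF H_deriv[OF e p] z]]])
      (simp add: fun_eq_iff algebra_simps)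
  show "(hq has_derivative (\<lambda>v. hqq z * fst v + hqp z * snd v)) (at z)" by (rule d)
  show "((\<lambda>z. hp z - 1 / V e (snd z)) has_derivative (\<lambda>v. hqp z * fst v + (hpp z - \<omega> (snd z) / V e (snd z) ^ 3) * snd v)) (at z)"
    by (rule has_derivative_eq_rhs[OF has_derivative_diff[OF d(3) deriv_snd[OF inv_V_deriv[OF e p] z]]])
      (simp add: fun_eq_iff algebra_simps)
qed

lemma V_bounds: assumes "e0 < e"
  shows "\<exists>B>0. \<forall>p\<in>{0..1}. V e p \<le> B \<and> 1 / V e p \<le> B"
proof -
  obtain B1 where B1: "\<forall>p\<in>{0..1}. \<bar>V e p\<bar> \<le> B1"
    using compact_imp_bounded[OF compact_continuous_image[OF V_cont1 compact_Icc]]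
    unfolding bounded_iff by auto
  obtain B2 where B2: "\<forall>p\<in>{0..1}. \<bar>1 / V e p\<bar> \<le> B2"
    using compact_imp_bounded[OF compact_continuous_image[OF cont_inv[OF assms] compact_Icc]]
    unfolding bounded_iff by auto
  show ?thesis
  proof (intro exI[of _ "max 1 (max B1 B2)"] conjI ballI)
    fix p :: real assume p: "p \<in> {0..1}"
    have "V e p \<le> B1" "1 / V e p \<le> B2"
      using abs_le_D1[OF bspec[OF B1 p]] abs_le_D1[OF bspec[OF B2 p]] .
    then show "V e p \<le> max 1 (max B1 B2)" "1 / V e p \<le> max 1 (max B1 B2)"
      by (simp_all add: le_max_iff_disj)
  qed simp
qed

text \<open>The laminar profile solves the same equation. Since \<open>\<omega>\<close> is evaluated
  at the same \<open>p\<close> for both, the defect factors through the gradient of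
  \<open>w e\<close> and no difference of values of \<open>\<omega>\<close> occurs.\<close>

lemma w_sol: assumes e: "e0 < e"
  shows "\<exists>K\<ge>1 + M\<^sup>2. elliptic_op.ell_sol strip (\<lambda>z. (hp z)\<^sup>2) (\<lambda>z. - hp z * hq z) (\<lambda>z. 1 + (hq z)\<^sup>2) K
    (w e) hq (\<lambda>z. hp z - 1 / V e (snd z)) hqq hqp (\<lambda>z. hpp z - \<omega> (snd z) / V e (snd z) ^ 3)"
proof -
  obtain N where N: "0 < N" "\<And>p. p \<in> {0..1} \<Longrightarrow> \<bar>\<omega> p\<bar> \<le> N" using omega_bound by blast
  obtain B where B: "0 < B" "\<And>p. p \<in> {0..1} \<Longrightarrow> 1 / V e p \<le> B" using V_bounds[OF e] by blast
  define K where "K = 1 + M\<^sup>2 + N * (M\<^sup>2 + M * B + B\<^sup>2) + N * (M * B ^ 3)"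
  have K: "1 + M\<^sup>2 \<le> K" "N * (M\<^sup>2 + M * B + B\<^sup>2) \<le> K" "N * (M * B ^ 3) \<le> K"
    using N B M_pos by (auto simp: K_def intro!: add_increasing)
  interpret elliptic_op strip "\<lambda>z. (hp z)\<^sup>2" "\<lambda>z. - hp z * hq z" "\<lambda>z. 1 + (hq z)\<^sup>2" K ec_const
    by (rule elliptic[OF open_strip order_refl K(1)])
  show ?thesis
  proof (intro exI[of _ K] conjI K(1))
    show "ell_sol (w e) hq (\<lambda>z. hp z - 1 / V e (snd z)) hqq hqp (\<lambda>z. hpp z - \<omega> (snd z) / V e (snd z) ^ 3)"
      unfolding ell_sol_def
    proof (intro conjI w_C2[OF e] ballI)
      fix z :: "real \<times> real" assume z: "z \<in> strip"
      have p: "snd z \<in> {0..1}" using z by auto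
      define o' x y b where "o' = \<omega> (snd z)" and "x = hp z" and "y = hq z" and "b = 1 / V e (snd z)"
      have x: "0 < x" "x \<le> M" "\<bar>y\<bar> \<le> M" using bounds[OF strip_cstrip[OF z]] hp_pos[OF strip_cstrip[OF z]]
        by (auto simp: x_def y_def)
      have b: "0 < b" "b \<le> B" using V_pos[OF e p] B(2)[OF p] by (auto simp: b_def)
      have o: "\<bar>o'\<bar> \<le> N" using N(2)[OF p] by (simp add: o'_def)
      have oV: "\<omega> (snd z) / V e (snd z) ^ 3 = o' * b ^ 3" by (simp add: o'_def b_def power_divide)
      have "(hp z)\<^sup>2 * hqq z + 2 * (- hp z * hq z) * hqp z + (1 + (hq z)\<^sup>2) * (hpp z - \<omega> (snd z) / V e (snd z) ^ 3)
        = o' * x ^ 3 - (1 + y\<^sup>2) * (o' * b ^ 3)"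
        using pde[OF z] unfolding oV unfolding o'_def[symmetric] x_def[symmetric] y_def[symmetric] by (simp add: algebra_simps)
      also have "\<dots> = o' * (x\<^sup>2 + x * b + b\<^sup>2) * (x - b) - o' * (y * b ^ 3) * y"
        by (simp add: power2_eq_square power3_eq_cube algebra_simps)
      finally have eq: "(hp z)\<^sup>2 * hqq z + 2 * (- hp z * hq z) * hqp z + (1 + (hq z)\<^sup>2) * (hpp z - \<omega> (snd z) / V e (snd z) ^ 3)
        = o' * (x\<^sup>2 + x * b + b\<^sup>2) * (x - b) - o' * (y * b ^ 3) * y" .
      have "\<bar>o' * (x\<^sup>2 + x * b + b\<^sup>2)\<bar> \<le> N * (M\<^sup>2 + M * B + B\<^sup>2)"
        unfolding abs_mult using x b o N M_pos B(1)
        by (intro mult_mono) (auto intro!: add_mono power_mono mult_mono simp: abs_of_nonneg)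
      then have 1: "\<bar>o' * (x\<^sup>2 + x * b + b\<^sup>2)\<bar> \<le> K" using K(2) by linarith
      have "\<bar>o' * (y * b ^ 3)\<bar> \<le> N * (M * B ^ 3)"
        unfolding abs_mult using x b o N M_pos B(1)
        by (intro mult_mono) (auto intro!: power_mono)
      then have 2: "\<bar>o' * (y * b ^ 3)\<bar> \<le> K" using K(3) by linarith
      have "\<bar>o' * (x\<^sup>2 + x * b + b\<^sup>2) * (x - b) - o' * (y * b ^ 3) * y\<bar> \<le> K * \<bar>x - b\<bar> + K * \<bar>y\<bar>"
        by (rule order_trans[OF abs_triangle_ineq4], unfold abs_mult[of _ "x - b"] abs_mult[of _ y],
            intro add_mono mult_right_mono 1 2 abs_ge_zero)
      then show "\<bar>(hp z)\<^sup>2 * hqq z + 2 * (- hp z * hq z) * hqp z + (1 + (hq z)\<^sup>2) * (hpp z - \<omega> (snd z) / V e (snd z) ^ 3)\<bar>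
        \<le> K * (\<bar>hq z\<bar> + \<bar>hp z - 1 / V e (snd z)\<bar>)"
        unfolding eq by (simp add: x_def y_def b_def algebra_simps)
    qed
  qed
qed

section \<open>The flux function\<close>

text \<open>In physical variables \<open>fa\<close> is the horizontal derivative of the stream
  function, and \<open>fb\<close> the excess of its vertical derivative over the laminar speed on
  the same streamline. If both vanish throughout, the wave is the laminar flow.\<close>

definition fa :: "real \<times> real \<Rightarrow> real" where "fa z = - hq z * (1 / hp z)"
definition fb :: "real \<Rightarrow> real \<times> real \<Rightarrow> real" where "fb e z = 1 / hp z - V e (snd z)"
definition fa_q :: "real \<times> real \<Rightarrow> real" where "fa_q z = - hqq z * (1 / hp z) + hq z * (1 / hp z)\<^sup>2 * hqp z"
definition fa_p :: "real \<times> real \<Rightarrow> real" where "fa_p z = - hqp z * (1 / hp z) + hq z * (1 / hp z)\<^sup>2 * hpp z"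
definition fb_q :: "real \<times> real \<Rightarrow> real" where "fb_q z = - ((1 / hp z)\<^sup>2) * hqp z"
definition fb_p :: "real \<Rightarrow> real \<times> real \<Rightarrow> real" where
  "fb_p e z = - ((1 / hp z)\<^sup>2) * hpp z - (- \<omega> (snd z) / V e (snd z))"

definition Phi_p where "Phi_p e z = ((fb e z)\<^sup>2 - (fa z)\<^sup>2) * hp z"
text \<open>A closed local form for the \<open>q\<close>-derivative of the column integral
  \<open>Phi\<close>; \<open>Phi_deriv_q\<close> justifies it.\<close>

definition Phi_q where "Phi_q e z = 2 * fa z * fb e z + hq z * ((fb e z)\<^sup>2 - (fa z)\<^sup>2)"
definition Phi_qq where "Phi_qq e z = 2 * fa_q z * fb e z + 2 * fa z * fb_q z + hqq z * ((fb e z)\<^sup>2 - (fa z)\<^sup>2)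
    + hq z * (2 * fb e z * fb_q z - 2 * fa z * fa_q z)"
definition Phi_qp where "Phi_qp e z = 2 * fa_p z * fb e z + 2 * fa z * fb_p e z + hqp z * ((fb e z)\<^sup>2 - (fa z)\<^sup>2)
    + hq z * (2 * fb e z * fb_p e z - 2 * fa z * fa_p z)"
definition Phi_pp where "Phi_pp e z = (2 * fb e z * fb_p e z - 2 * fa z * fa_p z) * hp z + ((fb e z)\<^sup>2 - (fa z)\<^sup>2) * hpp z"

text \<open>The flow force flux function relative to the laminar flow with parameter \<open>e\<close>.\<close>
definition Phi :: "real \<Rightarrow> real \<times> real \<Rightarrow> real" where
  "Phi e z = integral {0..snd z} (\<lambda>s. Phi_p e (fst z, s))"

text \<open>The flow force after the change of variable from \<open>y\<close> to \<open>p\<close> in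
  each column, which accounts for the factor \<open>hp\<close>.\<close>

definition flow_force :: "real \<Rightarrow> real" where
  "flow_force q = integral {0..1} (\<lambda>p. ((1 - (hq (q, p))\<^sup>2) / (2 * (hp (q, p))\<^sup>2) - h (q, p) - \<Omega> p + \<Omega> 1 + r) * hp (q, p))"

lemma hp_nz: "z \<in> cstrip \<Longrightarrow> hp z \<noteq> 0" using hp_pos[of z] by simp

lemma cont_V_snd: "continuous_on cstrip (\<lambda>z. V e (snd z))"
  by (rule continuous_on_compose2[OF V_cont1]) (auto intro!: continuous_intros)

lemma cont_inv_hp: "continuous_on cstrip (\<lambda>z. 1 / hp z)"
  using hp_nz by (intro continuous_intros conts) auto

lemma cont_fa: "continuous_on cstrip fa"
  unfolding fa_def[abs_def] by (intro continuous_on_mult continuous_on_minus cont_inv_hp conts)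
lemma cont_fb: "continuous_on cstrip (fb e)"
  unfolding fb_def[abs_def] by (intro continuous_on_diff cont_V_snd cont_inv_hp)
lemma cont_fa_q: "continuous_on cstrip fa_q"
  unfolding fa_q_def[abs_def]
  by (intro continuous_on_add continuous_on_mult continuous_on_minus continuous_on_power cont_inv_hp conts)
lemma cont_fb_q: "continuous_on cstrip fb_q"
  unfolding fb_q_def[abs_def]
  by (intro continuous_on_add continuous_on_mult continuous_on_minus continuous_on_power cont_inv_hp conts)

lemma cont_Phi_p: "continuous_on cstrip (Phi_p e)"
  unfolding Phi_p_def[abs_def] by (intro continuous_on_mult continuous_on_diff continuous_on_power cont_fa cont_fb conts)
lemma cont_Phi_q: "continuous_on cstrip (Phi_q e)"
  unfolding Phi_q_def[abs_def]
  by (intro continuous_on_mult continuous_on_add continuous_on_diff continuous_on_power continuous_on_const cont_fa cont_fb conts)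

lemma deriv_total:
  assumes e: "e0 < e" and z: "z \<in> strip"
  shows "(fa has_derivative (\<lambda>v. fa_q z * fst v + fa_p z * snd v)) (at z)"
    "(fb e has_derivative (\<lambda>v. fb_q z * fst v + fb_p e z * snd v)) (at z)"
proof -
  note d = C2_dataD[OF C2 z]
  have p: "snd z \<in> {0..1}" using z by auto
  have nz: "hp z \<noteq> 0" by (rule hp_nz[OF strip_cstrip[OF z]])
  have di: "((\<lambda>z. 1 / hp z) has_derivative (\<lambda>v. - ((1 / hp z)\<^sup>2) * (hqp z * fst v + hpp z * snd v))) (at z)"
    by (rule has_derivative_eq_rhs[OF has_derivative_divide[OF has_derivative_const d(3) nz]])
      (simp add: fun_eq_iff power2_eq_square divide_inverse algebra_simps)
  show "(fa has_derivative (\<lambda>v. fa_q z * fst v + fa_p z * snd v)) (at z)"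
    unfolding fa_def[abs_def]
    by (rule has_derivative_eq_rhs[OF has_derivative_mult[OF has_derivative_minus[OF d(2)] di]])
      (simp add: fun_eq_iff fa_q_def fa_p_def algebra_simps)
  show "(fb e has_derivative (\<lambda>v. fb_q z * fst v + fb_p e z * snd v)) (at z)"
    unfolding fb_def[abs_def]
    by (rule has_derivative_eq_rhs[OF has_derivative_diff[OF di deriv_snd[OF V_deriv_p[OF e p] z]]])
      (simp add: fun_eq_iff fb_q_def fb_p_def algebra_simps)
qed

lemma Phi_q_total:
  assumes e: "e0 < e" and z: "z \<in> strip"
  shows "(Phi_q e has_derivative (\<lambda>v. Phi_qq e z * fst v + Phi_qp e z * snd v)) (at z)"
proof -
  note d = C2_dataD[OF C2 z] deriv_total[OF e z]
  show ?thesis unfolding Phi_q_def[abs_def]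
    by (rule has_derivative_eq_rhs, (rule derivative_intros d)+)
      (simp add: fun_eq_iff Phi_qq_def Phi_qp_def algebra_simps power2_eq_square)
qed

text \<open>The left side is the raw \<open>q\<close>-derivative of \<open>Phi_p\<close>. It agrees
  with the \<open>p\<close>-derivative of \<open>Phi_q\<close> only by virtue of the equation for
  \<open>h\<close>.\<close>

lemma compat:
  assumes e: "e0 < e" and z: "z \<in> strip"
  shows "(2 * fb e z * fb_q z - 2 * fa z * fa_q z) * hp z + ((fb e z)\<^sup>2 - (fa z)\<^sup>2) * hqp z = Phi_qp e z"
  unfolding Phi_qp_def
proof (rule flux_compatibility[where v = "V e (snd z)" and vd = "- \<omega> (snd z) / V e (snd z)" and o' = "\<omega> (snd z)" and k = "1 / hp z"])
  have p: "snd z \<in> {0..1}" using z by auto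
  show "1 / hp z * hp z = 1" using hp_nz[OF strip_cstrip[OF z]] by simp
  show "V e (snd z) * (- \<omega> (snd z) / V e (snd z)) = - \<omega> (snd z)" using V_pos[OF e p] by simp
  show "(hp z)\<^sup>2 * hqq z - 2 * hp z * hq z * hqp z + (1 + (hq z)\<^sup>2) * hpp z = \<omega> (snd z) * hp z ^ 3" by (rule pde[OF z])
qed (simp_all only: fa_def fb_def fa_q_def fa_p_def fb_q_def fb_p_def)

lemma Phi_p_total:
  assumes e: "e0 < e" and z: "z \<in> strip"
  shows "(Phi_p e has_derivative (\<lambda>v. Phi_qp e z * fst v + Phi_pp e z * snd v)) (at z)"
proof -
  note d = C2_dataD[OF C2 z] deriv_total[OF e z]
  show ?thesis unfolding Phi_p_def[abs_def] compat[OF e z, symmetric]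
    by (rule has_derivative_eq_rhs, (rule derivative_intros d)+)
      (simp add: fun_eq_iff Phi_pp_def algebra_simps power2_eq_square)
qed

lemma Phi_q_bottom: "Phi_q e (q, 0) = 0"
  by (simp add: Phi_q_def fa_def hq_bottom)

lemma Phi_p_q_deriv:
  assumes p: "p \<in> {0..1}"
  shows "((\<lambda>q. Phi_p e (q, p)) has_real_derivative
     ((2 * fb e (q, p) * fb_q (q, p) - 2 * fa (q, p) * fa_q (q, p)) * hp (q, p)
      + ((fb e (q, p))\<^sup>2 - (fa (q, p))\<^sup>2) * hqp (q, p))) (at q)"
proof -
  note d = deriv_q[OF p, of q]
  have nz: "hp (q, p) \<noteq> 0" by (rule hp_nz) (use p in simp)
  have di: "((\<lambda>q. 1 / hp (q, p)) has_real_derivative - ((1 / hp (q, p))\<^sup>2) * hqp (q, p)) (at q)"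
    by (rule DERIV_cong[OF DERIV_divide[OF DERIV_const d(3) nz]]) (simp add: power2_eq_square)
  have da: "((\<lambda>q. fa (q, p)) has_real_derivative fa_q (q, p)) (at q)"
    unfolding fa_def
    by (rule DERIV_cong[OF DERIV_mult[OF DERIV_minus[OF d(2)] di]]) (simp add: fa_q_def)
  have db: "((\<lambda>q. fb e (q, p)) has_real_derivative fb_q (q, p)) (at q)"
    unfolding fb_def snd_conv by (rule DERIV_cong[OF DERIV_diff[OF di DERIV_const]]) (simp add: fb_q_def)
  have da2: "((\<lambda>q. (fa (q, p))\<^sup>2) has_real_derivative 2 * fa (q, p) * fa_q (q, p)) (at q)"
    by (rule DERIV_cong[OF DERIV_power[OF da]]) simp
  have db2: "((\<lambda>q. (fb e (q, p))\<^sup>2) has_real_derivative 2 * fb e (q, p) * fb_q (q, p)) (at q)"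
    by (rule DERIV_cong[OF DERIV_power[OF db]]) simp
  show ?thesis unfolding Phi_p_def
    by (rule DERIV_cong[OF DERIV_mult[OF DERIV_diff[OF db2 da2] d(3)]]) simp
qed

text \<open>Differentiation under the integral gives the integral of the raw
  \<open>q\<close>-derivative of \<open>Phi_p\<close>. By \<open>compat\<close> this is a
  \<open>p\<close>-derivative of \<open>Phi_q\<close>, and \<open>Phi_q\<close> vanishes on the flat
  bottom.\<close>

lemma Phi_deriv_q:
  assumes e: "e0 < e" and p: "p \<in> {0..1}"
  shows "((\<lambda>q. Phi e (q, p)) has_real_derivative Phi_q e (q, p)) (at q)"
proof -
  let ?g = "\<lambda>z. (2 * fb e z * fb_q z - 2 * fa z * fa_q z) * hp z + ((fb e z)\<^sup>2 - (fa z)\<^sup>2) * hqp z"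
  have cg: "continuous_on cstrip ?g"
    by (intro continuous_on_mult continuous_on_add continuous_on_diff continuous_on_power continuous_on_const
        cont_fa cont_fb cont_fa_q cont_fb_q conts)
  have sub: "(UNIV :: real set) \<times> cbox 0 p \<subseteq> cstrip" using p by auto
  have "((\<lambda>q. integral (cbox 0 p) (\<lambda>s. Phi_p e (q, s))) has_real_derivative integral (cbox 0 p) (\<lambda>s. ?g (q, s))) (at q within UNIV)"
  proof (rule leibniz_rule_field_derivative)
    show "((\<lambda>q. Phi_p e (q, s)) has_real_derivative ?g (x, s)) (at x within UNIV)" if "s \<in> cbox 0 p" for x s
      using Phi_p_q_deriv[of s e x] that p by simp
    show "(\<lambda>s. Phi_p e (x, s)) integrable_on cbox 0 p" for x
      by (intro integrable_continuous continuous_on_compose2[OF cont_Phi_p]) (use p in \<open>auto intro!: continuous_intros\<close>)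
    show "continuous_on (UNIV \<times> cbox 0 p) (\<lambda>(x, s). ?g (x, s))"
      unfolding case_prod_beta prod.collapse by (rule continuous_on_subset[OF cg sub])
  qed auto
  moreover have "integral (cbox 0 p) (\<lambda>s. ?g (q, s)) = Phi_q e (q, p)"
  proof -
    have "((\<lambda>s. ?g (q, s)) has_integral (Phi_q e (q, p) - Phi_q e (q, 0))) {0..p}"
    proof (rule fundamental_theorem_of_calculus_interior)
      show "continuous_on {0..p} (\<lambda>s. Phi_q e (q, s))"
        by (intro continuous_on_compose2[OF cont_Phi_q]) (use p in \<open>auto intro!: continuous_intros\<close>)
      fix s assume s: "s \<in> {0<..<p}"
      then have z: "(q, s) \<in> strip" using p by auto
      show "((\<lambda>s. Phi_q e (q, s)) has_vector_derivative ?g (q, s)) (at s)"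
        using has_derivative_partials(2)[OF Phi_q_total[OF e z]] compat[OF e z]
        by (simp add: has_real_derivative_iff_has_vector_derivative)
    qed (use p in simp)
    then show ?thesis by (simp add: integral_unique Phi_q_bottom)
  qed
  ultimately show ?thesis by (simp add: Phi_def)
qed

lemma Phi_deriv_p:
  assumes "p \<in> {0..1}"
  shows "((\<lambda>p. Phi e (q, p)) has_real_derivative Phi_p e (q, p)) (at p within {0..1})"
  using integral_has_real_derivative[OF sect_cont[OF cont_Phi_p] assms] by (simp add: Phi_def)

lemma Phi_C2: assumes e: "e0 < e"
  shows "C2_data strip (Phi e) (Phi_q e) (Phi_p e) (Phi_qq e) (Phi_qp e) (Phi_pp e)"
  unfolding C2_data_def
proof (intro ballI conjI Phi_q_total Phi_p_total e)
  fix z :: "real \<times> real" assume z: "z \<in> strip"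
  show "(Phi e has_derivative (\<lambda>v. Phi_q e z * fst v + Phi_p e z * snd v)) (at z)"
  proof (rule has_derivative_of_partials[OF open_strip z])
    fix x y :: real assume xy: "(x, y) \<in> strip"
    then have y: "0 < y" "y < 1" by auto
    then have y01: "y \<in> {0..1}" by auto
    show "((\<lambda>t. Phi e (t, y)) has_real_derivative Phi_q e (x, y)) (at x)"
      by (rule Phi_deriv_q[OF e y01])
    show "((\<lambda>t. Phi e (x, t)) has_real_derivative Phi_p e (x, y)) (at y)"
      by (rule has_real_derivative_interior[OF Phi_deriv_p[OF y01] y])
  next
    show "continuous_on strip (Phi_p e)" by (rule continuous_on_subset[OF cont_Phi_p]) auto
  qed
qed

lemma fb_bound: assumes e: "e0 < e" shows "\<exists>B>0. \<forall>z\<in>cstrip. \<bar>fa z\<bar> \<le> B \<and> \<bar>fb e z\<bar> \<le> B"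
proof -
  obtain B where B: "0 < B" "\<And>p. p \<in> {0..1} \<Longrightarrow> V e p \<le> B" using V_bounds[OF e] by blast
  have ih: "\<bar>1 / hp z\<bar> \<le> 1 / c0" if "z \<in> cstrip" for z
    using hp_ge[OF that] c0 by (simp add: frac_le)
  show ?thesis
  proof (intro exI conjI ballI)
    show "0 < M / c0 + (1 / c0 + B)" using M_pos c0 B by (intro add_pos_pos) auto
    fix z :: "real \<times> real" assume z: "z \<in> cstrip"
    have "\<bar>hq z\<bar> * \<bar>1 / hp z\<bar> \<le> M * (1 / c0)" using bounds(2)[OF z] ih[OF z] M_pos by (intro mult_mono) auto
    then have "\<bar>fa z\<bar> \<le> M / c0" by (simp add: fa_def abs_mult)
    then show "\<bar>fa z\<bar> \<le> M / c0 + (1 / c0 + B)" using c0 B by (simp add: add_increasing2)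
    have p: "snd z \<in> {0..1}" using z by auto
    have "\<bar>fb e z\<bar> \<le> \<bar>1 / hp z\<bar> + \<bar>V e (snd z)\<bar>" unfolding fb_def by (rule abs_triangle_ineq4)
    also have "\<dots> \<le> 1 / c0 + B" using ih[OF z] B(2)[OF p] V_pos[OF e p] by (intro add_mono) auto
    finally show "\<bar>fb e z\<bar> \<le> M / c0 + (1 / c0 + B)" using M_pos c0 by (simp add: add_increasing)
  qed
qed

lemma Phi_p_bound: assumes e: "e0 < e" shows "\<exists>B>0. \<forall>z\<in>cstrip. \<bar>Phi_p e z\<bar> \<le> B"
proof -
  obtain B where B: "B > 0" "\<And>z. z \<in> cstrip \<Longrightarrow> \<bar>fa z\<bar> \<le> B \<and> \<bar>fb e z\<bar> \<le> B" using fb_bound[OF e] by blast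
  show ?thesis
  proof (intro exI conjI ballI)
    show "0 < 2 * B\<^sup>2 * M" using B M_pos by simp
    fix z :: "real \<times> real" assume z: "z \<in> cstrip"
    have "(fb e z)\<^sup>2 \<le> B\<^sup>2" "(fa z)\<^sup>2 \<le> B\<^sup>2"
      using B(2)[OF z] B(1) abs_le_square_iff[of "fb e z" B] abs_le_square_iff[of "fa z" B] by auto
    then have "\<bar>(fb e z)\<^sup>2 - (fa z)\<^sup>2\<bar> \<le> 2 * B\<^sup>2"
      using zero_le_power2[of "fb e z"] zero_le_power2[of "fa z"] by (simp only: abs_le_iff) linarith
    then show "\<bar>Phi_p e z\<bar> \<le> 2 * B\<^sup>2 * M"
      unfolding Phi_p_def abs_mult using bounds(3)[OF z] M_pos by (intro mult_mono) auto
  qed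
qed

lemma Phi_0 [simp]: "Phi e (q, 0) = 0" by (simp add: Phi_def)

lemma Phi_bound: assumes e: "e0 < e" shows "\<exists>B>0. \<forall>z\<in>cstrip. \<bar>Phi e z\<bar> \<le> B"
proof -
  obtain B where B: "B > 0" "\<And>z. z \<in> cstrip \<Longrightarrow> \<bar>Phi_p e z\<bar> \<le> B" using Phi_p_bound[OF e] by blast
  have "\<bar>Phi e (q, p)\<bar> \<le> B" if p: "p \<in> {0..1}" for q p
  proof -
    have "\<bar>Phi e (q, p) - Phi e (q, 0)\<bar> \<le> B * \<bar>p - 0\<bar>"
      by (rule lipschitz_of_bounded_deriv[of "{0..1}" _ "\<lambda>p. Phi_p e (q, p)"]) (use p B Phi_deriv_p in auto)
    also have "\<dots> \<le> B * 1" using B p by (intro mult_left_mono) auto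
    finally show ?thesis by simp
  qed
  then show ?thesis using B by auto
qed

text \<open>Rescaling every column to the unit interval fixes the domain of integration, so joint
  continuity follows from that of the integrand.\<close>

lemma Phi_cont: assumes e: "e0 < e" shows "continuous_on cstrip (Phi e)"
proof -
  have c: "continuous_on (UNIV \<times> {0..1}) (\<lambda>(q, p). Phi_p e (q, p * s))" if "s \<in> {0..1}" for s
    unfolding case_prod_beta
    by (rule continuous_on_compose2[OF cont_Phi_p]) (use that in \<open>auto intro!: continuous_intros simp: mult_le_one\<close>)
  have eq: "Phi e z = snd z * integral (cbox 0 1) (\<lambda>s. Phi_p e (fst z, snd z * s))" if z: "z \<in> cstrip" for z
  proof (cases "snd z = 0")
    case True then show ?thesis by (simp add: Phi_def)
  next
    case False
    have "((\<lambda>s. snd z *\<^sub>R Phi_p e (fst z, snd z * s)) has_integral integral {snd z * 0..snd z * 1} (\<lambda>s. Phi_p e (fst z, s))) {0..1}"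
    proof (rule has_integral_substitution[where c = 0 and d = 1])
      show "(\<lambda>s. snd z * s) ` {0..1} \<subseteq> {0..1}" using z by (auto simp: mult_le_one)
      show "continuous_on {0..1} (\<lambda>s. Phi_p e (fst z, s))" by (rule sect_cont[OF cont_Phi_p])
    qed (use z in \<open>auto intro!: derivative_eq_intros\<close>)
    from integral_unique[OF this] show ?thesis by (simp add: Phi_def)
  qed
  have "continuous_on cstrip (\<lambda>z. snd z * integral (cbox 0 1) (\<lambda>s. Phi_p e (fst z, snd z * s)))"
  proof (intro continuous_intros)
    show "continuous_on cstrip (\<lambda>z. integral (cbox 0 1) (\<lambda>s. Phi_p e (fst z, snd z * s)))"
    proof (rule integral_continuous_on_param)
      show "continuous_on (cstrip \<times> cbox 0 1) (\<lambda>(z, s). Phi_p e (fst z, snd z * s))"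
        unfolding case_prod_beta
        by (rule continuous_on_compose2[OF cont_Phi_p]) (auto intro!: continuous_intros simp: mult_le_one)
    qed
  qed
  then show ?thesis by (rule continuous_on_eq) (simp add: eq)
qed

text \<open>The source in \<open>flux_equation\<close> is quadratic in \<open>fa\<close>,
  \<open>fb\<close>, but so is the gradient of \<open>Phi\<close>. By
  \<open>sum_sq_le_double_products\<close> the source is at most a multiple of that gradient, and a
  maximum principle becomes available for every \<open>e\<close>.\<close>

lemma Phi_sol: assumes e: "e0 < e"
  shows "\<exists>K\<ge>1 + M\<^sup>2. elliptic_op.ell_sol strip (\<lambda>z. (hp z)\<^sup>2) (\<lambda>z. - hp z * hq z) (\<lambda>z. 1 + (hq z)\<^sup>2) K
    (Phi e) (Phi_q e) (Phi_p e) (Phi_qq e) (Phi_qp e) (Phi_pp e)"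
proof -
  obtain N where N: "0 < N" "\<And>p. p \<in> {0..1} \<Longrightarrow> \<bar>\<omega> p\<bar> \<le> N" using omega_bound by blast
  obtain B where B: "0 < B" "\<And>p. p \<in> {0..1} \<Longrightarrow> 1 / V e p \<le> B" using V_bounds[OF e] by blast
  define L where "L = M\<^sup>2 * N"
  have L: "L > 0" using N M_pos by (simp add: L_def)
  define K where "K = 1 + M\<^sup>2 + 2 * L * B + (2 * L * B * ((M + 1) / c0) + L)"
  have K: "1 + M\<^sup>2 \<le> K" "2 * L * B \<le> K" "2 * L * B * ((M + 1) / c0) + L \<le> K"
    using L B M_pos c0 by (auto simp: K_def intro!: add_increasing add_nonneg_nonneg)
  interpret elliptic_op strip "\<lambda>z. (hp z)\<^sup>2" "\<lambda>z. - hp z * hq z" "\<lambda>z. 1 + (hq z)\<^sup>2" K ec_const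
    by (rule elliptic[OF open_strip order_refl K(1)])
  show ?thesis
  proof (intro exI[of _ K] conjI K(1))
    show "ell_sol (Phi e) (Phi_q e) (Phi_p e) (Phi_qq e) (Phi_qp e) (Phi_pp e)"
      unfolding ell_sol_def
    proof (intro conjI Phi_C2[OF e] ballI)
      fix z :: "real \<times> real" assume z: "z \<in> strip"
      have p: "snd z \<in> {0..1}" using z by auto
      have hp: "0 < hp z" "c0 \<le> hp z" "hp z \<le> M" "\<bar>hq z\<bar> \<le> M"
        using bounds[OF strip_cstrip[OF z]] hp_pos[OF strip_cstrip[OF z]] hp_ge[OF strip_cstrip[OF z]] by auto
      define a b where "a = fa z" and "b = fb e z"
      have eq: "(hp z)\<^sup>2 * Phi_qq e z + 2 * (- hp z * hq z) * Phi_qp e z + (1 + (hq z)\<^sup>2) * Phi_pp e z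
        = (hp z)\<^sup>2 * (- 2 * (- \<omega> (snd z) / V e (snd z)) * ((fa z)\<^sup>2 + (fb e z)\<^sup>2)) + \<omega> (snd z) * (hp z)\<^sup>2 * (((fb e z)\<^sup>2 - (fa z)\<^sup>2) * hp z)"
      proof (rule flux_equation[where v = "V e (snd z)" and vd = "- \<omega> (snd z) / V e (snd z)" and o' = "\<omega> (snd z)" and k = "1 / hp z"])
        show "1 / hp z * hp z = 1" using hp by simp
        show "V e (snd z) * (- \<omega> (snd z) / V e (snd z)) = - \<omega> (snd z)" using V_pos[OF e p] by simp
        show "(hp z)\<^sup>2 * hqq z - 2 * hp z * hq z * hqp z + (1 + (hq z)\<^sup>2) * hpp z = \<omega> (snd z) * hp z ^ 3" by (rule pde[OF z])
      qed (simp_all only: fa_def fb_def fa_q_def fa_p_def fb_q_def fb_p_def Phi_qq_def Phi_qp_def Phi_pp_def)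
      have eq2: "(hp z)\<^sup>2 * Phi_qq e z + 2 * (- hp z * hq z) * Phi_qp e z + (1 + (hq z)\<^sup>2) * Phi_pp e z
        = 2 * ((hp z)\<^sup>2 * \<omega> (snd z)) * (1 / V e (snd z)) * (a\<^sup>2 + b\<^sup>2) + ((hp z)\<^sup>2 * \<omega> (snd z)) * Phi_p e z"
        unfolding eq a_def b_def Phi_p_def by (simp add: algebra_simps add_divide_distrib)
      have L1: "\<bar>(hp z)\<^sup>2 * \<omega> (snd z)\<bar> \<le> L"
        unfolding L_def abs_mult using hp N p M_pos by (intro mult_mono) (auto simp: abs_of_nonneg power_mono)
      have XY: "2 * a * b = Phi_q e z - hq z / hp z * Phi_p e z" "b\<^sup>2 - a\<^sup>2 = 1 / hp z * Phi_p e z"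
        using hp by (simp_all add: Phi_q_def Phi_p_def a_def b_def)
      have hb: "\<bar>hq z / hp z\<bar> \<le> M / c0" "\<bar>1 / hp z\<bar> \<le> 1 / c0"
        using hp c0 M_pos by (auto simp: abs_divide intro!: frac_le)
      have "a\<^sup>2 + b\<^sup>2 \<le> \<bar>2 * a * b\<bar> + \<bar>b\<^sup>2 - a\<^sup>2\<bar>" by (rule sum_sq_le_double_products)
      also have "\<dots> \<le> (\<bar>Phi_q e z\<bar> + \<bar>hq z / hp z * Phi_p e z\<bar>) + \<bar>1 / hp z * Phi_p e z\<bar>"
        unfolding XY by (intro add_right_mono abs_triangle_ineq4)
      also have "\<dots> \<le> (\<bar>Phi_q e z\<bar> + M / c0 * \<bar>Phi_p e z\<bar>) + 1 / c0 * \<bar>Phi_p e z\<bar>"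
        unfolding abs_mult using hb by (intro add_mono mult_right_mono) auto
      also have "\<dots> = \<bar>Phi_q e z\<bar> + (M + 1) / c0 * \<bar>Phi_p e z\<bar>" by (simp add: add_divide_distrib algebra_simps)
      finally have ab: "a\<^sup>2 + b\<^sup>2 \<le> \<bar>Phi_q e z\<bar> + (M + 1) / c0 * \<bar>Phi_p e z\<bar>" .
      have iV: "\<bar>1 / V e (snd z)\<bar> \<le> B" using B(2)[OF p] V_pos[OF e p] by simp
      have "\<bar>2 * ((hp z)\<^sup>2 * \<omega> (snd z)) * (1 / V e (snd z)) * (a\<^sup>2 + b\<^sup>2)\<bar> \<le> 2 * L * B * (\<bar>Phi_q e z\<bar> + (M + 1) / c0 * \<bar>Phi_p e z\<bar>)"
        unfolding abs_mult[of _ "a\<^sup>2 + b\<^sup>2"] abs_mult[of _ "1 / V e (snd z)"] abs_mult[of 2]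
        using L1 iV ab L B(1) by (intro mult_mono mult_left_mono) (auto simp: abs_of_nonneg)
      moreover have "\<bar>((hp z)\<^sup>2 * \<omega> (snd z)) * Phi_p e z\<bar> \<le> L * \<bar>Phi_p e z\<bar>"
        unfolding abs_mult[of _ "Phi_p e z"] using L1 by (intro mult_right_mono) auto
      ultimately have "\<bar>(hp z)\<^sup>2 * Phi_qq e z + 2 * (- hp z * hq z) * Phi_qp e z + (1 + (hq z)\<^sup>2) * Phi_pp e z\<bar>
        \<le> 2 * L * B * \<bar>Phi_q e z\<bar> + (2 * L * B * ((M + 1) / c0) + L) * \<bar>Phi_p e z\<bar>"
        unfolding eq2 by (intro order_trans[OF abs_triangle_ineq]) (simp add: algebra_simps)
      also have "\<dots> \<le> K * \<bar>Phi_q e z\<bar> + K * \<bar>Phi_p e z\<bar>"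
        using K by (intro add_mono mult_right_mono) auto
      finally show "\<bar>(hp z)\<^sup>2 * Phi_qq e z + 2 * (- hp z * hq z) * Phi_qp e z + (1 + (hq z)\<^sup>2) * Phi_pp e z\<bar>
        \<le> K * (\<bar>Phi_q e z\<bar> + \<bar>Phi_p e z\<bar>)" by (simp add: algebra_simps)
    qed
  qed
qed

text \<open>Expanding the square of \<open>fb\<close> isolates \<open>V\<close>, whose integral is
  \<open>W e\<close>, and leaves exact derivatives of \<open>h\<close> and \<open>h^2 / 2\<close>.
  Given the flow force, \<open>Phi\<close> on the surface depends on the height alone.\<close>

lemma Phi_top:
  assumes e: "e0 < e"
  shows "Phi e (q, 1) = 2 * (flow_force q - S r e (h (q, 1)))"
proof -
  have hi: "((\<lambda>p. hp (q, p)) has_integral (h (q, 1) - h (q, 0))) {0..1}"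
    by (rule fundamental_theorem_of_calculus)
      (use deriv_p(1) in \<open>auto simp: has_real_derivative_iff_has_vector_derivative[symmetric]\<close>)
  have hhi: "((\<lambda>p. h (q, p) * hp (q, p)) has_integral ((h (q, 1))\<^sup>2 / 2 - (h (q, 0))\<^sup>2 / 2)) {0..1}"
  proof (rule fundamental_theorem_of_calculus)
    fix p :: real assume p: "p \<in> {0..1}"
    have "((\<lambda>p. (h (q, p))\<^sup>2 / 2) has_real_derivative h (q, p) * hp (q, p)) (at p within {0..1})"
      by (rule DERIV_cong[OF DERIV_cdivide[OF DERIV_power[OF deriv_p(1)[OF p]]]]) simp
    then show "((\<lambda>p. (h (q, p))\<^sup>2 / 2) has_vector_derivative h (q, p) * hp (q, p)) (at p within {0..1})"
      by (simp add: has_real_derivative_iff_has_vector_derivative)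
  qed simp
  have Vi: "(V e has_integral W e) {0..1}"
    unfolding flowW_def by (intro integrable_integral integrable_continuous_real V_cont1)
  have Pi: "((\<lambda>p. Phi_p e (q, p)) has_integral Phi e (q, 1)) {0..1}"
    unfolding Phi_def fst_conv snd_conv by (intro integrable_integral integrable_continuous_real sect_cont cont_Phi_p)
  have "((\<lambda>p. 1/2 * Phi_p e (q, p) + V e p - h (q, p) * hp (q, p) + (\<Omega> 1 + r - e) * hp (q, p)) has_integral
     (1/2 * Phi e (q, 1) + W e - (h (q, 1))\<^sup>2 / 2 + (\<Omega> 1 + r - e) * h (q, 1))) {0..1}"
    using has_integral_add[OF has_integral_diff[OF has_integral_add[OF has_integral_mult_right[OF Pi, of "1/2"] Vi] hhi]
        has_integral_mult_right[OF hi, of "\<Omega> 1 + r - e"]] by (simp add: bottom)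
  then have "((\<lambda>p. ((1 - (hq (q, p))\<^sup>2) / (2 * (hp (q, p))\<^sup>2) - h (q, p) - \<Omega> p + \<Omega> 1 + r) * hp (q, p)) has_integral
     (1/2 * Phi e (q, 1) + W e - (h (q, 1))\<^sup>2 / 2 + (\<Omega> 1 + r - e) * h (q, 1))) {0..1}"
  proof (rule has_integral_eq[rotated])
    fix p :: real assume p: "p \<in> {0..1}"
    have nz: "hp (q, p) > 0" by (rule hp_pos) (use p in simp)
    have Om: "\<Omega> p = e - (V e p)\<^sup>2 / 2" using V_sq[OF e p] by argo
    show "1/2 * Phi_p e (q, p) + V e p - h (q, p) * hp (q, p) + (\<Omega> 1 + r - e) * hp (q, p)
      = ((1 - (hq (q, p))\<^sup>2) / (2 * (hp (q, p))\<^sup>2) - h (q, p) - \<Omega> p + \<Omega> 1 + r) * hp (q, p)"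
      unfolding Om Phi_p_def fa_def fb_def using nz by (simp add: power2_eq_square field_simps)
  qed
  then have "flow_force q = 1/2 * Phi e (q, 1) + W e - (h (q, 1))\<^sup>2 / 2 + (\<Omega> 1 + r - e) * h (q, 1)"
    unfolding flow_force_def by (rule integral_unique)
  then show ?thesis by (simp add: flowS_def algebra_simps)
qed

text \<open>The laminar speed enters only through \<open>V^2\<close>, and Bernoulli's condition
  replaces the squared speed of the wave by the height.\<close>

lemma Phi_q_top:
  assumes e: "e0 < e"
  shows "Phi_q e (q, 1) = 2 * hq (q, 1) * (e - \<Omega> 1 - r + h (q, 1))"
proof -
  have nz: "hp (q, 1) > 0" by (rule hp_pos) simp
  have V2: "(V e 1)\<^sup>2 = 2 * e - 2 * \<Omega> 1" by (rule V_sq[OF e]) simp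
  have B: "(1 + (hq (q, 1))\<^sup>2) / (hp (q, 1))\<^sup>2 = 2 * (r - h (q, 1))"
    using bernoulli[of q] by (simp add: field_simps)
  have "Phi_q e (q, 1) = hq (q, 1) * ((V e 1)\<^sup>2 - (1 + (hq (q, 1))\<^sup>2) / (hp (q, 1))\<^sup>2)"
    unfolding Phi_q_def fa_def fb_def using nz by (simp add: power2_eq_square field_simps)
  then show ?thesis unfolding V2 B by (simp add: algebra_simps)
qed

text \<open>By Bernoulli's condition the derivative of \<open>Phi\<close> along the surface cancels
  that of \<open>S\<close>. Any admissible energy would do, and \<open>em\<close> is one.\<close>

lemma flow_force_const: "flow_force q = flow_force q'"
proof -
  have e: "e0 < em" by (rule em)
  have "((\<lambda>q. flow_force q) has_real_derivative 0) (at q)" for q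
  proof -
    have eq: "flow_force = (\<lambda>q. Phi em (q, 1) / 2 + S r em (h (q, 1)))"
    proof
      fix q show "flow_force q = Phi em (q, 1) / 2 + S r em (h (q, 1))" using Phi_top[OF e, of q] by argo
    qed
    have d: "((\<lambda>q. h (q, 1)) has_real_derivative hq (q, 1)) (at q)" by (rule deriv_q) simp
    have dP: "((\<lambda>q. Phi em (q, 1)) has_real_derivative Phi_q em (q, 1)) (at q)" by (rule Phi_deriv_q[OF e]) simp
    have dS: "((\<lambda>q. S r em (h (q, 1))) has_real_derivative hq (q, 1) * (\<Omega> 1 + r - em - h (q, 1))) (at q)"
      unfolding flowS_def by (auto intro!: derivative_eq_intros d simp: algebra_simps)
    show ?thesis unfolding eq
      by (rule DERIV_cong[OF DERIV_add[OF DERIV_cdivide[OF dP] dS]]) (simp add: Phi_q_top[OF e] field_simps)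
  qed
  then show ?thesis using DERIV_isconst_all by blast
qed

end

abbreviation half_strip :: "real \<Rightarrow> (real \<times> real) set" where
  "half_strip l \<equiv> {z. l < fst z \<and> 0 < snd z \<and> snd z < 1}"

lemma open_half_strip: "open (half_strip l)"
  by (intro open_Collect_conj open_Collect_less continuous_intros)

lemma half_strip_subset: "half_strip l \<subseteq> strip" by auto

context elliptic_op
begin

text \<open>What the gradient term loses when \<open>\<beta>\<close> is subtracted is
  \<open>K * \<bar>\<beta>'\<bar>\<close>, and the convexity of \<open>\<beta>\<close> pays for
  it.\<close>

lemma supersol_minus_barrier:
  assumes f: "supersol f fx fy fxx fxy fyy"
    and \<beta>: "\<And>p. (\<beta> has_real_derivative \<beta>' p) (at p)" "\<And>p. (\<beta>' has_real_derivative \<beta>'' p) (at p)"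
    and ineq: "\<And>z. z \<in> S \<Longrightarrow> K * \<bar>\<beta>' (snd z)\<bar> \<le> C z * \<beta>'' (snd z)"
  shows "supersol (\<lambda>z. f z - \<beta> (snd z)) fx (\<lambda>z. fy z - \<beta>' (snd z)) fxx fxy (\<lambda>z. fyy z - \<beta>'' (snd z))"
  unfolding supersol_def
proof (intro conjI ballI)
  have d: "((\<lambda>z. g (snd z)) has_derivative (\<lambda>v. 0 * fst v + g' (snd z) * snd v)) (at z)"
    if "\<And>p. (g has_real_derivative g' p) (at p)" for g g' :: "real \<Rightarrow> real" and z :: "real \<times> real"
  proof -
    have "(g has_derivative (\<lambda>x. x * g' (snd z))) (at (snd z))"
      using that[of "snd z"] by (simp add: has_field_derivative_def mult_commute_abs)
    from has_derivative_compose[OF has_derivative_snd[OF has_derivative_ident] this]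
    show ?thesis by (simp add: mult.commute)
  qed
  have "C2_data S (\<lambda>z. \<beta> (snd z)) (\<lambda>z. 0) (\<lambda>z. \<beta>' (snd z)) (\<lambda>z. 0) (\<lambda>z. 0) (\<lambda>z. \<beta>'' (snd z))"
    unfolding C2_data_def using d[OF \<beta>(1)] d[OF \<beta>(2)] by simp
  from C2_data_diff[OF supersolD(1)[OF f] this]
  show "C2_data S (\<lambda>z. f z - \<beta> (snd z)) fx (\<lambda>z. fy z - \<beta>' (snd z)) fxx fxy (\<lambda>z. fyy z - \<beta>'' (snd z))"
    by simp
  fix z assume z: "z \<in> S"
  have "A z * fxx z + 2 * B z * fxy z + C z * fyy z \<le> K * (\<bar>fx z\<bar> + \<bar>fy z\<bar>)" by (rule supersolD(2)[OF f z])
  also have "\<dots> \<le> K * (\<bar>fx z\<bar> + (\<bar>fy z - \<beta>' (snd z)\<bar> + \<bar>\<beta>' (snd z)\<bar>))"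
    using K_nonneg abs_triangle_ineq[of "fy z - \<beta>' (snd z)" "\<beta>' (snd z)"] by (intro mult_left_mono add_left_mono) auto
  also have "\<dots> \<le> K * (\<bar>fx z\<bar> + \<bar>fy z - \<beta>' (snd z)\<bar>) + C z * \<beta>'' (snd z)"
    using ineq[OF z] by (simp add: algebra_simps)
  finally show "A z * fxx z + 2 * B z * fxy z + C z * (fyy z - \<beta>'' (snd z)) \<le> K * (\<bar>fx z\<bar> + \<bar>fy z - \<beta>' (snd z)\<bar>)"
    by (simp add: algebra_simps)
qed

text \<open>The Hopf lemma at the two flat boundaries, along the vertical through \<open>x0\<close>.
  A positive value at one interior point of that column gives linear growth from either end.\<close>

lemma vertical_cap:
  assumes f: "supersol f fx fy fxx fxy fyy" and S: "S = half_strip l"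
    and cont: "continuous_on ({l..} \<times> {0..1}) f"
    and nonneg: "\<And>x y. l \<le> x \<Longrightarrow> 0 \<le> y \<Longrightarrow> y \<le> 1 \<Longrightarrow> 0 \<le> f (x, y)"
    and x0: "l < x0" and p1: "0 < p1" "p1 < 1" and pos: "0 < f (x0, p1)"
  shows "\<exists>\<epsilon>>0. \<forall>t\<in>{0..1 - p1}. \<epsilon> * t \<le> f (x0, 1 - t)"
    and "\<exists>\<epsilon>>0. \<forall>t\<in>{0..p1}. \<epsilon> * t \<le> f (x0, t)"
proof -
  have main: "\<exists>\<epsilon>>0. \<forall>t\<in>{0..t1}. \<epsilon> * t \<le> f (fst (x0, y0) + t * 0, snd (x0, y0) + t * e)"
    if e: "e = 1 \<or> e = - 1" and t1: "0 < t1" "0 < f (x0, y0 + t1 * e)"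
      and seg: "\<And>t. 0 \<le> t \<Longrightarrow> t \<le> t1 \<Longrightarrow> 0 \<le> y0 + e * t \<and> y0 + e * t \<le> 1"
      "\<And>t. 0 < t \<Longrightarrow> t \<le> t1 \<Longrightarrow> 0 < y0 + e * t \<and> y0 + e * t < 1" for e t1 y0
  proof -
    let ?a = "4 * t1 / (x0 - l)\<^sup>2"
    have ee: "e * e = 1" using e by auto
    have key: "l < fst z \<and> (\<exists>t. snd z = y0 + e * t \<and> t = e * (snd z - y0) \<and> 0 \<le> t \<and> t \<le> t1 \<and> (0 < cap_fun (x0, y0) 0 e ?a z \<longrightarrow> 0 < t))"
      if z: "0 \<le> cap_fun (x0, y0) 0 e ?a z" "e * (snd z - y0) \<le> t1" for z
    proof -
      have sq: "(e * (fst z - x0))\<^sup>2 = (fst z - x0)\<^sup>2" by (simp add: power_mult_distrib power2_eq_square[of e] ee)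
      have cf: "cap_fun (x0, y0) 0 e ?a z = e * (snd z - y0) - ?a * (fst z - x0)\<^sup>2"
        using sq by (simp add: cap_fun_def power2_commute[of "0"])
      have a: "0 \<le> ?a * (fst z - x0)\<^sup>2" using t1(1) by (intro mult_nonneg_nonneg divide_nonneg_nonneg) auto
      have "?a * (fst z - x0)\<^sup>2 \<le> t1" using z cf by linarith
      then have "\<bar>fst z - x0\<bar> \<le> (x0 - l) / 2"
        using t1(1) x0 by (intro abs_le_half_if_scaled_square_le[of t1]) auto
      from abs_le_D2[OF this] have "l < fst z" using x0 by argo
      moreover have "snd z = y0 + e * (e * (snd z - y0))" using ee by (simp add: mult.assoc[symmetric])
      moreover have "0 \<le> e * (snd z - y0)" using z(1) cf a by linarith
      moreover have "0 < e * (snd z - y0)" if "0 < cap_fun (x0, y0) 0 e ?a z" using that cf a by linarith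
      ultimately show ?thesis using z(2) by blast
    qed
    show ?thesis
    proof (rule hopf_cap[OF f, where ?a0.0 = ?a and ?T0.0 = "{l..} \<times> {0..1}"])
      show "0\<^sup>2 + e\<^sup>2 = 1" using ee by (simp add: power2_eq_square)
      show "closed ({l..} \<times> {0..1::real})" by (intro closed_Times) auto
      show "z \<in> {l..} \<times> {0..1} \<and> 0 \<le> f z" if "0 \<le> cap_fun (x0, y0) 0 e ?a z"
          "0 * (fst z - fst (x0, y0)) + e * (snd z - snd (x0, y0)) \<le> t1" for z
      proof -
        have k: "l < fst z" "\<exists>t. snd z = y0 + e * t \<and> 0 \<le> t \<and> t \<le> t1" using key[of z] that by auto
        then have "0 \<le> snd z" "snd z \<le> 1" using seg(1) by auto
        then show ?thesis using k(1) nonneg[of "fst z" "snd z"] by (cases z) auto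
      qed
      show "z \<in> S" if "0 < cap_fun (x0, y0) 0 e ?a z"
          "0 * (fst z - fst (x0, y0)) + e * (snd z - snd (x0, y0)) < t1" for z
      proof -
        have k: "l < fst z" "\<exists>t. snd z = y0 + e * t \<and> 0 < t \<and> t \<le> t1" using key[of z] that by auto
        then have "0 < snd z" "snd z < 1" using seg(2) by auto
        then show ?thesis using k(1) by (simp add: S)
      qed
    qed (use t1 x0 cont in auto)
  qed
  show "\<exists>\<epsilon>>0. \<forall>t\<in>{0..1 - p1}. \<epsilon> * t \<le> f (x0, 1 - t)"
    using main[of "-1" "1 - p1" 1] p1 pos by simp
  show "\<exists>\<epsilon>>0. \<forall>t\<in>{0..p1}. \<epsilon> * t \<le> f (x0, t)"
    using main[of 1 p1 0] p1 pos by simp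
qed

end

lemma deriv_nonpos_left_end:
  fixes f :: "real \<Rightarrow> real"
  assumes "(f has_real_derivative d) (at 0 within {0..1})" "0 < P" "P \<le> 1" "\<And>p. 0 < p \<Longrightarrow> p \<le> P \<Longrightarrow> f p \<le> f 0"
  shows "d \<le> 0"
proof (rule ccontr)
  assume "\<not> d \<le> 0"
  then obtain \<delta> where \<delta>: "\<delta> > 0" "\<And>h. 0 < h \<Longrightarrow> 0 + h \<in> {0..1} \<Longrightarrow> h < \<delta> \<Longrightarrow> f 0 < f (0 + h)"
    using has_real_derivative_pos_inc_right[OF assms(1)] by auto
  define h where "h = min P (\<delta> / 2)"
  have "0 < h" "h \<le> P" "h < \<delta>" using assms(2) \<delta>(1) by (auto simp: h_def)
  with \<delta>(2)[of h] assms(3) assms(4)[of h] show False by simp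
qed

text \<open>An approximate form of the first derivative test, since the infimum over a line need not be attained.\<close>
lemma near_minimum:
  fixes f fp :: "real \<times> real \<Rightarrow> real"
  assumes P: "0 < P" "P \<le> 1"
    and der: "\<And>q p. p \<in> {0..1} \<Longrightarrow> ((\<lambda>p. f (q, p)) has_real_derivative fp (q, p)) (at p within {0..1})"
    and lip: "\<And>q x y. x \<in> {0..1} \<Longrightarrow> y \<in> {0..1} \<Longrightarrow> \<bar>fp (q, x) - fp (q, y)\<bar> \<le> C * \<bar>x - y\<bar>"
    and m: "\<And>q p. 0 \<le> p \<Longrightarrow> p \<le> P \<Longrightarrow> m \<le> f (q, p)"
    and inf: "\<And>\<delta>. 0 < \<delta> \<Longrightarrow> \<exists>q. f (q, P) < m + \<delta>" and \<kappa>: "0 < \<kappa>"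
  shows "\<exists>q. fp (q, P) < \<kappa>"
proof -
  have C: "0 \<le> C" using lip[of 0 1 0] by auto
  define t where "t = min P (\<kappa> / (4 * (C + 1)))"
  have t: "0 < t" "t \<le> P" using P \<kappa> C by (auto simp: t_def)
  have "t \<le> \<kappa> / (4 * (C + 1))" by (simp add: t_def)
  then have "t * (4 * (C + 1)) \<le> \<kappa>" using C by (simp add: pos_le_divide_eq)
  then have Ct: "4 * (C * t) \<le> \<kappa>" using t by (simp add: algebra_simps)
  obtain q where q: "f (q, P) < m + t * \<kappa> / 4" using inf[of "t * \<kappa> / 4"] t \<kappa> by auto
  have "fp (q, P) \<le> (t * \<kappa> / 4) / t + C * t"
    by (rule endpoint_deriv_le[OF P(2) t der[of _ q] lip C m[of "P - t" q]]) (use t q in auto)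
  also have "\<dots> < \<kappa>" using t Ct \<kappa> by simp
  finally show ?thesis by blast
qed

section \<open>A priori range of the surface height\<close>

context wave
begin

abbreviation "\<eta> q \<equiv> h (q, 1)"

definition "eta_inf = (INF q. \<eta> q)"

lemma ell_sol_subset:
  assumes "elliptic_op.ell_sol strip (\<lambda>z. (hp z)\<^sup>2) (\<lambda>z. - hp z * hq z) (\<lambda>z. 1 + (hq z)\<^sup>2) K f fx fy fxx fxy fyy"
    and "1 + M\<^sup>2 \<le> K" "open X" "X \<subseteq> strip"
  shows "elliptic_op.ell_sol X (\<lambda>z. (hp z)\<^sup>2) (\<lambda>z. - hp z * hq z) (\<lambda>z. 1 + (hq z)\<^sup>2) K f fx fy fxx fxy fyy"
  using assms(1,4) unfolding elliptic_op.ell_sol_def[OF elliptic[OF open_strip order_refl assms(2)]]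
    elliptic_op.ell_sol_def[OF elliptic[OF assms(3,4,2)]] C2_data_def by blast

lemma wp_lipschitz: assumes e: "e0 < e"
  shows "\<exists>C>0. \<forall>q. \<forall>x\<in>{0..1}. \<forall>y\<in>{0..1}. \<bar>(hp (q, x) - 1 / V e x) - (hp (q, y) - 1 / V e y)\<bar> \<le> C * \<bar>x - y\<bar>"
proof -
  obtain N where N: "0 < N" "\<And>p. p \<in> {0..1} \<Longrightarrow> \<bar>\<omega> p\<bar> \<le> N" using omega_bound by blast
  obtain B where B: "0 < B" "\<And>p. p \<in> {0..1} \<Longrightarrow> 1 / V e p \<le> B" using V_bounds[OF e] by blast
  have b: "\<bar>\<omega> p / V e p ^ 3\<bar> \<le> N * B ^ 3" if p: "p \<in> {0..1}" for p
  proof -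
    have "\<bar>\<omega> p / V e p ^ 3\<bar> = \<bar>\<omega> p\<bar> * (1 / V e p) ^ 3"
      using V_pos[OF e p] by (simp add: abs_mult power_divide)
    also have "\<dots> \<le> N * B ^ 3" using N B p V_pos[OF e p] by (intro mult_mono power_mono) auto
    finally show ?thesis .
  qed
  show ?thesis
  proof (intro exI conjI allI ballI)
    show "0 < M + N * B ^ 3" using M_pos N B by (intro add_pos_pos) auto
    fix q x y :: real assume xy: "x \<in> {0..1}" "y \<in> {0..1}"
    show "\<bar>(hp (q, x) - 1 / V e x) - (hp (q, y) - 1 / V e y)\<bar> \<le> (M + N * B ^ 3) * \<bar>x - y\<bar>"
    proof (rule lipschitz_of_bounded_deriv[of "{0..1}" "\<lambda>p. hp (q, p) - 1 / V e p" "\<lambda>p. hpp (q, p) - \<omega> p / V e p ^ 3"])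
      fix p :: real assume p: "p \<in> {0..1}"
      show "((\<lambda>p. hp (q, p) - 1 / V e p) has_real_derivative hpp (q, p) - \<omega> p / V e p ^ 3) (at p within {0..1})"
        by (intro DERIV_diff deriv_p inv_V_deriv p e)
      show "\<bar>hpp (q, p) - \<omega> p / V e p ^ 3\<bar> \<le> M + N * B ^ 3"
        using abs_triangle_ineq4[of "hpp (q, p)" "\<omega> p / V e p ^ 3"] bounds(6)[of "(q, p)"] b[OF p] p by auto
    qed (use xy in auto)
  qed
qed

lemma w_deriv_p: assumes "e0 < e" "p \<in> {0..1}"
  shows "((\<lambda>p. w e (q, p)) has_real_derivative hp (q, p) - 1 / V e p) (at p within {0..1})"
  unfolding w_def snd_conv by (intro DERIV_diff deriv_p H_deriv assms)

lemma w_bottom: "w e (q, 0) = 0" by (simp add: w_def bottom)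
lemma w_top: "w e (q, 1) = \<eta> q - D e" by (simp add: w_def H_1)

lemma w_bound: assumes e: "e0 < e" and z: "z \<in> cstrip" shows "\<bar>w e z\<bar> \<le> M + D e"
proof -
  have p: "snd z \<in> {0..1}" using z by auto
  have "0 \<le> Hf e (snd z)" using H_strict_mono[OF e, of 0 "snd z"] p by (cases "snd z = 0") auto
  moreover have "Hf e (snd z) \<le> D e" using H_strict_mono[OF e, of "snd z" 1] p by (cases "snd z = 1") (auto simp: H_1)
  ultimately show ?thesis using bounds(1)[OF z] by (auto simp: w_def abs_le_iff)
qed

text \<open>The sign \<open>s\<close> treats minima and maxima together, and \<open>P\<close> may be
  an interior streamline, as in \<open>bottom_speed\<close>.\<close>

lemma w_min_principle:
  assumes e: "e0 < e" and P: "0 < P" "P \<le> 1" and s: "s = 1 \<or> s = - 1"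
    and m: "m \<le> 0" "\<And>q. m \<le> s * w e (q, P)" and p: "0 \<le> p" "p \<le> P"
  shows "m \<le> s * w e (q, p)"
proof -
  obtain K where K: "1 + M\<^sup>2 \<le> K" and sol: "elliptic_op.ell_sol strip (\<lambda>z. (hp z)\<^sup>2) (\<lambda>z. - hp z * hq z) (\<lambda>z. 1 + (hq z)\<^sup>2) K
    (w e) hq (\<lambda>z. hp z - 1 / V e (snd z)) hqq hqp (\<lambda>z. hpp z - \<omega> (snd z) / V e (snd z) ^ 3)"
    using w_sol[OF e] by blast
  interpret E: elliptic_op strip "\<lambda>z. (hp z)\<^sup>2" "\<lambda>z. - hp z * hq z" "\<lambda>z. 1 + (hq z)\<^sup>2" K ec_const
    by (rule elliptic[OF open_strip order_refl K(1)])
  have "\<exists>fx fy fxx fxy fyy. E.supersol (w e) fx fy fxx fxy fyy"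
    by (intro exI) (rule E.ell_sol_supersol[OF sol])
  moreover have "\<exists>fx fy fxx fxy fyy. E.supersol (\<lambda>z. - w e z) fx fy fxx fxy fyy"
    by (intro exI) (rule E.ell_sol_supersol[OF E.ell_sol_uminus[OF sol]])
  ultimately have "\<exists>fx fy fxx fxy fyy. E.supersol (\<lambda>z. s * w e z) fx fy fxx fxy fyy"
    using s by (elim disjE) simp_all
  then obtain fx fy fxx fxy fyy where super: "E.supersol (\<lambda>z. s * w e z) fx fy fxx fxy fyy" by blast
  show ?thesis
  proof (rule E.min_principle[OF super P(1)])
    show "(x, y) \<in> strip" if "0 < y" "y < P" for x y using that P by auto
    show "continuous_on (UNIV \<times> {0..P}) (\<lambda>z. s * w e z)"
      using P by (intro continuous_intros continuous_on_subset[OF w_cont[OF e]]) auto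
    show "- (M + D e) \<le> s * w e (x, y)" if "0 \<le> y" "y \<le> P" for x y
      using w_bound[OF e, of "(x, y)"] that P s by (auto simp: abs_le_iff)
    show "m \<le> s * w e (x, 0)" for x using m(1) by (simp add: w_bottom)
  qed (use m p in auto)
qed

lemma eta_ge: "c0 \<le> \<eta> q"
proof -
  have hi: "((\<lambda>p. hp (q, p)) has_integral (h (q, 1) - h (q, 0))) {0..1}"
    by (rule fundamental_theorem_of_calculus)
      (use deriv_p(1) in \<open>auto simp: has_real_derivative_iff_has_vector_derivative[symmetric]\<close>)
  have "((\<lambda>p::real. c0) has_integral c0) {0..1}" using has_integral_const_real[of c0 0 1] by simp
  from has_integral_le[OF this hi] hp_ge show ?thesis by (simp add: bottom)
qed

lemma eta_bdd: "bdd_below (range \<eta>)" using eta_ge by (auto intro: bdd_belowI[of _ c0])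

lemma eta_inf_le: "eta_inf \<le> \<eta> q" unfolding eta_inf_def by (intro cINF_lower eta_bdd) auto

lemma eta_inf_pos: "0 < eta_inf"
proof -
  have "c0 \<le> eta_inf" unfolding eta_inf_def by (intro cINF_greatest) (auto intro: eta_ge)
  then show ?thesis using c0 by linarith
qed

lemma eta_inf_approx: assumes "0 < \<delta>" shows "\<exists>q. \<eta> q < eta_inf + \<delta>"
proof (rule ccontr)
  assume "\<nexists>q. \<eta> q < eta_inf + \<delta>"
  then have "eta_inf + \<delta> \<le> eta_inf" unfolding eta_inf_def by (intro cINF_greatest) (auto simp: not_less)
  then show False using assms by simp
qed

text \<open>Near the argmax \<open>p0\<close> of \<open>\<Omega>\<close> the laminar profiles with \<open>e\<close> close to \<open>e0\<close> are much steeper than \<open>h\<close>,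
  so \<open>w\<close> cannot have a positive supremum on the line \<open>p = p0\<close>.\<close>
lemma bottom_speed: "\<exists>e1>e0. \<forall>q. hp (q, 0) \<le> 1 / V e1 0"
proof -
  obtain p0 where p0: "p0 \<in> {0..1}" "\<Omega> p0 = e0" by (rule Omega_argmax)
  \<comment> \<open>Chosen so that \<open>1 / V e1 p0 = M + 2\<close>, which exceeds every value of
    \<open>hp\<close> by at least 2.\<close>
  define e1 where "e1 = e0 + 1 / (2 * (M + 2)\<^sup>2)"
  have e1: "e0 < e1" using M_pos by (simp add: e1_def)
  have "V e1 p0 = sqrt ((1 / (M + 2))\<^sup>2)" by (simp add: flowV_def p0 e1_def power_divide)
  then have "V e1 p0 = 1 / (M + 2)" using M_pos by simp
  then have iV: "1 / V e1 p0 = M + 2" by simp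
  have steep: "2 \<le> 1 / V e1 p0 - hp (q, p0)" for q
    using iV bounds(3)[of "(q, p0)"] p0 by (auto simp: abs_le_iff)
  show ?thesis
  proof (intro exI conjI allI)
    show "e0 < e1" by (rule e1)
    fix q
    show "hp (q, 0) \<le> 1 / V e1 0"
    proof (cases "p0 = 0")
      case True then show ?thesis using steep[of q] by simp
    next
      case False
      then have P: "0 < p0" "p0 \<le> 1" using p0 by auto
      define m where "m = (INF q. - w e1 (q, p0))"
      have bdd: "bdd_below (range (\<lambda>q. - w e1 (q, p0)))"
      proof (rule bdd_belowI2)
        fix q show "- (M + D e1) \<le> - w e1 (q, p0)"
          using abs_le_D1[OF w_bound[OF e1, of "(q, p0)"]] p0 by simp
      qed
      have m_le: "m \<le> - w e1 (q, p0)" for q unfolding m_def by (intro cINF_lower bdd) auto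
      have "0 \<le> m"
      proof (rule ccontr)
        assume "\<not> 0 \<le> m"
        then have m0: "m \<le> 0" by simp
        obtain C where C: "C > 0" "\<And>q x y. x \<in> {0..1} \<Longrightarrow> y \<in> {0..1} \<Longrightarrow>
            \<bar>(hp (q, x) - 1 / V e1 x) - (hp (q, y) - 1 / V e1 y)\<bar> \<le> C * \<bar>x - y\<bar>"
          using wp_lipschitz[OF e1] by blast
        have "\<exists>q. (\<lambda>z. - (hp z - 1 / V e1 (snd z))) (q, p0) < 2"
        proof (rule near_minimum[OF P, where f = "\<lambda>z. - w e1 z" and C = C and m = m])
          show "((\<lambda>p. - w e1 (q, p)) has_real_derivative - (hp (q, p) - 1 / V e1 (snd (q, p)))) (at p within {0..1})"
            if "p \<in> {0..1}" for q p using DERIV_minus[OF w_deriv_p[OF e1 that]] by simp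
          show "\<bar>- (hp (q, x) - 1 / V e1 (snd (q, x))) - - (hp (q, y) - 1 / V e1 (snd (q, y)))\<bar> \<le> C * \<bar>x - y\<bar>"
            if "x \<in> {0..1}" "y \<in> {0..1}" for q x y
            using C(2)[OF that, of q] by (simp add: abs_minus_commute)
          show "m \<le> - w e1 (q, p)" if "0 \<le> p" "p \<le> p0" for q p
            using w_min_principle[OF e1 P, of "-1" m p q] m0 m_le that by simp
          show "\<exists>q. - w e1 (q, p0) < m + \<delta>" if "0 < \<delta>" for \<delta>
          proof (rule ccontr)
            assume "\<nexists>q. - w e1 (q, p0) < m + \<delta>"
            then have "m + \<delta> \<le> m" unfolding m_def by (intro cINF_greatest) (auto simp: not_less)
            then show False using that by simp
          qed
        qed simp
        then show False using steep by (auto simp: not_less[symmetric])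
      qed
      then have "0 \<le> - w e1 (q, p0)" for q using m_le[of q] by linarith
      then have neg: "w e1 (q, p) \<le> w e1 (q, 0)" if "0 < p" "p \<le> p0" for p
        using w_min_principle[OF e1 P, of "-1" 0 p q] that by (simp add: w_bottom)
      have "hp (q, 0) - 1 / V e1 0 \<le> 0"
        by (rule deriv_nonpos_left_end[OF w_deriv_p[OF e1] P neg]) auto
      then show ?thesis by simp
    qed
  qed
qed

text \<open>If the surface dips below \<open>D e\<close>, the infimum of \<open>w e\<close> sits on
  the surface, so at almost minimal points \<open>hp\<close> exceeds \<open>1 / V e 1\<close> by
  arbitrarily little. Bernoulli's condition with \<open>\<eta> \<ge> eta_inf\<close> bounds
  \<open>hp\<close> below by \<open>1 / sqrt (2 * (r - eta_inf))\<close>, and the two are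
  incompatible unless the claim holds.\<close>

lemma eta_inf_le_flow: assumes e: "e0 < e" and lt: "eta_inf < D e" shows "eta_inf \<le> \<Omega> 1 + r - e"
proof (rule ccontr)
  assume "\<not> eta_inf \<le> \<Omega> 1 + r - e"
  then have lt2: "r - eta_inf < e - \<Omega> 1" by simp
  have V2: "(V e 1)\<^sup>2 = 2 * (e - \<Omega> 1)" using V_sq[OF e, of 1] by simp
  have Vp: "0 < V e 1" by (rule V_pos[OF e]) simp
  have hp2: "1 \<le> 2 * (r - eta_inf) * (hp (q, 1))\<^sup>2" for q
  proof -
    have pos: "0 < (hp (q, 1))\<^sup>2" using hp_pos[of "(q, 1)"] by simp
    have "(1 + (hq (q, 1))\<^sup>2) / (2 * (hp (q, 1))\<^sup>2) \<le> r - eta_inf" using bernoulli[of q] eta_inf_le[of q] by simp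
    then have *: "1 + (hq (q, 1))\<^sup>2 \<le> (r - eta_inf) * (2 * (hp (q, 1))\<^sup>2)" using pos by (simp add: divide_le_eq)
    have "1 \<le> 1 + (hq (q, 1))\<^sup>2" by simp
    also note *
    finally show ?thesis by (simp add: algebra_simps)
  qed
  have rp: "0 < r - eta_inf"
  proof (rule ccontr)
    assume "\<not> 0 < r - eta_inf"
    then have "2 * (r - eta_inf) \<le> 0" by simp
    then have "2 * (r - eta_inf) * (hp (0, 1))\<^sup>2 \<le> 0" by (rule mult_nonpos_nonneg) simp
    then show False using hp2[of 0] by linarith
  qed
  \<comment> \<open>The uniform gap by which Bernoulli's condition forces \<open>hp\<close> above
    the laminar slope on the surface.\<close>
  define \<kappa> where "\<kappa> = 1 / sqrt (2 * (r - eta_inf)) - 1 / V e 1"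
  have sq: "sqrt (2 * (r - eta_inf)) < V e 1"
  proof -
    have "sqrt (2 * (r - eta_inf)) < sqrt (2 * (e - \<Omega> 1))" using lt2 by simp
    then show ?thesis using V2 Vp by (metis abs_of_pos real_sqrt_abs)
  qed
  then have \<kappa>: "0 < \<kappa>" using rp Vp unfolding \<kappa>_def by (simp add: frac_less2)
  have steep: "\<kappa> \<le> hp (q, 1) - 1 / V e 1" for q
  proof -
    have hp0: "0 < hp (q, 1)" by (rule hp_pos) simp
    have "1 \<le> (sqrt (2 * (r - eta_inf)) * hp (q, 1))\<^sup>2"
      using hp2[of q] rp by (simp add: power_mult_distrib)
    then have "1 \<le> sqrt (2 * (r - eta_inf)) * hp (q, 1)"
      using power2_le_imp_le[of 1 "sqrt (2 * (r - eta_inf)) * hp (q, 1)"] hp0 rp by simp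
    then have "1 / sqrt (2 * (r - eta_inf)) \<le> hp (q, 1)" using rp by (simp add: divide_le_eq mult.commute)
    then show ?thesis by (simp add: \<kappa>_def)
  qed
  define m where "m = eta_inf - D e"
  obtain C where C: "C > 0" "\<And>q x y. x \<in> {0..1} \<Longrightarrow> y \<in> {0..1} \<Longrightarrow>
      \<bar>(hp (q, x) - 1 / V e x) - (hp (q, y) - 1 / V e y)\<bar> \<le> C * \<bar>x - y\<bar>"
    using wp_lipschitz[OF e] by blast
  have "\<exists>q. (\<lambda>z. hp z - 1 / V e (snd z)) (q, 1) < \<kappa>"
  proof (rule near_minimum[of 1 "w e" _ C m])
    show "((\<lambda>p. w e (q, p)) has_real_derivative hp (q, p) - 1 / V e (snd (q, p))) (at p within {0..1})"
      if "p \<in> {0..1}" for q p using w_deriv_p[OF e that] by simp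
    show "\<bar>hp (q, x) - 1 / V e (snd (q, x)) - (hp (q, y) - 1 / V e (snd (q, y)))\<bar> \<le> C * \<bar>x - y\<bar>"
      if "x \<in> {0..1}" "y \<in> {0..1}" for q x y using C(2)[OF that, of q] by simp
    show "m \<le> w e (q, p)" if "0 \<le> p" "p \<le> 1" for q p
      using w_min_principle[OF e, of 1 1 m p q] that lt eta_inf_le by (simp add: w_top m_def)
    show "\<exists>q. w e (q, 1) < m + \<delta>" if "0 < \<delta>" for \<delta>
      using eta_inf_approx[OF that] by (auto simp: w_top m_def)
  qed (use \<kappa> in auto)
  then show False using steep by (auto simp: not_less[symmetric])
qed

text \<open>The infimum is itself a laminar depth \<open>D es\<close>. Depths may stay bounded as
  \<open>e\<close> tends to \<open>e0\<close>; it is \<open>bottom_speed\<close> that keeps the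
  infimum from exceeding them. Then \<open>eta_inf_le_flow\<close> at energies just below
  \<open>es\<close> gives \<open>R es \<le> r\<close>, which confines \<open>es\<close> to the
  interval between the conjugate energies.\<close>

lemma eta_inf_range: "D ep \<le> eta_inf" "eta_inf \<le> D em"
proof -
  obtain e1 where e1: "e0 < e1" "\<And>q. hp (q, 0) \<le> 1 / V e1 0" using bottom_speed by blast
  have low: "eta_inf \<le> D e" if e: "e0 < e" "e < e1" for e
  proof (rule ccontr)
    assume "\<not> eta_inf \<le> D e"
    then have "0 \<le> 1 * w e (q, 1)" for q using eta_inf_le[of q] by (simp add: w_top)
    then have "0 \<le> 1 * w e (0, p)" if "0 \<le> p" "p \<le> 1" for p
      by (intro w_min_principle[OF e(1), of 1 1 0 p 0]) (use that in auto)
    then have neg: "- w e (0, p) \<le> - w e (0, 0)" if "0 < p" "p \<le> 1" for p using that by (simp add: w_bottom)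
    have "- (hp (0, 0) - 1 / V e 0) \<le> 0"
      by (rule deriv_nonpos_left_end[OF DERIV_minus[OF w_deriv_p[OF e(1)]] zero_less_one order_refl neg]) auto
    then have "1 / V e 0 \<le> 1 / V e1 0" using e1(2)[of 0] by simp
    moreover have "V e 0 < V e1 0" "0 < V e 0" using V_strict_mono[OF e] V_pos[OF e(1)] by auto
    ultimately show False using frac_less2[of 1 1 "V e 0" "V e1 0"] by simp
  qed
  define ea where "ea = (e0 + e1) / 2"
  have ea: "e0 < ea" "eta_inf \<le> D ea" using e1(1) low[of ea] by (auto simp: ea_def)
  \<comment> \<open>Large enough for \<open>D_le\<close> to give
    \<open>D eb \<le> eta_inf\<close>.\<close>
  define eb where "eb = max ea (e0 + 1 / (2 * eta_inf\<^sup>2))"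
  have eb: "ea \<le> eb" "D eb \<le> eta_inf"
  proof -
    show "ea \<le> eb" by (simp add: eb_def)
    have eb0: "e0 < eb" using ea(1) by (simp add: eb_def)
    have "1 / (2 * eta_inf\<^sup>2) \<le> eb - e0" by (simp add: eb_def le_max_iff_disj)
    then have "(1 / eta_inf)\<^sup>2 \<le> 2 * (eb - e0)" using eta_inf_pos by (simp add: power_divide field_simps)
    then have "1 / eta_inf \<le> sqrt (2 * (eb - e0))" by (rule real_le_rsqrt)
    then have "1 / sqrt (2 * (eb - e0)) \<le> eta_inf" using eta_inf_pos eb0 by (simp add: field_simps)
    then show "D eb \<le> eta_inf" using D_le[OF eb0] by linarith
  qed
  have "{ea..eb} \<subseteq> {e0<..}" using ea(1) by auto
  then have "continuous_on {ea..eb} D" by (rule continuous_on_subset[OF D_cont])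
  then have "\<exists>e\<ge>ea. e \<le> eb \<and> D e = eta_inf" using ea eb by (intro IVT2') auto
  then obtain es where es: "ea \<le> es" "D es = eta_inf" by blast
  have es0: "e0 < es" using ea(1) es(1) by (rule less_le_trans)
  have "R es \<le> r"
  proof (rule ccontr)
    assume "\<not> R es \<le> r"
    then have gt: "r < \<Omega> 1 * 0 + (es - \<Omega> 1 + eta_inf)" by (simp add: flowR_def es)
    define d where "d = (es - \<Omega> 1 + eta_inf - r) / 2"
    have d: "d > 0" using gt by (simp add: d_def)
    \<comment> \<open>Slightly below \<open>es\<close>, so that its depth strictly exceeds
      \<open>eta_inf\<close>, yet close enough for the conclusion of \<open>eta_inf_le_flow\<close>
      to be violated by at least \<open>d\<close>.\<close>
    define e where "e = max (es - d) ((e0 + es) / 2)"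
    have e: "e0 < e" "e < es" "es - d \<le> e"
    proof -
      have "e0 < (e0 + es) / 2" using es0 by simp
      then show "e0 < e" unfolding e_def by (rule less_le_trans) simp
      show "e < es" "es - d \<le> e" using d es0 by (simp_all add: e_def)
    qed
    have "eta_inf < D e" using D_strict_antimono[OF e(1,2)] es by simp
    from eta_inf_le_flow[OF e(1) this] e(3) d show False unfolding d_def by argo
  qed
  from R_le_imp[OF es0 this]
  have *: "em \<le> es" "es \<le> ep" .
  show "D ep \<le> eta_inf" using D_strict_antimono[OF es0, of ep] *(2) es(2) by (cases "es = ep") auto
  show "eta_inf \<le> D em" using D_strict_antimono[OF em(1), of es] *(1) es(2) by (cases "es = em") auto
qed

section \<open>Bounds for the flow force\<close>

abbreviation "F_sub \<equiv> S r em (D em)"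
abbreviation "F_sup \<equiv> S r ep (D ep)"

lemma hq_from_interior: assumes "\<And>z. z \<in> strip \<Longrightarrow> hq z = 0" "z \<in> cstrip" shows "hq z = 0"
proof -
  have "closure strip = cstrip" by (simp add: closure_Times)
  then show ?thesis
    using continuous_constant_on_closure[of strip hq 0 z] conts(2) assms by auto
qed

text \<open>Vanishing \<open>fa\<close> and \<open>fb\<close> give \<open>hq = 0\<close> and
  \<open>hp = 1 / V\<close>, hence the laminar profile; Bernoulli's condition then reads
  \<open>R e = r\<close>.\<close>

lemma laminar_of_flux_zero:
  assumes e: "e0 < e" and ab: "\<And>z. z \<in> strip \<Longrightarrow> fa z = 0" "\<And>z. z \<in> strip \<Longrightarrow> fb e z = 0"
  shows "\<And>q p. p \<in> {0..1} \<Longrightarrow> h (q, p) = Hf e p" "R e = r"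
proof -
  have "hq z = 0" if "z \<in> strip" for z using ab(1)[OF that] hp_nz[OF strip_cstrip[OF that]] by (simp add: fa_def)
  then have hq0: "hq z = 0" if "z \<in> cstrip" for z using hq_from_interior that by blast
  have hV: "1 / hp z - V e (snd z) = 0" if z: "z \<in> cstrip" for z
  proof -
    have "closure strip = cstrip" by (simp add: closure_Times)
    then have "fb e z = 0"
      using continuous_constant_on_closure[of strip "fb e" 0 z] cont_fb ab(2) z by auto
    then show ?thesis by (simp add: fb_def)
  qed
  have hpV: "hp (q, p) = 1 / V e p" if "p \<in> {0..1}" for q p
  proof -
    have "V e p = 1 / hp (q, p)" using hV[of "(q, p)"] that by simp
    then show ?thesis by simp
  qed
  have hp_int: "((\<lambda>s. hp (q, s)) has_integral (h (q, p) - h (q, 0))) {0..p}" if p: "p \<in> {0..1}" for q p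
  proof (rule fundamental_theorem_of_calculus)
    show "0 \<le> p" using p by simp
    fix x assume "x \<in> {0..p}"
    then have x: "x \<in> {0..1}" using p by auto
    have "((\<lambda>s. h (q, s)) has_real_derivative hp (q, x)) (at x within {0..p})"
      by (rule DERIV_subset[OF deriv_p(1)[OF x]]) (use p in auto)
    then show "((\<lambda>s. h (q, s)) has_vector_derivative hp (q, x)) (at x within {0..p})"
      by (simp add: has_real_derivative_iff_has_vector_derivative)
  qed
  show hH: "h (q, p) = Hf e p" if p: "p \<in> {0..1}" for q p
  proof -
    have "integral {0..p} (\<lambda>s. hp (q, s)) = h (q, p)"
      using integral_unique[OF hp_int[OF p]] by (simp add: bottom)
    moreover have "integral {0..p} (\<lambda>s. hp (q, s)) = Hf e p"
      unfolding flowH_def by (rule integral_cong) (use p hpV in auto)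
    ultimately show ?thesis by simp
  qed
  have "r = (V e 1)\<^sup>2 / 2 + D e"
    using bernoulli[of 0] hq0[of "(0, 1)"] hpV[of 1 0] hH[of 1 0] by (simp add: H_1 power_divide)
  then show "R e = r" using V_sq[OF e, of 1] by (simp add: flowR_def)
qed

lemma flux_zero_of_grad_zero:
  assumes "z \<in> strip" "Phi_q e z = 0" "Phi_p e z = 0"
  shows "fa z = 0" "fb e z = 0"
proof -
  have "(fb e z)\<^sup>2 - (fa z)\<^sup>2 = 0" using assms(3) hp_nz[OF strip_cstrip[OF assms(1)]] by (simp add: Phi_p_def)
  moreover from this have "2 * fa z * fb e z = 0" using assms(2) by (simp add: Phi_q_def)
  ultimately show "fa z = 0" "fb e z = 0" by auto
qed

lemma Phi_supersol_half:
  assumes e: "e0 < e"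
  shows "\<exists>K\<ge>1 + M\<^sup>2. \<forall>l. elliptic_op.supersol (half_strip l) (\<lambda>z. (hp z)\<^sup>2) (\<lambda>z. - hp z * hq z) (\<lambda>z. 1 + (hq z)\<^sup>2) K
    (Phi e) (Phi_q e) (Phi_p e) (Phi_qq e) (Phi_qp e) (Phi_pp e)"
proof -
  obtain K where K: "1 + M\<^sup>2 \<le> K" and sol: "elliptic_op.ell_sol strip (\<lambda>z. (hp z)\<^sup>2) (\<lambda>z. - hp z * hq z) (\<lambda>z. 1 + (hq z)\<^sup>2) K
    (Phi e) (Phi_q e) (Phi_p e) (Phi_qq e) (Phi_qp e) (Phi_pp e)"
    using Phi_sol[OF e] by blast
  show ?thesis
    using elliptic_op.ell_sol_supersol[OF elliptic[OF open_half_strip half_strip_subset K]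
        ell_sol_subset[OF sol K open_half_strip half_strip_subset]] K by blast
qed

lemma Phi_minus_const_supersol:
  assumes "1 + M\<^sup>2 \<le> K" "elliptic_op.supersol X (\<lambda>z. (hp z)\<^sup>2) (\<lambda>z. - hp z * hq z) (\<lambda>z. 1 + (hq z)\<^sup>2) K
    (Phi e) (Phi_q e) (Phi_p e) (Phi_qq e) (Phi_qp e) (Phi_pp e)" "open X" "X \<subseteq> strip"
  shows "elliptic_op.supersol X (\<lambda>z. (hp z)\<^sup>2) (\<lambda>z. - hp z * hq z) (\<lambda>z. 1 + (hq z)\<^sup>2) K
    (\<lambda>z. Phi e z - m) (Phi_q e) (Phi_p e) (Phi_qq e) (Phi_qp e) (Phi_pp e)"
  using elliptic_op.supersol_minus_barrier[OF elliptic[OF assms(3,4,1)] assms(2), of "\<lambda>_. m" "\<lambda>_. 0" "\<lambda>_. 0"]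
  by simp

lemma Phi_min_principle:
  assumes e: "e0 < e" and m: "m \<le> 0" "\<And>q. m \<le> Phi e (q, 1)" and p: "0 \<le> p" "p \<le> 1"
  shows "m \<le> Phi e (q, p)"
proof -
  obtain K where K: "1 + M\<^sup>2 \<le> K" and sol: "elliptic_op.ell_sol strip (\<lambda>z. (hp z)\<^sup>2) (\<lambda>z. - hp z * hq z) (\<lambda>z. 1 + (hq z)\<^sup>2) K
    (Phi e) (Phi_q e) (Phi_p e) (Phi_qq e) (Phi_qp e) (Phi_pp e)"
    using Phi_sol[OF e] by blast
  interpret E: elliptic_op strip "\<lambda>z. (hp z)\<^sup>2" "\<lambda>z. - hp z * hq z" "\<lambda>z. 1 + (hq z)\<^sup>2" K ec_const
    by (rule elliptic[OF open_strip order_refl K(1)])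
  obtain B where B: "\<And>z. z \<in> cstrip \<Longrightarrow> \<bar>Phi e z\<bar> \<le> B" using Phi_bound[OF e] by blast
  show ?thesis
  proof (rule E.min_principle[OF E.ell_sol_supersol[OF sol] zero_less_one])
    show "- B \<le> Phi e (x, y)" if "0 \<le> y" "y \<le> 1" for x y
      using abs_le_D2[OF B[of "(x, y)"]] that by simp
  qed (use m p Phi_cont[OF e] in auto)
qed

text \<open>The comparison flow changes with the column: it has the bottom speed of the wave at
  \<open>(q, 0)\<close>, so \<open>Phi_p\<close> vanishes there. A flow force of at least
  \<open>F_sub\<close> makes \<open>Phi\<close> nonnegative, by \<open>S_le_F_plus\<close> on the
  surface and the minimum principle inside. The Hopf lemma at the bottom then leaves only
  \<open>Phi = 0\<close> on the column above \<open>q\<close>, and at these interior minima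
  \<open>fa\<close> and \<open>fb\<close> vanish.\<close>

lemma upper_bound:
  assumes F: "F_sub \<le> flow_force 0"
  shows "flow_force 0 = F_sub" "\<And>q p. p \<in> {0..1} \<Longrightarrow> h (q, p) = Hf em p"
proof -
  obtain e1 where e1: "e0 < e1" "\<And>q. hp (q, 0) \<le> 1 / V e1 0" using bottom_speed by blast
  define es where "es q = 1 / (2 * (hp (q, 0))\<^sup>2)" for q
  have V0: "V (es q) 0 = 1 / hp (q, 0)" for q
    using hp_pos[of "(q, 0)"] by (simp add: flowV_def es_def Omega_0 real_sqrt_divide)
  \<comment> \<open>\<open>bottom_speed\<close> ensures that a laminar flow with this bottom speed
    exists, with energy at least \<open>e1\<close>.\<close>
  have es: "e0 < es q" for q
  proof -
    have hp: "0 < hp (q, 0)" by (rule hp_pos) simp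
    have V1: "0 < V e1 0" by (rule V_pos[OF e1(1)]) simp
    have "V e1 0 \<le> 1 / hp (q, 0)" using e1(2)[of q] hp V1 by (simp add: field_simps)
    then have "(V e1 0)\<^sup>2 \<le> (1 / hp (q, 0))\<^sup>2" using V1 by (intro power_mono) auto
    moreover have "(V e1 0)\<^sup>2 = 2 * e1" using V_sq[OF e1(1), of 0] by (simp add: Omega_0)
    ultimately have "e1 \<le> es q" by (simp add: es_def power_divide)
    then show ?thesis using e1(1) by (rule less_le_trans[rotated])
  qed
  have zero: "fa (q, p) = 0 \<and> fb (es q) (q, p) = 0" if p: "0 < p" "p < 1" for q p
  proof -
    have top: "0 \<le> Phi (es q) (x, 1)" for x
    proof -
      have "D ep \<le> \<eta> x" using eta_inf_range(1) eta_inf_le[of x] by linarith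
      from S_le_F_plus[OF es[of q] this] F flow_force_const[of x 0]
      show ?thesis by (simp add: Phi_top[OF es])
    qed
    have nonneg: "0 \<le> Phi (es q) (x, y)" if "0 \<le> y" "y \<le> 1" for x y
      by (rule Phi_min_principle[OF es order_refl top that])
    obtain K where K: "1 + M\<^sup>2 \<le> K" and super: "\<And>l. elliptic_op.supersol (half_strip l) (\<lambda>z. (hp z)\<^sup>2) (\<lambda>z. - hp z * hq z) (\<lambda>z. 1 + (hq z)\<^sup>2) K
      (Phi (es q)) (Phi_q (es q)) (Phi_p (es q)) (Phi_qq (es q)) (Phi_qp (es q)) (Phi_pp (es q))"
      using Phi_supersol_half[OF es[of q]] by blast
    let ?l = "q - 1"
    interpret E: elliptic_op "half_strip ?l" "\<lambda>z. (hp z)\<^sup>2" "\<lambda>z. - hp z * hq z" "\<lambda>z. 1 + (hq z)\<^sup>2" K ec_const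
      by (rule elliptic[OF open_half_strip half_strip_subset K])
    have "Phi (es q) (q, p) = 0"
    proof (rule ccontr)
      assume "Phi (es q) (q, p) \<noteq> 0"
      then have pos: "0 < Phi (es q) (q, p)" using nonneg[of p q] p by simp
      have "continuous_on ({?l..} \<times> {0..1}) (Phi (es q))" by (rule continuous_on_subset[OF Phi_cont[OF es]]) auto
      from E.vertical_cap(2)[OF super refl this _ _ p pos] nonneg
      obtain \<epsilon> where \<epsilon>: "0 < \<epsilon>" "\<And>t. t \<in> {0..p} \<Longrightarrow> \<epsilon> * t \<le> Phi (es q) (q, t)" by auto
      have "Phi_p (es q) (q, 0) = 0"
        by (simp add: Phi_p_def fa_def fb_def hq_bottom V0)
      then have "((\<lambda>t. Phi (es q) (q, t)) has_real_derivative 0) (at 0 within {0..1})"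
        using Phi_deriv_p[of 0 "es q" q] by simp
      then have d: "((\<lambda>t. \<epsilon> * t - Phi (es q) (q, t)) has_real_derivative \<epsilon> * 1 - 0) (at 0 within {0..1})"
        by (intro DERIV_diff DERIV_cmult DERIV_ident)
      have "\<epsilon> * 1 - 0 \<le> 0"
        by (rule deriv_nonpos_left_end[OF d p(1)]) (use p \<epsilon>(2) in auto)
      then show False using \<epsilon>(1) by simp
    qed
    have z: "(q, p) \<in> strip" using p by simp
    have ev: "eventually (\<lambda>w. Phi (es q) (q, p) \<le> Phi (es q) w) (nhds (q, p))"
      using eventually_nhds_in_open[OF open_strip z]
      by eventually_elim (use nonneg \<open>Phi (es q) (q, p) = 0\<close> in auto)
    have "Phi_q (es q) (q, p) = 0" "Phi_p (es q) (q, p) = 0"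
      using hessian_at_local_min[OF Phi_C2[OF es] open_strip z ev] by auto
    from flux_zero_of_grad_zero[OF z this] show ?thesis by blast
  qed
  \<comment> \<open>\<open>fa\<close> does not involve the energy, so its vanishing column by column
    gives \<open>hq = 0\<close> throughout; consequently all energies \<open>es q\<close>
    coincide.\<close>
  have hq0: "hq z = 0" if "z \<in> cstrip" for z
  proof (rule hq_from_interior[OF _ that])
    fix z :: "real \<times> real" assume z: "z \<in> strip"
    have "fa z = 0" using zero[of "snd z" "fst z"] z by auto
    then show "hq z = 0" using hp_nz[OF strip_cstrip[OF z]] by (simp add: fa_def)
  qed
  have hconst: "h (q, p) = h (0, p)" if p: "p \<in> {0..1}" for q p
  proof -
    have "((\<lambda>q. h (q, p)) has_real_derivative 0) (at x)" for x
      using deriv_q(1)[OF p, of x] hq0[of "(x, p)"] p by simp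
    then show ?thesis using DERIV_isconst_all[of "\<lambda>q. h (q, p)"] by blast
  qed
  have hp0: "hp (q, 0) = hp (0, 0)" for q
  proof -
    have "((\<lambda>p. h (q, p)) has_real_derivative hp (q, 0)) (at 0 within {0..1})" by (rule deriv_p) simp
    moreover have "((\<lambda>p. h (0, p)) has_real_derivative hp (0, 0)) (at 0 within {0..1})" by (rule deriv_p) simp
    then have "((\<lambda>p. h (q, p)) has_real_derivative hp (0, 0)) (at 0 within {0..1})"
      by (rule has_field_derivative_transform_within[OF _ zero_less_one]) (simp, rule hconst[symmetric])
    ultimately show ?thesis
      using vector_derivative_unique_within_closed_interval[of 0 1 0 "\<lambda>p. h (q, p)" "hp (q, 0)" "hp (0, 0)"]
      by (simp add: has_real_derivative_iff_has_vector_derivative)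
  qed
  have esc: "es q = es 0" for q by (simp add: es_def hp0[of q])
  have ab: "fa z = 0" "fb (es 0) z = 0" if "z \<in> strip" for z
    using zero[of "snd z" "fst z"] that esc[of "fst z"] by auto
  note lam = laminar_of_flux_zero[OF es[of 0] ab]
  have F0: "flow_force 0 = S r (es 0) (D (es 0))"
  proof -
    have "Phi (es 0) (0, 1) = 0"
    proof -
      have "Phi_p (es 0) (0, s) = 0" if "s \<in> {0<..<1}" for s
        using ab[of "(0, s)"] that by (simp add: Phi_p_def)
      then have "Phi_p (es 0) (0, s) = 0" if "s \<in> {0..1}" for s
        using continuous_constant_on_closure[of "{0<..<1}" "\<lambda>s. Phi_p (es 0) (0, s)" 0 s] sect_cont[OF cont_Phi_p] that
        by auto
      then have "integral {0..1} (\<lambda>s. Phi_p (es 0) (0, s)) = integral {0..1} (\<lambda>s::real. 0)"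
        by (intro integral_cong) auto
      then show ?thesis by (simp add: Phi_def)
    qed
    then show ?thesis using Phi_top[OF es[of 0], of 0] lam(1)[of 1 0] by (simp add: H_1)
  qed
  \<comment> \<open>Both conjugate flows satisfy \<open>R e = r\<close>, but the supercritical one
    has too small a flow force.\<close>
  have "es 0 = em"
    using R_eq_imp[OF es lam(2)] F0 F F_minus_less_F_plus by auto
  then show "flow_force 0 = F_sub" "\<And>q p. p \<in> {0..1} \<Longrightarrow> h (q, p) = Hf em p"
    using F0 lam(1) by auto
qed

lemma eta_deriv_sq: assumes "\<And>q. m \<le> \<eta> q" shows "(hq (q, 1))\<^sup>2 \<le> 4 * M * (\<eta> q - m)"
proof (rule deriv_sq_le[of "\<lambda>q. \<eta> q" "\<lambda>q. hq (q, 1)"])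
  show "((\<lambda>q. \<eta> q) has_real_derivative hq (x, 1)) (at x)" for x by (rule deriv_q) simp
  show "\<bar>hq (x, 1) - hq (y, 1)\<bar> \<le> M * \<bar>x - y\<bar>" for x y
    by (rule lipschitz_of_bounded_deriv[of UNIV "\<lambda>q. hq (q, 1)" "\<lambda>q. hqq (q, 1)"])
      (auto intro!: deriv_q bounds)
qed (use assms M_pos in auto)

text \<open>\<open>\<Omega> 1 + r - y\<close> is the energy \<open>e\<close> for which the parabola
  \<open>S r e\<close> has its vertex at height \<open>y\<close>.\<close>

lemma conjugate_param:
  assumes "D ep \<le> y" "y \<le> D em"
  shows "em \<le> \<Omega> 1 + r - y" "\<Omega> 1 + r - y \<le> ep"
  using assms depth_from_R[OF em(3)] depth_from_R[OF ep(2)] by linarith+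

lemma Phi_top_G:
  assumes "e0 < \<Omega> 1 + r - y"
  shows "Phi (\<Omega> 1 + r - y) (q, 1) = 2 * (flow_force q - G r (\<Omega> 1 + r - y)) + (\<eta> q - y)\<^sup>2"
  using Phi_top[OF assms, of q] by (simp add: flowS_eq_G algebra_simps)

text \<open>With \<open>e = \<Omega> 1 + r - inf \<eta>\<close> the flux function on the surface is smallest exactly where \<open>\<eta>\<close> is, and there
  the Hopf lemma contradicts \<open>\<Phi>\<^sub>p \<ge> - h\<^sub>q\<^sup>2 / h\<^sub>p\<close>.\<close>
lemma lower_bound: "G r (\<Omega> 1 + r - eta_inf) \<le> flow_force 0"
proof (rule ccontr)
  assume neg: "\<not> G r (\<Omega> 1 + r - eta_inf) \<le> flow_force 0"
  define e where "e = \<Omega> 1 + r - eta_inf"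
  have e: "e0 < e" using conjugate_param(1)[OF eta_inf_range] em(1) by (simp add: e_def)
  define m where "m = 2 * (flow_force 0 - G r e)"
  have m: "m < 0" using neg by (simp add: m_def e_def)
  have top: "Phi e (q, 1) = m + (\<eta> q - eta_inf)\<^sup>2" for q
    using Phi_top_G[of eta_inf q] e flow_force_const[of q 0] by (simp add: e_def m_def)
  obtain K where K: "1 + M\<^sup>2 \<le> K" and sol: "elliptic_op.ell_sol strip (\<lambda>z. (hp z)\<^sup>2) (\<lambda>z. - hp z * hq z) (\<lambda>z. 1 + (hq z)\<^sup>2) K
    (Phi e) (Phi_q e) (Phi_p e) (Phi_qq e) (Phi_qp e) (Phi_pp e)"
    using Phi_sol[OF e] by blast
  interpret E: elliptic_op strip "\<lambda>z. (hp z)\<^sup>2" "\<lambda>z. - hp z * hq z" "\<lambda>z. 1 + (hq z)\<^sup>2" K ec_const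
    by (rule elliptic[OF open_strip order_refl K(1)])
  have K0: "0 < K" using K zero_le_power2[of M] by linarith
  \<comment> \<open>Makes \<open>\<beta> 1 = m\<close>. The barrier satisfies
    \<open>\<beta>'' = - K * \<beta>'\<close>, just what \<open>supersol_minus_barrier\<close>
    tolerates, and its slope is at least \<open>c1\<close> in size.\<close>
  define n where "n = - m / (1 - exp (- K))"
  have ek: "0 < 1 - exp (- K)" using K0 by simp
  have n: "0 < n" unfolding n_def using m ek by (intro divide_pos_pos) auto
  define \<beta> where "\<beta> p = - n * (1 - exp (- K * p))" for p
  have \<beta>1: "\<beta> 1 = m" using ek by (simp add: \<beta>_def n_def)
  have d\<beta>: "(\<beta> has_real_derivative - n * K * exp (- K * p)) (at p)" for p
    unfolding \<beta>_def[abs_def] by (auto intro!: derivative_eq_intros)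
  have d\<beta>2: "((\<lambda>p. - n * K * exp (- K * p)) has_real_derivative n * K * K * exp (- K * p)) (at p)" for p
    by (auto intro!: derivative_eq_intros)
  have super: "E.supersol (\<lambda>z. Phi e z - \<beta> (snd z)) (Phi_q e) (\<lambda>z. Phi_p e z - (- n * K * exp (- K * snd z)))
     (Phi_qq e) (Phi_qp e) (\<lambda>z. Phi_pp e z - n * K * K * exp (- K * snd z))"
  proof (rule E.supersol_minus_barrier[OF E.ell_sol_supersol[OF sol] d\<beta> d\<beta>2])
    fix z :: "real \<times> real"
    have "K * \<bar>- n * K * exp (- K * snd z)\<bar> = 1 * (n * K * K * exp (- K * snd z))" using n K0 by (simp add: abs_mult)
    also have "\<dots> \<le> (1 + (hq z)\<^sup>2) * (n * K * K * exp (- K * snd z))" using n K0 by (intro mult_right_mono) auto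
    finally show "K * \<bar>- n * K * exp (- K * snd z)\<bar> \<le> (1 + (hq z)\<^sup>2) * (n * K * K * exp (- K * snd z))" .
  qed
  obtain B where B: "\<And>z. z \<in> cstrip \<Longrightarrow> \<bar>Phi e z\<bar> \<le> B" using Phi_bound[OF e] by blast
  have \<beta>_nonpos: "\<beta> p \<le> 0" if "0 \<le> p" for p
    using n that K0 by (simp add: \<beta>_def mult_nonneg_nonneg)
  have low: "\<beta> p \<le> Phi e (q, p)" if p: "0 \<le> p" "p \<le> 1" for q p
  proof -
    have "0 \<le> (\<lambda>z. Phi e z - \<beta> (snd z)) (q, p)"
    proof (rule E.min_principle[OF super zero_less_one])
      show "continuous_on (UNIV \<times> {0..1}) (\<lambda>z. Phi e z - \<beta> (snd z))"
        unfolding \<beta>_def by (intro continuous_intros Phi_cont[OF e])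
      show "- B \<le> Phi e (x, y) - \<beta> (snd (x, y))" if "0 \<le> y" "y \<le> 1" for x y
        using abs_le_D2[OF B[of "(x, y)"]] that \<beta>_nonpos[of y] by simp
      show "0 \<le> Phi e (x, 0) - \<beta> (snd (x, 0))" for x by (simp add: \<beta>_def)
      show "0 \<le> Phi e (x, 1) - \<beta> (snd (x, 1))" for x by (simp add: top \<beta>1)
    qed (use p in auto)
    then show ?thesis by simp
  qed
  define c1 where "c1 = n * K * exp (- K)"
  have c1: "0 < c1" using n K0 by (simp add: c1_def)
  have \<beta>_drop: "m + c1 * t \<le> \<beta> (1 - t)" if t: "0 < t" "t \<le> 1" for t
  proof -
    have "\<exists>\<xi>. 1 - t < \<xi> \<and> \<xi> < 1 \<and> \<beta> 1 - \<beta> (1 - t) = (1 - (1 - t)) * (- n * K * exp (- K * \<xi>))"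
      using t d\<beta> by (intro MVT2) auto
    then obtain \<xi> where \<xi>: "\<xi> < 1" "\<beta> 1 - \<beta> (1 - t) = - (t * (n * K * exp (- K * \<xi>)))" by auto
    have "exp (- K) \<le> exp (- K * \<xi>)" using \<xi>(1) K0 by simp
    then have "c1 \<le> n * K * exp (- K * \<xi>)" unfolding c1_def using n K0 by (intro mult_left_mono) auto
    then have "t * c1 \<le> t * (n * K * exp (- K * \<xi>))" using t by (intro mult_left_mono) auto
    then show ?thesis using \<xi>(2) \<beta>1 by (simp add: mult.commute)
  qed
  \<comment> \<open>Collects the errors at a surface point whose gap is \<open>t^2\<close>: the
    square of the gap and a term \<open>hq^2 / hp\<close> of order \<open>t^2\<close>, integrated
    over a depth \<open>t\<close>. Together they are at most \<open>t * (t * N)\<close>, against a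
    drop \<open>c1 * t\<close> of the barrier.\<close>
  define N where "N = 1 + (2 * sqrt M + M)\<^sup>2 / c0"
  have N: "0 < N" using c0 by (auto simp: N_def intro!: add_pos_nonneg)
  define t where "t = min 1 (c1 / (2 * N))"
  have t: "0 < t" "t \<le> 1" using c1 N by (auto simp: t_def)
  have "t \<le> c1 / (2 * N)" by (simp add: t_def)
  then have tN: "t * N < c1" using c1 N by (simp add: field_simps)
  \<comment> \<open>With gap \<open>t^2\<close> the Landau inequality makes \<open>hq\<close> of
    order \<open>t\<close> on the surface, hence also within distance \<open>t\<close> below
    it.\<close>
  obtain q where q: "\<eta> q < eta_inf + t\<^sup>2" using eta_inf_approx[of "t\<^sup>2"] t by auto
  have dq: "0 \<le> \<eta> q - eta_inf" "\<eta> q - eta_inf \<le> t\<^sup>2" using eta_inf_le[of q] q by auto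
  have hq1: "\<bar>hq (q, 1)\<bar> \<le> 2 * sqrt M * t"
  proof -
    have "(hq (q, 1))\<^sup>2 \<le> 4 * M * (\<eta> q - eta_inf)" by (rule eta_deriv_sq[OF eta_inf_le])
    also have "\<dots> \<le> 4 * M * t\<^sup>2" using dq M_pos by (intro mult_left_mono) auto
    also have "\<dots> = (2 * sqrt M * t)\<^sup>2" using M_pos by (simp add: power_mult_distrib)
    finally have "\<bar>hq (q, 1)\<bar> \<le> \<bar>2 * sqrt M * t\<bar>" by (simp only: abs_le_square_iff)
    then show ?thesis using M_pos t by simp
  qed
  have "\<exists>\<xi>\<in>{1 - t<..<1}. Phi e (q, 1) - Phi e (q, 1 - t) = (\<lambda>x h. h * Phi_p e (q, x)) \<xi> (1 - (1 - t))"
  proof (rule mvt_simple)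
    show "1 - t < 1" using t by simp
    show "((\<lambda>p. Phi e (q, p)) has_derivative (\<lambda>h. h * Phi_p e (q, x))) (at x within {1 - t..1})"
      if "1 - t \<le> x" "x \<le> 1" for x
    proof -
      have x: "x \<in> {0..1}" using that t by auto
      have "((\<lambda>p. Phi e (q, p)) has_derivative (\<lambda>h. h * Phi_p e (q, x))) (at x within {0..1})"
        using Phi_deriv_p[OF x, of e q] by (simp add: has_field_derivative_def mult_commute_abs)
      then show ?thesis by (rule has_derivative_subset) (use t in auto)
    qed
  qed
  then obtain \<xi> where \<xi>: "1 - t < \<xi>" "\<xi> < 1" "Phi e (q, 1) - Phi e (q, 1 - t) = t * Phi_p e (q, \<xi>)" by auto
  have \<xi>01: "\<xi> \<in> {0..1}" using \<xi> t by auto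
  have hq\<xi>: "\<bar>hq (q, \<xi>)\<bar> \<le> (2 * sqrt M + M) * t"
  proof -
    have "\<bar>hq (q, \<xi>) - hq (q, 1)\<bar> \<le> M * \<bar>\<xi> - 1\<bar>"
      by (rule lipschitz_of_bounded_deriv[of "{0..1}" "\<lambda>p. hq (q, p)" "\<lambda>p. hqp (q, p)"])
        (use \<xi>01 in \<open>auto intro!: deriv_p bounds\<close>)
    also have "\<dots> \<le> M * t" using \<xi> M_pos by (intro mult_left_mono) auto
    finally have "\<bar>hq (q, \<xi>)\<bar> \<le> \<bar>hq (q, 1)\<bar> + M * t"
      using abs_triangle_ineq[of "hq (q, \<xi>) - hq (q, 1)" "hq (q, 1)"] by simp
    then show ?thesis using hq1 by (simp add: algebra_simps)
  qed
  have "- ((2 * sqrt M + M)\<^sup>2 / c0 * t\<^sup>2) \<le> Phi_p e (q, \<xi>)"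
  proof -
    have z: "(q, \<xi>) \<in> cstrip" using \<xi>01 by simp
    have "(hq (q, \<xi>))\<^sup>2 \<le> ((2 * sqrt M + M) * t)\<^sup>2"
      using hq\<xi> abs_le_square_iff[of "hq (q, \<xi>)" "(2 * sqrt M + M) * t"] M_pos t by simp
    then have "(hq (q, \<xi>))\<^sup>2 / hp (q, \<xi>) \<le> ((2 * sqrt M + M) * t)\<^sup>2 / c0"
      using hp_ge[OF z] c0 by (intro frac_le) auto
    moreover have "- ((hq (q, \<xi>))\<^sup>2 / hp (q, \<xi>)) \<le> Phi_p e (q, \<xi>)"
    proof -
      have "Phi_p e (q, \<xi>) = (fb e (q, \<xi>))\<^sup>2 * hp (q, \<xi>) - (hq (q, \<xi>))\<^sup>2 / hp (q, \<xi>)"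
        unfolding Phi_p_def fa_def using hp_pos[OF z] by (simp add: power2_eq_square field_simps)
      moreover have "0 \<le> (fb e (q, \<xi>))\<^sup>2 * hp (q, \<xi>)" using hp_pos[OF z] by simp
      ultimately show ?thesis by linarith
    qed
    ultimately show ?thesis by (simp add: power_mult_distrib)
  qed
  from mult_left_mono[OF this, of t]
  have "- (t * ((2 * sqrt M + M)\<^sup>2 / c0 * t\<^sup>2)) \<le> t * Phi_p e (q, \<xi>)"
    using t(1) by (simp only: mult_minus_right)
  also have "\<dots> \<le> (\<eta> q - eta_inf)\<^sup>2 - c1 * t"
    using low[of "1 - t" q] \<beta>_drop[OF t] t \<xi>(3) top[of q] by simp
  also have "(\<eta> q - eta_inf)\<^sup>2 \<le> (t\<^sup>2)\<^sup>2" using dq by (intro power_mono) auto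
  finally have "c1 * t \<le> (t\<^sup>2)\<^sup>2 + t * ((2 * sqrt M + M)\<^sup>2 / c0 * t\<^sup>2)" by simp
  also have "\<dots> \<le> t * t + t * ((2 * sqrt M + M)\<^sup>2 / c0 * t)"
  proof (intro add_mono mult_left_mono)
    have t2: "t\<^sup>2 \<le> t" using t by (simp add: power2_eq_square mult_le_cancel_left1)
    then show "t\<^sup>2 \<le> t" .
    have "t\<^sup>2 * t\<^sup>2 \<le> t * t" using t2 t by (intro mult_mono) auto
    then show "(t\<^sup>2)\<^sup>2 \<le> t * t" by (simp add: power2_eq_square)
  qed (use t c0 in auto)
  also have "\<dots> = t * (t * N)" by (simp add: N_def algebra_simps)
  finally have "c1 \<le> t * N" using t by simp
  then show False using tN by simp
qed

section \<open>Extreme flow force and the shape of the surface\<close>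

lemma F_sup_le: "F_sup \<le> flow_force 0"
proof -
  have "em \<le> \<Omega> 1 + r - eta_inf" "\<Omega> 1 + r - eta_inf \<le> ep" using conjugate_param[OF eta_inf_range] .
  then have "G r ep \<le> G r (\<Omega> 1 + r - eta_inf)"
    using G_strict[of "\<Omega> 1 + r - eta_inf" ep] by (cases "\<Omega> 1 + r - eta_inf = ep") auto
  then show ?thesis using lower_bound S_eq_G[OF ep(2)] by simp
qed

text \<open>Strict monotonicity of \<open>G\<close> turns equality of the flow forces into equality
  of the energies.\<close>

lemma eta_inf_of_F_sup: assumes "flow_force 0 = F_sup" shows "eta_inf = D ep"
proof -
  have "em \<le> \<Omega> 1 + r - eta_inf" "\<Omega> 1 + r - eta_inf \<le> ep" using conjugate_param[OF eta_inf_range] .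
  then have "\<Omega> 1 + r - eta_inf = ep"
    using G_strict[of "\<Omega> 1 + r - eta_inf" ep] lower_bound assms S_eq_G[OF ep(2)]
    by (cases "\<Omega> 1 + r - eta_inf = ep") auto
  then show ?thesis using depth_from_R[OF ep(2)] by simp
qed

text \<open>Where \<open>hq = 0\<close> on the surface, \<open>Phi_p\<close> equals
  \<open>fb^2 * hp\<close> and is nonnegative, while the Hopf lemma at a surface minimum demands a
  negative value unless the whole column is at the minimum.\<close>

lemma column_of_top_minimum:
  assumes e: "e0 < e" and m: "m \<le> 0" "\<And>q. m \<le> Phi e (q, 1)"
    and x0: "Phi e (x0, 1) = m" "hq (x0, 1) = 0" and p: "0 < p" "p < 1"
  shows "Phi e (x0, p) = m"
proof (rule ccontr)
  assume ne: "Phi e (x0, p) \<noteq> m"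
  have nonneg: "m \<le> Phi e (x, y)" if "0 \<le> y" "y \<le> 1" for x y
    by (rule Phi_min_principle[OF e m that])
  obtain K where K: "1 + M\<^sup>2 \<le> K" and super: "\<And>l. elliptic_op.supersol (half_strip l) (\<lambda>z. (hp z)\<^sup>2) (\<lambda>z. - hp z * hq z) (\<lambda>z. 1 + (hq z)\<^sup>2) K
    (Phi e) (Phi_q e) (Phi_p e) (Phi_qq e) (Phi_qp e) (Phi_pp e)"
    using Phi_supersol_half[OF e] by blast
  let ?l = "x0 - 1"
  interpret E: elliptic_op "half_strip ?l" "\<lambda>z. (hp z)\<^sup>2" "\<lambda>z. - hp z * hq z" "\<lambda>z. 1 + (hq z)\<^sup>2" K ec_const
    by (rule elliptic[OF open_half_strip half_strip_subset K])
  note super' = Phi_minus_const_supersol[OF K super[of ?l] open_half_strip half_strip_subset, where m = m]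
  have c: "continuous_on ({?l..} \<times> {0..1}) (\<lambda>z. Phi e z - m)"
    by (intro continuous_intros continuous_on_subset[OF Phi_cont[OF e]]) auto
  have "0 < Phi e (x0, p) - m" using nonneg[of p x0] p ne by simp
  from E.vertical_cap(1)[OF super' refl c _ _ p this] nonneg
  obtain \<epsilon> where \<epsilon>: "0 < \<epsilon>" "\<And>t. t \<in> {0..1 - p} \<Longrightarrow> \<epsilon> * t \<le> Phi e (x0, 1 - t) - m" by auto
  have d1: "((\<lambda>s. Phi e (x0, s)) has_real_derivative Phi_p e (x0, 1)) (at (1 - 0) within {0..1})"
    using Phi_deriv_p[of 1 e x0] by simp
  have d2: "((\<lambda>t. 1 - t) has_real_derivative - 1) (at 0 within {0..1})"
    by (auto intro!: derivative_eq_intros)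
  have "((\<lambda>t. Phi e (x0, 1 - t)) has_real_derivative Phi_p e (x0, 1) * (- 1)) (at 0 within {0..1})"
    using DERIV_image_chain[OF _ d2, of "\<lambda>s. Phi e (x0, s)" "Phi_p e (x0, 1)"] d1
    by (simp add: image_diff_atLeastAtMost o_def)
  from DERIV_diff[OF DERIV_cmult[OF DERIV_ident, of \<epsilon>] this]
  have d: "((\<lambda>t. \<epsilon> * t - Phi e (x0, 1 - t)) has_real_derivative \<epsilon> * 1 - Phi_p e (x0, 1) * (- 1)) (at 0 within {0..1})" .
  have "\<epsilon> * 1 - Phi_p e (x0, 1) * (- 1) \<le> 0"
    by (rule deriv_nonpos_left_end[OF d, of "1 - p"]) (use p \<epsilon>(2) x0(1) in \<open>auto simp: algebra_simps\<close>)
  moreover have "0 \<le> Phi_p e (x0, 1)"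
    using hp_pos[of "(x0, 1)"] by (simp add: Phi_p_def fa_def x0(2))
  ultimately show False using \<epsilon>(1) by simp
qed

text \<open>At the energy whose vertex is the height of the critical point, \<open>Phi\<close>
  attains its negative minimum \<open>m\<close> there. By \<open>column_of_top_minimum\<close> it
  equals \<open>m\<close> down the whole column, but at the bottom it is zero.\<close>

lemma no_low_critical_point:
  assumes F: "flow_force 0 = F_sup" and y: "D ep < \<eta> x0" "\<eta> x0 \<le> D em"
  shows "hq (x0, 1) \<noteq> 0"
proof
  assume hq0: "hq (x0, 1) = 0"
  define e where "e = \<Omega> 1 + r - \<eta> x0"
  have e: "em \<le> e" "e < ep"
    using conjugate_param(1)[of "\<eta> x0"] y depth_from_R[OF ep(2)] by (auto simp: e_def)
  have e0: "e0 < e" using em(1) e(1) by (rule less_le_trans)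
  define m where "m = 2 * (flow_force 0 - G r e)"
  have m: "m < 0" using G_strict[OF e(1,2)] F S_eq_G[OF ep(2)] by (simp add: m_def)
  have top: "Phi e (q, 1) = m + (\<eta> q - \<eta> x0)\<^sup>2" for q
    using Phi_top_G[of "\<eta> x0" q] e0 flow_force_const[of q 0] by (simp add: e_def m_def)
  have col: "Phi e (x0, p) = m" if "0 < p" "p < 1" for p
    by (rule column_of_top_minimum[OF e0 _ _ _ hq0 that]) (use m top in auto)
  have "Phi e (x0, 0) = m"
    using continuous_constant_on_closure[of "{0<..<1}" "\<lambda>p. Phi e (x0, p)" m 0] sect_cont[OF Phi_cont[OF e0]] col
    by auto
  then show False using m by simp
qed

text \<open>At energy \<open>ep\<close> the surface values of \<open>Phi\<close> are the squares of
  \<open>\<eta> - D ep\<close>, with a zero and zero slope at the contact point. The zero runs down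
  the column and then fills the strip.\<close>

lemma touching_laminar:
  assumes F: "flow_force 0 = F_sup" and y: "\<eta> x0 = D ep"
  shows "p \<in> {0..1} \<Longrightarrow> h (q, p) = Hf ep p"
proof -
  have inf: "eta_inf = D ep" by (rule eta_inf_of_F_sup[OF F])
  have hq0: "hq (x0, 1) = 0" using eta_deriv_sq[OF eta_inf_le, of x0] y inf by simp
  have top: "Phi ep (q, 1) = (\<eta> q - D ep)\<^sup>2" for q
    using Phi_top_G[of "D ep" q] depth_from_R[OF ep(2)] e0_ep flow_force_const[of q 0] F S_eq_G[OF ep(2)]
    by (auto simp: algebra_simps)
  have nonneg: "0 \<le> Phi ep (x, y)" if "0 \<le> y" "y \<le> 1" for x y
    by (rule Phi_min_principle[OF e0_ep order_refl _ that]) (simp add: top)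
  have col: "Phi ep (x0, 1/2) = 0"
    by (rule column_of_top_minimum[OF e0_ep order_refl _ _ hq0]) (auto simp: top y)
  obtain K where K: "1 + M\<^sup>2 \<le> K" and super: "\<And>l. elliptic_op.supersol (half_strip l) (\<lambda>z. (hp z)\<^sup>2) (\<lambda>z. - hp z * hq z) (\<lambda>z. 1 + (hq z)\<^sup>2) K
    (Phi ep) (Phi_q ep) (Phi_p ep) (Phi_qq ep) (Phi_qp ep) (Phi_pp ep)"
    using Phi_supersol_half[OF e0_ep] by blast
  have zero: "Phi ep (x, y) = 0" if xy: "0 \<le> y" "y \<le> 1" for x y
  proof -
    let ?l = "min x x0 - 1"
    interpret E: elliptic_op "half_strip ?l" "\<lambda>z. (hp z)\<^sup>2" "\<lambda>z. - hp z * hq z" "\<lambda>z. 1 + (hq z)\<^sup>2" K ec_const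
      by (rule elliptic[OF open_half_strip half_strip_subset K])
    show ?thesis
      by (rule E.strong_min_principle[OF super refl, of x0 "1/2"])
        (use xy nonneg col in \<open>auto intro: continuous_on_subset[OF Phi_cont[OF e0_ep]]\<close>)
  qed
  have ab: "fa z = 0 \<and> fb ep z = 0" if z: "z \<in> strip" for z
  proof -
    have "eventually (\<lambda>w. Phi ep z \<le> Phi ep w) (nhds z)"
      using eventually_nhds_in_open[OF open_strip z] by eventually_elim (use zero z in auto)
    then have "Phi_q ep z = 0" "Phi_p ep z = 0"
      using hessian_at_local_min[OF Phi_C2[OF e0_ep] open_strip z] by auto
    from flux_zero_of_grad_zero[OF z this] show ?thesis by blast
  qed
  show "p \<in> {0..1} \<Longrightarrow> h (q, p) = Hf ep p"
    by (rule laminar_of_flux_zero(1)[OF e0_ep]) (use ab in auto)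
qed

section \<open>Solitary waves and moving planes\<close>

abbreviation "rh l z \<equiv> h (2 * l - fst z, snd z)"
abbreviation "rhq l z \<equiv> - hq (2 * l - fst z, snd z)"
abbreviation "rhp l z \<equiv> hp (2 * l - fst z, snd z)"
abbreviation "rhqq l z \<equiv> hqq (2 * l - fst z, snd z)"
abbreviation "rhqp l z \<equiv> - hqp (2 * l - fst z, snd z)"
abbreviation "rhpp l z \<equiv> hpp (2 * l - fst z, snd z)"

text \<open>Horizontal reflection keeps every hypothesis; derivatives of odd order in
  \<open>q\<close> change sign. It provides both the mirror images for the moving planes and the
  statements at the left end.\<close>

lemma reflected_wave:
  "wave \<omega> r em ep (rh l) (rhq l) (rhp l)
    (rhqq l) (rhqp l) (rhpp l) M c0"
proof unfold_locales
  let ?R = "\<lambda>z :: real \<times> real. (2 * l - fst z, snd z)"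
  have dR: "(?R has_derivative (\<lambda>v. (- fst v, snd v))) (at z)" for z
    by (auto intro!: derivative_eq_intros)
  have comp: "((\<lambda>z. g (?R z)) has_derivative (\<lambda>v. a * (- fst v) + b * snd v)) (at z)"
    if "(g has_derivative (\<lambda>v. a * fst v + b * snd v)) (at (?R z))" for g :: "real \<times> real \<Rightarrow> real" and a b z
    using has_derivative_compose[OF dR that] by simp
  show "C2_data strip (\<lambda>z. h (?R z)) (\<lambda>z. - hq (?R z)) (\<lambda>z. hp (?R z)) (\<lambda>z. hqq (?R z)) (\<lambda>z. - hqp (?R z)) (\<lambda>z. hpp (?R z))"
    unfolding C2_data_def
  proof (intro ballI conjI)
    fix z :: "real \<times> real" assume "z \<in> strip"
    then have "?R z \<in> strip" by auto
    note d = C2_dataD[OF C2 this]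
    show "((\<lambda>z. h (?R z)) has_derivative (\<lambda>v. - hq (?R z) * fst v + hp (?R z) * snd v)) (at z)"
      using comp[OF d(1)] by simp
    show "((\<lambda>z. - hq (?R z)) has_derivative (\<lambda>v. hqq (?R z) * fst v + - hqp (?R z) * snd v)) (at z)"
      using has_derivative_minus[OF comp[OF d(2)]] by simp
    show "((\<lambda>z. hp (?R z)) has_derivative (\<lambda>v. - hqp (?R z) * fst v + hpp (?R z) * snd v)) (at z)"
      using comp[OF d(3)] by simp
  qed
  have cont': "continuous_on cstrip (\<lambda>z. g (?R z))" if "continuous_on cstrip g" for g :: "real \<times> real \<Rightarrow> real"
    by (rule continuous_on_compose2[OF that]) (auto intro!: continuous_intros)
  show "continuous_on cstrip g" if "g \<in> {\<lambda>z. h (?R z), \<lambda>z. - hq (?R z), \<lambda>z. hp (?R z), \<lambda>z. hqq (?R z), \<lambda>z. - hqp (?R z), \<lambda>z. hpp (?R z)}" for g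
    using that by (elim insertE emptyE) (simp_all only:, (intro continuous_on_minus cont' conts)+)
  show "\<bar>g z\<bar> \<le> M" if "g \<in> {\<lambda>z. h (?R z), \<lambda>z. - hq (?R z), \<lambda>z. hp (?R z), \<lambda>z. hqq (?R z), \<lambda>z. - hqp (?R z), \<lambda>z. hpp (?R z)}" "z \<in> cstrip" for g z
  proof -
    have "?R z \<in> cstrip" using that(2) by auto
    note b = bounds[OF this]
    show ?thesis using that(1) b by (elim insertE emptyE) simp_all
  qed
  show "0 < c0" by (rule c0)
  show "c0 \<le> hp (?R z)" if "z \<in> cstrip" for z by (rule hp_ge) (use that in auto)
  show "\<exists>d>0. \<forall>p\<in>{0..1}. \<forall>x y. \<bar>x - y\<bar> \<le> d \<longrightarrow> \<bar>hqq (?R (x, p)) - hqq (?R (y, p))\<bar> < \<epsilon>" if \<epsilon>: "0 < \<epsilon>" for \<epsilon>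
  proof -
    obtain d where d: "d > 0" "\<And>p x y. p \<in> {0..1} \<Longrightarrow> \<bar>x - y\<bar> \<le> d \<Longrightarrow> \<bar>hqq (x, p) - hqq (y, p)\<bar> < \<epsilon>"
      using hqq_unif[OF \<epsilon>] by blast
    show ?thesis
    proof (intro exI[of _ d] conjI d(1) ballI allI impI)
      fix p x y :: real assume "p \<in> {0..1}" "\<bar>x - y\<bar> \<le> d"
      then show "\<bar>hqq (?R (x, p)) - hqq (?R (y, p))\<bar> < \<epsilon>"
        using d(2)[of p "2 * l - x" "2 * l - y"] by (simp add: abs_minus_commute)
    qed
  qed
  show "(hp (?R z))\<^sup>2 * hqq (?R z) - 2 * hp (?R z) * - hq (?R z) * - hqp (?R z) + (1 + (- hq (?R z))\<^sup>2) * hpp (?R z)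
    = \<omega> (snd z) * hp (?R z) ^ 3" if "z \<in> strip" for z
    using pde[of "?R z"] that by auto
  show "(1 + (- hq (?R (q, 1)))\<^sup>2) / (2 * (hp (?R (q, 1)))\<^sup>2) + h (?R (q, 1)) = r" for q
    using bernoulli[of "2 * l - q"] by simp
  show "h (?R (q, 0)) = 0" for q by (simp add: bottom)
qed

lemma hq_equicont: assumes \<epsilon>: "0 < \<epsilon>"
  shows "\<exists>d>0. \<forall>p\<in>{0..1}. \<forall>x y. \<bar>x - y\<bar> \<le> d \<longrightarrow> \<bar>hq (x, p) - hq (y, p)\<bar> < \<epsilon>"
proof (intro exI[of _ "\<epsilon> / (2 * M)"] conjI ballI allI impI)
  show "0 < \<epsilon> / (2 * M)" using \<epsilon> M_pos by simp
  fix p x y :: real assume p: "p \<in> {0..1}" and xy: "\<bar>x - y\<bar> \<le> \<epsilon> / (2 * M)"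
  have "\<bar>hq (x, p) - hq (y, p)\<bar> \<le> M * \<bar>x - y\<bar>"
    by (rule lipschitz_of_bounded_deriv[of UNIV "\<lambda>q. hq (q, p)" "\<lambda>q. hqq (q, p)"])
      (use p in \<open>auto intro!: deriv_q bounds\<close>)
  also have "\<dots> \<le> M * (\<epsilon> / (2 * M))" using xy M_pos by (intro mult_left_mono) auto
  also have "\<dots> < \<epsilon>" using \<epsilon> M_pos by simp
  finally show "\<bar>hq (x, p) - hq (y, p)\<bar> < \<epsilon>" .
qed

lemma reflected_flow_force: "wave.flow_force \<omega> r (rh l) (rhq l)
    (rhp l) q = flow_force (2 * l - q)"
proof -
  interpret RW: wave \<omega> r em ep "rh l" "rhq l" "rhp l"
    "rhqq l" "rhqp l" "rhpp l" M c0
    by (rule reflected_wave)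
  show ?thesis unfolding RW.flow_force_def flow_force_def by simp
qed

text \<open>At heights up to \<open>D em\<close> there are no critical points, so a descending
  surface can neither turn nor leave that range. The contradiction is found at the first zero of the
  slope.\<close>

lemma eta_decreasing_from:
  assumes F: "flow_force 0 = F_sup" and above: "\<And>q. D ep < \<eta> q"
    and x: "hq (x, 1) < 0" "\<eta> x \<le> D em" and y: "x \<le> y"
  shows "\<eta> y \<le> \<eta> x" "hq (y, 1) < 0"
proof -
  have dec: "\<eta> b \<le> \<eta> a" if "a \<le> b" "\<And>t. a \<le> t \<Longrightarrow> t \<le> b \<Longrightarrow> hq (t, 1) \<le> 0" for a b
  proof (rule DERIV_nonpos_imp_nonincreasing[OF that(1)])
    fix t assume "a \<le> t" "t \<le> b"
    moreover have "((\<lambda>q. \<eta> q) has_real_derivative hq (t, 1)) (at t)" by (rule deriv_q) simp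
    ultimately show "\<exists>y. ((\<lambda>q. \<eta> q) has_real_derivative y) (at t) \<and> y \<le> 0" using that(2) by blast
  qed
  have chq: "continuous_on X (\<lambda>t. hq (t, 1))" for X by (rule sect_cont_q[OF conts(2)]) simp
  have neg: "hq (t, 1) < 0" if t: "x \<le> t" for t
  proof (rule ccontr)
    assume "\<not> hq (t, 1) < 0"
    define Z where "Z = {s \<in> {x..t}. 0 \<le> hq (s, 1)}"
    have "closed Z" unfolding Z_def
      by (rule continuous_on_closed_Collect_le[OF continuous_on_const chq closed_atLeastAtMost])
    moreover have "bounded Z" by (rule bounded_subset[OF bounded_closed_interval[of x t]]) (auto simp: Z_def)
    ultimately have cZ: "compact Z" by (simp add: compact_eq_bounded_closed)
    have "t \<in> Z" using t \<open>\<not> hq (t, 1) < 0\<close> by (simp add: Z_def)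
    then obtain s where s: "s \<in> Z" "\<And>s'. s' \<in> Z \<Longrightarrow> s \<le> s'"
      using compact_attains_inf[OF cZ] by blast
    have "\<exists>s'\<ge>x. s' \<le> s \<and> hq (s', 1) = 0"
      using s(1) x(1) chq by (intro IVT') (auto simp: Z_def)
    then obtain s' where s': "x \<le> s'" "s' \<le> s" "hq (s', 1) = 0" by blast
    have "hq (u, 1) \<le> 0" if "x \<le> u" "u \<le> s'" for u
    proof (rule ccontr)
      assume "\<not> hq (u, 1) \<le> 0"
      then have "u \<in> Z" using that s' s(1) by (auto simp: Z_def)
      then have "s \<le> u" by (rule s(2))
      then have "u = s'" using that s' by simp
      then show False using \<open>\<not> hq (u, 1) \<le> 0\<close> s' by simp
    qed
    from dec[OF s'(1) this] have "\<eta> s' \<le> D em" using x(2) by linarith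
    from no_low_critical_point[OF F above this] s'(3) show False by simp
  qed
  show "hq (y, 1) < 0" by (rule neg[OF y])
  show "\<eta> y \<le> \<eta> x" by (rule dec[OF y]) (use neg in \<open>auto intro: less_imp_le\<close>)
qed

lemma tends_at_top:
  assumes F: "flow_force 0 = F_sup" and above: "\<And>q. D ep < \<eta> q"
    and ex: "\<And>\<delta>. 0 < \<delta> \<Longrightarrow> \<exists>x. \<eta> x < D ep + \<delta> \<and> hq (x, 1) < 0"
  shows "(\<eta> \<longlongrightarrow> D ep) at_top"
proof (rule tendstoI)
  fix \<delta> :: real assume \<delta>: "0 < \<delta>"
  obtain x where x: "\<eta> x < D ep + min \<delta> (D em - D ep)" "hq (x, 1) < 0"
    using ex[of "min \<delta> (D em - D ep)"] \<delta> D_ep_less by auto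
  have "\<eta> x \<le> D em" "\<eta> x < D ep + \<delta>" using x(1) by linarith+
  have "dist (\<eta> y) (D ep) < \<delta>" if "x \<le> y" for y
    using eta_decreasing_from(1)[OF F above x(2) \<open>\<eta> x \<le> D em\<close> that] above[of y] \<open>\<eta> x < D ep + \<delta>\<close>
    by (simp add: dist_real_def)
  then show "\<forall>\<^sub>F y in at_top. dist (\<eta> y) (D ep) < \<delta>"
    using eventually_ge_at_top[of x] by (rule eventually_mono[rotated])
qed

text \<open>The infimum \<open>D ep\<close> is approached, and points close to it have nonzero
  slope. If descending ones exist arbitrarily low, the surface decays to the right; otherwise all
  low points are ascending and the mirror image decays.\<close>

lemma tends_at_one_end:
  assumes F: "flow_force 0 = F_sup" and above: "\<And>q. D ep < \<eta> q"
  shows "(\<eta> \<longlongrightarrow> D ep) at_top \<or> ((\<lambda>q. \<eta> (- q)) \<longlongrightarrow> D ep) at_top"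
proof (cases "\<forall>\<delta>>0. \<exists>x. \<eta> x < D ep + \<delta> \<and> hq (x, 1) < 0")
  case True then show ?thesis using tends_at_top[OF F above] by blast
next
  case False
  then obtain \<delta>0 where \<delta>0: "\<delta>0 > 0" "\<And>x. \<eta> x < D ep + \<delta>0 \<Longrightarrow> 0 \<le> hq (x, 1)" by force
  have ex: "\<exists>x. \<eta> x < D ep + \<delta> \<and> 0 < hq (x, 1)" if \<delta>: "0 < \<delta>" for \<delta>
  proof -
    obtain x where x: "\<eta> x < D ep + min \<delta> (min \<delta>0 (D em - D ep))"
      using eta_inf_approx[of "min \<delta> (min \<delta>0 (D em - D ep))"] \<delta> \<delta>0 D_ep_less eta_inf_of_F_sup[OF F] by auto
    then have "\<eta> x < D ep + \<delta>" "\<eta> x < D ep + \<delta>0" "\<eta> x \<le> D em" by linarith+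
    with \<delta>0(2)[of x] no_low_critical_point[OF F above, of x] show ?thesis by force
  qed
  interpret RW: wave \<omega> r em ep "rh 0" "rhq 0" "rhp 0"
    "rhqq 0" "rhqp 0" "rhpp 0" M c0
    by (rule reflected_wave)
  have "((\<lambda>q. h (2 * 0 - fst (q, 1::real), snd (q, 1::real))) \<longlongrightarrow> D ep) at_top"
  proof (rule RW.tends_at_top)
    show "RW.flow_force 0 = F_sup" using reflected_flow_force[of 0 0] F by simp
    show "D ep < h (2 * 0 - fst (q, 1), snd (q, 1))" for q using above by simp
    fix \<delta> :: real assume "0 < \<delta>"
    then obtain x where "\<eta> x < D ep + \<delta>" "0 < hq (x, 1)" using ex by blast
    then show "\<exists>x. h (2 * 0 - fst (x, 1::real), snd (x, 1::real)) < D ep + \<delta> \<and> - hq (2 * 0 - fst (x, 1::real), snd (x, 1::real)) < 0"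
      by (intro exI[of _ "- x"]) simp
  qed
  then show ?thesis by simp
qed

text \<open>As \<open>\<omega>\<close> depends on \<open>p\<close> only, the equation for \<open>u\<close> has no zeroth-order term, however rough \<open>\<omega>\<close> is.\<close>
definition u where "u l z = h (2 * l - fst z, snd z) - h z"
definition uq where "uq l z = rhq l z - hq z"
definition up where "up l z = rhp l z - hp z"
definition uqq where "uqq l z = hqq (2 * l - fst z, snd z) - hqq z"
definition uqp where "uqp l z = - hqp (2 * l - fst z, snd z) - hqp z"
definition upp where "upp l z = hpp (2 * l - fst z, snd z) - hpp z"

lemma u_C2: "C2_data strip (u l) (uq l) (up l) (uqq l) (uqp l) (upp l)"
  unfolding u_def[abs_def] uq_def[abs_def] up_def[abs_def] uqq_def[abs_def] uqp_def[abs_def] upp_def[abs_def]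
  by (rule C2_data_diff[OF wave.C2[OF reflected_wave] C2])

lemma u_cont: "continuous_on cstrip (u l)" "continuous_on cstrip (uq l)" "continuous_on cstrip (up l)"
  unfolding u_def[abs_def] uq_def[abs_def] up_def[abs_def]
  by (intro continuous_on_diff wave.conts(1)[OF reflected_wave] wave.conts(2)[OF reflected_wave]
      wave.conts(3)[OF reflected_wave] conts)+

text \<open>Coefficients of \<open>up\<close> and \<open>uq\<close> after subtracting the two
  equations. The principal part is taken from the reflected wave, so the second derivatives left
  over are those of \<open>h\<close> to the right of the plane, where decay is known.\<close>

definition ub1 where "ub1 l z = \<omega> (snd z) * ((rhp l z)\<^sup>2 + rhp l z * hp z + (hp z)\<^sup>2)
  - (rhp l z + hp z) * hqq z + 2 * hq z * hqp z"
definition ub2 where "ub2 l z = 2 * rhp l z * hqp z - (rhq l z + hq z) * hpp z"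

lemma u_equation:
  assumes z: "z \<in> strip"
  shows "(rhp l z)\<^sup>2 * uqq l z + 2 * (- rhp l z * rhq l z) * uqp l z
      + (1 + (rhq l z)\<^sup>2) * upp l z = up l z * ub1 l z + uq l z * ub2 l z"
proof -
  define P Q where "P = rhp l z" and "Q = rhq l z"
  have 1: "P\<^sup>2 * hqq (2 * l - fst z, snd z) - 2 * P * Q * - hqp (2 * l - fst z, snd z) + (1 + Q\<^sup>2) * hpp (2 * l - fst z, snd z)
    = \<omega> (snd z) * P ^ 3"
    using wave.pde[OF reflected_wave z, of l] by (simp only: P_def Q_def)
  note 2 = pde[OF z]
  show ?thesis
    using 1 2 unfolding uqq_def uqp_def upp_def up_def uq_def ub1_def ub2_def P_def[symmetric] Q_def[symmetric] by algebra
qed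

lemma u_coeff_bound: "\<exists>K\<ge>1 + M\<^sup>2. \<forall>l. \<forall>z\<in>cstrip. \<bar>ub1 l z\<bar> \<le> K \<and> \<bar>ub2 l z\<bar> \<le> K"
proof -
  obtain N where N: "0 < N" "\<And>p. p \<in> {0..1} \<Longrightarrow> \<bar>\<omega> p\<bar> \<le> N" using omega_bound by blast
  define K where "K = 1 + M\<^sup>2 + (3 * N * M\<^sup>2 + 4 * M\<^sup>2)"
  have K: "1 + M\<^sup>2 \<le> K" "3 * N * M\<^sup>2 + 4 * M\<^sup>2 \<le> K" using N by (auto simp: K_def add_nonneg_nonneg)
  show ?thesis
  proof (intro exI[of _ K] conjI K(1) allI ballI)
    fix l and z :: "real \<times> real" assume z: "z \<in> cstrip"
    define P Q where "P = rhp l z" and "Q = rhq l z"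
    have p: "snd z \<in> {0..1}" using z by auto
    have Rz: "(2 * l - fst z, snd z) \<in> cstrip" using z by auto
    have PQ: "\<bar>P\<bar> \<le> M" "\<bar>Q\<bar> \<le> M" using bounds[OF Rz] by (auto simp: P_def Q_def)
    note b = bounds[OF z]
    have mm: "\<bar>x * y\<bar> \<le> M\<^sup>2" if "\<bar>x\<bar> \<le> M" "\<bar>y\<bar> \<le> M" for x y
      unfolding abs_mult power2_eq_square using that M_pos by (intro mult_mono) auto
    have tri3: "\<bar>x + y + z\<bar> \<le> 3 * B" if "\<bar>x\<bar> \<le> B" "\<bar>y\<bar> \<le> B" "\<bar>z\<bar> \<le> B" for x y z B :: real
      using that by (simp add: abs_le_iff)
    have tri4: "\<bar>x - (y1 + y2) + 2 * z\<bar> \<le> A + 4 * B" if "\<bar>x\<bar> \<le> A" "\<bar>y1\<bar> \<le> B" "\<bar>y2\<bar> \<le> B" "\<bar>z\<bar> \<le> B" for x y1 y2 z A B :: real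
      using that by (simp add: abs_le_iff)
    show "\<bar>ub1 l z\<bar> \<le> K"
    proof -
      have "\<bar>P\<^sup>2 + P * hp z + (hp z)\<^sup>2\<bar> \<le> 3 * M\<^sup>2"
        using tri3[OF mm[OF PQ(1) PQ(1)] mm[OF PQ(1) b(3)] mm[OF b(3) b(3)]] by (simp add: power2_eq_square)
      then have 1: "\<bar>\<omega> (snd z) * (P\<^sup>2 + P * hp z + (hp z)\<^sup>2)\<bar> \<le> N * (3 * M\<^sup>2)"
        unfolding abs_mult[of "\<omega> (snd z)"] using N p by (intro mult_mono) auto
      have "\<bar>ub1 l z\<bar> \<le> N * (3 * M\<^sup>2) + 4 * M\<^sup>2"
        using tri4[OF 1 mm[OF PQ(1) b(4)] mm[OF b(3) b(4)] mm[OF b(2) b(5)]]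
        unfolding ub1_def P_def[symmetric] distrib_right mult.assoc[of 2] .
      then show ?thesis using K(2) by simp
    qed
    show "\<bar>ub2 l z\<bar> \<le> K"
    proof -
      have "\<bar>ub2 l z\<bar> \<le> 4 * M\<^sup>2"
        using tri4[OF abs_zero[THEN eq_refl] mm[OF PQ(2) b(6)] mm[OF b(2) b(6)] mm[OF PQ(1) b(5)]]
        unfolding ub2_def P_def[symmetric] Q_def[symmetric] by (simp add: distrib_right mult.assoc)
      moreover have "0 \<le> 3 * N * M\<^sup>2" using N by simp
      ultimately show ?thesis using K(2) by linarith
    qed
  qed
qed

lemma u_sol:
  "\<exists>K\<ge>1 + M\<^sup>2. \<forall>l. elliptic_op.ell_sol (half_strip l) (\<lambda>z. (rhp l z)\<^sup>2)
     (\<lambda>z. - rhp l z * rhq l z) (\<lambda>z. 1 + (rhq l z)\<^sup>2) K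
     (u l) (uq l) (up l) (uqq l) (uqp l) (upp l)"
proof -
  obtain K where K: "1 + M\<^sup>2 \<le> K" and b: "\<And>l z. z \<in> cstrip \<Longrightarrow> \<bar>ub1 l z\<bar> \<le> K \<and> \<bar>ub2 l z\<bar> \<le> K"
    using u_coeff_bound by blast
  show ?thesis
  proof (intro exI[of _ K] conjI K allI)
    fix l
    interpret RW: wave \<omega> r em ep "rh l" "rhq l" "rhp l"
      "rhqq l" "rhqp l" "rhpp l" M c0
      by (rule reflected_wave)
    interpret E: elliptic_op "half_strip l" "\<lambda>z. (rhp l z)\<^sup>2"
      "\<lambda>z. - rhp l z * rhq l z" "\<lambda>z. 1 + (rhq l z)\<^sup>2" K RW.ec_const
      by (rule RW.elliptic[OF open_half_strip half_strip_subset K])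
    show "E.ell_sol (u l) (uq l) (up l) (uqq l) (uqp l) (upp l)"
      unfolding E.ell_sol_def
    proof (intro conjI C2_data_subset[OF u_C2 half_strip_subset] ballI)
      fix z assume "z \<in> half_strip l"
      then have z: "z \<in> strip" using half_strip_subset by blast
      note b' = b[OF strip_cstrip[OF z], of l]
      have "\<bar>up l z * ub1 l z + uq l z * ub2 l z\<bar> \<le> \<bar>up l z\<bar> * \<bar>ub1 l z\<bar> + \<bar>uq l z\<bar> * \<bar>ub2 l z\<bar>"
        by (rule order_trans[OF abs_triangle_ineq]) (simp add: abs_mult)
      also have "\<dots> \<le> \<bar>up l z\<bar> * K + \<bar>uq l z\<bar> * K" using b' by (intro add_mono mult_left_mono) auto
      finally show "\<bar>(rhp l z)\<^sup>2 * uqq l z + 2 * (- rhp l z * rhq l z) * uqp l z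
          + (1 + (rhq l z)\<^sup>2) * upp l z\<bar> \<le> K * (\<bar>uq l z\<bar> + \<bar>up l z\<bar>)"
        unfolding u_equation[OF z] by (simp add: algebra_simps)
    qed
  qed
qed

end

text \<open>Decay is assumed at the right end only; the left end is settled by symmetry.\<close>

locale solitary = wave +
  assumes F_eq: "flow_force 0 = F_sup" and above: "D ep < \<eta> q" and right: "(\<eta> \<longlongrightarrow> D ep) at_top"
begin

section \<open>Decay of the wave and its derivatives\<close>

lemma w_nonneg: "p \<in> {0..1} \<Longrightarrow> 0 \<le> w ep (q, p)"
  using w_min_principle[OF e0_ep zero_less_one order_refl, of 1 0 p q] above by (simp add: w_top less_imp_le)

text \<open>Surface decay spreads inwards through rectangles: the error of
  \<open>local_min_principle\<close> is \<open>c / l\<close>, so one length \<open>l\<close> works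
  for each tolerance and the rectangle is pushed to the right.\<close>

lemma w_uniform: "uniform_limit {0..1} (\<lambda>q p. w ep (q, p)) (\<lambda>_. 0) at_top"
proof (rule uniform_limitI)
  fix \<epsilon> :: real assume \<epsilon>: "0 < \<epsilon>"
  obtain K where K: "1 + M\<^sup>2 \<le> K" and sol: "elliptic_op.ell_sol strip (\<lambda>z. (hp z)\<^sup>2) (\<lambda>z. - hp z * hq z) (\<lambda>z. 1 + (hq z)\<^sup>2) K
    (w ep) hq (\<lambda>z. hp z - 1 / V ep (snd z)) hqq hqp (\<lambda>z. hpp z - \<omega> (snd z) / V ep (snd z) ^ 3)"
    using w_sol[OF e0_ep] by blast
  interpret E: elliptic_op strip "\<lambda>z. (hp z)\<^sup>2" "\<lambda>z. - hp z * hq z" "\<lambda>z. 1 + (hq z)\<^sup>2" K ec_const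
    by (rule elliptic[OF open_strip order_refl K(1)])
  define B where "B = M + D ep"
  have B: "0 \<le> B" using M_pos D_pos[OF e0_ep] by (simp add: B_def)
  define c where "c = 4 * B * K * exp (((K + 1) / ec_const) * 1)"
  define l where "l = max 1 (4 * \<bar>c\<bar> / \<epsilon>)"
  have l: "1 \<le> l" by (simp add: l_def)
  have cl: "c / l \<le> \<epsilon> / 4"
  proof -
    have "4 * \<bar>c\<bar> / \<epsilon> \<le> l" by (simp add: l_def)
    then have "4 * \<bar>c\<bar> \<le> l * \<epsilon>" using \<epsilon> by (simp add: divide_le_eq)
    then show ?thesis using l by (simp add: field_simps abs_le_iff)
  qed
  have "\<forall>\<^sub>F q in at_top. dist (\<eta> q) (D ep) < \<epsilon> / 2" using tendstoD[OF right, of "\<epsilon> / 2"] \<epsilon> by simp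
  then obtain X where X: "\<And>q. X \<le> q \<Longrightarrow> \<eta> q - D ep < \<epsilon> / 2"
    unfolding eventually_at_top_linorder dist_real_def abs_less_iff by blast
  have "\<bar>w ep (q, p)\<bar> < \<epsilon>" if q: "X + l \<le> q" and p: "p \<in> {0..1}" for q p
  proof -
    have "- (\<epsilon> / 2) - c / l \<le> - w ep (q, p)"
      unfolding c_def
    proof (rule E.local_min_principle[OF E.ell_sol_supersol[OF E.ell_sol_uminus[OF sol]] zero_less_one])
      show "continuous_on ({q - l..q + l} \<times> {0..1}) (\<lambda>z. - w ep z)"
        by (intro continuous_intros continuous_on_subset[OF w_cont[OF e0_ep]]) auto
      show "- (\<epsilon> / 2) - B \<le> - w ep (x, y)" if "0 \<le> y" "y \<le> 1" for x y
        using abs_le_D1[OF w_bound[OF e0_ep, of "(x, y)"]] that \<epsilon> by (simp add: B_def)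
      show "- (\<epsilon> / 2) \<le> - w ep (x, 0)" for x using \<epsilon> by (simp add: w_bottom)
      show "- (\<epsilon> / 2) \<le> - w ep (x, 1)" if "\<bar>x - q\<bar> \<le> l" for x
        using X[of x] abs_le_D2[OF that] q by (simp add: w_top)
    qed (use B l p in auto)
    then show ?thesis using cl w_nonneg[OF p, of q] \<epsilon> by simp
  qed
  then show "\<forall>\<^sub>F q in at_top. \<forall>p\<in>{0..1}. dist (w ep (q, p)) 0 < \<epsilon>"
    unfolding eventually_at_top_linorder dist_real_def by (intro exI[of _ "X + l"]) simp
qed

lemma hq_uniform: "uniform_limit {0..1} (\<lambda>q p. hq (q, p)) (\<lambda>_. 0) at_top"
proof (rule uniform_deriv_tendsto_zero[OF w_uniform])
  show "((\<lambda>q. w ep (q, p)) has_real_derivative hq (q, p)) (at q)" if "p \<in> {0..1}" for q p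
    using DERIV_diff[OF deriv_q(1)[OF that, of q] DERIV_const] by (simp add: w_def)
qed (rule hq_equicont)

lemma hqq_uniform: "uniform_limit {0..1} (\<lambda>q p. hqq (q, p)) (\<lambda>_. 0) at_top"
  by (rule uniform_deriv_tendsto_zero[OF hq_uniform]) (auto intro!: deriv_q hqq_unif)

text \<open>Barbalat's argument needs decay in the direction of differentiation. For
  \<open>p\<close> it is replaced by interpolation between small \<open>w\<close> and Lipschitz
  slopes.\<close>

lemma hp_uniform: "uniform_limit {0..1} (\<lambda>q p. hp (q, p) - 1 / V ep p) (\<lambda>_. 0) at_top"
proof (rule uniform_limitI)
  fix \<epsilon> :: real assume \<epsilon>: "0 < \<epsilon>"
  obtain C where C: "C > 0" "\<And>q x y. x \<in> {0..1} \<Longrightarrow> y \<in> {0..1} \<Longrightarrow>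
      \<bar>(hp (q, x) - 1 / V ep x) - (hp (q, y) - 1 / V ep y)\<bar> \<le> C * \<bar>x - y\<bar>"
    using wp_lipschitz[OF e0_ep] by blast
  define t where "t = min (1/2) (\<epsilon> / (4 * C))"
  have t: "0 < t" "t \<le> 1/2" using \<epsilon> C by (auto simp: t_def)
  have "t \<le> \<epsilon> / (4 * C)" by (simp add: t_def)
  then have Ct: "C * t \<le> \<epsilon> / 4" using C by (simp add: field_simps)
  have "\<forall>\<^sub>F q in at_top. \<forall>p\<in>{0..1}. dist (w ep (q, p)) 0 < t * \<epsilon> / 8"
    using uniform_limitD[OF w_uniform, of "t * \<epsilon> / 8"] t \<epsilon> by simp
  then show "\<forall>\<^sub>F q in at_top. \<forall>p\<in>{0..1}. dist (hp (q, p) - 1 / V ep p) 0 < \<epsilon>"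
  proof eventually_elim
    case (elim q)
    show ?case
    proof
      fix p :: real assume p: "p \<in> {0..1}"
      have "\<bar>hp (q, p) - 1 / V ep p\<bar> \<le> 2 * (t * \<epsilon> / 8) / t + C * t"
        by (rule unit_interval_deriv_le[of "\<lambda>p. w ep (q, p)" "\<lambda>p. hp (q, p) - 1 / V ep p", OF w_deriv_p[OF e0_ep] C(2)])
          (use elim C t p in \<open>auto simp: less_imp_le\<close>)
      also have "\<dots> < \<epsilon>" using t Ct \<epsilon> by simp
      finally show "dist (hp (q, p) - 1 / V ep p) 0 < \<epsilon>" by simp
    qed
  qed
qed

lemma far_field: assumes "0 < \<delta>"
  shows "\<exists>X. \<forall>q\<ge>X. \<forall>p\<in>{0..1}. w ep (q, p) \<le> \<delta> \<and> \<bar>hq (q, p)\<bar> \<le> \<delta> \<and> \<bar>hqq (q, p)\<bar> \<le> \<delta> \<and> \<bar>hp (q, p) - 1 / V ep p\<bar> \<le> \<delta>"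
proof -
  have "\<forall>\<^sub>F q in at_top. \<forall>p\<in>{0..1}. w ep (q, p) \<le> \<delta> \<and> \<bar>hq (q, p)\<bar> \<le> \<delta> \<and> \<bar>hqq (q, p)\<bar> \<le> \<delta> \<and> \<bar>hp (q, p) - 1 / V ep p\<bar> \<le> \<delta>"
    using uniform_limitD[OF w_uniform assms] uniform_limitD[OF hq_uniform assms]
      uniform_limitD[OF hqq_uniform assms] uniform_limitD[OF hp_uniform assms]
    by eventually_elim (auto simp: less_imp_le)
  then show ?thesis by (simp add: eventually_at_top_linorder)
qed

end

section \<open>Starting the moving planes\<close>

lemma deriv_nonpos_right_end:
  fixes f :: "real \<Rightarrow> real"
  assumes "(f has_real_derivative d) (at 1 within {0..1})" "\<And>p. 0 \<le> p \<Longrightarrow> p \<le> 1 \<Longrightarrow> f 1 \<le> f p"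
  shows "d \<le> 0"
proof (rule ccontr)
  assume "\<not> d \<le> 0"
  then obtain \<delta> where \<delta>: "\<delta> > 0" "\<And>h. 0 < h \<Longrightarrow> 1 - h \<in> {0..1} \<Longrightarrow> h < \<delta> \<Longrightarrow> f (1 - h) < f 1"
    using has_real_derivative_pos_inc_left[OF assms(1)] by auto
  define h where "h = min 1 (\<delta> / 2)"
  have "0 < h" "h \<le> 1" "h < \<delta>" using \<delta>(1) by (auto simp: h_def)
  with \<delta>(2)[of h] assms(2)[of "1 - h"] show False by simp
qed

text \<open>The linear operator on the exponential part of the barrier in
  \<open>reflection_principle\<close>: \<open>e\<close> is \<open>exp (k * p)\<close> and
  \<open>s\<close> is \<open>A - exp (k * p)\<close>. With \<open>k = K + 1\<close> the term
  \<open>- k^2 * e\<close> leaves \<open>- k * e\<close> after absorbing the drift in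
  \<open>p\<close>, and \<open>\<mu>\<close> is small enough for the \<open>q\<close>-derivatives to
  use up only part of it.\<close>

lemma exponential_barrier_sign:
  fixes K :: real
  assumes K: "1 \<le> K" and k: "k = K + 1" and A: "1 \<le> A" and \<mu>: "\<mu> = 1 / (8 * K * A)"
    and e: "1 \<le> e" and s: "0 \<le> s" "s \<le> A"
    and P: "\<bar>P2\<bar> \<le> K" "\<bar>PQ\<bar> \<le> K" "1 \<le> Q2" and B: "\<bar>B1\<bar> \<le> K" "\<bar>B2\<bar> \<le> K"
  shows "P2 * (\<mu>\<^sup>2 * s) + 2 * PQ * (\<mu> * (k * e)) - Q2 * (k\<^sup>2 * e) + k * e * B1 + \<mu> * s * B2 \<le> - (1 / 4)"
proof -
  have KA: "1 \<le> K * A" using mult_mono[OF K A] K by simp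
  have \<mu>0: "0 < \<mu>" "K * A * \<mu> = 1 / 8" "\<mu> \<le> 1 / 8"
    using K A KA by (auto simp: \<mu> field_simps)
  have k1: "1 \<le> k" "1 \<le> k * e" using K e mult_mono[of 1 k 1 e] by (auto simp: k)
  have "P2 * (\<mu>\<^sup>2 * s) \<le> K * (\<mu>\<^sup>2 * A)" using P(1) s K by (intro mult_mono) (auto simp: abs_le_iff)
  also have "\<dots> = (K * A * \<mu>) * \<mu>" by (simp add: power2_eq_square)
  also have "\<dots> \<le> 1 / 8" unfolding \<mu>0(2) using \<mu>0(3) by simp
  finally have 1: "P2 * (\<mu>\<^sup>2 * s) \<le> 1 / 8" .
  have "PQ * (\<mu> * (k * e)) \<le> K * (\<mu> * (k * e))" using P(2) \<mu>0 k1 by (intro mult_right_mono) (auto simp: abs_le_iff)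
  also have "\<dots> \<le> (K * A * \<mu>) * (k * e)"
    using A K \<mu>0 k1 mult_right_mono[of 1 A "K * \<mu> * (k * e)"] by (simp add: algebra_simps)
  also have "\<dots> = (k * e) / 8" unfolding \<mu>0(2) by simp
  finally have 2: "2 * PQ * (\<mu> * (k * e)) \<le> (k * e) / 4" by simp
  have 3: "k\<^sup>2 * e \<le> Q2 * (k\<^sup>2 * e)" using P(3) e mult_right_mono[of 1 Q2 "k\<^sup>2 * e"] by simp
  have 4: "k * e * B1 \<le> k * e * K" using B(1) k1 by (intro mult_left_mono) (auto simp: abs_le_iff)
  have "\<mu> * s * B2 \<le> \<mu> * s * K" using B(2) s \<mu>0 by (intro mult_left_mono) (auto simp: abs_le_iff)
  also have "\<dots> \<le> \<mu> * A * K" using s \<mu>0 K by (intro mult_right_mono mult_left_mono) auto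
  finally have "\<mu> * s * B2 \<le> \<mu> * A * K" .
  then have 5: "\<mu> * s * B2 \<le> 1 / 8" using \<mu>0(2) by (simp add: algebra_simps)
  have 6: "k\<^sup>2 * e = k * e * K + k * e" by (simp add: k power2_eq_square algebra_simps)
  show ?thesis using 1 2 3 4 5 6 k1(2) by linarith
qed

context solitary
begin

text \<open>With exactly laminar coefficients, \<open>P = x = b\<close> and
  \<open>Q = y = hqq' = 0\<close>, the terms with \<open>zp\<close> cancel and
  \<open>- \<epsilon>1 * b ^ 3\<close> remains. The deviations contribute at most linearly in
  \<open>d\<close>.\<close>

lemma laminar_interior_sign:
  assumes b: "0 < b" "b \<le> B" and zp: "0 \<le> zp" "zp \<le> B ^ 3" and o: "\<bar>o'\<bar> \<le> N"
    and P: "0 \<le> P" "P \<le> M" "\<bar>P - b\<bar> \<le> d" and x: "0 \<le> x" "x \<le> M" "\<bar>x - b\<bar> \<le> d"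
    and y: "\<bar>y\<bar> \<le> d" and Q: "\<bar>Q\<bar> \<le> d" "\<bar>Q\<bar> \<le> M" and s: "\<bar>hqq'\<bar> \<le> d" "\<bar>hqp'\<bar> \<le> M"
    and \<epsilon>: "0 \<le> \<epsilon>1"
  shows "(1 + Q\<^sup>2) * (3 * o' * b\<^sup>2 * zp - \<epsilon>1 * b ^ 3) - zp * (o' * (P\<^sup>2 + P * x + x\<^sup>2) - (P + x) * hqq' + 2 * y * hqp')
    \<le> B ^ 3 * ((3 * N * (B + M) + 3 * N * B\<^sup>2 * M + 4 * M) * d) - \<epsilon>1 * b ^ 3"
proof -
  have d: "0 \<le> d" using y by simp
  have N: "0 \<le> N" using o by simp
  have B0: "0 \<le> B" using b by simp
  have M0: "0 \<le> M" using M_pos by simp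
  have prod: "\<bar>x1 * x2 - b\<^sup>2\<bar> \<le> (B + M) * d" if x1: "\<bar>x1 - b\<bar> \<le> d" "0 \<le> x1" "x1 \<le> M" and x2: "\<bar>x2 - b\<bar> \<le> d" for x1 x2
  proof -
    have "x1 * x2 - b\<^sup>2 = x1 * (x2 - b) + b * (x1 - b)" by (simp add: power2_eq_square algebra_simps)
    then have "\<bar>x1 * x2 - b\<^sup>2\<bar> \<le> \<bar>x1\<bar> * \<bar>x2 - b\<bar> + \<bar>b\<bar> * \<bar>x1 - b\<bar>"
      by (metis abs_mult abs_triangle_ineq)
    also have "\<dots> \<le> M * d + B * d" using x1 x2 b d by (intro add_mono mult_mono) auto
    finally show ?thesis by (simp add: algebra_simps)
  qed
  define S where "S = (P * P - b\<^sup>2) + (P * x - b\<^sup>2) + (x * x - b\<^sup>2)"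
  have "\<bar>S\<bar> \<le> 3 * ((B + M) * d)"
    using prod[OF P(3,1,2) P(3)] prod[OF P(3,1,2) x(3)] prod[OF x(3,1,2) x(3)] unfolding S_def by (simp add: abs_le_iff)
  then have "\<bar>o' * S\<bar> \<le> N * (3 * ((B + M) * d))" unfolding abs_mult using o N by (intro mult_mono) auto
  then have 1: "- (o' * S) \<le> 3 * N * (B + M) * d" by (simp add: abs_le_iff algebra_simps)
  have "\<bar>o' * b\<^sup>2 * Q\<^sup>2\<bar> \<le> N * B\<^sup>2 * (M * d)"
    unfolding abs_mult power2_eq_square[of Q] using o b Q N B0 d M0 by (intro mult_mono) (auto simp: abs_of_nonneg)
  then have 2: "3 * o' * b\<^sup>2 * Q\<^sup>2 \<le> 3 * N * B\<^sup>2 * M * d" by (simp add: abs_le_iff algebra_simps)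
  have "\<bar>(P + x) * hqq'\<bar> \<le> (2 * M) * d" unfolding abs_mult using P x s d by (intro mult_mono) auto
  then have 3: "(P + x) * hqq' \<le> 2 * M * d" by (simp add: abs_le_iff)
  have "\<bar>y * hqp'\<bar> \<le> d * M" unfolding abs_mult using y s d by (intro mult_mono) auto
  then have 4: "- (2 * y * hqp') \<le> 2 * M * d" by (simp add: abs_le_iff algebra_simps)
  define br where "br = - (o' * S) + 3 * o' * b\<^sup>2 * Q\<^sup>2 + (P + x) * hqq' - 2 * y * hqp'"
  define C5 where "C5 = 3 * N * (B + M) + 3 * N * B\<^sup>2 * M + 4 * M"
  have C5: "0 \<le> C5 * d" using N B0 M0 d by (simp add: C5_def add_nonneg_nonneg)
  have br: "br \<le> C5 * d" using 1 2 3 4 unfolding br_def C5_def by (simp add: algebra_simps)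
  have "(1 + Q\<^sup>2) * (3 * o' * b\<^sup>2 * zp - \<epsilon>1 * b ^ 3) - zp * (o' * (P\<^sup>2 + P * x + x\<^sup>2) - (P + x) * hqq' + 2 * y * hqp')
    = zp * br - \<epsilon>1 * b ^ 3 - Q\<^sup>2 * (\<epsilon>1 * b ^ 3)"
    unfolding br_def S_def by (simp add: power2_eq_square algebra_simps)
  also have "\<dots> \<le> zp * br - \<epsilon>1 * b ^ 3" using b \<epsilon> by simp
  also have "zp * br \<le> zp * (C5 * d)" using br zp by (intro mult_left_mono) auto
  also have "\<dots> \<le> B ^ 3 * (C5 * d)" using zp C5 by (intro mult_right_mono) auto
  finally show ?thesis unfolding C5_def by simp
qed

text \<open>The graph of the inverse square lies above its tangents.\<close>

lemma inverse_square_tangent: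
  fixes P x :: real
  assumes "0 < P" "0 < x"
  shows "1 / x\<^sup>2 - 2 * (P - x) / x ^ 3 \<le> 1 / P\<^sup>2"
proof -
  have "0 \<le> (P - x)\<^sup>2 * (2 * P + x)" using assms by (intro mult_nonneg_nonneg) auto
  then have "(3 * x - 2 * P) * P\<^sup>2 \<le> x ^ 3" by (simp add: power2_eq_square power3_eq_cube algebra_simps)
  then have "(3 * x - 2 * P) / x ^ 3 \<le> 1 / P\<^sup>2" using assms by (simp add: field_simps)
  moreover have "1 / x\<^sup>2 - 2 * (P - x) / x ^ 3 = (3 * x - 2 * P) / x ^ 3"
    using assms by (simp add: power2_eq_square power3_eq_cube field_simps)
  ultimately show ?thesis by simp
qed

text \<open>Where the reflected wave touches \<open>h - m Z\<close> from above on the surface, the gradients differ by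
  \<open>m \<nabla>Z\<close> and Bernoulli's equation linearizes with the right sign.\<close>
lemma surface_touching:
  fixes P Q x y m Z Zp Zq Y :: real
  assumes P: "0 < P" "0 < x" and m: "0 < m" and Zp: "0 \<le> Zp"
    and B: "(1 + Q\<^sup>2) / (2 * P\<^sup>2) + (Y - m * Z) = r" "(1 + y\<^sup>2) / (2 * x\<^sup>2) + Y = r"
    and Q: "Q = y - m * Zq" and Pl: "P \<le> x - m * Zp"
  shows "Zp / x ^ 3 - y * Zq / x\<^sup>2 \<le> Z"
proof -
  have "1 / x\<^sup>2 + 2 * (m * Zp) / x ^ 3 \<le> 1 / x\<^sup>2 - 2 * (P - x) / x ^ 3"
  proof -
    have "2 * (m * Zp) / x ^ 3 \<le> (2 * (x - P)) / x ^ 3" using Pl P by (intro divide_right_mono) auto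
    also have "\<dots> = - (2 * (P - x) / x ^ 3)" unfolding minus_divide_left by (rule arg_cong[of _ _ "\<lambda>a. a / x ^ 3"]) simp
    finally have "2 * (m * Zp) / x ^ 3 \<le> - (2 * (P - x) / x ^ 3)" .
    then show ?thesis by argo
  qed
  also have "\<dots> \<le> 1 / P\<^sup>2" by (rule inverse_square_tangent[OF P])
  finally have 1: "1 / x\<^sup>2 + 2 * (m * Zp) / x ^ 3 \<le> 1 / P\<^sup>2" .
  have mz: "0 \<le> 2 * (m * Zp) / x ^ 3" using m Zp P by simp
  have "(1 + Q\<^sup>2) * (1 / x\<^sup>2) + 2 * (m * Zp) / x ^ 3 \<le> (1 + Q\<^sup>2) * (1 / x\<^sup>2 + 2 * (m * Zp) / x ^ 3)"
    using mult_right_mono[of 1 "1 + Q\<^sup>2", OF _ mz] by (simp add: algebra_simps)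
  also have "\<dots> \<le> (1 + Q\<^sup>2) * (1 / P\<^sup>2)" using 1 by (intro mult_left_mono) auto
  finally have 2: "(1 + Q\<^sup>2) / x\<^sup>2 + 2 * (m * Zp) / x ^ 3 \<le> (1 + Q\<^sup>2) / P\<^sup>2" by simp
  have "y\<^sup>2 - 2 * y * (m * Zq) \<le> Q\<^sup>2" unfolding Q by (simp add: power2_diff)
  then have "(1 + y\<^sup>2 - 2 * y * (m * Zq)) / x\<^sup>2 \<le> (1 + Q\<^sup>2) / x\<^sup>2" by (intro divide_right_mono) auto
  with 2 have 3: "(1 + y\<^sup>2 - 2 * y * (m * Zq)) / x\<^sup>2 + 2 * (m * Zp) / x ^ 3 \<le> (1 + Q\<^sup>2) / P\<^sup>2" by linarith
  have B1: "(1 + Q\<^sup>2) / P\<^sup>2 = 2 * (r - Y + m * Z)" using B(1) P by (simp add: field_simps)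
  have B2: "(1 + y\<^sup>2) / x\<^sup>2 = 2 * (r - Y)" using B(2) P by (simp add: field_simps)
  have "(1 + y\<^sup>2 - 2 * y * (m * Zq)) / x\<^sup>2 = 2 * (r - Y) - 2 * y * (m * Zq) / x\<^sup>2"
    using B2 by (simp add: diff_divide_distrib)
  with 3 B1 have "2 * (m * Zp) / x ^ 3 - 2 * y * (m * Zq) / x\<^sup>2 \<le> 2 * (m * Z)" by simp
  then have "(2 * m) * (Zp / x ^ 3 - y * Zq / x\<^sup>2) \<le> (2 * m) * Z" by (simp add: algebra_simps)
  then show ?thesis using m by simp
qed

text \<open>A negative minimum of \<open>u l / Z\<close> is excluded for the barrier \<open>Z = zz p + C3 exp (- \<mu> (q - X)) (A - exp (k p))\<close>.
  For \<open>q > X\<close> the coefficients are almost laminar and \<open>zz\<close> is a strict supersolution of the linearized problem,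
  including Bernoulli's condition on the top, because \<open>I ep < 1\<close>; for \<open>q \<le> X\<close> the exponential term dominates in the
  interior. On the top \<open>u l\<close> is nonnegative up to \<open>Y\<close>, beyond which the exponential term is negligible.\<close>
lemma reflection_principle:
  "\<exists>Y. \<forall>l. (\<forall>q. l \<le> q \<longrightarrow> q \<le> Y \<longrightarrow> \<eta> q \<le> \<eta> (2 * l - q)) \<longrightarrow> (\<forall>q p. l \<le> q \<longrightarrow> p \<in> {0..1} \<longrightarrow> 0 \<le> u l (q, p))"
proof -
  obtain N where N: "0 < N" "\<And>p. p \<in> {0..1} \<Longrightarrow> \<bar>\<omega> p\<bar> \<le> N" using omega_bound by blast
  obtain B where B: "0 < B" "\<And>p. p \<in> {0..1} \<Longrightarrow> V ep p \<le> B" "\<And>p. p \<in> {0..1} \<Longrightarrow> 1 / V ep p \<le> B"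
    using V_bounds[OF e0_ep] by blast
  obtain K where K: "1 + M\<^sup>2 \<le> K" and ub: "\<And>l z. z \<in> cstrip \<Longrightarrow> \<bar>ub1 l z\<bar> \<le> K \<and> \<bar>ub2 l z\<bar> \<le> K"
    using u_coeff_bound by blast
  have K1: "1 \<le> K" using K zero_le_power2[of M] by linarith
  let ?b = "\<lambda>p. 1 / V ep p"
  have b_pos: "0 < ?b p" if "p \<in> {0..1}" for p using V_pos[OF e0_ep that] by simp
  have b_ge: "1 / B \<le> ?b p" if "p \<in> {0..1}" for p
    using B(2)[OF that] V_pos[OF e0_ep that] by (intro divide_left_mono mult_pos_pos B(1)) auto
  \<comment> \<open>Positive because the flow \<open>ep\<close> is supercritical; the margins below
    are fractions of it.\<close>
  define g where "g = 1 - I ep"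
  have g: "0 < g" "g < 1" using I_lt_1[OF ep(1)] I_pos[OF e0_ep] by (auto simp: g_def)
  define \<epsilon>0 where "\<epsilon>0 = g / 4"
  define \<epsilon>1 where "\<epsilon>1 = g / 4"
  have \<epsilon>: "0 < \<epsilon>0" "0 < \<epsilon>1" "\<epsilon>1 < 1" using g by (auto simp: \<epsilon>0_def \<epsilon>1_def)
  \<comment> \<open>\<open>?b p ^ 3\<close> is minus the energy derivative of the laminar slope
    \<open>1 / V\<close>, so its integral solves the linearized interior equation. The factor with
    \<open>\<epsilon>1\<close> makes the inequality strict, and \<open>\<epsilon>0\<close> keeps
    \<open>zz\<close> positive at the bottom.\<close>
  define zp where "zp p = ?b p ^ 3 * (1 - \<epsilon>1 * p)" for p
  define zpp where "zpp p = 3 * \<omega> p * (?b p)\<^sup>2 * zp p - \<epsilon>1 * ?b p ^ 3" for p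
  define zz where "zz p = \<epsilon>0 + integral {0..p} zp" for p
  have b3: "?b p ^ 3 \<le> B ^ 3" if "p \<in> {0..1}" for p
    using b_pos[OF that] B(3)[OF that] by (intro power_mono) auto
  have ep1: "0 \<le> 1 - \<epsilon>1 * p" "1 - \<epsilon>1 * p \<le> 1" if "p \<in> {0..1}" for p
    using that \<epsilon> mult_mono[of \<epsilon>1 1 p 1] by auto
  have zp_bd: "0 \<le> zp p" "zp p \<le> B ^ 3" if "p \<in> {0..1}" for p
  proof -
    have 0: "0 \<le> ?b p ^ 3" using b_pos[OF that] by (intro zero_le_power) simp
    show "0 \<le> zp p" unfolding zp_def using 0 ep1[OF that] by (intro mult_nonneg_nonneg)
    show "zp p \<le> B ^ 3" unfolding zp_def using mult_mono[OF b3[OF that] ep1(2)[OF that]] ep1[OF that] B by simp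
  qed
  have db: "(?b has_real_derivative \<omega> p * ?b p ^ 3) (at p within {0..1})" if "p \<in> {0..1}" for p
    using inv_V_deriv[OF e0_ep that] by (simp add: power_divide)
  have dzp: "(zp has_real_derivative zpp p) (at p within {0..1})" if "p \<in> {0..1}" for p
  proof -
    have "(zp has_real_derivative of_nat 3 * (\<omega> p * ?b p ^ 3) * ?b p ^ (3 - 1) * (1 - \<epsilon>1 * p) + (0 - \<epsilon>1 * 1) * ?b p ^ 3) (at p within {0..1})"
      unfolding zp_def[abs_def]
      by (rule DERIV_cong[OF DERIV_mult[OF DERIV_power[OF db[OF that]] DERIV_diff[OF DERIV_const DERIV_cmult[OF DERIV_ident]]]])
        simp
    then show ?thesis
      by (rule DERIV_cong) (simp add: zpp_def zp_def power2_eq_square power3_eq_cube algebra_simps)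
  qed
  have czp: "continuous_on {0..1} zp" by (rule DERIV_continuous_on[OF dzp])
  have dzz: "(zz has_real_derivative zp p) (at p within {0..1})" if "p \<in> {0..1}" for p
    unfolding zz_def[abs_def]
    by (rule DERIV_cong[OF DERIV_add[OF DERIV_const integral_has_real_derivative[OF czp that]]]) simp
  have zz_ge: "\<epsilon>0 \<le> zz p" if "p \<in> {0..1}" for p
  proof -
    have "{0..p} \<subseteq> {0..1}" using that by auto
    then have "0 \<le> integral {0..p} zp"
      by (intro integral_nonneg integrable_continuous_real continuous_on_subset[OF czp] zp_bd) auto
    then show ?thesis by (simp add: zz_def)
  qed
  \<comment> \<open>The linearized Bernoulli condition is contradicted if
    \<open>zp 1 / ?b 1 ^ 3\<close> exceeds \<open>zz 1\<close>: the former is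
    \<open>1 - g / 4\<close>, the latter at most \<open>1 - 3 * g / 4\<close>.\<close>
  have zz1: "zz 1 \<le> 1 - 3 * g / 4"
  proof -
    have "integral {0..1} zp \<le> integral {0..1} (\<lambda>p. ?b p ^ 3)"
    proof (rule integral_le)
      show "zp integrable_on {0..1}" by (rule integrable_continuous_real[OF czp])
      show "(\<lambda>p. ?b p ^ 3) integrable_on {0..1}"
        by (intro integrable_continuous_real continuous_on_power cont_inv e0_ep)
      fix p :: real assume p: "p \<in> {0..1}"
      have "0 \<le> ?b p ^ 3" using b_pos[OF p] by (intro zero_le_power) simp
      then show "zp p \<le> ?b p ^ 3" unfolding zp_def using ep1[OF p] by (simp add: mult_left_le)
    qed
    also have "\<dots> = I ep" by (simp add: flowI_def power_divide)
    finally show ?thesis unfolding zz_def \<epsilon>0_def g_def by argo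
  qed
  define k where "k = K + 1"
  define A where "A = exp k + 1"
  define \<mu> where "\<mu> = 1 / (8 * K * A)"
  have A: "1 \<le> A" by (simp add: A_def)
  have \<mu>: "0 < \<mu>" using K1 A by (simp add: \<mu>_def)
  have k: "0 < k" using K1 by (simp add: k_def)
  \<comment> \<open>\<open>C2\<close> bounds the operator on \<open>zz\<close> without any closeness
    to the laminar flow. With \<open>C3 = 4 * (C2 + 1)\<close> the exponential part wins wherever
    \<open>E\<close> is at least 1, that is for \<open>q \<le> X\<close>.\<close>
  define C2 where "C2 = K * ((3 * N * B\<^sup>2 * B ^ 3 + B ^ 3) + B ^ 3)"
  define C3 where "C3 = 4 * (C2 + 1)"
  have C2: "0 \<le> C2" using K1 N B by (auto simp: C2_def intro!: mult_nonneg_nonneg add_nonneg_nonneg)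
  have C3: "0 < C3" using C2 by (simp add: C3_def)
  \<comment> \<open>Bounds each component of the gradient of \<open>Z\<close> for
    \<open>q \<ge> X\<close>.\<close>
  define Cz where "Cz = B ^ 3 + C3 * (k * exp k) + C3 * (\<mu> * A)"
  have Cz: "0 \<le> Cz" "C3 * (k * exp k) \<le> Cz" "C3 * (\<mu> * A) \<le> Cz" "B ^ 3 + C3 * (k * exp k) \<le> Cz"
    using B C3 k \<mu> A by (auto simp: Cz_def intro!: add_nonneg_nonneg mult_nonneg_nonneg)
  define C5 where "C5 = 3 * N * (B + M) + 3 * N * B\<^sup>2 * M + 4 * M"
  have C5: "0 < C5" using N B M_pos by (auto simp: C5_def intro!: add_nonneg_pos add_nonneg_nonneg)
  define C6 where "C6 = M\<^sup>2 + M * B + B\<^sup>2"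
  define C7 where "C7 = C6 * (1 + C3 * A) + M * (C3 * (A * \<mu>))"
  have C6: "0 \<le> C6" using B M_pos by (simp add: C6_def)
  have C7: "0 \<le> C7" using C6 C3 A M_pos \<mu> by (auto simp: C7_def intro!: add_nonneg_nonneg mult_nonneg_nonneg)
  \<comment> \<open>Sixteen errors of this size fit into the margin \<open>b1 ^ 3 * g\<close> of the
    surface condition.\<close>
  define \<kappa> where "\<kappa> = g / (16 * B ^ 3)"
  have \<kappa>: "0 < \<kappa>" using g B by (simp add: \<kappa>_def)
  define c where "c = 1 + Cz / \<epsilon>0"
  have c: "1 \<le> c" using Cz \<epsilon> by (simp add: c_def)
  \<comment> \<open>The first entry keeps deviations of the coefficients below the interior margin,
    the second keeps the surface errors below \<open>\<kappa>\<close>.\<close>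
  define \<delta> where "\<delta> = min (\<epsilon>1 / (2 * B ^ 3 * (B ^ 3 * C5 * c))) (\<kappa> / (C7 + 1))"
  have \<delta>: "0 < \<delta>" using \<epsilon> B C5 c \<kappa> C7 by (auto simp: \<delta>_def intro!: divide_pos_pos mult_pos_pos)
  have \<delta>1: "B ^ 3 * (C5 * (c * \<delta>)) < \<epsilon>1 * (1 / B) ^ 3"
  proof -
    have "\<delta> \<le> \<epsilon>1 / (2 * B ^ 3 * (B ^ 3 * C5 * c))" by (simp add: \<delta>_def)
    moreover have "0 < 2 * B ^ 3 * (B ^ 3 * C5 * c)" using B C5 c by (intro mult_pos_pos) auto
    ultimately have "\<delta> * (2 * B ^ 3 * (B ^ 3 * C5 * c)) \<le> \<epsilon>1" by (simp add: pos_le_divide_eq)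
    then have "2 * (B ^ 3 * (C5 * (c * \<delta>))) * B ^ 3 \<le> \<epsilon>1" by (simp add: algebra_simps)
    then have "2 * (B ^ 3 * (C5 * (c * \<delta>))) \<le> \<epsilon>1 / B ^ 3" using B by (simp add: pos_le_divide_eq)
    moreover have "0 < \<epsilon>1 / B ^ 3" using \<epsilon> B by simp
    ultimately show ?thesis by (simp add: power_divide)
  qed
  have \<delta>2: "\<delta> * C7 \<le> \<kappa>"
  proof -
    have "\<delta> \<le> \<kappa> / (C7 + 1)" by (simp add: \<delta>_def)
    then have "\<delta> * (C7 + 1) \<le> \<kappa>" using C7 by (simp add: pos_le_divide_eq)
    then show ?thesis using \<delta> by (simp add: algebra_simps)
  qed
  obtain X where X: "\<And>q p. X \<le> q \<Longrightarrow> p \<in> {0..1} \<Longrightarrow> w ep (q, p) \<le> \<delta> \<and> \<bar>hq (q, p)\<bar> \<le> \<delta> \<and> \<bar>hqq (q, p)\<bar> \<le> \<delta> \<and> \<bar>hp (q, p) - ?b p\<bar> \<le> \<delta>"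
    using far_field[OF \<delta>] by blast
  \<comment> \<open>Multiplies \<open>E\<close> in the surface errors caused by the exponential
    part; beyond \<open>Y\<close> these are at most \<open>\<kappa>\<close>.\<close>
  define C8 where "C8 = C3 * (k * exp k) + B ^ 3 * (C3 * A)"
  have C8: "0 \<le> C8" using C3 k B A by (auto simp: C8_def intro!: add_nonneg_nonneg mult_nonneg_nonneg)
  have "((\<lambda>q. exp (- \<mu> * (q - X))) \<longlongrightarrow> 0) at_top"
  proof (rule filterlim_compose[OF exp_at_bot])
    show "filterlim (\<lambda>q. - \<mu> * (q - X)) at_bot at_top"
    proof (rule filterlim_tendsto_neg_mult_at_bot[OF tendsto_const])
      show "- \<mu> < 0" using \<mu> by simp
      show "filterlim (\<lambda>q. q - X) at_top at_top"
        using filterlim_tendsto_add_at_top[OF tendsto_const[of "- X"] filterlim_ident] by simp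
    qed
  qed
  then have "\<forall>\<^sub>F q in at_top. exp (- \<mu> * (q - X)) < \<kappa> / (C8 + 1)"
    by (rule order_tendstoD) (use \<kappa> C8 in simp)
  then obtain Y0 where Y0: "\<And>q. Y0 \<le> q \<Longrightarrow> exp (- \<mu> * (q - X)) < \<kappa> / (C8 + 1)"
    unfolding eventually_at_top_linorder by blast
  define Y where "Y = max X Y0"
  define E where "E q = exp (- \<mu> * (q - X))" for q
  have E0: "0 < E q" for q by (simp add: E_def)
  have E_X: "1 \<le> E q" if "q \<le> X" for q using that \<mu> mult_nonneg_nonneg[of \<mu> "X - q"] by (simp add: E_def algebra_simps)
  have E_X': "E q \<le> 1" if "X \<le> q" for q using that \<mu> by (simp add: E_def)
  have E_Y: "C8 * E q \<le> \<kappa>" if "Y \<le> q" for q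
  proof -
    have "E q < \<kappa> / (C8 + 1)" using Y0[of q] that by (simp add: E_def Y_def)
    then have "E q * (C8 + 1) < \<kappa>" using C8 by (simp add: pos_less_divide_eq)
    then show ?thesis using E0[of q] by (simp add: algebra_simps)
  qed
  let ?e = "\<lambda>z :: real \<times> real. exp (k * snd z)"
  let ?s = "\<lambda>z :: real \<times> real. A - ?e z"
  define Z where "Z z = zz (snd z) + C3 * (E (fst z) * ?s z)" for z
  define Zq where "Zq z = - (C3 * (\<mu> * (E (fst z) * ?s z)))" for z
  define Zp where "Zp z = zp (snd z) - C3 * (k * (E (fst z) * ?e z))" for z
  define Zqq where "Zqq z = C3 * (\<mu>\<^sup>2 * (E (fst z) * ?s z))" for z
  define Zqp where "Zqp z = C3 * (\<mu> * (k * (E (fst z) * ?e z)))" for z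
  define Zpp where "Zpp z = zpp (snd z) - C3 * (k\<^sup>2 * (E (fst z) * ?e z))" for z
  have e_bd: "1 \<le> ?e z" "?e z \<le> exp k" "1 \<le> ?s z" "?s z \<le> A" if "z \<in> cstrip" for z :: "real \<times> real"
  proof -
    have p: "0 \<le> snd z" "snd z \<le> 1" using that by auto
    have kp: "k * snd z \<le> k" using mult_left_mono[OF p(2), of k] k by simp
    show "1 \<le> ?e z" using p k by simp
    show "?e z \<le> exp k" using kp by simp
    then show "1 \<le> ?s z" by (simp add: A_def)
    show "?s z \<le> A" by simp
  qed
  have Z_ge: "\<epsilon>0 \<le> Z z" if "z \<in> cstrip" for z
  proof -
    have "0 \<le> C3 * (E (fst z) * ?s z)" using C3 E0[of "fst z"] e_bd(3)[OF that] by (intro mult_nonneg_nonneg) auto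
    moreover have "\<epsilon>0 \<le> zz (snd z)" using that by (intro zz_ge) auto
    ultimately show ?thesis by (simp add: Z_def)
  qed
  have dE: "((\<lambda>z. E (fst z)) has_derivative (\<lambda>v. - (\<mu> * E (fst z)) * fst v)) (at z)" for z :: "real \<times> real"
    unfolding E_def by (auto intro!: derivative_eq_intros simp: fun_eq_iff)
  have de: "(?e has_derivative (\<lambda>v. k * ?e z * snd v)) (at z)" for z
    by (auto intro!: derivative_eq_intros simp: fun_eq_iff)
  have dEs: "((\<lambda>z. E (fst z) * ?s z) has_derivative (\<lambda>v. - (\<mu> * (E (fst z) * ?s z)) * fst v - k * (E (fst z) * ?e z) * snd v)) (at z)" for z
    by (rule has_derivative_eq_rhs[OF has_derivative_mult[OF dE has_derivative_diff[OF has_derivative_const de]]])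
      (simp add: fun_eq_iff algebra_simps)
  have dEe: "((\<lambda>z. E (fst z) * ?e z) has_derivative (\<lambda>v. - (\<mu> * (E (fst z) * ?e z)) * fst v + k * (E (fst z) * ?e z) * snd v)) (at z)" for z
    by (rule has_derivative_eq_rhs[OF has_derivative_mult[OF dE de]]) (simp add: fun_eq_iff algebra_simps)
  have Z_C2: "C2_data strip Z Zq Zp Zqq Zqp Zpp"
    unfolding C2_data_def
  proof (intro ballI conjI)
    fix z :: "real \<times> real" assume z: "z \<in> strip"
    have p: "snd z \<in> {0..1}" using z by auto
    show "(Z has_derivative (\<lambda>v. Zq z * fst v + Zp z * snd v)) (at z)"
      unfolding Z_def[abs_def]
      by (rule has_derivative_eq_rhs[OF has_derivative_add[OF deriv_snd[OF dzz[OF p] z] has_derivative_mult_right[OF dEs]]])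
        (simp add: fun_eq_iff Zq_def Zp_def algebra_simps)
    show "(Zq has_derivative (\<lambda>v. Zqq z * fst v + Zqp z * snd v)) (at z)"
      unfolding Zq_def[abs_def]
      by (rule has_derivative_eq_rhs[OF has_derivative_minus[OF has_derivative_mult_right[OF has_derivative_mult_right[OF dEs]]]])
        (simp add: fun_eq_iff Zqq_def Zqp_def power2_eq_square algebra_simps)
    show "(Zp has_derivative (\<lambda>v. Zqp z * fst v + Zpp z * snd v)) (at z)"
      unfolding Zp_def[abs_def]
      by (rule has_derivative_eq_rhs[OF has_derivative_diff[OF deriv_snd[OF dzp[OF p] z] has_derivative_mult_right[OF has_derivative_mult_right[OF dEe]]]])
        (simp add: fun_eq_iff Zpp_def Zqp_def power2_eq_square algebra_simps)
  qed
  have cE: "continuous_on X' E" for X' unfolding E_def by (intro continuous_intros)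
  have Z_cont: "continuous_on cstrip Z"
    unfolding Z_def
    by (intro continuous_intros continuous_on_compose2[OF DERIV_continuous_on[OF dzz]] continuous_on_compose2[OF cE[of UNIV]]) auto
  show ?thesis
  proof (intro exI[of _ Y] allI impI)
    fix l q1 p1 :: real
    assume top: "\<forall>q. l \<le> q \<longrightarrow> q \<le> Y \<longrightarrow> \<eta> q \<le> \<eta> (2 * l - q)" and q1: "l \<le> q1" and p1: "p1 \<in> {0..1}"
    interpret RW: wave \<omega> r em ep "rh l" "rhq l" "rhp l"
      "rhqq l" "rhqp l" "rhpp l" M c0
      by (rule reflected_wave)
    interpret El: elliptic_op "half_strip l" "\<lambda>z. (rhp l z)\<^sup>2"
      "\<lambda>z. - rhp l z * rhq l z" "\<lambda>z. 1 + (rhq l z)\<^sup>2" K RW.ec_const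
      by (rule RW.elliptic[OF open_half_strip half_strip_subset K])
    show "0 \<le> u l (q1, p1)"
    proof (rule ccontr)
      assume neg: "\<not> 0 \<le> u l (q1, p1)"
      \<comment> \<open>Its positive maximum \<open>m\<close> is the least multiple for which
        \<open>u l + m * Z\<close> is nonnegative; the contradiction is sought at the contact
        point.\<close>
      define \<rho> where "\<rho> z = - u l z / Z z" for z
      \<comment> \<open>As \<open>w ep\<close> is nonnegative at the reflected point, the defect is
        controlled by the decaying \<open>w ep\<close> at the point itself, uniformly in
        \<open>l\<close>.\<close>
      have uw: "- u l z \<le> w ep z" if "z \<in> cstrip" for z
      proof -
        have "snd z \<in> {0..1}" using that by auto
        then have "0 \<le> w ep (2 * l - fst z, snd z)" by (rule w_nonneg)
        then show ?thesis by (simp add: w_def u_def)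
      qed
      have Zpos: "0 < Z z" if "z \<in> cstrip" for z using Z_ge[OF that] \<epsilon> by linarith
      have z1: "(q1, p1) \<in> cstrip" using p1 by simp
      have \<rho>1: "0 < \<rho> (q1, p1)" using neg Zpos[OF z1] by (simp add: \<rho>_def divide_neg_pos)
      obtain X1 where X1: "\<And>q p. X1 \<le> q \<Longrightarrow> p \<in> {0..1} \<Longrightarrow> w ep (q, p) \<le> \<rho> (q1, p1) * \<epsilon>0 / 2"
      proof -
        have "0 < \<rho> (q1, p1) * \<epsilon>0 / 2" using \<rho>1 \<epsilon> by simp
        from far_field[OF this] show ?thesis using that by blast
      qed
      have far: "\<rho> (q, p) < \<rho> (q1, p1)" if "X1 \<le> q" "p \<in> {0..1}" for q p
      proof -
        have z: "(q, p) \<in> cstrip" using that by simp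
        have "- u l (q, p) \<le> \<rho> (q1, p1) * \<epsilon>0 / 2" using uw[OF z] X1[OF that] by linarith
        also have "\<dots> < \<rho> (q1, p1) * \<epsilon>0" using \<rho>1 \<epsilon> by simp
        also have "\<dots> \<le> \<rho> (q1, p1) * Z (q, p)" using Z_ge[OF z] \<rho>1 by (intro mult_left_mono) auto
        finally have "- u l (q, p) < \<rho> (q1, p1) * Z (q, p)" .
        then show ?thesis unfolding \<rho>_def[of "(q, p)"] using pos_divide_less_eq[OF Zpos[OF z]] by blast
      qed
      define T where "T = {l..max q1 X1} \<times> {0..1::real}"
      have "compact T" unfolding T_def by (intro compact_Times) auto
      moreover have "continuous_on T \<rho>"
      proof -
        have "T \<subseteq> cstrip" by (auto simp: T_def)
        then show ?thesis unfolding \<rho>_def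
          using Zpos by (intro continuous_on_divide continuous_on_minus continuous_on_subset[OF u_cont(1)] continuous_on_subset[OF Z_cont])
            (auto simp: less_imp_neq[symmetric])
      qed
      moreover have z1T: "(q1, p1) \<in> T" using q1 p1 by (simp add: T_def)
      ultimately obtain z0 where z0: "z0 \<in> T" "\<And>z. z \<in> T \<Longrightarrow> \<rho> z \<le> \<rho> z0"
        using continuous_attains_sup[of T \<rho>] by blast
      obtain q0 p0 where qp: "z0 = (q0, p0)" by (cases z0)
      define m where "m = \<rho> z0"
      have m: "0 < m" using z0(2)[OF z1T] \<rho>1 by (simp add: m_def)
      have q0: "l \<le> q0" and p0: "p0 \<in> {0..1}" using z0(1) by (auto simp: T_def qp)
      have z0c: "z0 \<in> cstrip" using p0 by (simp add: qp)
      have \<rho>_le: "\<rho> (q, p) \<le> m" if "l \<le> q" "p \<in> {0..1}" for q p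
      proof (cases "X1 \<le> q")
        case True
        then show ?thesis using far[OF True that(2)] z0(2)[OF z1T] by (simp add: m_def)
      next
        case False
        then have "(q, p) \<in> T" using that by (auto simp: T_def)
        then show ?thesis using z0(2) by (simp add: m_def)
      qed
      define f where "f z = u l z - (- m) * Z z" for z
      have f_nonneg: "0 \<le> f (q, p)" if "l \<le> q" "p \<in> {0..1}" for q p
      proof -
        have z: "(q, p) \<in> cstrip" using that by simp
        have "- u l (q, p) \<le> m * Z (q, p)"
          using \<rho>_le[OF that] pos_divide_le_eq[OF Zpos[OF z]] unfolding \<rho>_def by blast
        then show ?thesis by (simp add: f_def)
      qed
      have f0: "f z0 = 0" using Zpos[OF z0c] by (simp add: f_def m_def \<rho>_def)
      have u0: "u l z0 = - (m * Z z0)" using f0 by (simp add: f_def)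
      have mZ: "0 < m * Z z0" using m Zpos[OF z0c] by simp
      have q0l: "l < q0"
      proof (rule ccontr)
        assume "\<not> l < q0"
        then have "q0 = l" using q0 by simp
        then have "u l z0 = 0" by (simp add: u_def qp)
        then show False using u0 mZ by linarith
      qed
      have p00: "0 < p0"
      proof (rule ccontr)
        assume "\<not> 0 < p0"
        then have "p0 = 0" using p0 by simp
        then have "u l z0 = 0" by (simp add: u_def qp bottom)
        then show False using u0 mZ by linarith
      qed
      define P Q x y where "P = hp (2 * l - q0, p0)" and "Q = - hq (2 * l - q0, p0)" and "x = hp z0" and "y = hq z0"
      have Rz: "(2 * l - q0, p0) \<in> cstrip" using p0 by simp
      have PM: "0 < P" "P \<le> M" "\<bar>Q\<bar> \<le> M" using bounds[OF Rz] hp_pos[OF Rz] by (auto simp: P_def Q_def)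
      have xM: "0 < x" "x \<le> M" "\<bar>y\<bar> \<le> M" using bounds[OF z0c] hp_pos[OF z0c] by (auto simp: x_def y_def)
      \<comment> \<open>Contact far to the right forces \<open>m\<close> to be small. The gradients
        of the two waves are then close, so the reflected wave is nearly laminar at the contact
        point, although nothing is known about its position.\<close>
      have mw: "m * \<epsilon>0 \<le> \<delta>" if "X \<le> q0"
      proof -
        have "m * \<epsilon>0 \<le> m * Z z0" using Z_ge[OF z0c] m by (intro mult_left_mono) auto
        also have "\<dots> = - u l z0" using u0 by simp
        also have "\<dots> \<le> \<delta>" using uw[OF z0c] X[OF that p0] by (simp add: qp)
        finally show ?thesis .
      qed
      show False
      proof (cases "p0 < 1")
        case True
        have zh: "z0 \<in> half_strip l" using q0l p00 True by (simp add: qp)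
        then have zs: "z0 \<in> strip" using half_strip_subset by blast
        have mZ_C2: "C2_data (half_strip l) (\<lambda>z. (- m) * Z z) (\<lambda>z. (- m) * Zq z) (\<lambda>z. (- m) * Zp z) (\<lambda>z. (- m) * Zqq z) (\<lambda>z. (- m) * Zqp z) (\<lambda>z. (- m) * Zpp z)"
          unfolding C2_data_def
        proof (intro ballI conjI)
          fix z assume "z \<in> half_strip l"
          then have "z \<in> strip" using half_strip_subset by blast
          note d = C2_dataD[OF Z_C2 this]
          show "((\<lambda>z. (- m) * Z z) has_derivative (\<lambda>v. - m * Zq z * fst v + - m * Zp z * snd v)) (at z)"
            by (rule has_derivative_eq_rhs[OF has_derivative_mult_right[OF d(1)]]) (simp add: fun_eq_iff algebra_simps)
          show "((\<lambda>z. (- m) * Zq z) has_derivative (\<lambda>v. - m * Zqq z * fst v + - m * Zqp z * snd v)) (at z)"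
            by (rule has_derivative_eq_rhs[OF has_derivative_mult_right[OF d(2)]]) (simp add: fun_eq_iff algebra_simps)
          show "((\<lambda>z. (- m) * Zp z) has_derivative (\<lambda>v. - m * Zqp z * fst v + - m * Zpp z * snd v)) (at z)"
            by (rule has_derivative_eq_rhs[OF has_derivative_mult_right[OF d(3)]]) (simp add: fun_eq_iff algebra_simps)
        qed
        have ev: "eventually (\<lambda>z. f z0 \<le> f z) (nhds z0)"
          using eventually_nhds_in_open[OF open_half_strip zh]
        proof eventually_elim
          case (elim z)
          then show ?case using f_nonneg[of "fst z" "snd z"] f0 by (cases z) auto
        qed
        note hess = hessian_at_local_min[OF C2_data_diff[OF C2_data_subset[OF u_C2 half_strip_subset] mZ_C2] open_half_strip zh ev[unfolded f_def]]
        have uqv: "uq l z0 = - m * Zq z0" and upv: "up l z0 = - m * Zp z0" using hess(1,2) by auto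
        have "0 \<le> P\<^sup>2 * (uqq l z0 - - m * Zqq z0) + 2 * (- P * Q) * (uqp l z0 - - m * Zqp z0) + (1 + Q\<^sup>2) * (upp l z0 - - m * Zpp z0)"
          using El.trace_psd_nonneg[OF zh hess(3)] by (simp add: P_def Q_def qp)
        also have "\<dots> = (P\<^sup>2 * uqq l z0 + 2 * (- P * Q) * uqp l z0 + (1 + Q\<^sup>2) * upp l z0)
            + m * (P\<^sup>2 * Zqq z0 + 2 * (- P * Q) * Zqp z0 + (1 + Q\<^sup>2) * Zpp z0)" by (simp add: algebra_simps)
        also have "P\<^sup>2 * uqq l z0 + 2 * (- P * Q) * uqp l z0 + (1 + Q\<^sup>2) * upp l z0 = up l z0 * ub1 l z0 + uq l z0 * ub2 l z0"
          using u_equation[OF zs, of l] by (simp add: P_def Q_def qp)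
        finally have "0 \<le> m * (P\<^sup>2 * Zqq z0 + 2 * (- P * Q) * Zqp z0 + (1 + Q\<^sup>2) * Zpp z0 - Zp z0 * ub1 l z0 - Zq z0 * ub2 l z0)"
          unfolding uqv upv by (simp add: algebra_simps)
        then have T0: "0 \<le> P\<^sup>2 * Zqq z0 + 2 * (- P * Q) * Zqp z0 + (1 + Q\<^sup>2) * Zpp z0 - Zp z0 * ub1 l z0 - Zq z0 * ub2 l z0"
          using m by (simp add: zero_le_mult_iff)
        define B1 B2 e s where "B1 = ub1 l z0" and "B2 = ub2 l z0" and "e = ?e z0" and "s = ?s z0"
        have Bb: "\<bar>B1\<bar> \<le> K" "\<bar>B2\<bar> \<le> K" using ub[OF z0c, of l] by (auto simp: B1_def B2_def)
        \<comment> \<open>The contribution of \<open>zz\<close>; the exponential part contributes at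
          most \<open>- C3 * E q0 / 4\<close>.\<close>
        define TZ where "TZ = (1 + Q\<^sup>2) * zpp p0 - zp p0 * B1"
        have "P\<^sup>2 * Zqq z0 + 2 * (- P * Q) * Zqp z0 + (1 + Q\<^sup>2) * Zpp z0 - Zp z0 * ub1 l z0 - Zq z0 * ub2 l z0
          = TZ + C3 * E q0 * (P\<^sup>2 * (\<mu>\<^sup>2 * s) + 2 * (- P * Q) * (\<mu> * (k * e)) - (1 + Q\<^sup>2) * (k\<^sup>2 * e) + k * e * B1 + \<mu> * s * B2)"
          unfolding Zqq_def Zqp_def Zpp_def Zp_def Zq_def TZ_def B1_def[symmetric] B2_def[symmetric] s_def[symmetric]
          unfolding e_def[symmetric]
          by (simp add: qp algebra_simps)
        moreover have "P\<^sup>2 * (\<mu>\<^sup>2 * s) + 2 * (- P * Q) * (\<mu> * (k * e)) - (1 + Q\<^sup>2) * (k\<^sup>2 * e) + k * e * B1 + \<mu> * s * B2 \<le> - (1 / 4)"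
        proof (rule exponential_barrier_sign[OF K1 k_def A \<mu>_def])
          show "1 \<le> e" "0 \<le> s" "s \<le> A" using e_bd[OF z0c] by (auto simp: e_def s_def)
          show "\<bar>P\<^sup>2\<bar> \<le> K" using El.coeff_bound(1)[OF zh] by (simp add: P_def qp)
          show "\<bar>- P * Q\<bar> \<le> K" using El.coeff_bound(2)[OF zh] by (simp add: P_def Q_def qp)
        qed (use Bb in auto)
        then have "C3 * E q0 * (P\<^sup>2 * (\<mu>\<^sup>2 * s) + 2 * (- P * Q) * (\<mu> * (k * e)) - (1 + Q\<^sup>2) * (k\<^sup>2 * e) + k * e * B1 + \<mu> * s * B2)
          \<le> C3 * E q0 * (- (1 / 4))" using C3 E0[of q0] by (intro mult_left_mono) auto
        ultimately have T1: "0 \<le> TZ - C3 * E q0 / 4" using T0 by simp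
        have TZ_gen: "TZ \<le> C2"
        proof -
          have zpb: "\<bar>zp p0\<bar> \<le> B ^ 3" using zp_bd[OF p0] by simp
          have "\<bar>3 * \<omega> p0 * (?b p0)\<^sup>2 * zp p0\<bar> \<le> 3 * N * B\<^sup>2 * B ^ 3"
            unfolding abs_mult using N p0 B(1) B(3)[OF p0] b_pos[OF p0] zpb
            by (intro mult_mono mult_nonneg_nonneg) (auto simp: abs_of_nonneg intro!: power_mono)
          moreover have "\<bar>\<epsilon>1 * ?b p0 ^ 3\<bar> \<le> 1 * B ^ 3"
            unfolding abs_mult using \<epsilon> b3[OF p0] b_pos[OF p0] by (intro mult_mono) (auto simp: abs_of_nonneg power_divide)
          ultimately have "\<bar>zpp p0\<bar> \<le> 3 * N * B\<^sup>2 * B ^ 3 + B ^ 3"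
            unfolding zpp_def by (intro order_trans[OF abs_triangle_ineq4]) simp
          moreover have "\<bar>1 + Q\<^sup>2\<bar> \<le> K" using El.coeff_bound(3)[OF zh] by (simp add: Q_def qp)
          ultimately have "\<bar>(1 + Q\<^sup>2) * zpp p0\<bar> \<le> K * (3 * N * B\<^sup>2 * B ^ 3 + B ^ 3)"
            unfolding abs_mult using K1 by (intro mult_mono) auto
          moreover have "\<bar>zp p0 * B1\<bar> \<le> B ^ 3 * K" unfolding abs_mult using zpb Bb B by (intro mult_mono) auto
          ultimately have "\<bar>TZ\<bar> \<le> K * (3 * N * B\<^sup>2 * B ^ 3 + B ^ 3) + B ^ 3 * K"
            unfolding TZ_def by (intro order_trans[OF abs_triangle_ineq4]) simp
          then show ?thesis by (simp add: C2_def algebra_simps abs_le_iff)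
        qed
        show False
        proof (cases "q0 \<le> X")
          case True
          have "C3 * 1 \<le> C3 * E q0" using E_X[OF True] C3 by (intro mult_left_mono) auto
          then show False using T1 TZ_gen by (simp add: C3_def)
        next
          case False
          then have qX: "X \<le> q0" by simp
          note Xq = X[OF qX p0]
          have mCz: "m * Cz \<le> \<delta> * (Cz / \<epsilon>0)"
          proof -
            have "m \<le> \<delta> / \<epsilon>0" using mw[OF qX] \<epsilon> by (simp add: pos_le_divide_eq)
            from mult_right_mono[OF this Cz(1)] show ?thesis by simp
          qed
          have cd: "\<delta> + m * Cz \<le> c * \<delta>" using mCz by (simp add: c_def algebra_simps)
          have mCz0: "0 \<le> m * Cz" using m Cz by simp
          have Zp_le: "\<bar>Zp z0\<bar> \<le> Cz"
          proof -
            have "\<bar>C3 * (k * (E q0 * e))\<bar> \<le> C3 * (k * exp k)"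
            proof -
              have "1 \<le> e" "e \<le> exp k" using e_bd(1,2)[OF z0c] by (auto simp: e_def)
              then have "E q0 * e \<le> exp k" "0 \<le> E q0 * e"
                using mult_mono[of "E q0" 1 e "exp k"] E0[of q0] E_X'[OF qX] by auto
              then have "C3 * (k * (E q0 * e)) \<le> C3 * (k * exp k)" "0 \<le> C3 * (k * (E q0 * e))"
                using C3 k by (auto intro!: mult_left_mono mult_nonneg_nonneg)
              then show ?thesis by simp
            qed
            moreover have "\<bar>zp p0\<bar> \<le> B ^ 3" using zp_bd[OF p0] by simp
            ultimately have "\<bar>Zp z0\<bar> \<le> B ^ 3 + C3 * (k * exp k)"
              unfolding Zp_def by (intro order_trans[OF abs_triangle_ineq4]) (simp add: qp e_def)
            then show ?thesis using Cz(4) by linarith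
          qed
          have Zq_le: "\<bar>Zq z0\<bar> \<le> Cz"
          proof -
            have "\<bar>Zq z0\<bar> = C3 * (\<mu> * (E q0 * s))"
              unfolding Zq_def s_def using C3 \<mu> E0[of q0] e_bd(3)[OF z0c] by (simp add: qp abs_mult)
            also have "\<dots> \<le> C3 * (\<mu> * (1 * A))"
              using C3 \<mu> E0[of q0] E_X'[OF qX] e_bd(3,4)[OF z0c]
              by (intro mult_left_mono mult_mono) (auto simp: s_def)
            finally show ?thesis using Cz(3) by simp
          qed
          have PP: "P - x = - (m * Zp z0)" using upv by (simp add: up_def P_def x_def qp)
          have QQ: "Q - y = - (m * Zq z0)" using uqv by (simp add: uq_def Q_def y_def qp)
          have mz: "\<bar>m * Zp z0\<bar> \<le> m * Cz" "\<bar>m * Zq z0\<bar> \<le> m * Cz"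
            unfolding abs_mult using Zp_le Zq_le m by (auto intro!: mult_left_mono)
          have dd: "\<delta> \<le> c * \<delta>" using c \<delta> by simp
          have x1: "\<bar>x - ?b p0\<bar> \<le> \<delta>" and y1: "\<bar>y\<bar> \<le> \<delta>" and s1: "\<bar>hqq z0\<bar> \<le> \<delta>"
            using Xq by (auto simp: x_def y_def qp)
          have P1: "\<bar>P - ?b p0\<bar> \<le> c * \<delta>"
          proof -
            have "P - ?b p0 = (x - ?b p0) + - (m * Zp z0)" using PP by simp
            then have "\<bar>P - ?b p0\<bar> \<le> \<bar>x - ?b p0\<bar> + \<bar>m * Zp z0\<bar>" by (metis abs_triangle_ineq abs_minus_cancel)
            then show ?thesis using x1 mz(1) cd by linarith
          qed
          have Q1: "\<bar>Q\<bar> \<le> c * \<delta>"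
          proof -
            have "Q = y + - (m * Zq z0)" using QQ by simp
            then have "\<bar>Q\<bar> \<le> \<bar>y\<bar> + \<bar>m * Zq z0\<bar>" by (metis abs_triangle_ineq abs_minus_cancel)
            then show ?thesis using y1 mz(2) cd by linarith
          qed
          have B1v: "B1 = \<omega> p0 * (P\<^sup>2 + P * x + x\<^sup>2) - (P + x) * hqq z0 + 2 * y * hqp z0"
            by (simp add: B1_def ub1_def P_def x_def y_def qp)
          have "TZ \<le> B ^ 3 * (C5 * (c * \<delta>)) - \<epsilon>1 * ?b p0 ^ 3"
            unfolding TZ_def zpp_def B1v C5_def
          proof (rule laminar_interior_sign)
            show "0 < ?b p0" "?b p0 \<le> B" using b_pos[OF p0] B(3)[OF p0] by auto
            show "\<bar>x - ?b p0\<bar> \<le> c * \<delta>" "\<bar>y\<bar> \<le> c * \<delta>" "\<bar>hqq z0\<bar> \<le> c * \<delta>" using x1 y1 s1 dd by linarith+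
            show "\<bar>hqp z0\<bar> \<le> M" by (rule bounds[OF z0c])
          qed (use zp_bd[OF p0] N p0 PM xM P1 Q1 \<epsilon> in auto)
          moreover have "(1 / B) ^ 3 \<le> ?b p0 ^ 3" using b_ge[OF p0] B by (intro power_mono) auto
          then have "\<epsilon>1 * (1 / B) ^ 3 \<le> \<epsilon>1 * ?b p0 ^ 3" using \<epsilon> by (intro mult_left_mono) auto
          ultimately have "TZ < 0" using \<delta>1 by linarith
          moreover have "0 < C3 * E q0" using C3 E0[of q0] by simp
          ultimately show False using T1 by simp
        qed
      next
        case False
        then have p01: "p0 = 1" using p0 by simp
        \<comment> \<open>Up to \<open>Y\<close> the hypothesis makes \<open>u l\<close> nonnegative
          on the surface, which excludes contact there.\<close>
        have qY: "Y < q0"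
        proof (rule ccontr)
          assume "\<not> Y < q0"
          then have "\<eta> q0 \<le> \<eta> (2 * l - q0)" using top q0 by simp
          then have "0 \<le> u l z0" by (simp add: u_def qp p01)
          then show False using u0 mZ by linarith
        qed
        then have qX: "X \<le> q0" by (simp add: Y_def)
        note Xq = X[OF qX p0]
        have one: "(1::real) \<in> {0..1}" by simp
        define b1 where "b1 = ?b 1"
        have b1: "0 < b1" "b1 \<le> B" "1 / B \<le> b1" using b_pos[OF one] B(3)[OF one] b_ge[OF one] by (auto simp: b1_def)
        define e s where "e = exp k" and "s = A - exp k"
        have es: "1 \<le> e" "1 \<le> s" "s \<le> A" using k by (auto simp: e_def s_def A_def)
        have Zv: "Z z0 = zz 1 + C3 * (E q0 * s)" "Zq z0 = - (C3 * (\<mu> * (E q0 * s)))" "Zp z0 = zp 1 - C3 * (k * (E q0 * e))"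
          by (simp_all add: Z_def Zq_def Zp_def qp p01 e_def s_def)
        have zp1: "zp 1 = b1 ^ 3 * (1 - \<epsilon>1)" by (simp add: zp_def b1_def)
        have EY: "C8 * E q0 \<le> \<kappa>" using E_Y[of q0] qY by simp
        have b13: "(1 / B) ^ 3 \<le> b1 ^ 3" "b1 ^ 3 \<le> B ^ 3" using b1 B by (auto intro!: power_mono)
        have g16: "16 * \<kappa> \<le> b1 ^ 3 * g"
        proof -
          have "16 * \<kappa> = (1 / B) ^ 3 * g" by (simp add: \<kappa>_def power_divide)
          also have "\<dots> \<le> b1 ^ 3 * g" using b13 g by (intro mult_right_mono) auto
          finally show ?thesis .
        qed
        have CE1: "C3 * (k * (E q0 * e)) + B ^ 3 * (C3 * (E q0 * A)) \<le> \<kappa>"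
          using EY by (simp add: C8_def e_def algebra_simps)
        have CE0: "0 \<le> C3 * (k * (E q0 * e))" "0 \<le> C3 * (E q0 * A)"
          using C3 k E0[of q0] es A by (auto intro!: mult_nonneg_nonneg)
        have Zp_pos: "0 \<le> Zp z0"
        proof -
          have "b1 ^ 3 * g \<le> b1 ^ 3 * (1 - \<epsilon>1) * 4 / 3"
          proof -
            have "g \<le> (1 - \<epsilon>1) * 4 / 3" using g by (simp add: \<epsilon>1_def)
            from mult_left_mono[OF this, of "b1 ^ 3"] b1 show ?thesis by simp
          qed
          moreover have "0 \<le> B ^ 3 * (C3 * (E q0 * A))" using B CE0 by simp
          ultimately show ?thesis using CE1 g16 \<kappa> unfolding Zv zp1 by linarith
        qed
        have fq: "((\<lambda>q. f (q, 1)) has_real_derivative uq l z0 - (- m) * Zq z0) (at q0)"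
        proof -
          have du: "((\<lambda>q. u l (q, 1)) has_real_derivative uq l z0) (at q0)"
            using DERIV_diff[OF RW.deriv_q(1)[OF one, of q0] deriv_q(1)[OF one, of q0]]
            by (simp add: u_def uq_def qp p01)
          have "((\<lambda>q. E q) has_real_derivative - (\<mu> * E q0)) (at q0)"
            unfolding E_def by (auto intro!: derivative_eq_intros)
          from DERIV_add[OF DERIV_const[of "zz 1"] DERIV_cmult[OF DERIV_cmult_right[OF this, of s], of C3]]
          have "((\<lambda>q. Z (q, 1)) has_real_derivative Zq z0) (at q0)"
            by (simp add: Z_def Zv s_def mult.assoc)
          from DERIV_diff[OF du DERIV_cmult[OF this, of "- m"]] show ?thesis by (simp add: f_def)
        qed
        have "uq l z0 - (- m) * Zq z0 = 0"
        proof (rule DERIV_local_min[OF fq])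
          show "0 < q0 - l" using q0l by simp
          show "\<forall>y. \<bar>q0 - y\<bar> < q0 - l \<longrightarrow> f (q0, 1) \<le> f (y, 1)"
          proof (intro allI impI)
            fix q assume "\<bar>q0 - q\<bar> < q0 - l"
            then have "l \<le> q" by (simp add: abs_less_iff)
            then show "f (q0, 1) \<le> f (q, 1)" using f_nonneg[of q 1] f0 by (simp add: qp p01)
          qed
        qed
        then have QQ: "Q = y - m * Zq z0" by (simp add: uq_def Q_def y_def qp p01)
        have fp: "((\<lambda>p. f (q0, p)) has_real_derivative up l z0 - (- m) * Zp z0) (at 1 within {0..1})"
        proof -
          have du: "((\<lambda>p. u l (q0, p)) has_real_derivative up l z0) (at 1 within {0..1})"
            using DERIV_diff[OF RW.deriv_p(1)[OF one, of q0] deriv_p(1)[OF one, of q0]]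
            by (simp add: u_def up_def qp p01)
          have "((\<lambda>p. A - exp (k * p)) has_real_derivative - (k * e)) (at 1 within {0..1})"
            by (auto intro!: derivative_eq_intros simp: e_def)
          from DERIV_add[OF dzz[OF one] DERIV_cmult[OF DERIV_cmult[OF this, of "E q0"], of C3]]
          have "((\<lambda>p. Z (q0, p)) has_real_derivative Zp z0) (at 1 within {0..1})"
            by (simp add: Z_def Zv algebra_simps)
          from DERIV_diff[OF du DERIV_cmult[OF this, of "- m"]] show ?thesis by (simp add: f_def)
        qed
        have "up l z0 - (- m) * Zp z0 \<le> 0"
          by (rule deriv_nonpos_right_end[OF fp]) (use f_nonneg[of q0] f0 q0 in \<open>auto simp: qp p01\<close>)
        then have PP: "P \<le> x - m * Zp z0" by (simp add: up_def P_def x_def qp p01)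
        have Bern1: "(1 + Q\<^sup>2) / (2 * P\<^sup>2) + (\<eta> q0 - m * Z z0) = r"
        proof -
          have "\<eta> (2 * l - q0) = \<eta> q0 - m * Z z0" using u0 by (simp add: u_def qp p01)
          then show ?thesis using RW.bernoulli[of q0] by (simp add: P_def Q_def p01)
        qed
        have Bern2: "(1 + y\<^sup>2) / (2 * x\<^sup>2) + \<eta> q0 = r" using bernoulli[of q0] by (simp add: x_def y_def qp p01)
        have key: "Zp z0 / x ^ 3 - y * Zq z0 / x\<^sup>2 \<le> Z z0"
          by (rule surface_touching[OF PM(1) xM(1) m Zp_pos Bern1 Bern2 QQ PP])
        have x1: "\<bar>x - b1\<bar> \<le> \<delta>" and y1: "\<bar>y\<bar> \<le> \<delta>" using Xq by (auto simp: x_def y_def b1_def qp p01)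
        have "x ^ 3 * (Zp z0 / x ^ 3 - y * Zq z0 / x\<^sup>2) \<le> x ^ 3 * Z z0" using key xM by (intro mult_left_mono) auto
        then have key2: "Zp z0 - x * (y * Zq z0) \<le> x ^ 3 * Z z0"
          using xM by (simp add: algebra_simps power2_eq_square power3_eq_cube)
        have x3: "x ^ 3 \<le> b1 ^ 3 + \<delta> * C6"
        proof -
          have "x ^ 3 - b1 ^ 3 = (x - b1) * (x\<^sup>2 + x * b1 + b1\<^sup>2)" by (simp add: power2_eq_square power3_eq_cube algebra_simps)
          also have "\<dots> \<le> \<delta> * C6"
            unfolding C6_def using x1 xM b1 \<delta> B(1) M_pos
            by (intro mult_mono add_mono power_mono add_nonneg_nonneg mult_nonneg_nonneg) auto
          finally show ?thesis by simp
        qed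
        have E1: "E q0 \<le> 1" by (rule E_X'[OF qX])
        have Zs: "Z z0 \<le> zz 1 + C3 * (E q0 * A)" using Zv(1) C3 E0[of q0] es by (simp add: mult_left_mono)
        have zz1': "zz 1 \<le> 1" using zz1 g by simp
        have Z0: "0 \<le> Z z0" using Zpos[OF z0c] by simp
        have "x ^ 3 * Z z0 \<le> (b1 ^ 3 + \<delta> * C6) * Z z0" using x3 Z0 by (rule mult_right_mono)
        also have "\<dots> = b1 ^ 3 * Z z0 + \<delta> * (C6 * Z z0)" by (simp add: algebra_simps)
        also have "b1 ^ 3 * Z z0 \<le> b1 ^ 3 * (zz 1 + C3 * (E q0 * A))" using Zs b1 by (intro mult_left_mono) auto
        also have "b1 ^ 3 * (zz 1 + C3 * (E q0 * A)) \<le> b1 ^ 3 * (1 - 3 * g / 4) + B ^ 3 * (C3 * (E q0 * A))"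
        proof -
          have "b1 ^ 3 * zz 1 \<le> b1 ^ 3 * (1 - 3 * g / 4)" using zz1 b1 by (intro mult_left_mono) auto
          moreover have "b1 ^ 3 * (C3 * (E q0 * A)) \<le> B ^ 3 * (C3 * (E q0 * A))" using b13 CE0 by (intro mult_right_mono)
          ultimately show ?thesis by (simp add: distrib_left)
        qed
        also have "C6 * Z z0 \<le> C6 * (1 + C3 * A)"
        proof (intro mult_left_mono C6)
          have "C3 * (E q0 * A) \<le> C3 * (1 * A)" using E1 C3 A by (intro mult_left_mono mult_right_mono) auto
          then show "Z z0 \<le> 1 + C3 * A" using Zs zz1' by simp
        qed
        finally have up: "x ^ 3 * Z z0 \<le> b1 ^ 3 * (1 - 3 * g / 4) + B ^ 3 * (C3 * (E q0 * A)) + \<delta> * (C6 * (1 + C3 * A))"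
          using \<delta> by (simp add: mult_left_mono)
        have "x * (y * Zq z0) \<le> \<delta> * (M * (C3 * (A * \<mu>)))"
        proof -
          have "\<bar>Zq z0\<bar> = C3 * (\<mu> * (E q0 * s))" unfolding Zv using C3 \<mu> E0[of q0] es by (simp add: abs_mult)
          also have "\<dots> \<le> C3 * (\<mu> * (1 * A))" using C3 \<mu> E0[of q0] E1 es by (intro mult_left_mono mult_mono) auto
          finally have "\<bar>Zq z0\<bar> \<le> C3 * (A * \<mu>)" by (simp add: mult.commute)
          then have "\<bar>x * (y * Zq z0)\<bar> \<le> M * (\<delta> * (C3 * (A * \<mu>)))"
            unfolding abs_mult using xM y1 \<delta> by (intro mult_mono) auto
          then show ?thesis by (simp add: algebra_simps abs_le_iff)
        qed
        with key2 up have "Zp z0 \<le> b1 ^ 3 * (1 - 3 * g / 4) + B ^ 3 * (C3 * (E q0 * A)) + \<delta> * C7"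
          by (simp add: C7_def algebra_simps)
        then have "b1 ^ 3 * (1 - \<epsilon>1) \<le> b1 ^ 3 * (1 - 3 * g / 4) + \<kappa> + \<kappa>"
          using CE1 \<delta>2 unfolding Zv zp1 by linarith
        then have "b1 ^ 3 * g / 2 \<le> 2 * \<kappa>" by (simp add: \<epsilon>1_def algebra_simps)
        then show False using g16 \<kappa> by simp
      qed
    qed
  qed
qed

end

section \<open>Limits of profiles at infinity\<close>

context wave
begin

text \<open>The Bernoulli function; by the equation for \<open>h\<close> its vertical derivative is \<open>(h\<^sub>q / h\<^sub>p)\<^sub>q\<close>.\<close>
lemma bernoulli_function_integral:
  assumes p: "p \<in> {0..1}"
  shows "((\<lambda>s. hqq (q, s) / hp (q, s) - hq (q, s) * hqp (q, s) / (hp (q, s))\<^sup>2) has_integral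
      (r - \<eta> q + \<Omega> 1 - ((1 + (hq (q, p))\<^sup>2) / (2 * (hp (q, p))\<^sup>2) + \<Omega> p))) {p..1}"
proof -
  let ?b = "\<lambda>s. (1 + (hq (q, s))\<^sup>2) / (2 * (hp (q, s))\<^sup>2) + \<Omega> s"
  have nz: "hp (q, s) \<noteq> 0" if "s \<in> {0..1}" for s by (rule hp_nz) (use that in simp)
  have "((\<lambda>s. hqq (q, s) / hp (q, s) - hq (q, s) * hqp (q, s) / (hp (q, s))\<^sup>2) has_integral (?b 1 - ?b p)) {p..1}"
  proof (rule fundamental_theorem_of_calculus_interior)
    show "p \<le> 1" using p by simp
    have "continuous_on {0..1} ?b"
      by (intro continuous_intros sect_cont conts Omega_cont) (use nz in auto)
    then show "continuous_on {p..1} ?b" by (rule continuous_on_subset) (use p in auto)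
    fix s assume s: "s \<in> {p<..<1}"
    then have s01: "0 < s" "s < 1" "s \<in> {0..1}" using p by auto
    note d = interior_partials(5,6)[OF s01(1,2), of q]
    have "(\<Omega> has_real_derivative \<omega> s) (at s)"
      by (rule has_real_derivative_interior[OF Omega_derivative[OF omega_cont s01(3)] s01(1,2)])
    from DERIV_add[OF DERIV_divide[OF DERIV_add[OF DERIV_const[of 1] DERIV_power[OF d(1), of 2]] DERIV_cmult[OF DERIV_power[OF d(2), of 2], of 2]] this]
    have "(?b has_real_derivative
        (((0 + real 2 * hqp (q, s) * hq (q, s) ^ (2 - 1)) * (2 * (hp (q, s))\<^sup>2) - (1 + (hq (q, s))\<^sup>2) * (2 * (real 2 * hpp (q, s) * hp (q, s) ^ (2 - 1)))) /
         (2 * (hp (q, s))\<^sup>2 * (2 * (hp (q, s))\<^sup>2))) + \<omega> s) (at s)"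
      using nz[OF s01(3)] by (simp add: mult_ac)
    moreover have "(((0 + real 2 * hqp (q, s) * hq (q, s) ^ (2 - 1)) * (2 * (hp (q, s))\<^sup>2) - (1 + (hq (q, s))\<^sup>2) * (2 * (real 2 * hpp (q, s) * hp (q, s) ^ (2 - 1)))) /
         (2 * (hp (q, s))\<^sup>2 * (2 * (hp (q, s))\<^sup>2))) + \<omega> s
        = hqq (q, s) / hp (q, s) - hq (q, s) * hqp (q, s) / (hp (q, s))\<^sup>2"
    proof -
      define P where "P = hp (q, s)"
      have P: "P \<noteq> 0" using nz[OF s01(3)] by (simp add: P_def)
      have "(q, s) \<in> strip" using s01 by simp
      from pde[OF this] have e: "(1 + (hq (q, s))\<^sup>2) * hpp (q, s) = \<omega> s * P ^ 3 - P\<^sup>2 * hqq (q, s) + 2 * P * hq (q, s) * hqp (q, s)"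
        by (simp add: P_def)
      have "(((0 + real 2 * hqp (q, s) * hq (q, s) ^ (2 - 1)) * (2 * P\<^sup>2) - (1 + (hq (q, s))\<^sup>2) * (2 * (real 2 * hpp (q, s) * P ^ (2 - 1)))) /
         (2 * P\<^sup>2 * (2 * P\<^sup>2))) + \<omega> s = (hqp (q, s) * hq (q, s) * P - (1 + (hq (q, s))\<^sup>2) * hpp (q, s)) / P ^ 3 + \<omega> s"
        using P by (simp add: power2_eq_square power3_eq_cube field_simps)
      also have "\<dots> = hqq (q, s) / P - hq (q, s) * hqp (q, s) / P\<^sup>2"
        unfolding e using P by (simp add: power2_eq_square power3_eq_cube field_simps)
      finally show ?thesis by (simp add: P_def)
    qed
    ultimately show "(?b has_vector_derivative hqq (q, s) / hp (q, s) - hq (q, s) * hqp (q, s) / (hp (q, s))\<^sup>2) (at s)"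
      unfolding has_real_derivative_iff_has_vector_derivative[symmetric] by simp
  qed
  moreover have "?b 1 = r - \<eta> q + \<Omega> 1" using bernoulli[of q] by simp
  ultimately show ?thesis by simp
qed

text \<open>Barbalat's lemma makes \<open>hq\<close> and \<open>hqq\<close> vanish at infinity, so
  the Bernoulli function becomes constant in \<open>p\<close> and \<open>1 / hp\<close> converges to
  some \<open>V e\<close>. Integration gives the limit depth \<open>D e\<close> with
  \<open>R e = r\<close>. The flow force rules out \<open>em\<close>, for which
  \<open>Phi em\<close> would tend to zero on the surface.\<close>

lemma limit_profile:
  assumes lim: "\<And>p. p \<in> {0..1} \<Longrightarrow> \<exists>L. ((\<lambda>q. h (q, p)) \<longlongrightarrow> L) at_top" and F: "flow_force 0 = F_sup"
  shows "(\<eta> \<longlongrightarrow> D ep) at_top"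
proof -
  obtain L where L: "\<And>p. p \<in> {0..1} \<Longrightarrow> ((\<lambda>q. h (q, p)) \<longlongrightarrow> L p) at_top" using lim by metis
  have hq0: "((\<lambda>q. hq (q, p)) \<longlongrightarrow> 0) at_top" if p: "p \<in> {0..1}" for p
  proof -
    have "uniform_limit {p} (\<lambda>q p. hq (q, p)) (\<lambda>_. 0) at_top"
    proof (rule uniform_deriv_tendsto_zero[where f = "\<lambda>q p. h (q, p)" and L = L])
      show "uniform_limit {p} (\<lambda>q p. h (q, p)) L at_top" using L[OF p] by simp
      show "((\<lambda>q. h (q, p')) has_real_derivative hq (q, p')) (at q)" if "p' \<in> {p}" for q p'
        using that p by (auto intro: deriv_q)
      fix \<epsilon> :: real assume \<epsilon>: "0 < \<epsilon>"
      show "\<exists>d>0. \<forall>p'\<in>{p}. \<forall>x y. \<bar>x - y\<bar> \<le> d \<longrightarrow> \<bar>hq (x, p') - hq (y, p')\<bar> < \<epsilon>"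
        using hq_equicont[OF \<epsilon>] p by blast
    qed
    then show ?thesis by simp
  qed
  have hqq0: "((\<lambda>q. hqq (q, p)) \<longlongrightarrow> 0) at_top" if p: "p \<in> {0..1}" for p
  proof -
    have "uniform_limit {p} (\<lambda>q p. hqq (q, p)) (\<lambda>_. 0) at_top"
    proof (rule uniform_deriv_tendsto_zero[where f = "\<lambda>q p. hq (q, p)" and L = "\<lambda>_. 0"])
      show "uniform_limit {p} (\<lambda>q p. hq (q, p)) (\<lambda>_. 0) at_top" using hq0[OF p] by simp
      show "((\<lambda>q. hq (q, p')) has_real_derivative hqq (q, p')) (at q)" if "p' \<in> {p}" for q p'
        using that p by (auto intro: deriv_q)
      fix \<epsilon> :: real assume \<epsilon>: "0 < \<epsilon>"
      show "\<exists>d>0. \<forall>p'\<in>{p}. \<forall>x y. \<bar>x - y\<bar> \<le> d \<longrightarrow> \<bar>hqq (x, p') - hqq (y, p')\<bar> < \<epsilon>"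
        using hqq_unif[OF \<epsilon>] p by blast
    qed
    then show ?thesis by simp
  qed
  note seq = filterlim_compose[OF _ filterlim_real_sequentially]
  \<comment> \<open>Limit of the Bernoulli function on the surface, hence on every
    streamline.\<close>
  define e where "e = r - L 1 + \<Omega> 1"
  let ?b = "\<lambda>n p. (1 + (hq (real n, p))\<^sup>2) / (2 * (hp (real n, p))\<^sup>2) + \<Omega> p"
  have b: "(\<lambda>n. ?b n p) \<longlonglongrightarrow> e" if p: "p \<in> {0..1}" for p
  proof -
    let ?g = "\<lambda>n s. hqq (real n, s) / hp (real n, s) - hq (real n, s) * hqp (real n, s) / (hp (real n, s))\<^sup>2"
    have sub: "s \<in> {0..1}" if "s \<in> {p..1}" for s using that p by auto
    have bd: "norm (?g n s) \<le> M / c0 + M * M / c0\<^sup>2" if s: "s \<in> {p..1}" for n s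
    proof -
      have z: "(real n, s) \<in> cstrip" using sub[OF s] by simp
      note b = bounds[OF z] and c = hp_ge[OF z]
      have "\<bar>hqq (real n, s) / hp (real n, s)\<bar> \<le> M / c0"
        unfolding abs_divide using b c c0 by (intro frac_le) auto
      moreover have "\<bar>hq (real n, s) * hqp (real n, s) / (hp (real n, s))\<^sup>2\<bar> \<le> M * M / c0\<^sup>2"
        unfolding abs_divide abs_mult using b c c0 M_pos by (intro frac_le mult_mono) (auto intro!: power_mono)
      ultimately show ?thesis
        unfolding real_norm_def by (rule order_trans[OF abs_triangle_ineq4 add_mono])
    qed
    have conv: "(\<lambda>n. ?g n s) \<longlonglongrightarrow> 0" if s: "s \<in> {p..1}" for s
    proof -
      have "(\<lambda>n. \<bar>hqq (real n, s)\<bar> / c0 + \<bar>hq (real n, s)\<bar> * M / c0\<^sup>2) \<longlonglongrightarrow> 0 / c0 + 0 * M / c0\<^sup>2"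
        using c0 by (intro tendsto_intros tendsto_rabs_zero seq[OF hq0[OF sub[OF s]]] seq[OF hqq0[OF sub[OF s]]]) auto
      then have l: "(\<lambda>n. \<bar>hqq (real n, s)\<bar> / c0 + \<bar>hq (real n, s)\<bar> * M / c0\<^sup>2) \<longlonglongrightarrow> 0" by simp
      show ?thesis
      proof (rule Lim_null_comparison[OF _ l], intro always_eventually allI)
        fix n
        have z: "(real n, s) \<in> cstrip" using sub[OF s] by simp
        note b = bounds[OF z] and c = hp_ge[OF z]
        have "\<bar>hqq (real n, s) / hp (real n, s)\<bar> \<le> \<bar>hqq (real n, s)\<bar> / c0"
          unfolding abs_divide using b c c0 by (intro frac_le) auto
        moreover have "\<bar>hq (real n, s) * hqp (real n, s) / (hp (real n, s))\<^sup>2\<bar> \<le> \<bar>hq (real n, s)\<bar> * M / c0\<^sup>2"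
          unfolding abs_divide abs_mult using b c c0 M_pos by (intro frac_le mult_mono) (auto intro!: power_mono)
        ultimately show "norm (?g n s) \<le> \<bar>hqq (real n, s)\<bar> / c0 + \<bar>hq (real n, s)\<bar> * M / c0\<^sup>2"
          unfolding real_norm_def by (rule order_trans[OF abs_triangle_ineq4 add_mono])
      qed
    qed
    have "(\<lambda>n. integral {p..1} (?g n)) \<longlonglongrightarrow> integral {p..1} (\<lambda>_. 0)"
      by (rule dominated_convergence(2)[where h = "\<lambda>_. M / c0 + M * M / c0\<^sup>2"])
        (use bernoulli_function_integral[OF p] bd conv in \<open>auto simp: integrable_on_def\<close>)
    moreover have "?b n p = r - \<eta> (real n) + \<Omega> 1 - integral {p..1} (?g n)" for n
      using integral_unique[OF bernoulli_function_integral[OF p, of "real n"]] by simp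
    moreover have "(\<lambda>n. r - \<eta> (real n) + \<Omega> 1) \<longlonglongrightarrow> e"
      unfolding e_def by (intro tendsto_intros seq[OF L]) simp
    ultimately show ?thesis using tendsto_diff[of "\<lambda>n. r - \<eta> (real n) + \<Omega> 1" e sequentially "\<lambda>n. integral {p..1} (?g n)" 0] by simp
  qed
  have inv: "(\<lambda>n. (1 / hp (real n, p))\<^sup>2) \<longlonglongrightarrow> 2 * e - 2 * \<Omega> p" if p: "p \<in> {0..1}" for p
  proof -
    have nz: "0 < 1 + (hq (real n, p))\<^sup>2" for n by (rule add_pos_nonneg) auto
    have "(\<lambda>n. 2 * (?b n p - \<Omega> p) / (1 + (hq (real n, p))\<^sup>2)) \<longlonglongrightarrow> 2 * (e - \<Omega> p) / (1 + 0\<^sup>2)"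
      by (intro tendsto_intros b p seq[OF hq0]) auto
    moreover have "2 * (?b n p - \<Omega> p) / (1 + (hq (real n, p))\<^sup>2) = (1 / hp (real n, p))\<^sup>2" for n
    proof -
      have "2 * (?b n p - \<Omega> p) = (1 + (hq (real n, p))\<^sup>2) * (1 / hp (real n, p))\<^sup>2"
        using hp_nz[of "(real n, p)"] p by (simp add: power_divide field_simps)
      then show ?thesis using nz[of n] by (metis nonzero_mult_div_cancel_left less_irrefl)
    qed
    ultimately show ?thesis by (simp add: algebra_simps)
  qed
  have ge: "1 / M\<^sup>2 \<le> 2 * e - 2 * \<Omega> p" if p: "p \<in> {0..1}" for p
  proof (rule LIMSEQ_le_const[OF inv[OF p]], intro exI allI impI)
    fix n
    have z: "(real n, p) \<in> cstrip" using p by simp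
    have "1 / M \<le> 1 / hp (real n, p)" using bounds(3)[OF z] hp_pos[OF z] M_pos by (intro divide_left_mono) auto
    then have "(1 / M)\<^sup>2 \<le> (1 / hp (real n, p))\<^sup>2" using M_pos by (intro power_mono) auto
    then show "1 / M\<^sup>2 \<le> (1 / hp (real n, p))\<^sup>2" by (simp add: power_divide)
  qed
  have e: "e0 < e"
  proof -
    \<comment> \<open>The bound on \<open>hp\<close> at the maximizer of \<open>\<Omega>\<close>
      keeps the limit energy strictly above \<open>e0\<close>.\<close>
    obtain p0 where p0: "p0 \<in> {0..1}" "\<Omega> p0 = e0" using Omega_argmax by blast
    have "0 < 1 / M\<^sup>2" using M_pos by simp
    then show ?thesis using ge[OF p0(1)] p0(2) by linarith
  qed
  have invV: "(\<lambda>n. 1 / hp (real n, p)) \<longlonglongrightarrow> V e p" if p: "p \<in> {0..1}" for p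
  proof -
    have "sqrt ((1 / hp (real n, p))\<^sup>2) = 1 / hp (real n, p)" for n
      using hp_pos[of "(real n, p)"] p by (intro real_sqrt_unique) auto
    then show ?thesis using tendsto_real_sqrt[OF inv[OF p]] by (simp add: flowV_def)
  qed
  have hpl: "(\<lambda>n. hp (real n, p)) \<longlonglongrightarrow> 1 / V e p" if p: "p \<in> {0..1}" for p
    using tendsto_divide[OF tendsto_const[of 1] invV[OF p]] V_pos[OF e p] by simp
  have hint: "((\<lambda>p. hp (q, p)) has_integral \<eta> q) {0..1}" for q
    using fundamental_theorem_of_calculus[of 0 1 "\<lambda>p. h (q, p)" "\<lambda>p. hp (q, p)"] deriv_p(1)
    by (simp add: has_real_derivative_iff_has_vector_derivative[symmetric] bottom)
  have "(\<lambda>n. integral {0..1} (\<lambda>p. hp (real n, p))) \<longlonglongrightarrow> integral {0..1} (\<lambda>p. 1 / V e p)"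
  proof (rule dominated_convergence(2)[where h = "\<lambda>_. M"])
    show "norm (hp (real n, p)) \<le> M" if "p \<in> {0..1}" for n p using bounds(3)[of "(real n, p)"] that by simp
  qed (use hint hpl in \<open>auto simp: integrable_on_def\<close>)
  then have "(\<lambda>n. \<eta> (real n)) \<longlonglongrightarrow> D e" using integral_unique[OF hint] by (simp add: flowD_def)
  then have LD: "L 1 = D e" using seq[OF L[of 1]] LIMSEQ_unique by auto
  then have "R e = r" by (simp add: flowR_def e_def)
  then have "e = em \<or> e = ep" by (rule R_eq_imp[OF e])
  moreover have "e \<noteq> em"
  proof
    assume em': "e = em"
    obtain B where B: "\<And>z. z \<in> cstrip \<Longrightarrow> \<bar>Phi_p em z\<bar> \<le> B" using Phi_p_bound[OF em(1)] by blast
    have "(\<lambda>n. integral {0..1} (\<lambda>p. Phi_p em (real n, p))) \<longlonglongrightarrow> integral {0..1} (\<lambda>_ :: real. 0)"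
    proof (rule dominated_convergence(2)[where h = "\<lambda>_. B"])
      show "(\<lambda>p. Phi_p em (real n, p)) integrable_on {0..1}" for n
        by (intro integrable_continuous_real sect_cont cont_Phi_p)
      show "norm (Phi_p em (real n, p)) \<le> B" if "p \<in> {0..1}" for n p using B[of "(real n, p)"] that by simp
      fix p :: real assume p: "p \<in> {0..1}"
      have "(\<lambda>n. ((1 / hp (real n, p) - V em p)\<^sup>2 - (- hq (real n, p) * (1 / hp (real n, p)))\<^sup>2) * hp (real n, p))
          \<longlonglongrightarrow> ((V e p - V em p)\<^sup>2 - (- 0 * V e p)\<^sup>2) * (1 / V e p)"
        by (intro tendsto_intros invV hpl p seq[OF hq0])
      then show "(\<lambda>n. Phi_p em (real n, p)) \<longlonglongrightarrow> 0" by (simp add: Phi_p_def fa_def fb_def em')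
    qed auto
    then have 1: "(\<lambda>n. Phi em (real n, 1)) \<longlonglongrightarrow> 0" by (simp add: Phi_def)
    have 2: "Phi em (real n, 1) = 2 * (F_sup - S r em (\<eta> (real n)))" for n
      using Phi_top[OF em(1), of "real n"] flow_force_const[of "real n" 0] F by simp
    have 3: "(\<lambda>n. 2 * (F_sup - S r em (\<eta> (real n)))) \<longlonglongrightarrow> 2 * (F_sup - S r em (D em))"
      unfolding flowS_def using seq[OF L[of 1]] LD em' by (intro tendsto_intros) auto
    have "2 * (F_sup - F_sub) = 0" by (rule LIMSEQ_unique[OF 3 1[unfolded 2]])
    then show False using F_minus_less_F_plus by simp
  qed
  ultimately show ?thesis using L[of 1] LD by simp
qed

end

context solitary
begin

text \<open>If every reflection were admissible, \<open>h\<close> would be nonincreasing in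
  \<open>q\<close> and converge as \<open>q\<close> tends to minus infinity. By
  \<open>limit_profile\<close> the surface would tend to \<open>D ep\<close> there too, and
  monotonicity would push it down to \<open>D ep\<close> everywhere.\<close>

lemma not_monotone: "\<not> (\<forall>l q p. l \<le> q \<longrightarrow> p \<in> {0..1} \<longrightarrow> 0 \<le> u l (q, p))"
proof
  assume all: "\<forall>l q p. l \<le> q \<longrightarrow> p \<in> {0..1} \<longrightarrow> 0 \<le> u l (q, p)"
  have mono: "h (b, p) \<le> h (a, p)" if p: "p \<in> {0..1}" and ab: "a \<le> b" for a b p
  proof -
    have "0 \<le> u ((a + b) / 2) (b, p)" using all p ab by simp
    then show ?thesis by (simp add: u_def field_simps)
  qed
  interpret RW: wave \<omega> r em ep "rh 0" "rhq 0" "rhp 0"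
    "rhqq 0" "rhqp 0" "rhpp 0" M c0
    by (rule reflected_wave)
  have "((\<lambda>q. h (2 * 0 - fst (q, 1::real), snd (q, 1::real))) \<longlongrightarrow> D ep) at_top"
  proof (rule RW.limit_profile)
    show "RW.flow_force 0 = F_sup" using reflected_flow_force[of 0 0] F_eq by simp
    fix p :: real assume p: "p \<in> {0..1}"
    have bdd: "bdd_above (range (\<lambda>q. h (q, p)))"
      using bounds(1)[of "(_, p)"] p by (intro bdd_aboveI[of _ M]) (auto simp: abs_le_iff)
    define L where "L = (SUP q. h (q, p))"
    have "((\<lambda>q. h (- q, p)) \<longlongrightarrow> L) at_top"
    proof (rule tendstoI)
      fix \<epsilon> :: real assume "0 < \<epsilon>"
      then have "L - \<epsilon> < L" by simp
      then obtain a where a: "L - \<epsilon> < h (a, p)" unfolding L_def using less_cSUP_iff[OF _ bdd] by auto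
      have "dist (h (- q, p)) L < \<epsilon>" if "- a \<le> q" for q
      proof -
        have "h (a, p) \<le> h (- q, p)" using that by (intro mono p) simp
        moreover have "h (- q, p) \<le> L" unfolding L_def by (rule cSUP_upper[OF _ bdd]) simp
        ultimately show ?thesis using a by (simp add: dist_real_def)
      qed
      then show "\<forall>\<^sub>F q in at_top. dist (h (- q, p)) L < \<epsilon>" unfolding eventually_at_top_linorder by blast
    qed
    then show "\<exists>L. ((\<lambda>q. h (2 * 0 - fst (q, p), snd (q, p))) \<longlongrightarrow> L) at_top" by auto
  qed
  then have lim: "((\<lambda>q. \<eta> (- q)) \<longlongrightarrow> D ep) at_top" by simp
  have "\<eta> 0 \<le> D ep"
  proof (rule tendsto_lowerbound[OF lim])
    show "\<forall>\<^sub>F q in at_top. \<eta> 0 \<le> \<eta> (- q)"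
      unfolding eventually_at_top_linorder using mono[of 1] by (intro exI[of _ 0]) auto
  qed simp
  then show False using above[of 0] by simp
qed

end

section \<open>Contact of the wave with its reflection\<close>

context wave
begin

text \<open>At a surface contact point the heights agree and the slopes agree up to sign, so
  Bernoulli's condition forces equal \<open>hp\<close> and the \<open>p\<close>-derivative of
  \<open>u l\<close> vanishes. The Hopf lemma allows this only if \<open>u l\<close> vanishes on the
  column.\<close>

lemma column_zero_of_surface_touching:
  assumes sol: "elliptic_op.ell_sol (half_strip l) (\<lambda>z. (rhp l z)\<^sup>2)
      (\<lambda>z. - rhp l z * rhq l z) (\<lambda>z. 1 + (rhq l z)\<^sup>2) K
      (u l) (uq l) (up l) (uqq l) (uqp l) (upp l)" and K: "1 + M\<^sup>2 \<le> K"
    and nonneg: "\<And>q p. l \<le> q \<Longrightarrow> p \<in> {0..1} \<Longrightarrow> 0 \<le> u l (q, p)"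
    and q0: "l < q0" "u l (q0, 1) = 0" and p1: "0 < p1" "p1 < 1"
  shows "u l (q0, p1) = 0"
proof (rule ccontr)
  assume nz: "u l (q0, p1) \<noteq> 0"
  interpret RW: wave \<omega> r em ep "rh l" "rhq l" "rhp l"
    "rhqq l" "rhqp l" "rhpp l" M c0
    by (rule reflected_wave)
  interpret El: elliptic_op "half_strip l" "\<lambda>z. (rhp l z)\<^sup>2"
    "\<lambda>z. - rhp l z * rhq l z" "\<lambda>z. 1 + (rhq l z)\<^sup>2" K RW.ec_const
    by (rule RW.elliptic[OF open_half_strip half_strip_subset K])
  have one: "(1::real) \<in> {0..1}" by simp
  have eta: "\<eta> (2 * l - q0) = \<eta> q0" using q0(2) by (simp add: u_def)
  have du: "((\<lambda>q. u l (q, 1)) has_real_derivative uq l (q0, 1)) (at q0)"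
    using DERIV_diff[OF RW.deriv_q(1)[OF one, of q0] deriv_q(1)[OF one, of q0]] by (simp add: u_def uq_def)
  have "uq l (q0, 1) = 0"
  proof (rule DERIV_local_min[OF du])
    show "0 < q0 - l" using q0 by simp
    show "\<forall>y. \<bar>q0 - y\<bar> < q0 - l \<longrightarrow> u l (q0, 1) \<le> u l (y, 1)"
      using nonneg q0(2) by (auto simp: abs_less_iff)
  qed
  then have hq: "hq (2 * l - q0, 1) = - hq (q0, 1)" by (simp add: uq_def)
  have "(1 + (hq (q0, 1))\<^sup>2) / (2 * (hp (2 * l - q0, 1))\<^sup>2) = (1 + (hq (q0, 1))\<^sup>2) / (2 * (hp (q0, 1))\<^sup>2)"
    using bernoulli[of "2 * l - q0"] bernoulli[of q0] unfolding eta hq power2_minus by linarith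
  moreover have "1 + (hq (q0, 1))\<^sup>2 \<noteq> 0" using add_pos_nonneg[of 1 "(hq (q0, 1))\<^sup>2"] by simp
  ultimately have "(hp (2 * l - q0, 1))\<^sup>2 = (hp (q0, 1))\<^sup>2" by (simp add: divide_cancel_left)
  moreover have "0 < hp (2 * l - q0, 1)" "0 < hp (q0, 1)" by (auto intro: hp_pos)
  ultimately have up0: "up l (q0, 1) = 0" by (simp add: up_def power2_eq_iff_nonneg)
  have dp: "((\<lambda>p. u l (q0, p)) has_real_derivative 0) (at 1 within {0..1})"
    using DERIV_diff[OF RW.deriv_p(1)[OF one, of q0] deriv_p(1)[OF one, of q0]] up0 by (simp add: u_def up_def)
  have "0 < u l (q0, p1)" using nonneg[of q0 p1] q0 p1 nz by simp
  then have "\<exists>\<epsilon>>0. \<forall>t\<in>{0..1 - p1}. \<epsilon> * t \<le> u l (q0, 1 - t)"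
    by (intro El.vertical_cap(1)[OF El.ell_sol_supersol[OF sol] refl _ _ q0(1) p1] continuous_on_subset[OF u_cont(1)])
      (use nonneg in auto)
  then obtain \<epsilon> where \<epsilon>: "0 < \<epsilon>" "\<And>t. t \<in> {0..1 - p1} \<Longrightarrow> \<epsilon> * t \<le> u l (q0, 1 - t)" by blast
  have "((\<lambda>p. u l (q0, p) - \<epsilon> * (1 - p)) has_real_derivative 0 - \<epsilon> * (0 - 1)) (at 1 within {0..1})"
    by (intro DERIV_diff dp DERIV_cmult DERIV_const DERIV_ident)
  then obtain d where d: "d > 0" "\<And>k. 0 < k \<Longrightarrow> 1 - k \<in> {0..1} \<Longrightarrow> k < d \<Longrightarrow> u l (q0, 1 - k) - \<epsilon> * (1 - (1 - k)) < u l (q0, 1) - \<epsilon> * (1 - 1)"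
    using has_real_derivative_pos_inc_left \<epsilon>(1) by fastforce
  define k where "k = min (1 - p1) (d / 2)"
  have "0 < k" "k \<le> 1 - p1" "k < d" "k \<le> 1" using p1 d(1) by (auto simp: k_def)
  then show False using d(2)[of k] \<epsilon>(2)[of k] q0(2) by simp
qed

text \<open>Differentiate Bernoulli's condition along the surface; with \<open>hq = 0\<close> only
  the term with \<open>hqp\<close> survives.\<close>

lemma hqp_zero_at_crest: assumes "hq (l, 1) = 0" shows "hqp (l, 1) = 0"
proof -
  have one: "(1::real) \<in> {0..1}" by simp
  note d = deriv_q[OF one, of l]
  have nz: "hp (l, 1) \<noteq> 0" by (rule hp_nz) simp
  have "((\<lambda>q. (1 + (hq (q, 1))\<^sup>2) / (2 * (hp (q, 1))\<^sup>2) + \<eta> q) has_real_derivative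
     ((0 + real 2 * hqq (l, 1) * hq (l, 1) ^ (2 - 1)) * (2 * (hp (l, 1))\<^sup>2) - (1 + (hq (l, 1))\<^sup>2) * (2 * (real 2 * hqp (l, 1) * hp (l, 1) ^ (2 - 1))))
      / (2 * (hp (l, 1))\<^sup>2 * (2 * (hp (l, 1))\<^sup>2)) + hq (l, 1)) (at l)"
    using DERIV_add[OF DERIV_divide[OF DERIV_add[OF DERIV_const[of 1] DERIV_power[OF d(2), of 2]] DERIV_cmult[OF DERIV_power[OF d(3), of 2], of 2]] d(1)] nz
    by (simp add: mult_ac)
  then have "((\<lambda>q. r) has_real_derivative - (4 * hqp (l, 1) * hp (l, 1)) / (2 * (hp (l, 1))\<^sup>2 * (2 * (hp (l, 1))\<^sup>2))) (at l)"
    unfolding bernoulli assms by (simp add: mult_ac)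
  then have "- (4 * hqp (l, 1) * hp (l, 1)) / (2 * (hp (l, 1))\<^sup>2 * (2 * (hp (l, 1))\<^sup>2)) = 0" by (rule DERIV_unique) (rule DERIV_const)
  then show ?thesis using nz by simp
qed

text \<open>All derivatives of \<open>u l\<close> up to second order vanish at a corner over a critical point of the surface.\<close>
lemma corner_flatness:
  assumes hq: "hq (l, 1) = 0" and \<epsilon>: "0 < \<epsilon>"
  shows "\<exists>d>0. \<forall>t\<in>{0..d}. \<bar>u l (l + t, 1 - t)\<bar> \<le> \<epsilon> * t\<^sup>2"
proof -
  interpret RW: wave \<omega> r em ep "rh l" "rhq l" "rhp l"
    "rhqq l" "rhqp l" "rhpp l" M c0
    by (rule reflected_wave)
  define g g1 g2 where "g t = u l (l + t, 1 - t)" and "g1 t = uq l (l + t, 1 - t) - up l (l + t, 1 - t)"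
    and "g2 t = uqq l (l + t, 1 - t) - 2 * uqp l (l + t, 1 - t) + upp l (l + t, 1 - t)" for t
  have diag: "continuous_on {0..1/2} (\<lambda>t. f (l + t, 1 - t))" if "continuous_on cstrip f" for f :: "real \<times> real \<Rightarrow> real"
    by (rule continuous_on_compose2[OF that]) (auto intro!: continuous_intros)
  have c: "continuous_on {0..1/2} g" "continuous_on {0..1/2} g1" "continuous_on {0..1/2} g2"
    unfolding g_def g1_def g2_def uqq_def[abs_def] uqp_def[abs_def] upp_def[abs_def]
    by (intro continuous_on_add continuous_on_diff continuous_on_mult continuous_on_const
        diag[OF u_cont(1)] diag[OF u_cont(2)] diag[OF u_cont(3)]
        diag[OF RW.conts(4)] diag[OF RW.conts(5)] diag[OF RW.conts(6)] diag[OF conts(4)] diag[OF conts(5)] diag[OF conts(6)])+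
  have line: "((\<lambda>t. (l + t, 1 - t)) has_derivative (\<lambda>s. (s, - s))) (at t)" for t :: real
    by (auto intro!: derivative_eq_intros)
  have comp: "((\<lambda>t. f (l + t, 1 - t)) has_real_derivative a - b) (at t)"
    if "(f has_derivative (\<lambda>v. a * fst v + b * snd v)) (at (l + t, 1 - t))" for f a b t
    unfolding has_field_derivative_def
    by (rule has_derivative_eq_rhs[OF has_derivative_compose[OF line that]]) (simp add: fun_eq_iff algebra_simps)
  have der: "(g has_real_derivative g1 t) (at t)" "(g1 has_real_derivative g2 t) (at t)" if t: "0 < t" "t < 1/2" for t
  proof -
    have "(l + t, 1 - t) \<in> strip" using t by simp
    note d = C2_dataD[OF u_C2[of l] this]
    show "(g has_real_derivative g1 t) (at t)" unfolding g_def[abs_def] g1_def by (rule comp[OF d(1)])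
    show "(g1 has_real_derivative g2 t) (at t)" unfolding g1_def[abs_def]
      by (rule DERIV_cong[OF DERIV_diff[OF comp[OF d(2)] comp[OF d(3)]]]) (simp add: g2_def)
  qed
  have half: "(0::real) < 1/2" by simp
  have d0: "(g has_real_derivative g1 t) (at t within {0..1/2})" if "t \<in> {0..1/2}" for t
    by (rule derivative_within_of_interior[OF half der(1) c(1,2) that])
  have d1: "(g1 has_real_derivative g2 t) (at t within {0..1/2})" if "t \<in> {0..1/2}" for t
    by (rule derivative_within_of_interior[OF half der(2) c(2,3) that])
  \<comment> \<open>On the plane \<open>u\<close>, \<open>up\<close>, \<open>uqq\<close> and
    \<open>upp\<close> vanish by reflection, while \<open>uq\<close> and \<open>uqp\<close> are
    \<open>- 2 * hq\<close> and \<open>- 2 * hqp\<close>, which are zero at the crest.\<close>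
  have z: "g 0 = 0" "g1 0 = 0" "g2 0 = 0"
    using hqp_zero_at_crest[OF hq] by (auto simp: g_def g1_def g2_def u_def uq_def up_def uqq_def uqp_def upp_def hq)
  have "\<exists>d>0. \<forall>t\<in>{0..1/2}. dist t 0 < d \<longrightarrow> dist (g2 t) (g2 0) < \<epsilon>"
    using c(3) \<epsilon> unfolding continuous_on_iff by (metis atLeastAtMost_iff half less_imp_le order_refl)
  then obtain d where d: "d > 0" "\<And>t. t \<in> {0..1/2} \<Longrightarrow> t < d \<Longrightarrow> \<bar>g2 t\<bar> < \<epsilon>"
    by (force simp: z dist_real_def)
  define d' where "d' = min (1/2) (d / 2)"
  have d': "0 < d'" "d' \<le> 1/2" "d' < d" using d(1) by (auto simp: d'_def)
  have b1: "\<bar>g1 t\<bar> \<le> \<epsilon> * t" if t: "t \<in> {0..d'}" for t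
  proof -
    have "\<bar>g1 t - g1 0\<bar> \<le> \<epsilon> * \<bar>t - 0\<bar>"
    proof (rule lipschitz_of_bounded_deriv[of "{0..t}" g1 g2])
      fix s assume s: "s \<in> {0..t}"
      then have s': "s \<in> {0..1/2}" "s < d" using t d' by auto
      show "(g1 has_real_derivative g2 s) (at s within {0..t})"
        by (rule DERIV_subset[OF d1[OF s'(1)]]) (use t d' in auto)
      show "\<bar>g2 s\<bar> \<le> \<epsilon>" using d(2)[OF s'] by simp
    qed (use t in auto)
    then show ?thesis using t by (simp add: z)
  qed
  have "\<bar>g t\<bar> \<le> \<epsilon> * t\<^sup>2" if t: "t \<in> {0..d'}" for t
  proof -
    have "\<bar>g t - g 0\<bar> \<le> \<epsilon> * t * \<bar>t - 0\<bar>"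
    proof (rule lipschitz_of_bounded_deriv[of "{0..t}" g g1])
      fix s assume s: "s \<in> {0..t}"
      then have s': "s \<in> {0..1/2}" "s \<in> {0..d'}" using t d' by auto
      show "(g has_real_derivative g1 s) (at s within {0..t})"
        by (rule DERIV_subset[OF d0[OF s'(1)]]) (use t d' in auto)
      have "\<epsilon> * s \<le> \<epsilon> * t" using s \<epsilon> by simp
      then show "\<bar>g1 s\<bar> \<le> \<epsilon> * t" using b1[OF s'(2)] by linarith
    qed (use t in auto)
    then show ?thesis using t by (simp add: z power2_eq_square)
  qed
  then show ?thesis using d'(1) unfolding g_def by blast
qed

text \<open>As \<open>hq\<close> vanishes at the corner and is Lipschitz, the mixed coefficient
  \<open>- hp * hq\<close> of the reflected wave is of the order of the distance to it, as
  \<open>serrin_corner\<close> requires. The resulting quadratic growth contradicts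
  \<open>corner_flatness\<close> unless \<open>u l\<close> has an interior zero.\<close>

lemma reflection_zero_of_corner:
  assumes sol: "elliptic_op.ell_sol (half_strip l) (\<lambda>z. (rhp l z)\<^sup>2)
      (\<lambda>z. - rhp l z * rhq l z) (\<lambda>z. 1 + (rhq l z)\<^sup>2) K
      (u l) (uq l) (up l) (uqq l) (uqp l) (upp l)" and K: "1 + M\<^sup>2 \<le> K"
    and nonneg: "\<And>q p. l \<le> q \<Longrightarrow> p \<in> {0..1} \<Longrightarrow> 0 \<le> u l (q, p)" and hq: "hq (l, 1) = 0"
  shows "\<exists>q p. l < q \<and> 0 < p \<and> p < 1 \<and> u l (q, p) = 0"
proof (rule ccontr)
  assume no: "\<not> ?thesis"
  interpret RW: wave \<omega> r em ep "rh l" "rhq l" "rhp l"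
    "rhqq l" "rhqp l" "rhpp l" M c0
    by (rule reflected_wave)
  interpret El: elliptic_op "half_strip l" "\<lambda>z. (rhp l z)\<^sup>2"
    "\<lambda>z. - rhp l z * rhq l z" "\<lambda>z. 1 + (rhq l z)\<^sup>2" K RW.ec_const
    by (rule RW.elliptic[OF open_half_strip half_strip_subset K])
  have pos: "0 < u l (q, p)" if "l < q" "0 < p" "p < 1" for q p
    using no nonneg[of q p] that by (metis atLeastAtMost_iff less_le)
  have "\<exists>\<epsilon>>0. \<exists>d>0. \<forall>t\<in>{0..d}. \<epsilon> * t\<^sup>2 \<le> u l (l + t, 1 - t)"
  proof (rule El.serrin_corner[OF El.ell_sol_supersol[OF sol] refl _ _ pos])
    show "continuous_on ({l..} \<times> {0..1}) (u l)" by (rule continuous_on_subset[OF u_cont(1)]) auto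
    show "0 \<le> u l (q, p)" if "l \<le> q" "0 \<le> p" "p \<le> 1" for q p using nonneg that by simp
    show "0 \<le> M * M" by simp
    fix x y assume "(x, y) \<in> half_strip l"
    then have x: "l < x" and y: "y \<in> {0..1}" by auto
    have "\<bar>hq (2 * l - x, y) - hq (l, y)\<bar> \<le> M * \<bar>(2 * l - x) - l\<bar>"
      by (rule lipschitz_of_bounded_deriv[of UNIV "\<lambda>q. hq (q, y)" "\<lambda>q. hqq (q, y)"])
        (use y in \<open>auto intro!: deriv_q bounds\<close>)
    moreover have "\<bar>hq (l, y) - hq (l, 1)\<bar> \<le> M * \<bar>y - 1\<bar>"
      by (rule lipschitz_of_bounded_deriv[of "{0..1}" "\<lambda>p. hq (l, p)" "\<lambda>p. hqp (l, p)"])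
        (use y in \<open>auto intro!: deriv_p bounds\<close>)
    ultimately have "\<bar>hq (2 * l - x, y)\<bar> \<le> M * ((x - l) + (1 - y))"
      using x y unfolding hq by (simp add: distrib_left abs_le_iff)
    moreover have "\<bar>hp (2 * l - x, y)\<bar> \<le> M" by (rule bounds) (use y in simp)
    ultimately have "\<bar>hp (2 * l - x, y)\<bar> * \<bar>hq (2 * l - x, y)\<bar> \<le> M * (M * ((x - l) + (1 - y)))"
      using M_pos by (intro mult_mono) auto
    then show "\<bar>- hp (2 * l - fst (x, y), snd (x, y)) * - hq (2 * l - fst (x, y), snd (x, y))\<bar> \<le> M * M * ((x - l) + (1 - y))"
      by (simp add: abs_mult mult.assoc)
  qed
  then obtain \<epsilon> d where \<epsilon>: "\<epsilon> > 0" "d > 0" "\<And>t. t \<in> {0..d} \<Longrightarrow> \<epsilon> * t\<^sup>2 \<le> u l (l + t, 1 - t)" by blast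
  obtain d' where d': "d' > 0" "\<And>t. t \<in> {0..d'} \<Longrightarrow> \<bar>u l (l + t, 1 - t)\<bar> \<le> \<epsilon> / 2 * t\<^sup>2"
    using corner_flatness[OF hq, of "\<epsilon> / 2"] \<epsilon>(1) by auto
  define t where "t = min d d'"
  have t: "0 < t" "t \<in> {0..d}" "t \<in> {0..d'}" using \<epsilon>(2) d'(1) by (auto simp: t_def)
  have "\<epsilon> * t\<^sup>2 \<le> \<epsilon> / 2 * t\<^sup>2" using \<epsilon>(3)[OF t(2)] d'(2)[OF t(3)] by linarith
  moreover have "0 < \<epsilon> * t\<^sup>2" using \<epsilon>(1) t(1) by simp
  ultimately show False by simp
qed

text \<open>Either kind of contact produces an interior zero of \<open>u l\<close>, and the strong
  minimum principle spreads it over the half-strip.\<close>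

lemma symmetric_of_reflection_zero:
  assumes nonneg: "\<And>q p. l \<le> q \<Longrightarrow> p \<in> {0..1} \<Longrightarrow> 0 \<le> u l (q, p)"
    and touch: "(\<exists>q>l. u l (q, 1) = 0) \<or> hq (l, 1) = 0"
  shows "\<eta> (l + t) = \<eta> (l - t)"
proof -
  obtain K where K: "1 + M\<^sup>2 \<le> K" and sol: "elliptic_op.ell_sol (half_strip l) (\<lambda>z. (rhp l z)\<^sup>2)
      (\<lambda>z. - rhp l z * rhq l z) (\<lambda>z. 1 + (rhq l z)\<^sup>2) K
      (u l) (uq l) (up l) (uqq l) (uqp l) (upp l)" using u_sol by blast
  interpret RW: wave \<omega> r em ep "rh l" "rhq l" "rhp l"
    "rhqq l" "rhqp l" "rhpp l" M c0
    by (rule reflected_wave)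
  interpret El: elliptic_op "half_strip l" "\<lambda>z. (rhp l z)\<^sup>2"
    "\<lambda>z. - rhp l z * rhq l z" "\<lambda>z. 1 + (rhq l z)\<^sup>2" K RW.ec_const
    by (rule RW.elliptic[OF open_half_strip half_strip_subset K])
  have "\<exists>q p. l < q \<and> 0 < p \<and> p < 1 \<and> u l (q, p) = 0"
    using touch
  proof
    assume "\<exists>q>l. u l (q, 1) = 0"
    then obtain q where q: "l < q" "u l (q, 1) = 0" by blast
    have "u l (q, 1/2) = 0" by (rule column_zero_of_surface_touching[OF sol K nonneg q]) auto
    then show ?thesis using q by (intro exI[of _ q] exI[of _ "1/2"]) simp
  next
    assume "hq (l, 1) = 0"
    then show ?thesis using nonneg by (intro reflection_zero_of_corner[OF sol K]) auto
  qed
  then obtain q0 p0 where z0: "l < q0" "0 < p0" "p0 < 1" "u l (q0, p0) = 0" by blast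
  have zero: "u l (q, 1) = 0" if "l \<le> q" for q
  proof (rule El.strong_min_principle[OF El.ell_sol_supersol[OF sol] refl _ _ z0 that])
    show "continuous_on ({l..} \<times> {0..1}) (u l)" by (rule continuous_on_subset[OF u_cont(1)]) auto
    show "0 \<le> u l (x, y)" if "l < x" "0 < y" "y < 1" for x y using nonneg[of x y] that by simp
  qed auto
  show ?thesis
  proof (cases "0 \<le> t")
    case True
    then show ?thesis using zero[of "l + t"] by (simp add: u_def)
  next
    case False
    then show ?thesis using zero[of "l - t"] by (simp add: u_def)
  qed
qed

end

context solitary
begin

text \<open>Admissibility of a plane is tested on the surface only;
  \<open>reflection_principle\<close> carries it into the strip and confines every failure to
  \<open>q \<le> Y\<close>. That bound makes failures near the last position accumulate, either at a
  surface contact point or at the corner, where the slope must vanish.\<close>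

lemma symmetric: "\<exists>x0. \<forall>t. \<eta> (x0 + t) = \<eta> (x0 - t)"
proof -
  obtain Y where Y: "\<And>l q p. (\<And>q. l \<le> q \<Longrightarrow> q \<le> Y \<Longrightarrow> \<eta> q \<le> \<eta> (2 * l - q)) \<Longrightarrow> l \<le> q \<Longrightarrow> p \<in> {0..1} \<Longrightarrow> 0 \<le> u l (q, p)"
    using reflection_principle by blast
  define good where "good l \<longleftrightarrow> (\<forall>q\<ge>l. \<eta> q \<le> \<eta> (2 * l - q))" for l
  have u_good: "0 \<le> u l (q, p)" if "good l" "l \<le> q" "p \<in> {0..1}" for l q p
    by (rule Y) (use that in \<open>auto simp: good_def\<close>)
  have bad: "\<exists>q>l. q \<le> Y \<and> \<eta> (2 * l - q) < \<eta> q" if "\<not> good l" for l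
  proof (rule ccontr)
    assume no: "\<not> ?thesis"
    have "\<eta> q \<le> \<eta> (2 * l - q)" if "l \<le> q" "q \<le> Y" for q
      using no that by (cases "q = l") (auto simp: not_less)
    then have "0 \<le> u l (q, 1)" if "l \<le> q" for q using Y[of l q 1] that by simp
    then have "good l" by (auto simp: good_def u_def)
    then show False using that by simp
  qed
  \<comment> \<open>Every plane to the right must be admissible as well, so that the infimum is the
    last position reached without interruption.\<close>
  define \<Lambda> where "\<Lambda> = {l. \<forall>l'\<ge>l. good l'}"
  have "good l" if "Y \<le> l" for l using bad[of l] that by force
  then have Y\<Lambda>: "Y \<in> \<Lambda>" by (auto simp: \<Lambda>_def)
  have bdd: "bdd_below \<Lambda>"
  proof (rule ccontr)
    assume "\<not> bdd_below \<Lambda>"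
    then have "\<exists>l'\<in>\<Lambda>. l' < l" for l unfolding bdd_below_def by (meson not_le)
    then have "good l" for l unfolding \<Lambda>_def by (metis (mono_tags, lifting) less_imp_le mem_Collect_eq)
    then show False using not_monotone u_good by blast
  qed
  define l where "l = Inf \<Lambda>"
  have above_l: "good l'" if "l < l'" for l'
  proof -
    have "\<Lambda> \<noteq> {}" using Y\<Lambda> by blast
    from cInf_lessD[OF this that[unfolded l_def]] obtain l1 where "l1 \<in> \<Lambda>" "l1 < l'" by blast
    then show ?thesis by (auto simp: \<Lambda>_def)
  qed
  have eta_cont: "isCont \<eta> q" for q by (rule DERIV_isCont[OF deriv_q(1)]) simp
  have good_l: "good l"
    unfolding good_def
  proof (intro allI impI)
    fix q assume q: "l \<le> q"
    show "\<eta> q \<le> \<eta> (2 * l - q)"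
    proof (cases "q = l")
      case False
      have "(\<lambda>n. (q - l) / real (Suc n)) \<longlonglongrightarrow> 0" by (rule LIMSEQ_Suc[OF lim_const_over_n])
      then have "(\<lambda>n. 2 * (l + (q - l) / real (Suc n)) - q) \<longlonglongrightarrow> 2 * (l + 0) - q"
        by (intro tendsto_intros)
      then have "(\<lambda>n. \<eta> (2 * (l + (q - l) / real (Suc n)) - q)) \<longlonglongrightarrow> \<eta> (2 * l - q)"
        using isCont_tendsto_compose[OF eta_cont] by simp
      then show ?thesis
      proof (rule LIMSEQ_le_const, intro exI allI impI)
        fix n
        have "l < l + (q - l) / real (Suc n)" "l + (q - l) / real (Suc n) \<le> q"
          using q False divide_left_mono[of 1 "real (Suc n)" "q - l"] by auto
        then show "\<eta> q \<le> \<eta> (2 * (l + (q - l) / real (Suc n)) - q)" using above_l unfolding good_def by blast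
      qed
    qed simp
  qed
  have "\<exists>l' q. l - 1 / real (Suc n) \<le> l' \<and> l' \<le> l \<and> l' < q \<and> q \<le> Y \<and> \<eta> (2 * l' - q) < \<eta> q" for n
  proof -
    have "l - 1 / real (Suc n) \<notin> \<Lambda>"
    proof
      assume "l - 1 / real (Suc n) \<in> \<Lambda>"
      then have "l \<le> l - 1 / real (Suc n)" unfolding l_def by (rule cInf_lower[OF _ bdd])
      then show False by simp
    qed
    then obtain l' where l': "l - 1 / real (Suc n) \<le> l'" "\<not> good l'" by (auto simp: \<Lambda>_def)
    then have "l' \<le> l" using above_l by (meson not_le)
    then show ?thesis using bad[OF l'(2)] l'(1) by blast
  qed
  then obtain ln qn where n: "\<And>n. l - 1 / real (Suc n) \<le> ln n" "\<And>n. ln n \<le> l" "\<And>n. ln n < qn n" "\<And>n. qn n \<le> Y"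
    "\<And>n. \<eta> (2 * ln n - qn n) < \<eta> (qn n)" by metis
  have ln: "ln \<longlonglongrightarrow> l"
  proof (rule tendsto_sandwich[OF _ _ _ tendsto_const])
    show "(\<lambda>n. l - 1 / real (Suc n)) \<longlonglongrightarrow> l" using tendsto_diff[OF tendsto_const LIMSEQ_Suc[OF lim_const_over_n[of 1]], of l] by simp
  qed (use n in auto)
  have "qn n \<in> {l - 1..Y}" for n
  proof -
    have "1 / real (Suc n) \<le> 1" by simp
    moreover note n(1,3,4)[of n]
    ultimately have "l - 1 \<le> qn n" "qn n \<le> Y" by linarith+
    then show ?thesis by simp
  qed
  then obtain q s where q: "strict_mono s" "(qn \<circ> s) \<longlonglongrightarrow> q"
    using compact_imp_seq_compact[OF compact_Icc[of "l - 1" Y]] unfolding seq_compact_def by metis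
  have ls: "(ln \<circ> s) \<longlonglongrightarrow> l" by (rule LIMSEQ_subseq_LIMSEQ[OF ln q(1)])
  have lq: "l \<le> q" by (rule LIMSEQ_le[OF ls q(2)]) (use n(3) in \<open>auto intro: less_imp_le\<close>)
  have "(\<exists>q>l. u l (q, 1) = 0) \<or> hq (l, 1) = 0"
  proof (cases "q = l")
    case False
    have 1: "(\<lambda>n. \<eta> ((qn \<circ> s) n)) \<longlonglongrightarrow> \<eta> q" by (rule isCont_tendsto_compose[OF eta_cont q(2)])
    have 2: "(\<lambda>n. \<eta> (2 * (ln \<circ> s) n - (qn \<circ> s) n)) \<longlonglongrightarrow> \<eta> (2 * l - q)"
      by (rule isCont_tendsto_compose[OF eta_cont]) (intro tendsto_intros ls q(2))
    have "\<eta> (2 * l - q) \<le> \<eta> q" by (rule LIMSEQ_le[OF 2 1]) (use n(5) in \<open>auto intro: less_imp_le\<close>)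
    then have "u l (q, 1) = 0" using good_l lq by (auto simp: good_def u_def intro: antisym)
    moreover have "l < q" using lq False by simp
    ultimately show ?thesis by blast
  next
    case True
    \<comment> \<open>When the failures collapse onto the plane, the mean value theorem puts a
      positive slope between \<open>qn n\<close> and its mirror image. In the limit
      \<open>hq (l, 1) \<ge> 0\<close>, and admissibility of \<open>l\<close> gives the opposite
      sign.\<close>
    have "\<exists>\<xi>. 2 * ln n - qn n < \<xi> \<and> \<xi> < qn n \<and> 0 < hq (\<xi>, 1)" for n
    proof -
      have lt: "2 * ln n - qn n < qn n" using n(3)[of n] by simp
      have "\<exists>\<xi>. 2 * ln n - qn n < \<xi> \<and> \<xi> < qn n \<and> \<eta> (qn n) - \<eta> (2 * ln n - qn n) = (qn n - (2 * ln n - qn n)) * hq (\<xi>, 1)"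
        by (rule MVT2[OF lt]) (auto intro: deriv_q)
      then obtain \<xi> where \<xi>: "2 * ln n - qn n < \<xi>" "\<xi> < qn n" "\<eta> (qn n) - \<eta> (2 * ln n - qn n) = (qn n - (2 * ln n - qn n)) * hq (\<xi>, 1)"
        by blast
      have "0 < (qn n - (2 * ln n - qn n)) * hq (\<xi>, 1)" using \<xi>(3) n(5)[of n] by linarith
      then have "0 < hq (\<xi>, 1)" using lt by (simp add: zero_less_mult_iff)
      then show ?thesis using \<xi> by blast
    qed
    then obtain \<xi> where \<xi>: "\<And>n. 2 * ln n - qn n < \<xi> n" "\<And>n. \<xi> n < qn n" "\<And>n. 0 < hq (\<xi> n, 1)" by metis
    have ql: "(qn \<circ> s) \<longlonglongrightarrow> l" using q(2) True by simp
    have "(\<lambda>n. 2 * (ln \<circ> s) n - (qn \<circ> s) n) \<longlonglongrightarrow> 2 * l - l" by (intro tendsto_intros ls ql)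
    then have lo: "(\<lambda>n. 2 * (ln \<circ> s) n - (qn \<circ> s) n) \<longlonglongrightarrow> l" by simp
    have \<xi>l: "(\<lambda>n. \<xi> (s n)) \<longlonglongrightarrow> l"
      by (rule tendsto_sandwich[OF _ _ lo ql]) (use \<xi>(1,2) in \<open>auto intro!: always_eventually less_imp_le\<close>)
    have "isCont (\<lambda>q. hq (q, 1)) l" by (rule DERIV_isCont[OF deriv_q(2)]) simp
    from isCont_tendsto_compose[OF this \<xi>l] have "0 \<le> hq (l, 1)"
      by (rule LIMSEQ_le_const) (use \<xi>(3) in \<open>auto intro: less_imp_le\<close>)
    moreover have "hq (l, 1) \<le> 0"
    proof (rule ccontr)
      assume "\<not> hq (l, 1) \<le> 0"
      moreover have "((\<lambda>q. \<eta> q - \<eta> (2 * l - q)) has_real_derivative hq (l, 1) - hq (2 * l - l, 1) * (0 - 1)) (at l)"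
        by (intro DERIV_diff deriv_q(1) DERIV_chain2[OF deriv_q(1)] DERIV_const DERIV_ident) auto
      ultimately obtain d where d: "d > 0" "\<And>k. 0 < k \<Longrightarrow> k < d \<Longrightarrow> \<eta> l - \<eta> (2 * l - l) < \<eta> (l + k) - \<eta> (2 * l - (l + k))"
        using DERIV_pos_inc_right[of "\<lambda>q. \<eta> q - \<eta> (2 * l - q)"] by force
      have "\<eta> (l + d / 2) \<le> \<eta> (2 * l - (l + d / 2))" using good_l[unfolded good_def, rule_format, of "l + d / 2"] d(1) by simp
      then show False using d(2)[of "d / 2"] d(1) by simp
    qed
    ultimately show ?thesis by simp
  qed
  from symmetric_of_reflection_zero[OF u_good[OF good_l] this] show ?thesis by blast
qed

end

section \<open>The hodograph transform\<close>

text \<open>A boundary point is approached within its own column by sliding towards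
  mid-height.\<close>

lemma closure_subgraph:
  fixes \<zeta> :: "real \<Rightarrow> real"
  assumes "0 < \<zeta> x" "0 \<le> y" "y \<le> \<zeta> x"
  shows "(x, y) \<in> closure {(x, y). 0 < y \<and> y < \<zeta> x}"
proof -
  define a where "a n = (1 - 1 / real (Suc (Suc n))) * y + (1 / real (Suc (Suc n))) * (\<zeta> x / 2)" for n
  have a: "0 < (1 - t) * y + t * (\<zeta> x / 2)" "(1 - t) * y + t * (\<zeta> x / 2) < \<zeta> x" if t: "0 < t" "t < 1" for t
  proof -
    have "0 < t * (\<zeta> x / 2)" "0 \<le> (1 - t) * y" using t assms by auto
    then show "0 < (1 - t) * y + t * (\<zeta> x / 2)" by linarith
    have "(1 - t) * y \<le> (1 - t) * \<zeta> x" using t assms by (intro mult_left_mono) auto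
    moreover have "(1 - t) * \<zeta> x + t * (\<zeta> x / 2) = \<zeta> x - t * (\<zeta> x / 2)" by (simp add: field_simps)
    ultimately show "(1 - t) * y + t * (\<zeta> x / 2) < \<zeta> x" using \<open>0 < t * (\<zeta> x / 2)\<close> by linarith
  qed
  have "(x, a n) \<in> {(x, y). 0 < y \<and> y < \<zeta> x}" for n using a[of "1 / real (Suc (Suc n))"] by (simp add: a_def)
  moreover have "(\<lambda>n. (x, a n)) \<longlonglongrightarrow> (x, y)"
  proof (intro tendsto_Pair tendsto_const)
    have "(\<lambda>n. 1 / real (Suc (Suc n))) \<longlonglongrightarrow> 0" by (intro LIMSEQ_Suc lim_const_over_n)
    then have "a \<longlonglongrightarrow> (1 - 0) * y + 0 * (\<zeta> x / 2)" unfolding a_def[abs_def] by (intro tendsto_intros)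
    then show "a \<longlonglongrightarrow> y" by simp
  qed
  ultimately show ?thesis unfolding closure_sequential by (intro exI[of _ "\<lambda>n. (x, a n)"]) blast
qed

text \<open>The regularity classes are reduced to what the transform uses: bounds, and uniform
  continuity of the second derivatives up to the boundary of the fluid.\<close>

locale steady_wave = conjugate_pair +
  fixes \<zeta> :: "real \<Rightarrow> real" and \<psi> \<psi>x \<psi>y \<psi>xx \<psi>xy \<psi>yy :: "real \<times> real \<Rightarrow> real" and B c :: real and Dm Dc :: "(real \<times> real) set"
  defines "Dm \<equiv> {(x, y). 0 < y \<and> y < \<zeta> x}" and "Dc \<equiv> {(x, y). 0 \<le> y \<and> y \<le> \<zeta> x}"
  assumes surface: "continuous_on UNIV \<zeta>" "0 < \<zeta> x" "\<zeta> x \<le> B"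
    and psi_C2: "C2_data Dm \<psi> \<psi>x \<psi>y \<psi>xx \<psi>xy \<psi>yy"
    and psi_cont: "g \<in> {\<psi>, \<psi>x, \<psi>y, \<psi>xx, \<psi>xy, \<psi>yy} \<Longrightarrow> continuous_on Dc g"
    and psi_bound: "g \<in> {\<psi>, \<psi>x, \<psi>y, \<psi>xx, \<psi>xy, \<psi>yy} \<Longrightarrow> z \<in> Dc \<Longrightarrow> \<bar>g z\<bar> \<le> B"
    and psi_unif: "g \<in> {\<psi>xx, \<psi>xy, \<psi>yy} \<Longrightarrow> uniformly_continuous_on Dc g"
    and c: "0 < c" and psi_y_ge: "z \<in> Dc \<Longrightarrow> c \<le> \<psi>y z"
    and psi_pde: "z \<in> Dm \<Longrightarrow> \<psi>xx z + \<psi>yy z + \<omega> (\<psi> z) = 0"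
    and psi_bernoulli: "(\<psi>x (x, \<zeta> x))\<^sup>2 / 2 + (\<psi>y (x, \<zeta> x))\<^sup>2 / 2 + \<zeta> x = r"
    and psi_top: "\<psi> (x, \<zeta> x) = 1" and psi_bottom: "\<psi> (x, 0) = 0"
begin

lemma psi_sect_cont: "g \<in> {\<psi>, \<psi>x, \<psi>y, \<psi>xx, \<psi>xy, \<psi>yy} \<Longrightarrow> continuous_on {0..\<zeta> q} (\<lambda>y. g (q, y))"
  by (rule continuous_on_compose2[OF psi_cont]) (auto intro!: continuous_intros simp: Dc_def)

lemma psi_increasing:
  assumes "0 \<le> y" "y \<le> y'" "y' \<le> \<zeta> q"
  shows "c * (y' - y) \<le> \<psi> (q, y') - \<psi> (q, y)"
proof (cases "y = y'")
  case False
  then have lt: "y < y'" using assms by simp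
  have der: "((\<lambda>y. \<psi> (q, y)) has_real_derivative \<psi>y (q, s)) (at s)" if "y < s" "s < y'" for s
  proof -
    have "(q, s) \<in> Dm" using that assms by (auto simp: Dm_def)
    from has_derivative_partials(2)[OF C2_dataD(1)[OF psi_C2 this]] show ?thesis .
  qed
  have "continuous_on {y..y'} (\<lambda>y. \<psi> (q, y))"
    by (rule continuous_on_subset[OF psi_sect_cont]) (use assms in auto)
  then obtain l s where s: "y < s" "s < y'" "((\<lambda>y. \<psi> (q, y)) has_real_derivative l) (at s)" "\<psi> (q, y') - \<psi> (q, y) = (y' - y) * l"
    using MVT[OF lt, of "\<lambda>y. \<psi> (q, y)"] der real_differentiable_def by blast
  have "l = \<psi>y (q, s)" by (rule DERIV_unique[OF s(3) der[OF s(1,2)]])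
  moreover have "c \<le> \<psi>y (q, s)" by (rule psi_y_ge) (use s assms in \<open>auto simp: Dc_def\<close>)
  ultimately have "(y' - y) * c \<le> (y' - y) * l" using lt by (intro mult_left_mono) auto
  then show ?thesis using s(4) by (simp add: mult.commute)
qed simp

lemma psi_diff_ge:
  assumes "y \<in> {0..\<zeta> q}" "y' \<in> {0..\<zeta> q}"
  shows "c * \<bar>y - y'\<bar> \<le> \<bar>\<psi> (q, y) - \<psi> (q, y')\<bar>"
  using psi_increasing[of y y' q] psi_increasing[of y' y q] assms by (cases "y \<le> y'") auto

definition height :: "real \<times> real \<Rightarrow> real" where
  "height z = (THE y. y \<in> {0..\<zeta> (fst z)} \<and> \<psi> (fst z, y) = snd z)"

lemma height:
  assumes "p \<in> {0..1}"
  shows "height (q, p) \<in> {0..\<zeta> q}" "\<psi> (q, height (q, p)) = p"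
proof -
  have "\<exists>y\<ge>0. y \<le> \<zeta> q \<and> \<psi> (q, y) = p"
    using assms surface(2)[of q] psi_sect_cont[of \<psi> q] psi_top psi_bottom by (intro IVT') auto
  then obtain y where y: "y \<in> {0..\<zeta> q} \<and> \<psi> (q, y) = p" by auto
  have "height (q, p) \<in> {0..\<zeta> q} \<and> \<psi> (q, height (q, p)) = p"
    unfolding height_def fst_conv snd_conv
  proof (rule theI)
    fix y' assume y': "y' \<in> {0..\<zeta> q} \<and> \<psi> (q, y') = p"
    then have "c * \<bar>y' - y\<bar> \<le> 0" using psi_diff_ge[of y' q y] y by simp
    then show "y' = y" using c by (simp add: mult_le_0_iff)
  qed (rule y)
  then show "height (q, p) \<in> {0..\<zeta> q}" "\<psi> (q, height (q, p)) = p" by auto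
qed

lemma psi_mem: assumes "y \<in> {0..\<zeta> q}" shows "\<psi> (q, y) \<in> {0..1}"
proof -
  have "0 \<le> c * (y - 0)" "0 \<le> c * (\<zeta> q - y)" using assms c by auto
  then show ?thesis
    using psi_increasing[of 0 y q] psi_increasing[of y "\<zeta> q" q] assms by (simp add: psi_top psi_bottom)
qed

lemma height_psi: assumes y: "y \<in> {0..\<zeta> q}" shows "height (q, \<psi> (q, y)) = y"
proof -
  note h = height[OF psi_mem[OF y], of q]
  have "c * \<bar>height (q, \<psi> (q, y)) - y\<bar> \<le> 0" using psi_diff_ge[OF h(1) y] h(2) by simp
  then show ?thesis using c by (simp add: mult_le_0_iff)
qed

lemma height_bottom: "height (q, 0) = 0"
  using height_psi[of 0 q] surface(2)[of q] by (simp add: psi_bottom)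

lemma height_top: "height (q, 1) = \<zeta> q"
  using height_psi[of "\<zeta> q" q] surface(2)[of q] by (simp add: psi_top)

definition T where "T z = (fst z, height z)" for z :: "real \<times> real"

lemma T_Dc: "z \<in> cstrip \<Longrightarrow> T z \<in> Dc"
  using height(1)[of "snd z" "fst z"] by (auto simp: T_def Dc_def)

lemma T_Dm: assumes "z \<in> strip" shows "T z \<in> Dm"
proof -
  obtain q p where z: "z = (q, p)" "0 < p" "p < 1" using assms by auto
  then have p: "p \<in> {0..1}" by simp
  note h = height[OF p, of q]
  have "height (q, p) \<noteq> 0" "height (q, p) \<noteq> \<zeta> q" using h(2) z psi_top[of q] psi_bottom[of q] by auto
  then show ?thesis using h(1) by (auto simp: T_def Dm_def z)
qed

text \<open>The implicit function theorem stops at the boundary. The lower bound on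
  \<open>\<psi>y\<close> instead makes heights in one column depend on \<open>p\<close> with
  Lipschitz constant \<open>1 / c\<close>, up to the surface and the bottom.\<close>

lemma height_cont: "continuous_on cstrip height"
  unfolding continuous_on_def
proof
  fix z0 :: "real \<times> real" assume z0: "z0 \<in> cstrip"
  obtain q0 p0 where z0': "z0 = (q0, p0)" by (cases z0)
  have p0: "p0 \<in> {0..1}" using z0 by (simp add: z0')
  \<comment> \<open>The target height, truncated so that it also lies in the neighbouring
    column.\<close>
  define m where "m z = min (height z0) (\<zeta> (fst z))" for z :: "real \<times> real"
  note h0 = height[OF p0, of q0]
  have \<zeta>: "((\<lambda>z. \<zeta> (fst z)) \<longlongrightarrow> \<zeta> q0) (at z0 within cstrip)"
  proof -
    have "isCont \<zeta> q0" using surface(1) by (simp add: continuous_on_eq_continuous_at)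
    moreover have "(fst \<longlongrightarrow> q0) (at z0 within cstrip)" using tendsto_fst[OF tendsto_ident_at, of z0 cstrip] by (simp add: z0')
    ultimately show ?thesis by (rule isCont_tendsto_compose)
  qed
  have m: "(m \<longlongrightarrow> height z0) (at z0 within cstrip)"
  proof -
    have "(m \<longlongrightarrow> min (height z0) (\<zeta> q0)) (at z0 within cstrip)"
      unfolding m_def by (intro tendsto_min tendsto_const \<zeta>)
    then show ?thesis using h0(1) by (simp add: z0')
  qed
  have mD: "m z \<in> {0..\<zeta> (fst z)}" for z using h0(1) surface(2)[of "fst z"] by (auto simp: m_def z0')
  have "((\<lambda>z. \<psi> (fst z, m z)) \<longlongrightarrow> \<psi> (q0, height z0)) (at z0 within cstrip)"
  proof (rule continuous_on_tendsto_compose[OF psi_cont[of \<psi>]])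
    show "((\<lambda>z. (fst z, m z)) \<longlongrightarrow> (q0, height z0)) (at z0 within cstrip)"
      using tendsto_fst[OF tendsto_ident_at, of z0 cstrip] by (intro tendsto_Pair m) (simp add: z0')
    show "(q0, height z0) \<in> Dc" using h0(1) by (simp add: z0' Dc_def)
    show "\<forall>\<^sub>F z in at z0 within cstrip. (fst z, m z) \<in> Dc" using mD by (auto simp: Dc_def)
  qed simp
  then have "((\<lambda>z. \<bar>snd z - \<psi> (fst z, m z)\<bar> / c) \<longlongrightarrow> \<bar>p0 - p0\<bar> / c) (at z0 within cstrip)"
    using h0(2) tendsto_snd[OF tendsto_ident_at, of z0 cstrip] c by (intro tendsto_intros) (auto simp: z0')
  then have lim: "((\<lambda>z. \<bar>snd z - \<psi> (fst z, m z)\<bar> / c) \<longlongrightarrow> 0) (at z0 within cstrip)" by simp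
  have "((\<lambda>z. height z - m z) \<longlongrightarrow> 0) (at z0 within cstrip)"
  proof (rule Lim_null_comparison[OF _ lim])
    show "\<forall>\<^sub>F z in at z0 within cstrip. norm (height z - m z) \<le> \<bar>snd z - \<psi> (fst z, m z)\<bar> / c"
      unfolding eventually_at_filter
    proof (intro always_eventually allI impI)
      fix z :: "real \<times> real" assume "z \<in> cstrip"
      then have p: "snd z \<in> {0..1}" by auto
      note h = height[OF p, of "fst z"]
      have "c * \<bar>height z - m z\<bar> \<le> \<bar>snd z - \<psi> (fst z, m z)\<bar>"
        using psi_diff_ge[OF h(1) mD[of z]] h(2) by simp
      then show "norm (height z - m z) \<le> \<bar>snd z - \<psi> (fst z, m z)\<bar> / c"
        using c by (simp add: pos_le_divide_eq mult.commute)
    qed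
  qed
  from tendsto_add[OF this m] show "(height \<longlongrightarrow> height z0) (at z0 within cstrip)" by simp
qed

lemma T_cont: "continuous_on cstrip T"
  unfolding T_def[abs_def] by (intro continuous_on_Pair continuous_on_fst continuous_on_id height_cont)

lemma comp_T_cont: "g \<in> {\<psi>, \<psi>x, \<psi>y, \<psi>xx, \<psi>xy, \<psi>yy} \<Longrightarrow> continuous_on cstrip (\<lambda>z. g (T z))"
  by (rule continuous_on_compose2[OF psi_cont T_cont]) (use T_Dc in auto)

text \<open>These formulas come from implicit differentiation of
  \<open>\<psi> (q, height (q, p)) = p\<close>.\<close>

definition height_p where "height_p z = 1 / \<psi>y (T z)"
definition height_q where "height_q z = - \<psi>x (T z) * height_p z"
definition height_pp where "height_pp z = - \<psi>yy (T z) * height_p z ^ 3"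
definition height_qp where "height_qp z = - (\<psi>xy (T z) + \<psi>yy (T z) * height_q z) * (height_p z)\<^sup>2"
definition height_qq where
  "height_qq z = - (\<psi>xx (T z) + 2 * \<psi>xy (T z) * height_q z + \<psi>yy (T z) * (height_q z)\<^sup>2) * height_p z"

lemma psi_y_pos: "z \<in> cstrip \<Longrightarrow> 0 < \<psi>y (T z)" using psi_y_ge[OF T_Dc] c by fastforce

lemma height_conts: "continuous_on cstrip height_p" "continuous_on cstrip height_q" "continuous_on cstrip height_pp"
  "continuous_on cstrip height_qp" "continuous_on cstrip height_qq"
proof -
  have C: "continuous_on cstrip (\<lambda>z. \<psi>x (T z))" "continuous_on cstrip (\<lambda>z. \<psi>y (T z))" "continuous_on cstrip (\<lambda>z. \<psi>xx (T z))"
    "continuous_on cstrip (\<lambda>z. \<psi>xy (T z))" "continuous_on cstrip (\<lambda>z. \<psi>yy (T z))"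
    by (rule comp_T_cont; simp)+
  have nz: "\<forall>z\<in>cstrip. \<psi>y (T z) \<noteq> 0" using psi_y_pos less_imp_neq by metis
  show p: "continuous_on cstrip height_p"
    unfolding height_p_def[abs_def] by (rule continuous_on_divide[OF continuous_on_const C(2) nz])
  show q: "continuous_on cstrip height_q"
    unfolding height_q_def[abs_def] by (rule continuous_on_mult[OF continuous_on_minus[OF C(1)] p])
  show "continuous_on cstrip height_pp"
    unfolding height_pp_def[abs_def] by (intro continuous_on_mult continuous_on_power continuous_on_minus p C)
  show "continuous_on cstrip height_qp"
    unfolding height_qp_def[abs_def]
    by (intro continuous_on_mult continuous_on_add continuous_on_power continuous_on_minus p q C)
  show "continuous_on cstrip height_qq"
    unfolding height_qq_def[abs_def]
    by (intro continuous_on_mult continuous_on_add continuous_on_power continuous_on_minus continuous_on_const p q C)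
qed

text \<open>\<open>T\<close> inverts the map from \<open>(x, y)\<close> to
  \<open>(x, \<psi> (x, y))\<close>, whose derivative is triangular with diagonal entries 1 and
  \<open>\<psi>y\<close>.\<close>

lemma T_deriv: assumes z: "z \<in> strip"
  shows "(T has_derivative (\<lambda>v. (fst v, height_q z * fst v + height_p z * snd v))) (at z)"
proof (rule has_derivative_inverse_basic[OF _ _ _ _ open_strip z])
  have "(snd has_derivative snd) (at (T z))" "(fst has_derivative fst) (at (T z))" by (auto intro!: derivative_eq_intros)
  show "((\<lambda>w. (fst w, \<psi> w)) has_derivative (\<lambda>v. (fst v, \<psi>x (T z) * fst v + \<psi>y (T z) * snd v))) (at (T z))"
    by (intro has_derivative_Pair has_derivative_fst has_derivative_ident C2_dataD(1)[OF psi_C2 T_Dm[OF z]])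
  show "bounded_linear (\<lambda>v. (fst v, height_q z * fst v + height_p z * snd v))"
    by (intro bounded_linear_Pair bounded_linear_add bounded_linear_const_mult bounded_linear_fst bounded_linear_snd)
  have nz: "\<psi>y (T z) \<noteq> 0" using psi_y_pos[of z] z by auto
  show "(\<lambda>v. (fst v, height_q z * fst v + height_p z * snd v)) \<circ> (\<lambda>v. (fst v, \<psi>x (T z) * fst v + \<psi>y (T z) * snd v)) = id"
    using nz by (simp add: fun_eq_iff height_q_def height_p_def field_simps)
  have "continuous_on strip T" by (rule continuous_on_subset[OF T_cont]) auto
  then show "continuous (at z) T" by (rule continuous_on_interior) (use z in \<open>simp only: interior_open[OF open_strip]\<close>)
  show "(fst (T w), \<psi> (T w)) = w" if "w \<in> strip" for w
    using that height(2)[of "snd w" "fst w"] by (auto simp: T_def prod_eq_iff)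
qed

lemma height_C2: "C2_data strip height height_q height_p height_qq height_qp height_pp"
  unfolding C2_data_def
proof (intro ballI)
  fix z :: "real \<times> real" assume z: "z \<in> strip"
  note dT = T_deriv[OF z]
  have dc: "((\<lambda>z. g (T z)) has_derivative (\<lambda>v. (a + b * height_q z) * fst v + b * height_p z * snd v)) (at z)"
    if "(g has_derivative (\<lambda>v. a * fst v + b * snd v)) (at (T z))" for g a b
    by (rule has_derivative_eq_rhs[OF has_derivative_compose[OF dT that]]) (simp add: fun_eq_iff algebra_simps)
  note d = C2_dataD[OF psi_C2 T_Dm[OF z]]
  have nz: "\<psi>y (T z) \<noteq> 0" using psi_y_pos[of z] z by auto
  have h: "(height has_derivative (\<lambda>v. height_q z * fst v + height_p z * snd v)) (at z)"
    using has_derivative_snd[OF dT] by (simp add: T_def)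
  have hp: "(height_p has_derivative (\<lambda>v. height_qp z * fst v + height_pp z * snd v)) (at z)"
    unfolding height_p_def[abs_def]
    by (rule has_derivative_eq_rhs[OF has_derivative_divide[OF has_derivative_const dc[OF d(3)] nz]])
      (use nz in \<open>simp add: fun_eq_iff height_qp_def height_pp_def height_p_def power2_eq_square power3_eq_cube field_simps\<close>)
  have px: "\<psi>x (T z) * height_p z = - height_q z" by (simp add: height_q_def)
  have hq: "(height_q has_derivative (\<lambda>v. height_qq z * fst v + height_qp z * snd v)) (at z)"
    unfolding height_q_def[abs_def]
  proof (rule has_derivative_eq_rhs[OF has_derivative_mult[OF has_derivative_minus[OF dc[OF d(2)]] hp]])
    have 1: "\<psi>x (T z) * height_qp z = height_q z * (\<psi>xy (T z) + \<psi>yy (T z) * height_q z) * height_p z"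
    proof -
      have "\<psi>x (T z) * height_qp z = - (\<psi>x (T z) * height_p z) * (\<psi>xy (T z) + \<psi>yy (T z) * height_q z) * height_p z"
        by (simp add: height_qp_def power2_eq_square algebra_simps)
      then show ?thesis unfolding px by simp
    qed
    have 2: "\<psi>x (T z) * height_pp z = height_q z * \<psi>yy (T z) * (height_p z)\<^sup>2"
    proof -
      have "\<psi>x (T z) * height_pp z = - (\<psi>x (T z) * height_p z) * \<psi>yy (T z) * (height_p z)\<^sup>2"
        by (simp add: height_pp_def power2_eq_square power3_eq_cube algebra_simps)
      then show ?thesis unfolding px by simp
    qed
    have "- \<psi>x (T z) * (height_qp z * x + height_pp z * y) + - ((\<psi>xx (T z) + \<psi>xy (T z) * height_q z) * x + \<psi>xy (T z) * height_p z * y) * height_p z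
      = height_qq z * x + height_qp z * y" for x y
    proof -
      have "- \<psi>x (T z) * (height_qp z * x + height_pp z * y) = - (\<psi>x (T z) * height_qp z) * x - (\<psi>x (T z) * height_pp z) * y"
        by (simp add: algebra_simps)
      then show ?thesis unfolding 1 2 by (simp add: height_qq_def height_qp_def power2_eq_square algebra_simps)
    qed
    then show "(\<lambda>v. - \<psi>x (T z) * (height_qp z * fst v + height_pp z * snd v) +
        - ((\<psi>xx (T z) + \<psi>xy (T z) * height_q z) * fst v + \<psi>xy (T z) * height_p z * snd v) * height_p z)
      = (\<lambda>v. height_qq z * fst v + height_qp z * snd v)" by (simp add: fun_eq_iff)
  qed
  show "(height has_derivative (\<lambda>v. height_q z * fst v + height_p z * snd v)) (at z) \<and>
     (height_q has_derivative (\<lambda>v. height_qq z * fst v + height_qp z * snd v)) (at z) \<and>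
     (height_p has_derivative (\<lambda>v. height_qp z * fst v + height_pp z * snd v)) (at z)"
    using h hq hp by blast
qed

text \<open>Substitution collapses the left side to
  \<open>- (\<psi>xx + \<psi>yy) * height_p ^ 3\<close>, evaluated along \<open>T\<close>.\<close>

lemma height_pde:
  assumes z: "z \<in> strip"
  shows "(height_p z)\<^sup>2 * height_qq z - 2 * height_p z * height_q z * height_qp z + (1 + (height_q z)\<^sup>2) * height_pp z
    = \<omega> (snd z) * height_p z ^ 3"
proof -
  have "\<psi> (T z) = snd z" using height(2)[of "snd z" "fst z"] z by (auto simp: T_def)
  then have w: "\<omega> (snd z) = - \<psi>xx (T z) - \<psi>yy (T z)" using psi_pde[OF T_Dm[OF z]] by simp
  show ?thesis unfolding w height_qq_def height_qp_def height_pp_def by (simp add: power2_eq_square power3_eq_cube algebra_simps)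
qed

lemma height_bernoulli: "(1 + (height_q (q, 1))\<^sup>2) / (2 * (height_p (q, 1))\<^sup>2) + height (q, 1) = r"
proof -
  have T1: "T (q, 1) = (q, \<zeta> q)" by (simp add: T_def height_top)
  have nz: "\<psi>y (q, \<zeta> q) \<noteq> 0" using psi_y_pos[of "(q, 1)"] by (simp add: T1)
  then have "(1 + (height_q (q, 1))\<^sup>2) / (2 * (height_p (q, 1))\<^sup>2) = ((\<psi>y (q, \<zeta> q))\<^sup>2 + (\<psi>x (q, \<zeta> q))\<^sup>2) / 2"
    by (simp add: height_q_def height_p_def T1 power_divide power_mult_distrib field_simps)
  then show ?thesis using psi_bernoulli[of q] by (simp add: height_top add_divide_distrib)
qed

text \<open>Boundedness and equicontinuity in \<open>q\<close>, uniform in \<open>p\<close>. These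
  functions form an algebra, in which \<open>height_qq\<close> is assembled to meet the uniformity
  demanded by \<open>wave\<close>.\<close>

definition regular :: "(real \<times> real \<Rightarrow> real) \<Rightarrow> bool" where
  "regular f \<longleftrightarrow> (\<exists>K. \<forall>z\<in>cstrip. \<bar>f z\<bar> \<le> K) \<and>
     (\<forall>\<epsilon>>0. \<exists>d>0. \<forall>p\<in>{0..1}. \<forall>x y. \<bar>x - y\<bar> \<le> d \<longrightarrow> \<bar>f (x, p) - f (y, p)\<bar> < \<epsilon>)"

lemma regularD:
  assumes "regular f"
  shows "\<exists>K. \<forall>z\<in>cstrip. \<bar>f z\<bar> \<le> K"
    and "0 < \<epsilon> \<Longrightarrow> \<exists>d>0. \<forall>p\<in>{0..1}. \<forall>x y. \<bar>x - y\<bar> \<le> d \<longrightarrow> \<bar>f (x, p) - f (y, p)\<bar> < \<epsilon>"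
  using assms by (simp_all add: regular_def)

lemma regular_add: assumes "regular f" "regular g" shows "regular (\<lambda>z. f z + g z)"
  unfolding regular_def
proof (intro conjI allI impI)
  obtain K L where "\<And>z. z \<in> cstrip \<Longrightarrow> \<bar>f z\<bar> \<le> K" "\<And>z. z \<in> cstrip \<Longrightarrow> \<bar>g z\<bar> \<le> L"
    using assms[THEN regularD(1)] by metis
  then show "\<exists>K. \<forall>z\<in>cstrip. \<bar>f z + g z\<bar> \<le> K"
    by (intro exI[of _ "K + L"] ballI order_trans[OF abs_triangle_ineq add_mono])
  fix \<epsilon> :: real assume "0 < \<epsilon>"
  then have "0 < \<epsilon> / 2" by simp
  then obtain d e where d: "d > 0" "\<And>p x y. p \<in> {0..1} \<Longrightarrow> \<bar>x - y\<bar> \<le> d \<Longrightarrow> \<bar>f (x, p) - f (y, p)\<bar> < \<epsilon> / 2"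
    and e: "e > 0" "\<And>p x y. p \<in> {0..1} \<Longrightarrow> \<bar>x - y\<bar> \<le> e \<Longrightarrow> \<bar>g (x, p) - g (y, p)\<bar> < \<epsilon> / 2"
    using regularD(2)[OF assms(1)] regularD(2)[OF assms(2)] by metis
  show "\<exists>d>0. \<forall>p\<in>{0..1}. \<forall>x y. \<bar>x - y\<bar> \<le> d \<longrightarrow> \<bar>(f (x, p) + g (x, p)) - (f (y, p) + g (y, p))\<bar> < \<epsilon>"
  proof (intro exI[of _ "min d e"] conjI ballI allI impI)
    show "0 < min d e" using d(1) e(1) by simp
    fix p x y :: real assume p: "p \<in> {0..1}" and xy: "\<bar>x - y\<bar> \<le> min d e"
    show "\<bar>(f (x, p) + g (x, p)) - (f (y, p) + g (y, p))\<bar> < \<epsilon>"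
      using d(2)[OF p, of x y] e(2)[OF p, of x y] xy abs_diff_triangle_ineq[of "f (x, p)" "g (x, p)" "f (y, p)" "g (y, p)"] by simp
  qed
qed

lemma regular_mult: assumes "regular f" "regular g" shows "regular (\<lambda>z. f z * g z)"
  unfolding regular_def
proof (intro conjI allI impI)
  obtain K' L' where KL': "\<And>z. z \<in> cstrip \<Longrightarrow> \<bar>f z\<bar> \<le> K'" "\<And>z. z \<in> cstrip \<Longrightarrow> \<bar>g z\<bar> \<le> L'"
    using assms[THEN regularD(1)] by metis
  define K L where "K = max 1 K'" and "L = max 1 L'"
  have KL: "\<And>z. z \<in> cstrip \<Longrightarrow> \<bar>f z\<bar> \<le> K" "\<And>z. z \<in> cstrip \<Longrightarrow> \<bar>g z\<bar> \<le> L" "1 \<le> K" "1 \<le> L"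
    using KL' by (auto simp: K_def L_def le_max_iff_disj)
  show "\<exists>K. \<forall>z\<in>cstrip. \<bar>f z * g z\<bar> \<le> K"
    unfolding abs_mult using KL by (intro exI[of _ "K * L"] ballI mult_mono) auto
  fix \<epsilon> :: real assume \<epsilon>: "0 < \<epsilon>"
  then have "0 < \<epsilon> / (2 * L)" "0 < \<epsilon> / (2 * K)" using KL by simp_all
  then obtain d e where d: "d > 0" "\<And>p x y. p \<in> {0..1} \<Longrightarrow> \<bar>x - y\<bar> \<le> d \<Longrightarrow> \<bar>f (x, p) - f (y, p)\<bar> < \<epsilon> / (2 * L)"
    and e: "e > 0" "\<And>p x y. p \<in> {0..1} \<Longrightarrow> \<bar>x - y\<bar> \<le> e \<Longrightarrow> \<bar>g (x, p) - g (y, p)\<bar> < \<epsilon> / (2 * K)"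
    using regularD(2)[OF assms(1)] regularD(2)[OF assms(2)] by metis
  show "\<exists>d>0. \<forall>p\<in>{0..1}. \<forall>x y. \<bar>x - y\<bar> \<le> d \<longrightarrow> \<bar>f (x, p) * g (x, p) - f (y, p) * g (y, p)\<bar> < \<epsilon>"
  proof (intro exI[of _ "min d e"] conjI ballI allI impI)
    show "0 < min d e" using d(1) e(1) by simp
    fix p x y :: real assume p: "p \<in> {0..1}" and xy: "\<bar>x - y\<bar> \<le> min d e"
    have "f (x, p) * g (x, p) - f (y, p) * g (y, p) = (f (x, p) - f (y, p)) * g (x, p) + f (y, p) * (g (x, p) - g (y, p))"
      by (simp add: algebra_simps)
    then have "\<bar>f (x, p) * g (x, p) - f (y, p) * g (y, p)\<bar> \<le> \<bar>f (x, p) - f (y, p)\<bar> * \<bar>g (x, p)\<bar> + \<bar>f (y, p)\<bar> * \<bar>g (x, p) - g (y, p)\<bar>"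
      by (metis abs_mult abs_triangle_ineq)
    also have "\<dots> \<le> \<bar>f (x, p) - f (y, p)\<bar> * L + K * \<bar>g (x, p) - g (y, p)\<bar>"
      using KL p by (intro add_mono mult_left_mono mult_right_mono) auto
    also have "\<dots> < \<epsilon> / (2 * L) * L + K * (\<epsilon> / (2 * K))"
      using d(2)[OF p, of x y] e(2)[OF p, of x y] xy KL by (intro add_strict_mono mult_strict_left_mono mult_strict_right_mono) auto
    also have "\<dots> = \<epsilon>" using KL by simp
    finally show "\<bar>f (x, p) * g (x, p) - f (y, p) * g (y, p)\<bar> < \<epsilon>" .
  qed
qed

lemma regular_const: "regular (\<lambda>_. a)"
  unfolding regular_def by (auto intro: exI[of _ 1])

lemma regular_minus: "regular f \<Longrightarrow> regular (\<lambda>z. - f z)"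
  using regular_mult[OF regular_const[of "-1"]] by simp

lemma regular_of_deriv:
  assumes C: "continuous_on cstrip f" "continuous_on cstrip fq"
    and der: "\<And>q p. 0 < p \<Longrightarrow> p < 1 \<Longrightarrow> ((\<lambda>q. f (q, p)) has_real_derivative fq (q, p)) (at q)"
    and bd: "\<And>z. z \<in> cstrip \<Longrightarrow> \<bar>f z\<bar> \<le> K" "\<And>z. z \<in> cstrip \<Longrightarrow> \<bar>fq z\<bar> \<le> L"
  shows "p \<in> {0..1} \<Longrightarrow> \<bar>f (x, p) - f (y, p)\<bar> \<le> L * \<bar>x - y\<bar>" "regular f"
proof -
  have lip: "\<bar>f (x, p) - f (y, p)\<bar> \<le> L * \<bar>x - y\<bar>" if p: "p \<in> {0..1}" for p x y
    by (rule lipschitz_of_bounded_deriv[of UNIV "\<lambda>q. f (q, p)" "\<lambda>q. fq (q, p)"])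
      (use strip_deriv_q[OF der C p] bd(2) p in auto)
  then show "p \<in> {0..1} \<Longrightarrow> \<bar>f (x, p) - f (y, p)\<bar> \<le> L * \<bar>x - y\<bar>" .
  have L: "0 \<le> L" using bd(2)[of "(0, 0)"] by simp
  show "regular f"
    unfolding regular_def
  proof (intro conjI allI impI)
    show "\<exists>K. \<forall>z\<in>cstrip. \<bar>f z\<bar> \<le> K" using bd(1) by blast
    fix \<epsilon> :: real assume \<epsilon>: "0 < \<epsilon>"
    show "\<exists>d>0. \<forall>p\<in>{0..1}. \<forall>x y. \<bar>x - y\<bar> \<le> d \<longrightarrow> \<bar>f (x, p) - f (y, p)\<bar> < \<epsilon>"
    proof (intro exI[of _ "\<epsilon> / (L + 1)"] conjI ballI allI impI)
      show "0 < \<epsilon> / (L + 1)" using \<epsilon> L by simp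
      fix p x y :: real assume p: "p \<in> {0..1}" and xy: "\<bar>x - y\<bar> \<le> \<epsilon> / (L + 1)"
      have "L * \<bar>x - y\<bar> \<le> L * (\<epsilon> / (L + 1))" using xy L by (rule mult_left_mono)
      also have "\<dots> < (L + 1) * (\<epsilon> / (L + 1))" using \<epsilon> L by (intro mult_strict_right_mono) auto
      also have "\<dots> = \<epsilon>" using L by simp
      finally show "\<bar>f (x, p) - f (y, p)\<bar> < \<epsilon>" using lip[OF p, of x y] by linarith
    qed
  qed
qed

lemma bounds_exist: "\<exists>M. \<forall>g\<in>{height, height_q, height_p, height_qq, height_qp, height_pp}. \<forall>z\<in>cstrip. \<bar>g z\<bar> \<le> M"
proof -
  define bdd where "bdd f \<longleftrightarrow> (\<exists>K. \<forall>z\<in>cstrip. \<bar>f z\<bar> \<le> K)" for f :: "real \<times> real \<Rightarrow> real"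
  have add: "bdd (\<lambda>z. f z + g z)" if "bdd f" "bdd g" for f g
  proof -
    obtain K L where "\<And>z. z \<in> cstrip \<Longrightarrow> \<bar>f z\<bar> \<le> K" "\<And>z. z \<in> cstrip \<Longrightarrow> \<bar>g z\<bar> \<le> L"
      using \<open>bdd f\<close> \<open>bdd g\<close> unfolding bdd_def by metis
    then show ?thesis unfolding bdd_def by (intro exI[of _ "K + L"] ballI order_trans[OF abs_triangle_ineq add_mono])
  qed
  have mult: "bdd (\<lambda>z. f z * g z)" if "bdd f" "bdd g" for f g
  proof -
    obtain K L where KL: "\<And>z. z \<in> cstrip \<Longrightarrow> \<bar>f z\<bar> \<le> K" "\<And>z. z \<in> cstrip \<Longrightarrow> \<bar>g z\<bar> \<le> L"
      using \<open>bdd f\<close> \<open>bdd g\<close> unfolding bdd_def by metis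
    have "0 \<le> K" using KL(1)[of "(0, 0)"] by simp
    then show ?thesis unfolding bdd_def abs_mult using KL by (intro exI[of _ "K * L"] ballI mult_mono) auto
  qed
  have neg: "bdd (\<lambda>z. - f z)" if "bdd f" for f using that by (simp add: bdd_def)
  have const: "bdd (\<lambda>_. a)" for a by (auto simp: bdd_def)
  have psi: "bdd (\<lambda>z. g (T z))" if "g \<in> {\<psi>, \<psi>x, \<psi>y, \<psi>xx, \<psi>xy, \<psi>yy}" for g
    unfolding bdd_def using psi_bound[OF that T_Dc] by blast
  have p: "bdd height_p"
  proof -
    have "\<bar>height_p z\<bar> \<le> 1 / c" if "z \<in> cstrip" for z
      using psi_y_ge[OF T_Dc[OF that]] psi_y_pos[OF that] c by (simp add: height_p_def frac_le)
    then show ?thesis by (auto simp: bdd_def)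
  qed
  have P: "bdd (\<lambda>z. \<psi>x (T z))" "bdd (\<lambda>z. \<psi>xx (T z))" "bdd (\<lambda>z. \<psi>xy (T z))" "bdd (\<lambda>z. \<psi>yy (T z))"
    by (rule psi; simp)+
  have q: "bdd height_q" unfolding height_q_def[abs_def] by (intro mult neg p P)
  have h: "bdd height"
  proof -
    have "\<bar>height z\<bar> \<le> B" if "z \<in> cstrip" for z
      using height(1)[of "snd z" "fst z"] surface(3)[of "fst z"] that by auto
    then show ?thesis by (auto simp: bdd_def)
  qed
  have pp: "bdd height_pp" unfolding height_pp_def[abs_def] power3_eq_cube by (intro mult neg p P)
  have qp: "bdd height_qp" unfolding height_qp_def[abs_def] power2_eq_square by (intro mult neg add p q P)
  have qq: "bdd height_qq" unfolding height_qq_def[abs_def] power2_eq_square by (intro mult neg add const p q P)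
  have un: "\<exists>M. \<forall>g\<in>G. \<forall>z\<in>cstrip. \<bar>g z\<bar> \<le> M" if "finite G" "\<forall>g\<in>G. bdd g" for G
    using that
  proof (induction G)
    case (insert g G)
    from insert.prems obtain K where K: "\<And>z. z \<in> cstrip \<Longrightarrow> \<bar>g z\<bar> \<le> K" unfolding bdd_def by blast
    from insert obtain M where M: "\<And>g z. g \<in> G \<Longrightarrow> z \<in> cstrip \<Longrightarrow> \<bar>g z\<bar> \<le> M" by blast
    show ?case
    proof (intro exI[of _ "max K M"] ballI)
      fix g' z assume "g' \<in> insert g G" "z \<in> cstrip"
      then show "\<bar>g' z\<bar> \<le> max K M" using K[of z] M[of g' z] by auto
    qed
  qed simp
  show ?thesis by (rule un) (use h q p qq qp pp in simp_all)
qed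

lemma wave_of_stream: "\<exists>M c0. wave \<omega> r em ep height height_q height_p height_qq height_qp height_pp M c0"
proof -
  obtain M where M: "\<And>g z. g \<in> {height, height_q, height_p, height_qq, height_qp, height_pp} \<Longrightarrow> z \<in> cstrip \<Longrightarrow> \<bar>g z\<bar> \<le> M"
    using bounds_exist by blast
  have B: "0 < B" using surface(2)[of 0] surface(3)[of 0] by linarith
  have part: "((\<lambda>q. height (q, p)) has_real_derivative height_q (q, p)) (at q)"
    "((\<lambda>q. height_q (q, p)) has_real_derivative height_qq (q, p)) (at q)"
    "((\<lambda>q. height_p (q, p)) has_real_derivative height_qp (q, p)) (at q)" if "0 < p" "p < 1" for q p
  proof -
    have "(q, p) \<in> strip" using that by simp
    note d = C2_dataD[OF height_C2 this]
    show "((\<lambda>q. height (q, p)) has_real_derivative height_q (q, p)) (at q)"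
      "((\<lambda>q. height_q (q, p)) has_real_derivative height_qq (q, p)) (at q)"
      "((\<lambda>q. height_p (q, p)) has_real_derivative height_qp (q, p)) (at q)"
      using has_derivative_partials(1)[OF d(1)] has_derivative_partials(1)[OF d(2)] has_derivative_partials(1)[OF d(3)] .
  qed
  have lip: "\<bar>height (x, p) - height (y, p)\<bar> \<le> M * \<bar>x - y\<bar>" if "p \<in> {0..1}" for x y p
    by (rule regular_of_deriv(1)[OF height_cont height_conts(2) part(1) _ _ that]) (auto intro: M)
  have rq: "regular height_q"
    by (rule regular_of_deriv(2)[OF height_conts(2,5) part(2)]) (auto intro: M)
  have rp: "regular height_p"
    by (rule regular_of_deriv(2)[OF height_conts(1,4) part(3)]) (auto intro: M)
  have rpsi: "regular (\<lambda>z. g (T z))" if g: "g \<in> {\<psi>xx, \<psi>xy, \<psi>yy}" for g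
    unfolding regular_def
  proof (intro conjI allI impI)
    have "g \<in> {\<psi>, \<psi>x, \<psi>y, \<psi>xx, \<psi>xy, \<psi>yy}" using g by blast
    then show "\<exists>K. \<forall>z\<in>cstrip. \<bar>g (T z)\<bar> \<le> K" using psi_bound T_Dc by blast
    fix \<epsilon> :: real assume "0 < \<epsilon>"
    then obtain d where d: "d > 0" "\<And>z w. z \<in> Dc \<Longrightarrow> w \<in> Dc \<Longrightarrow> dist z w < d \<Longrightarrow> dist (g z) (g w) < \<epsilon>"
      using psi_unif[OF g] unfolding uniformly_continuous_on_def by metis
    have M0: "0 \<le> M" using M[of height "(0, 0)"] by simp
    show "\<exists>d>0. \<forall>p\<in>{0..1}. \<forall>x y. \<bar>x - y\<bar> \<le> d \<longrightarrow> \<bar>g (T (x, p)) - g (T (y, p))\<bar> < \<epsilon>"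
    proof (intro exI[of _ "d / (2 + M)"] conjI ballI allI impI)
      show "0 < d / (2 + M)" using d M0 by simp
      fix p x y :: real assume p: "p \<in> {0..1}" and xy: "\<bar>x - y\<bar> \<le> d / (2 + M)"
      have "dist (T (x, p)) (T (y, p)) \<le> \<bar>x - y\<bar> + \<bar>height (x, p) - height (y, p)\<bar>"
        using sqrt_sum_squares_le_sum_abs[of "x - y" "height (x, p) - height (y, p)"]
        by (simp add: T_def dist_Pair_Pair dist_real_def)
      also have "\<dots> \<le> (1 + M) * \<bar>x - y\<bar>" using lip[OF p, of x y] by (simp add: algebra_simps)
      also have "\<dots> \<le> (1 + M) * (d / (2 + M))" using xy M0 by (intro mult_left_mono) auto
      also have "\<dots> < (2 + M) * (d / (2 + M))" using d M0 by (intro mult_strict_right_mono) auto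
      also have "\<dots> = d" using M0 by simp
      finally show "\<bar>g (T (x, p)) - g (T (y, p))\<bar> < \<epsilon>"
        using d(2)[OF T_Dc T_Dc, of "(x, p)" "(y, p)"] p by (simp add: dist_real_def)
    qed
  qed
  have P: "regular (\<lambda>z. \<psi>xx (T z))" "regular (\<lambda>z. \<psi>xy (T z))" "regular (\<lambda>z. \<psi>yy (T z))"
    by (rule rpsi; simp)+
  have rqq: "regular height_qq"
    unfolding height_qq_def[abs_def] power2_eq_square
    by (intro regular_mult regular_minus regular_add regular_const rq rp P)
  \<comment> \<open>The lower bound \<open>1 / B\<close> for \<open>height_p\<close> comes from the
    upper bound on \<open>\<psi>y\<close>.\<close>
  have "wave \<omega> r em ep height height_q height_p height_qq height_qp height_pp M (1 / B)"
  proof unfold_locales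
    show "C2_data strip height height_q height_p height_qq height_qp height_pp" by (rule height_C2)
    show "continuous_on cstrip g" if "g \<in> {height, height_q, height_p, height_qq, height_qp, height_pp}" for g
      using that height_cont height_conts by blast
    show "\<bar>g z\<bar> \<le> M" if "g \<in> {height, height_q, height_p, height_qq, height_qp, height_pp}" "z \<in> cstrip" for g z
      by (rule M[OF that])
    show "0 < 1 / B" using B by simp
    show "1 / B \<le> height_p z" if "z \<in> cstrip" for z
      unfolding height_p_def using psi_bound[of \<psi>y, OF _ T_Dc[OF that]] psi_y_pos[OF that] B
      by (intro divide_left_mono) auto
    show "\<exists>d>0. \<forall>p\<in>{0..1}. \<forall>x y. \<bar>x - y\<bar> \<le> d \<longrightarrow> \<bar>height_qq (x, p) - height_qq (y, p)\<bar> < \<epsilon>" if "0 < \<epsilon>" for \<epsilon>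
      using regularD(2)[OF rqq that] .
  qed (auto simp: height_bottom height_bernoulli intro: height_pde)
  then show ?thesis by blast
qed

lemma flow_force_eq:
  "integral {0..\<zeta> x} (\<lambda>y. ((\<psi>y (x, y))\<^sup>2 - (\<psi>x (x, y))\<^sup>2) / 2 - y + \<Omega> 1 - \<Omega> (\<psi> (x, y)) + r)
    = integral {0..1} (\<lambda>p. ((1 - (height_q (x, p))\<^sup>2) / (2 * (height_p (x, p))\<^sup>2) - height (x, p) - \<Omega> p + \<Omega> 1 + r) * height_p (x, p))"
proof -
  let ?f = "\<lambda>y. ((\<psi>y (x, y))\<^sup>2 - (\<psi>x (x, y))\<^sup>2) / 2 - y + \<Omega> 1 - \<Omega> (\<psi> (x, y)) + r"
  have sect: "continuous_on {0..1} (\<lambda>p. g (x, p))" if "continuous_on cstrip g" for g :: "real \<times> real \<Rightarrow> real"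
    by (rule continuous_on_compose2[OF that]) (auto intro!: continuous_intros)
  have "((\<lambda>p. height_p (x, p) *\<^sub>R ?f (height (x, p))) has_integral (integral {height (x, 0)..height (x, 1)} ?f)) {0..1}"
  proof (rule has_integral_substitution[where c = 0 and d = "\<zeta> x"])
    show "height (x, 0) \<le> height (x, 1)" using surface(2)[of x] by (simp add: height_bottom height_top)
    show "(\<lambda>p. height (x, p)) ` {0..1} \<subseteq> {0..\<zeta> x}" using height(1) by blast
    have "continuous_on {0..\<zeta> x} (\<lambda>y. \<Omega> (\<psi> (x, y)))"
      by (rule continuous_on_compose2[OF Omega_cont psi_sect_cont]) (use psi_mem in auto)
    moreover have "continuous_on {0..\<zeta> x} (\<lambda>y. \<psi>x (x, y))" "continuous_on {0..\<zeta> x} (\<lambda>y. \<psi>y (x, y))"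
      by (rule psi_sect_cont; simp)+
    ultimately show "continuous_on {0..\<zeta> x} ?f" by (intro continuous_intros) auto
    show "((\<lambda>p. height (x, p)) has_real_derivative height_p (x, p)) (at p within {0..1})" if p: "p \<in> {0..1}" for p
    proof (rule derivative_within_of_interior[OF zero_less_one _ sect[OF height_cont] sect[OF height_conts(1)] p])
      fix t :: real assume "0 < t" "t < 1"
      then have "(x, t) \<in> strip" by simp
      from has_derivative_partials(2)[OF C2_dataD(1)[OF height_C2 this]]
      show "((\<lambda>p. height (x, p)) has_real_derivative height_p (x, t)) (at t)" .
    qed
  qed simp
  then have "integral {0..\<zeta> x} ?f = integral {0..1} (\<lambda>p. height_p (x, p) * ?f (height (x, p)))"
    by (simp add: height_bottom height_top integral_unique)
  also have "\<dots> = integral {0..1} (\<lambda>p. ((1 - (height_q (x, p))\<^sup>2) / (2 * (height_p (x, p))\<^sup>2) - height (x, p) - \<Omega> p + \<Omega> 1 + r) * height_p (x, p))"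
  proof (rule integral_cong)
    fix p :: real assume p: "p \<in> {0..1}"
    have T: "T (x, p) = (x, height (x, p))" by (simp add: T_def)
    have nz: "\<psi>y (x, height (x, p)) \<noteq> 0" using psi_y_pos[of "(x, p)"] p by (simp add: T)
    have "(1 - (height_q (x, p))\<^sup>2) / (2 * (height_p (x, p))\<^sup>2) = ((\<psi>y (x, height (x, p)))\<^sup>2 - (\<psi>x (x, height (x, p)))\<^sup>2) / 2"
      using nz by (simp add: height_q_def height_p_def T power_divide power_mult_distrib field_simps)
    then have "?f (height (x, p)) = (1 - (height_q (x, p))\<^sup>2) / (2 * (height_p (x, p))\<^sup>2) - height (x, p) - \<Omega> p + \<Omega> 1 + r"
      using height(2)[OF p, of x] by simp
    then show "height_p (x, p) * ?f (height (x, p)) = ((1 - (height_q (x, p))\<^sup>2) / (2 * (height_p (x, p))\<^sup>2) - height (x, p) - \<Omega> p + \<Omega> 1 + r) * height_p (x, p)"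
      by (simp only: mult.commute)
  qed
  finally show ?thesis .
qed

end

context wave
begin

text \<open>A surface that never reaches \<open>D ep\<close> decays at one end. A wave decaying on
  the left is reflected first, and symmetry turns decay at one end into decay at both.\<close>

lemma F_sup_classification:
  assumes F: "flow_force 0 = F_sup"
  shows "(\<forall>q. \<forall>p\<in>{0..1}. h (q, p) = Hf ep p) \<or>
    ((\<exists>x0. \<forall>t. \<eta> (x0 + t) = \<eta> (x0 - t)) \<and> (\<forall>q. D ep < \<eta> q) \<and> (\<eta> \<longlongrightarrow> D ep) at_top \<and> (\<eta> \<longlongrightarrow> D ep) at_bot)"
proof (cases "\<exists>x0. \<eta> x0 = D ep")
  case True
  then show ?thesis using touching_laminar[OF F] by blast
next
  case False
  have above: "D ep < \<eta> q" for q
    using eta_inf_le[of q] eta_inf_of_F_sup[OF F] False by (simp add: less_le) metis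
  have both: "(\<eta> \<longlongrightarrow> D ep) at_top \<and> (\<eta> \<longlongrightarrow> D ep) at_bot"
    if sym: "\<And>t. \<eta> (x0 + t) = \<eta> (x0 - t)" and one: "(\<eta> \<longlongrightarrow> D ep) at_top \<or> ((\<lambda>q. \<eta> (- q)) \<longlongrightarrow> D ep) at_top" for x0
  proof -
    have eq: "\<eta> (2 * x0 + q) = \<eta> (- q)" for q using sym[of "x0 + q"] by (simp add: algebra_simps)
    have "(\<eta> \<longlongrightarrow> D ep) at_top \<longleftrightarrow> ((\<lambda>q. \<eta> (- q)) \<longlongrightarrow> D ep) at_top"
    proof
      assume "(\<eta> \<longlongrightarrow> D ep) at_top"
      moreover have "filterlim (\<lambda>q. 2 * x0 + q) at_top at_top"
        by (rule filterlim_tendsto_add_at_top[OF tendsto_const filterlim_ident])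
      ultimately have "((\<lambda>q. \<eta> (2 * x0 + q)) \<longlongrightarrow> D ep) at_top" by (rule filterlim_compose)
      then show "((\<lambda>q. \<eta> (- q)) \<longlongrightarrow> D ep) at_top" unfolding eq .
    next
      assume "((\<lambda>q. \<eta> (- q)) \<longlongrightarrow> D ep) at_top"
      then have "((\<lambda>q. \<eta> (2 * x0 + q)) \<longlongrightarrow> D ep) at_top" unfolding eq .
      moreover have "filterlim (\<lambda>q. - (2 * x0) + q) at_top at_top"
        by (rule filterlim_tendsto_add_at_top[OF tendsto_const filterlim_ident])
      ultimately have "((\<lambda>q. \<eta> (2 * x0 + (- (2 * x0) + q))) \<longlongrightarrow> D ep) at_top" by (rule filterlim_compose)
      then show "(\<eta> \<longlongrightarrow> D ep) at_top" by simp
    qed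
    with one show ?thesis by (simp add: at_bot_mirror filterlim_filtermap)
  qed
  have ends: "(\<eta> \<longlongrightarrow> D ep) at_top \<or> ((\<lambda>q. \<eta> (- q)) \<longlongrightarrow> D ep) at_top" by (rule tends_at_one_end[OF F above])
  have "\<exists>x0. \<forall>t. \<eta> (x0 + t) = \<eta> (x0 - t)"
    using ends
  proof
    assume lim: "(\<eta> \<longlongrightarrow> D ep) at_top"
    interpret solitary \<omega> r em ep h hq hp hqq hqp hpp M c0
      by unfold_locales (use F above lim in auto)
    show ?thesis by (rule symmetric)
  next
    assume lim: "((\<lambda>q. \<eta> (- q)) \<longlongrightarrow> D ep) at_top"
    interpret RW: wave \<omega> r em ep "rh 0" "rhq 0" "rhp 0"
      "rhqq 0" "rhqp 0" "rhpp 0" M c0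
      by (rule reflected_wave)
    interpret RS: solitary \<omega> r em ep "rh 0" "rhq 0" "rhp 0"
      "rhqq 0" "rhqp 0" "rhpp 0" M c0
    proof unfold_locales
      show "RW.flow_force 0 = F_sup" using reflected_flow_force[of 0 0] F by simp
      show "D ep < h (2 * 0 - fst (q, 1), snd (q, 1))" for q using above by simp
      show "((\<lambda>q. h (2 * 0 - fst (q, 1), snd (q, 1))) \<longlongrightarrow> D ep) at_top" using lim by simp
    qed
    obtain x0 where x0: "\<And>t. \<eta> (- (x0 + t)) = \<eta> (- (x0 - t))" using RS.symmetric by auto
    have "\<eta> (- x0 + t) = \<eta> (- x0 - t)" for t
    proof -
      have "- (x0 + - t) = - x0 + t" "- (x0 - - t) = - x0 - t" by simp_all
      then show ?thesis using x0[of "- t"] by (simp only:)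
    qed
    then show ?thesis by blast
  qed
  then obtain x0 where "\<And>t. \<eta> (x0 + t) = \<eta> (x0 - t)" by blast
  with both[OF this ends] above show ?thesis by blast
qed

end

section \<open>From the physical formulation to the theorem\<close>

lemma uniformly_continuous_of_holder:
  assumes "holder_on \<gamma> S f" "0 < \<gamma>"
  shows "uniformly_continuous_on S f"
  unfolding uniformly_continuous_on_def
proof (intro allI impI)
  obtain C where C: "\<And>p q. p \<in> S \<Longrightarrow> q \<in> S \<Longrightarrow> \<bar>f p - f q\<bar> \<le> C * dist p q powr \<gamma>"
    using assms(1) unfolding holder_on_def by blast
  fix e :: real assume e: "0 < e"
  \<comment> \<open>Solves \<open>(\<bar>C\<bar> + 1) * d powr \<gamma> = e\<close>; the summand 1
    guards against \<open>C = 0\<close>.\<close>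
  define d where "d = (e / (\<bar>C\<bar> + 1)) powr (1 / \<gamma>)"
  have "0 < d" using e by (simp add: d_def)
  moreover have "dist (f q) (f p) < e" if "p \<in> S" "q \<in> S" "dist q p < d" for p q
  proof -
    have "dist p q powr \<gamma> < d powr \<gamma>"
      using that assms(2) by (intro powr_less_mono2) (auto simp: dist_commute)
    also have "d powr \<gamma> = e / (\<bar>C\<bar> + 1)" using assms(2) e by (simp add: d_def powr_powr)
    finally have lt: "dist p q powr \<gamma> < e / (\<bar>C\<bar> + 1)" .
    have "\<bar>f p - f q\<bar> \<le> C * dist p q powr \<gamma>" by (rule C[OF that(1,2)])
    also have "\<dots> \<le> (\<bar>C\<bar> + 1) * dist p q powr \<gamma>" by (intro mult_right_mono) auto
    also have "\<dots> < (\<bar>C\<bar> + 1) * (e / (\<bar>C\<bar> + 1))" by (intro mult_strict_left_mono lt) auto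
    also have "\<dots> = e" by simp
    finally show ?thesis by (simp add: dist_real_def abs_minus_commute)
  qed
  ultimately show "\<exists>d>0. \<forall>p\<in>S. \<forall>q\<in>S. dist q p < d \<longrightarrow> dist (f q) (f p) < e" by blast
qed

text \<open>Bounds and the positive infimum of \<open>\<psi>y\<close> pass from the open fluid
  domain to its closure by continuity, and surface and bottom lie in that closure.\<close>

lemma steady_wave_of_solution:
  fixes \<eta> :: "real \<Rightarrow> real"
  assumes cp: "conjugate_pair \<omega> r em ep" and \<gamma>: "0 < \<gamma>"
    and eta_reg: "C2g_line \<gamma> \<eta>" and eta_pos: "\<forall>x. \<eta> x > 0"
    and D_def: "D = {(x, y). 0 < y \<and> y < \<eta> x}"
    and psi_reg: "C2g_closure \<gamma> D \<psi> \<psi>x \<psi>y \<psi>xx \<psi>xy \<psi>yy"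
    and pde: "\<forall>p\<in>D. \<psi>xx p + \<psi>yy p + \<omega> (\<psi> p) = 0"
    and bernoulli: "\<forall>x. (\<psi>x (x, \<eta> x))\<^sup>2 / 2 + (\<psi>y (x, \<eta> x))\<^sup>2 / 2 + \<eta> x = r"
    and top: "\<forall>x. \<psi> (x, \<eta> x) = 1"
    and bottom: "\<forall>x. \<psi> (x, 0) = 0"
    and psi_y_pos: "(INF p\<in>D. \<psi>y p) > 0"
  shows "\<exists>B c. steady_wave \<omega> r em ep \<eta> \<psi> \<psi>x \<psi>y \<psi>xx \<psi>xy \<psi>yy B c"
proof -
  interpret conjugate_pair \<omega> r em ep by (rule cp)
  let ?G = "{\<psi>, \<psi>x, \<psi>y, \<psi>xx, \<psi>xy, \<psi>yy}"
  let ?C = "{(x, y). 0 \<le> y \<and> y \<le> \<eta> x}"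
  obtain f1 f2 where f: "\<And>x. (\<eta> has_real_derivative f1 x) (at x)" and fb: "bounded (range \<eta>)"
    using eta_reg unfolding C2g_line_def by blast
  have eta_cont: "continuous_on UNIV \<eta>" by (rule DERIV_continuous_on[OF f])
  have sub: "?C \<subseteq> closure D"
    unfolding D_def using closure_subgraph[of \<eta>] eta_pos by auto
  have oD: "open D"
  proof -
    have "continuous_on UNIV (\<lambda>z :: real \<times> real. \<eta> (fst z))"
      by (rule continuous_on_compose2[OF eta_cont]) (auto intro!: continuous_intros)
    then have "open {z :: real \<times> real. 0 < snd z \<and> snd z < \<eta> (fst z)}"
      by (intro open_Collect_conj open_Collect_less continuous_intros)
    moreover have "{z :: real \<times> real. 0 < snd z \<and> snd z < \<eta> (fst z)} = D" by (auto simp: D_def)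
    ultimately show ?thesis by simp
  qed
  have part: "((\<lambda>t. \<psi> (t, y)) has_real_derivative \<psi>x (x, y)) (at x)" "((\<lambda>t. \<psi> (x, t)) has_real_derivative \<psi>y (x, y)) (at y)"
    "((\<lambda>t. \<psi>x (t, y)) has_real_derivative \<psi>xx (x, y)) (at x)" "((\<lambda>t. \<psi>x (x, t)) has_real_derivative \<psi>xy (x, y)) (at y)"
    "((\<lambda>t. \<psi>y (t, y)) has_real_derivative \<psi>xy (x, y)) (at x)" "((\<lambda>t. \<psi>y (x, t)) has_real_derivative \<psi>yy (x, y)) (at y)"
    if "(x, y) \<in> D" for x y
    using psi_reg that unfolding C2g_closure_def by blast+
  have cont: "continuous_on (closure D) g" and bd: "bounded (g ` D)" if "g \<in> ?G" for g
    using psi_reg that unfolding C2g_closure_def by blast+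
  have hol: "holder_on \<gamma> D g" if "g \<in> {\<psi>xx, \<psi>xy, \<psi>yy}" for g
    using psi_reg that unfolding C2g_closure_def by blast
  have contD: "continuous_on D g" if "g \<in> ?G" for g
    by (rule continuous_on_subset[OF cont[OF that] closure_subset])
  obtain B0 where B0: "\<And>x. \<bar>\<eta> x\<bar> \<le> B0" using fb unfolding bounded_iff by auto
  have bdd: "\<exists>B. \<forall>z\<in>closure D. \<bar>g z\<bar> \<le> B" if g: "g \<in> ?G" for g
  proof -
    obtain B where "\<forall>z\<in>D. norm (g z) \<le> B" using bd[OF g] unfolding bounded_iff by auto
    from continuous_on_closure_norm_le[OF cont[OF g] this] show ?thesis by (auto intro!: exI[of _ B])
  qed
  have "\<exists>B. \<forall>g\<in>G. \<forall>z\<in>closure D. \<bar>g z\<bar> \<le> B" if "finite G" "G \<subseteq> ?G" for G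
    using that
  proof (induction G)
    case (insert g G)
    from bdd[of g] insert.prems obtain K where K: "\<And>z. z \<in> closure D \<Longrightarrow> \<bar>g z\<bar> \<le> K" by auto
    from insert obtain L where L: "\<And>g z. g \<in> G \<Longrightarrow> z \<in> closure D \<Longrightarrow> \<bar>g z\<bar> \<le> L" by blast
    show ?case
    proof (intro exI[of _ "max K L"] ballI)
      fix g' z assume "g' \<in> insert g G" "z \<in> closure D"
      then show "\<bar>g' z\<bar> \<le> max K L" using K[of z] L[of g' z] by auto
    qed
  qed simp
  from this[of ?G] have "\<exists>B. \<forall>g\<in>?G. \<forall>z\<in>closure D. \<bar>g z\<bar> \<le> B" by simp
  then obtain B1 where B1: "\<And>g z. g \<in> ?G \<Longrightarrow> z \<in> closure D \<Longrightarrow> \<bar>g z\<bar> \<le> B1" by blast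
  define B where "B = max B0 B1"
  define c where "c = (INF p\<in>D. \<psi>y p)"
  have "\<psi>y z \<ge> c" if "z \<in> D" for z
    unfolding c_def using bd[of \<psi>y] that by (intro cINF_lower bounded_imp_bdd_below) auto
  then have cge: "c \<le> \<psi>y z" if "z \<in> closure D" for z
    using continuous_ge_on_closure[OF cont[of \<psi>y] that, of c] by blast
  have "steady_wave \<omega> r em ep \<eta> \<psi> \<psi>x \<psi>y \<psi>xx \<psi>xy \<psi>yy B c"
  proof (unfold_locales, unfold D_def[symmetric])
    show "continuous_on UNIV \<eta>" by (rule eta_cont)
    show "0 < \<eta> x" "\<eta> x \<le> B" for x using eta_pos B0[of x] by (auto simp: B_def)
    show "C2_data D \<psi> \<psi>x \<psi>y \<psi>xx \<psi>xy \<psi>yy"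
      unfolding C2_data_def
    proof (intro ballI conjI)
      fix z assume z: "z \<in> D"
      show "(\<psi> has_derivative (\<lambda>v. \<psi>x z * fst v + \<psi>y z * snd v)) (at z)"
        by (rule has_derivative_of_partials[OF oD z part(1,2) contD]) auto
      show "(\<psi>x has_derivative (\<lambda>v. \<psi>xx z * fst v + \<psi>xy z * snd v)) (at z)"
        by (rule has_derivative_of_partials[OF oD z part(3,4) contD]) auto
      show "(\<psi>y has_derivative (\<lambda>v. \<psi>xy z * fst v + \<psi>yy z * snd v)) (at z)"
        by (rule has_derivative_of_partials[OF oD z part(5,6) contD]) auto
    qed
    show "continuous_on ?C g" if "g \<in> ?G" for g by (rule continuous_on_subset[OF cont[OF that] sub])
    show "\<bar>g z\<bar> \<le> B" if "g \<in> ?G" "z \<in> ?C" for g z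
      using B1[OF that(1)] sub that(2) unfolding B_def by (meson le_max_iff_disj subsetD)
    show "uniformly_continuous_on ?C g" if g: "g \<in> {\<psi>xx, \<psi>xy, \<psi>yy}" for g
    proof -
      have "g \<in> ?G" using g by blast
      from uniformly_continuous_on_closure[OF uniformly_continuous_of_holder[OF hol[OF g] \<gamma>] cont[OF this]]
      show ?thesis using sub unfolding uniformly_continuous_on_def by (meson subsetD)
    qed
    show "0 < c" using psi_y_pos by (simp add: c_def)
    show "c \<le> \<psi>y z" if "z \<in> ?C" for z using cge sub that by blast
  qed (use pde bernoulli top bottom in auto)
  then show ?thesis by blast
qed

theorem theorem2p1:
  fixes \<gamma> r :: real
    and \<omega> \<eta> :: "real \<Rightarrow> real"
    and \<psi> \<psi>x \<psi>y \<psi>xx \<psi>xy \<psi>yy :: "real \<times> real \<Rightarrow> real"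
    and D :: "(real \<times> real) set"
    and F :: "real \<Rightarrow> real"
  assumes gamma: "0 < \<gamma>" "\<gamma> < 1"
    and omega_cont: "continuous_on {0..1} \<omega>"
    and r_range: "R_crit \<omega> < r" "ereal r < R_zero \<omega>"
    and eta_reg: "C2g_line \<gamma> \<eta>"
    and eta_pos: "\<forall>x. \<eta> x > 0"
    and D_def: "D = {(x, y). 0 < y \<and> y < \<eta> x}"
    and psi_reg: "C2g_closure \<gamma> D \<psi> \<psi>x \<psi>y \<psi>xx \<psi>xy \<psi>yy"
    and pde: "\<forall>p\<in>D. \<psi>xx p + \<psi>yy p + \<omega> (\<psi> p) = 0"
    and bernoulli: "\<forall>x. (\<psi>x (x, \<eta> x))\<^sup>2 / 2 + (\<psi>y (x, \<eta> x))\<^sup>2 / 2 + \<eta> x = r"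
    and top: "\<forall>x. \<psi> (x, \<eta> x) = 1"
    and bottom: "\<forall>x. \<psi> (x, 0) = 0"
    and psi_y_pos: "(INF p\<in>D. \<psi>y p) > 0"
    and F_def: "\<forall>x. F x = integral {0..\<eta> x} (\<lambda>y.
        ((\<psi>y (x, y))\<^sup>2 - (\<psi>x (x, y))\<^sup>2) / 2 - y + Omega \<omega> 1 - Omega \<omega> (\<psi> (x, y)) + r)"
  shows "(\<forall>x x'. F x = F x') \<and>
    (\<forall>x. F_minus \<omega> r \<le> F x \<and> F x \<le> F_plus \<omega> r) \<and>
    (\<forall>x. F x = F_minus \<omega> r \<longrightarrow>
        ((\<forall>x'. \<eta> x' = d_minus \<omega> r) \<and>
         (\<forall>x' y. 0 \<le> y \<and> y \<le> \<eta> x' \<longrightarrow> \<psi> (x', y) = U \<omega> (s_plus \<omega> r) y))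
      \<or> ((\<exists>x0. \<forall>t. \<eta> (x0 + t) = \<eta> (x0 - t)) \<and>
         (\<forall>x'. \<eta> x' > d_minus \<omega> r) \<and>
         (\<eta> \<longlongrightarrow> d_minus \<omega> r) at_top \<and> (\<eta> \<longlongrightarrow> d_minus \<omega> r) at_bot)) \<and>
    (\<forall>x. F x = F_plus \<omega> r \<longrightarrow>
        (\<forall>x'. \<eta> x' = d_plus \<omega> r) \<and>
        (\<forall>x' y. 0 \<le> y \<and> y \<le> \<eta> x' \<longrightarrow> \<psi> (x', y) = U \<omega> (s_minus \<omega> r) y))"
proof -
  interpret vo: vorticity \<omega> by unfold_locales (rule omega_cont)
  obtain em ep where e: "vo.e0 < em" "em < vo.ec" "vo.ec < ep" "vo.R em = r" "vo.R ep = r"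
    and s: "s_minus \<omega> r = sqrt (2 * em)" "s_plus \<omega> r = sqrt (2 * ep)"
    by (rule vo.conjugate_flows[OF r_range])
  interpret cp: conjugate_pair \<omega> r em ep by unfold_locales (use e in auto)
  obtain B c where steady: "steady_wave \<omega> r em ep \<eta> \<psi> \<psi>x \<psi>y \<psi>xx \<psi>xy \<psi>yy B c"
    using steady_wave_of_solution[OF cp.conjugate_pair_axioms gamma(1) eta_reg eta_pos D_def psi_reg pde bernoulli top bottom psi_y_pos]
    by blast
  interpret st: steady_wave \<omega> r em ep \<eta> \<psi> \<psi>x \<psi>y \<psi>xx \<psi>xy \<psi>yy B c
    "{(x, y). 0 < y \<and> y < \<eta> x}" "{(x, y). 0 \<le> y \<and> y \<le> \<eta> x}"
    by (rule steady reflexive)+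
  obtain M c0 where "wave \<omega> r em ep st.height st.height_q st.height_p st.height_qq st.height_qp st.height_pp M c0"
    using st.wave_of_stream by blast
  then interpret w: wave \<omega> r em ep st.height st.height_q st.height_p st.height_qq st.height_qp st.height_pp M c0 .
  have sq: "(s_minus \<omega> r)\<^sup>2 / 2 = em" "(s_plus \<omega> r)\<^sup>2 / 2 = ep"
    using e vo.e0_nonneg by (auto simp: s)
  have F: "F x = w.flow_force x" for x
    unfolding F_def[rule_format] st.flow_force_eq w.flow_force_def ..
  have Fm: "F_minus \<omega> r = w.F_sup"
    using vo.sigma_eq[of "s_plus \<omega> r" r] cp.e0_ep by (simp add: F_minus_def sq)
  have Fp: "F_plus \<omega> r = w.F_sub"
    using vo.sigma_eq[of "s_minus \<omega> r" r] e(1) by (simp add: F_plus_def sq)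
  have dm: "d_minus \<omega> r = vo.D ep" by (simp add: d_minus_def vo.depth_eq sq)
  have dp: "d_plus \<omega> r = vo.D em" by (simp add: d_plus_def vo.depth_eq sq)
  have const: "F x = w.flow_force 0" for x unfolding F by (rule w.flow_force_const)
  \<comment> \<open>Evaluating the height at \<open>p = \<psi> (x', y)\<close> turns the statement
    about \<open>height\<close> into one about \<open>\<psi>\<close>, because \<open>U\<close>
    inverts \<open>Hf\<close>.\<close>
  have laminar: "(\<forall>x'. \<eta> x' = vo.D e) \<and> (\<forall>x' y. 0 \<le> y \<and> y \<le> \<eta> x' \<longrightarrow> \<psi> (x', y) = U \<omega> s y)"
    if h: "\<And>q p. p \<in> {0..1} \<Longrightarrow> st.height (q, p) = vo.Hf e p" and s: "s\<^sup>2 / 2 = e" "vo.e0 < e" for e s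
  proof (intro conjI allI impI)
    fix x' show "\<eta> x' = vo.D e" using h[of 1 x'] by (simp add: st.height_top vo.H_1)
  next
    fix x' y assume "0 \<le> y \<and> y \<le> \<eta> x'"
    then have y: "y \<in> {0..\<eta> x'}" by simp
    have "U \<omega> s (vo.Hf (s\<^sup>2 / 2) (\<psi> (x', y))) = \<psi> (x', y)"
      by (rule vo.U_eq) (use s st.psi_mem[OF y] in simp_all)
    then show "\<psi> (x', y) = U \<omega> s y" using h[OF st.psi_mem[OF y], of x'] by (simp add: s st.height_psi[OF y])
  qed
  \<comment> \<open>A flow force that is at least \<open>F_sub\<close> already equals it, so it can
    never exceed it.\<close>
  have upper: "w.flow_force 0 \<le> w.F_sub"
    using w.upper_bound(1) by linarith
  have "(\<forall>x'. \<eta> x' = vo.D ep) \<and> (\<forall>x' y. 0 \<le> y \<and> y \<le> \<eta> x' \<longrightarrow> \<psi> (x', y) = U \<omega> (s_plus \<omega> r) y)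
      \<or> ((\<exists>x0. \<forall>t. \<eta> (x0 + t) = \<eta> (x0 - t)) \<and> (\<forall>x'. \<eta> x' > vo.D ep) \<and> (\<eta> \<longlongrightarrow> vo.D ep) at_top \<and> (\<eta> \<longlongrightarrow> vo.D ep) at_bot)"
    if "w.flow_force 0 = w.F_sup"
    using w.F_sup_classification[OF that]
  proof
    assume "\<forall>q. \<forall>p\<in>{0..1}. st.height (q, p) = vo.Hf ep p"
    then show ?thesis using laminar[OF _ sq(2) cp.e0_ep] by blast
  next
    assume "(\<exists>x0. \<forall>t. st.height (x0 + t, 1) = st.height (x0 - t, 1)) \<and> (\<forall>q. vo.D ep < st.height (q, 1)) \<and>
      ((\<lambda>q. st.height (q, 1)) \<longlongrightarrow> vo.D ep) at_top \<and> ((\<lambda>q. st.height (q, 1)) \<longlongrightarrow> vo.D ep) at_bot"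
    then show ?thesis by (simp add: st.height_top)
  qed
  moreover have "(\<forall>x'. \<eta> x' = vo.D em) \<and> (\<forall>x' y. 0 \<le> y \<and> y \<le> \<eta> x' \<longrightarrow> \<psi> (x', y) = U \<omega> (s_minus \<omega> r) y)"
    if "w.flow_force 0 = w.F_sub"
    by (rule laminar[OF w.upper_bound(2) sq(1) e(1)]) (use that in auto)
  ultimately show ?thesis
    unfolding const Fm Fp dm dp using w.F_sup_le upper by blast
qed

end
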